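(* Let $\mathfrak g\subset\mathfrak t$ be rational, let $\alpha\in\mathfrak t^*$ be of type $J=J_+\cup J_-$ and put $\chi=\sum_{k=1}^n\alpha_k\eta_k$. Assume $\alpha_J\neq z$ and let $a_0\in\mathbb Q$ be such that $z\in a_0\alpha_J+V_0$; then $a_0<1$. Write $a_0=\frac{a_Z}{a_N}$ with $a_Z,a_N\in\mathbb Z$, $a_N>0$ (so that $a_N-a_Z>0$), and put $$Q=\frac{1}{a_N-a_Z}\,(P_J-z).$$ Then for every $x\in\mathbb Z_{>0}$ such that $x\alpha$ is again of type $J$ (with the same $J_+$ and $J_-$), the Goldie rank of the primitive quotient $B^{x\chi}/J(x\alpha)$ is a quasi-polynomial in $x$ given by $$\mathrm{Grk}\big(B^{x\chi}/J(x\alpha)\big)=\mathrm{EHP}_Q(a_Nx-a_Z),$$ where $\mathrm{EHP}_Q$ is the classical Ehrhart quasi-polynomial of the rational polytope $Q$ with respect to the standard lattice $L=\mathbb Z^J$.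
   Context: Algebraic setup. Let $k$ be an algebraically closed field of characteristic $0$ and $n=r+s$ with $r,s\in\mathbb Z_{\ge0}$. The Weyl algebra $\mathcal A$ is the $k$-algebra generated by $x_1,\dots,x_r,x_{r+1}^{\pm1},\dots,x_n^{\pm1},\partial_1,\dots,\partial_n$ with relations $[x_i,x_j]=0$, $[\partial_i,\partial_j]=0$, $[\partial_i,x_j]=\delta_{ij}$, $x_ix_i^{-1}=1$ for $i>r$. Put $\pi_i=x_i\partial_i$, $\mathfrak t=\mathrm{span}_k\{\pi_1,\dots,\pi_n\}$, and identify $\mathfrak t^*$ with $k^n$ via the dual basis $\pi_i^*$. For a subspace $\mathfrak g\subset\mathfrak t$ and $\chi\in\mathfrak g^*$ let $\mathcal A^{\mathfrak g}=\{a:[t,a]=0\ \forall t\in\mathfrak g\}$ and $B^\chi=\mathcal A^{\mathfrak g}/(\mathfrak g-\chi(\mathfrak g))$, the quotient by the two-sided ideal generated by all $t-\chi(t)$, $t\in\mathfrak g$. Put $\eta_i=\pi_i^*|_{\mathfrak g}$, $V(\mathfrak g)=\{\gamma\in k^n:\sum_i\gamma_i\eta_i=0\}$ and $V(\mathfrak g-\chi(\mathfrak g))=\{\gamma\in k^n:\sum_i\gamma_i\eta_i=\chi\}$. For $\alpha\in V(\mathfrak g-\chi(\mathfrak g))$ let $\mathfrak m_\alpha\subset\mathrm{Sym}(\mathfrak t)$ be the maximal ideal of $\alpha$ (acting via $\mathrm{Sym}(\mathfrak t)\subset\mathcal A^{\mathfrak g}\to B^\chi$), let $L(\alpha)$ be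 the unique simple quotient of the left module $B^\chi/B^\chi\mathfrak m_\alpha$, and $J(\alpha)=\mathrm{Ann}_{B^\chi}L(\alpha)$. $\mathrm{Grk}(R)$, for a prime noetherian ring $R$, is the maximal $m$ such that $R$ contains a direct sum of $m$ nonzero left ideals. Sign configuration and type. $\mathfrak g$ is called rational if the defining equations of $V(\mathfrak g)\subset k^n$ have coefficients in $\mathbb Q$. Let $E=V(\mathfrak g)\cap\mathbb Q^n$. For $\alpha\in\mathbb Q^n$ let $T_\alpha=\{i:1\le i\le r,\ \alpha_i\in\mathbb Z\}$ and for $i\in T_\alpha$ let $\lambda_i\in E^*$ be $\lambda_i(u)=-u_i$ if $\alpha_i\ge0$ and $\lambda_i(u)=u_i$ if $\alpha_i<0$. There is a unique decomposition $T_\alpha=I'\,\dot\cup\,J$ for which there exist $e\in E$ and rational numbers $(c_i)_{i\in T_\alpha}$ with $\sum_i c_i\lambda_i=0$, $\lambda_i(e)>0$ and $c_i=0$ for $i\in I'$, and $\lambda_j(e)=0$ and $c_j>0$ for $j\in J$. The sign configuration of $\alpha$ is this $J$ together with $J_+=\{j\in J:\alpha_j\ge0\}$, $J_-=\{j\in J:\alpha_j<0\}$; put $I=\{1,\dots,n\}\setminus J$. We say $\alpha$ is of type $J=J_+\cup J_-$ if $\mathfrak g$ is rational, $\alpha\in\mathbb Q^n$ has sign configuration $J=J_+\cup J_-$, and $\mathfrak g^*=\mathrm{span}_k\{\eta_j:j\in J\}\oplus\mathrm{span}_k\{\eta_i:i\in I\}$. Polytope. Put $\alpha_J=(\alpha_j)_{j\in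 J}\in\mathbb Q^J$, $V_0=\{v\in\mathbb Q^J:\sum_{j\in J}v_j\eta_j=0\}$, $L=\mathbb Z^J$, let $z\in\mathbb Z^J$ have coordinates $z_j=0$ for $j\in J_+$ and $z_j=-1$ for $j\in J_-$, and let $$P_J=\Big\{d\in\mathbb Q^J:\ \sum_{j\in J}d_j\eta_j=\sum_{j\in J}\alpha_j\eta_j,\ d_j\ge0\text{ for }j\in J_+,\ d_j\le-1\text{ for }j\in J_-\Big\},$$ a rational polytope (also regarded in $\mathbb R^J$). Ehrhart theory. A quasi-polynomial in $t$ is an expression $\sum_i c_i(t)t^i$ with finitely many terms and coefficients $c_i$ that are periodic functions of the integer $t$. For a rational polytope $Q\subset\mathbb R^J$, $\mathrm{EHP}_Q$ is the quasi-polynomial with $\mathrm{EHP}_Q(t)=\#(tQ\cap\mathbb Z^J)$ for all $t\in\mathbb Z_{>0}$. *)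

theory Defs
  imports
    "HOL-Algebra.QuotRing"
    "HOL-Algebra.Module"
    "HOL-Algebra.Generated_Rings"
    "HOL-Algebra.Algebraic_Closure_Type"
    "HOL-Library.Poly_Mapping"
    "HOL-Library.Function_Algebras"
begin

section \<open>Left modules and Goldie rank\<close>

text \<open>
  The locale \<^locale>\<open>module\<close> of the library requires a commutative ring of scalars. Left modules over
  a noncommutative ring \<open>R\<close> reuse only the record type \<^typ>\<open>('a, 'b) module\<close> and the locale
  \<^locale>\<open>submodule\<close>, neither of which mentions commutativity. The ring fields \<open>mult\<close> and
  \<open>one\<close> of such a record carry no meaning.
\<close>

definition regular_module :: "('a, 'm) ring_scheme \<Rightarrow> ('a, 'a) module" where
  "regular_module R =
     \<lparr>carrier = carrier R, monoid.mult = monoid.mult R, one = \<one>\<^bsub>R\<^esub>, ring.zero = \<zero>\<^bsub>R\<^esub>,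
      ring.add = add R, module.smult = monoid.mult R\<rparr>"

definition quotient_module :: "('a, 'b, 'm) module_scheme \<Rightarrow> 'b set \<Rightarrow> ('a, 'b set) module" where
  "quotient_module M N =
     \<lparr>carrier = a_rcosets\<^bsub>M\<^esub> N, monoid.mult = undefined, one = undefined, ring.zero = N, ring.add = set_add M,
      module.smult = (\<lambda>a C. \<Union>x\<in>C. N +>\<^bsub>M\<^esub> (a \<odot>\<^bsub>M\<^esub> x))\<rparr>"

definition simple_module :: "('a, 'm) ring_scheme \<Rightarrow> ('a, 'b, 'n) module_scheme \<Rightarrow> bool" where
  "simple_module R M \<longleftrightarrow>
     carrier M \<noteq> {\<zero>\<^bsub>M\<^esub>} \<and> (\<forall>N. submodule N R M \<longrightarrow> N = {\<zero>\<^bsub>M\<^esub>} \<or> N = carrier M)"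

definition annihilator :: "('a, 'm) ring_scheme \<Rightarrow> ('a, 'b, 'n) module_scheme \<Rightarrow> 'a set" where
  "annihilator R M = {a \<in> carrier R. \<forall>x\<in>carrier M. a \<odot>\<^bsub>M\<^esub> x = \<zero>\<^bsub>M\<^esub>}"

text \<open>Simple quotients are quotients by submodules \<open>N\<close>; uniqueness means that \<open>N\<close> is unique.\<close>

definition the_simple_quotient ::
    "('a, 'm) ring_scheme \<Rightarrow> ('a, 'b, 'n) module_scheme \<Rightarrow> ('a, 'b set) module" where
  "the_simple_quotient R M =
     quotient_module M (THE N. submodule N R M \<and> simple_module R (quotient_module M N))"

definition left_ideal :: "'a set \<Rightarrow> ('a, 'm) ring_scheme \<Rightarrow> bool" where
  "left_ideal I R \<longleftrightarrow> submodule I R (regular_module R)"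

definition left_ideal_generated :: "('a, 'm) ring_scheme \<Rightarrow> 'a set \<Rightarrow> 'a set" where
  "left_ideal_generated R S = \<Inter>{I. left_ideal I R \<and> S \<subseteq> I}"

definition has_direct_sum_of_left_ideals :: "('a, 'm) ring_scheme \<Rightarrow> nat \<Rightarrow> bool" where
  "has_direct_sum_of_left_ideals R m \<longleftrightarrow>
     (\<exists>I :: nat \<Rightarrow> 'a set.
        (\<forall>i<m. left_ideal (I i) R \<and> I i \<noteq> {\<zero>\<^bsub>R\<^esub>}) \<and>
        (\<forall>a \<in> Pi {..<m} I. finsum R a {..<m} = \<zero>\<^bsub>R\<^esub> \<longrightarrow> (\<forall>i<m. a i = \<zero>\<^bsub>R\<^esub>)))"

definition goldie_rank :: "('a, 'm) ring_scheme \<Rightarrow> nat" where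
  "goldie_rank R = (GREATEST m. has_direct_sum_of_left_ideals R m)"


section \<open>Coordinate spaces\<close>

text \<open>The space $K^S$ for a set \<open>S\<close> of indices, as functions vanishing outside \<open>S\<close>.\<close>

definition coord_space :: "nat set \<Rightarrow> (nat \<Rightarrow> 'a::zero) set" where
  "coord_space S = {v. \<forall>i. i \<notin> S \<longrightarrow> v i = 0}"

definition restrict_coord :: "nat set \<Rightarrow> (nat \<Rightarrow> 'a::zero) \<Rightarrow> nat \<Rightarrow> 'a" where
  "restrict_coord S v = (\<lambda>i. if i \<in> S then v i else 0)"

definition fscale :: "'k::field \<Rightarrow> ('a \<Rightarrow> 'k) \<Rightarrow> 'a \<Rightarrow> 'k" where
  "fscale c f = (\<lambda>x. c * f x)"

interpretation fun_space: vector_space "fscale :: 'k::field \<Rightarrow> ('a \<Rightarrow> 'k) \<Rightarrow> 'a \<Rightarrow> 'k"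
  by unfold_locales (auto simp: fscale_def fun_eq_iff algebra_simps)


section \<open>The Weyl algebra\<close>

text \<open>
  The free algebra on a set of generators is the monoid algebra of the free monoid. The latter is
  written additively to fit the product of \<^type>\<open>poly_mapping\<close>.
\<close>

datatype 'a word = Word (letters: "'a list")

instantiation word :: (type) monoid_add
begin

definition zero_word :: "'a word" where "0 = Word []"

definition plus_word :: "'a word \<Rightarrow> 'a word \<Rightarrow> 'a word" where
  "v + w = Word (letters v @ letters w)"

instance by standard (simp_all add: zero_word_def plus_word_def)

end

datatype weyl_gen = GX nat | GXinv nat | GD nat

type_synonym 'k free_alg = "weyl_gen word \<Rightarrow>\<^sub>0 'k"

definition fgen :: "weyl_gen \<Rightarrow> 'k::field free_alg" where
  "fgen a = Poly_Mapping.single (Word [a]) 1"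

definition fconst :: "'k::field \<Rightarrow> 'k free_alg" where
  "fconst c = Poly_Mapping.single 0 c"

definition weyl_gens :: "nat \<Rightarrow> nat \<Rightarrow> weyl_gen set" where
  "weyl_gens r s = GX ` {1..r+s} \<union> GXinv ` {r+1..r+s} \<union> GD ` {1..r+s}"

definition free_weyl :: "nat \<Rightarrow> nat \<Rightarrow> 'k::field free_alg ring" where
  "free_weyl r s =
     ring_of_type_algebra\<lparr>carrier := {p. \<forall>w\<in>Poly_Mapping.keys p. set (letters w) \<subseteq> weyl_gens r s}\<rparr>"

text \<open>The generator \<open>GXinv i\<close> is a two-sided inverse of \<open>GX i\<close>; the commutation relations for the
  inverses follow from those for \<open>GX i\<close>.\<close>

definition weyl_relators :: "nat \<Rightarrow> nat \<Rightarrow> 'k::field free_alg set" where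
  "weyl_relators r s =
     {fgen (GX i) * fgen (GX j) - fgen (GX j) * fgen (GX i) | i j. i \<in> {1..r+s} \<and> j \<in> {1..r+s}}
   \<union> {fgen (GD i) * fgen (GD j) - fgen (GD j) * fgen (GD i) | i j. i \<in> {1..r+s} \<and> j \<in> {1..r+s}}
   \<union> {fgen (GD i) * fgen (GX j) - fgen (GX j) * fgen (GD i) - (if i = j then 1 else 0) | i j.
        i \<in> {1..r+s} \<and> j \<in> {1..r+s}}
   \<union> {fgen (GX i) * fgen (GXinv i) - 1 | i. i \<in> {r+1..r+s}}
   \<union> {fgen (GXinv i) * fgen (GX i) - 1 | i. i \<in> {r+1..r+s}}"

definition weyl_ideal :: "nat \<Rightarrow> nat \<Rightarrow> 'k::field free_alg set" where
  "weyl_ideal r s = Idl\<^bsub>free_weyl r s\<^esub> (weyl_relators r s)"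

definition weyl :: "nat \<Rightarrow> nat \<Rightarrow> 'k::field free_alg set ring" where
  "weyl r s = free_weyl r s Quot weyl_ideal r s"

definition weyl_const :: "nat \<Rightarrow> nat \<Rightarrow> 'k::field \<Rightarrow> 'k free_alg set" where
  "weyl_const r s c = weyl_ideal r s +>\<^bsub>free_weyl r s\<^esub> fconst c"

text \<open>
  A vector \<open>t\<close> in $k^n$ with $n = r + s$ stands for the element $\sum_i t_i \pi_i$ of $\mathfrak t$,
  and a vector \<open>\<alpha>\<close> in $k^n$ for the functional $\sum_i \alpha_i \pi_i^*$ on $\mathfrak t$.
\<close>

definition torus :: "nat \<Rightarrow> nat \<Rightarrow> (nat \<Rightarrow> 'k::field) \<Rightarrow> 'k free_alg set" where
  "torus r s t =
     weyl_ideal r s +>\<^bsub>free_weyl r s\<^esub> (\<Sum>i\<in>{1..r+s}. fconst (t i) * fgen (GX i) * fgen (GD i))"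

definition weyl_invariants ::
    "nat \<Rightarrow> nat \<Rightarrow> (nat \<Rightarrow> 'k::field) set \<Rightarrow> 'k free_alg set ring" where
  "weyl_invariants r s g = (weyl r s)
     \<lparr>carrier := {a \<in> carrier (weyl r s).
        \<forall>t\<in>g. torus r s t \<otimes>\<^bsub>weyl r s\<^esub> a \<ominus>\<^bsub>weyl r s\<^esub> a \<otimes>\<^bsub>weyl r s\<^esub> torus r s t = \<zero>\<^bsub>weyl r s\<^esub>}\<rparr>"

definition character_ideal ::
    "nat \<Rightarrow> nat \<Rightarrow> (nat \<Rightarrow> 'k::field) set \<Rightarrow> ((nat \<Rightarrow> 'k) \<Rightarrow> 'k) \<Rightarrow> 'k free_alg set set" where
  "character_ideal r s g \<chi> =
     Idl\<^bsub>weyl_invariants r s g\<^esub> {torus r s t \<ominus>\<^bsub>weyl r s\<^esub> weyl_const r s (\<chi> t) | t. t \<in> g}"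

definition Bring ::
    "nat \<Rightarrow> nat \<Rightarrow> (nat \<Rightarrow> 'k::field) set \<Rightarrow> ((nat \<Rightarrow> 'k) \<Rightarrow> 'k) \<Rightarrow> 'k free_alg set set ring" where
  "Bring r s g \<chi> = weyl_invariants r s g Quot character_ideal r s g \<chi>"

text \<open>$\mathrm{Sym}(\mathfrak t)$, identified with the subalgebra of the Weyl algebra generated by the
  commuting, algebraically independent elements $\pi_i$.\<close>

definition sym_torus :: "nat \<Rightarrow> nat \<Rightarrow> 'k::field free_alg set ring" where
  "sym_torus r s = (weyl r s)
     \<lparr>carrier := generate_ring (weyl r s) (range (weyl_const r s) \<union> torus r s ` coord_space {1..r+s})\<rparr>"

text \<open>The maximal ideal of \<open>\<alpha>\<close> is generated by the elements $t - \alpha(t)$.\<close>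

definition point_ideal :: "nat \<Rightarrow> nat \<Rightarrow> (nat \<Rightarrow> 'k::field) \<Rightarrow> 'k free_alg set set" where
  "point_ideal r s \<alpha> =
     Idl\<^bsub>sym_torus r s\<^esub>
       {torus r s t \<ominus>\<^bsub>weyl r s\<^esub> weyl_const r s (\<Sum>i\<in>{1..r+s}. \<alpha> i * t i) | t. t \<in> coord_space {1..r+s}}"

text \<open>The left module $B^\chi / B^\chi \mathfrak m_\alpha$.\<close>

definition verma ::
    "nat \<Rightarrow> nat \<Rightarrow> (nat \<Rightarrow> 'k::field) set \<Rightarrow> ((nat \<Rightarrow> 'k) \<Rightarrow> 'k) \<Rightarrow> (nat \<Rightarrow> 'k) \<Rightarrow>
      ('k free_alg set set, 'k free_alg set set set) module" where
  "verma r s g \<chi> \<alpha> =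
     quotient_module (regular_module (Bring r s g \<chi>))
       (left_ideal_generated (Bring r s g \<chi>)
         ((\<lambda>a. character_ideal r s g \<chi> +>\<^bsub>weyl_invariants r s g\<^esub> a) ` point_ideal r s \<alpha>))"

definition Lmod ::
    "nat \<Rightarrow> nat \<Rightarrow> (nat \<Rightarrow> 'k::field) set \<Rightarrow> ((nat \<Rightarrow> 'k) \<Rightarrow> 'k) \<Rightarrow> (nat \<Rightarrow> 'k) \<Rightarrow>
      ('k free_alg set set, 'k free_alg set set set set) module" where
  "Lmod r s g \<chi> \<alpha> = the_simple_quotient (Bring r s g \<chi>) (verma r s g \<chi> \<alpha>)"

definition Jideal ::
    "nat \<Rightarrow> nat \<Rightarrow> (nat \<Rightarrow> 'k::field) set \<Rightarrow> ((nat \<Rightarrow> 'k) \<Rightarrow> 'k) \<Rightarrow> (nat \<Rightarrow> 'k) \<Rightarrow>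
      'k free_alg set set set" where
  "Jideal r s g \<chi> \<alpha> = annihilator (Bring r s g \<chi>) (Lmod r s g \<chi> \<alpha>)"


section \<open>Sign configurations and types\<close>

text \<open>Functionals on the subspace \<open>g\<close> are extended by zero outside \<open>g\<close>, so that equality of
  functionals is equality of functions.\<close>

definition dual_space :: "(nat \<Rightarrow> 'k::field) set \<Rightarrow> ((nat \<Rightarrow> 'k) \<Rightarrow> 'k) set" where
  "dual_space g =
     {f. (\<forall>t. t \<notin> g \<longrightarrow> f t = 0) \<and> (\<forall>t\<in>g. \<forall>u\<in>g. f (t + u) = f t + f u) \<and>
         (\<forall>c. \<forall>t\<in>g. f (fscale c t) = c * f t)}"

text \<open>\<open>eta g i\<close> is the restriction of $\pi_i^*$ to \<open>g\<close>.\<close>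

definition eta :: "(nat \<Rightarrow> 'k::field) set \<Rightarrow> nat \<Rightarrow> (nat \<Rightarrow> 'k) \<Rightarrow> 'k" where
  "eta g i = (\<lambda>t. if t \<in> g then t i else 0)"

definition eta_comb ::
    "(nat \<Rightarrow> 'k::field) set \<Rightarrow> nat set \<Rightarrow> (nat \<Rightarrow> 'k) \<Rightarrow> (nat \<Rightarrow> 'k) \<Rightarrow> 'k" where
  "eta_comb g S \<gamma> = (\<Sum>i\<in>S. fscale (\<gamma> i) (eta g i))"

definition Vset :: "nat \<Rightarrow> (nat \<Rightarrow> 'k::field) set \<Rightarrow> (nat \<Rightarrow> 'k) set" where
  "Vset n g = {\<gamma> \<in> coord_space {1..n}. eta_comb g {1..n} \<gamma> = 0}"

definition of_rat_vec :: "(nat \<Rightarrow> rat) \<Rightarrow> nat \<Rightarrow> 'k::field_char_0" where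
  "of_rat_vec v = (\<lambda>i. of_rat (v i))"

definition rational_subspace :: "nat \<Rightarrow> (nat \<Rightarrow> 'k::field_char_0) set \<Rightarrow> bool" where
  "rational_subspace n g \<longleftrightarrow>
     (\<exists>C :: (nat \<Rightarrow> rat) set. finite C \<and>
        Vset n g = {\<gamma> \<in> coord_space {1..n}. \<forall>c\<in>C. (\<Sum>i\<in>{1..n}. of_rat (c i) * \<gamma> i) = 0})"

definition Eset :: "nat \<Rightarrow> (nat \<Rightarrow> 'k::field_char_0) set \<Rightarrow> (nat \<Rightarrow> rat) set" where
  "Eset n g = {u \<in> coord_space {1..n}. of_rat_vec u \<in> Vset n g}"

definition Tset :: "nat \<Rightarrow> (nat \<Rightarrow> rat) \<Rightarrow> nat set" where
  "Tset r \<alpha> = {i \<in> {1..r}. \<alpha> i \<in> \<int>}"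

definition lam :: "(nat \<Rightarrow> rat) \<Rightarrow> nat \<Rightarrow> (nat \<Rightarrow> rat) \<Rightarrow> rat" where
  "lam \<alpha> i u = (if \<alpha> i \<ge> 0 then - u i else u i)"

definition sign_decomposition ::
    "nat \<Rightarrow> nat \<Rightarrow> (nat \<Rightarrow> 'k::field_char_0) set \<Rightarrow> (nat \<Rightarrow> rat) \<Rightarrow> nat set \<Rightarrow> nat set \<Rightarrow> bool" where
  "sign_decomposition r s g \<alpha> I' J \<longleftrightarrow>
     I' \<union> J = Tset r \<alpha> \<and> I' \<inter> J = {} \<and>
     (\<exists>e \<in> Eset (r+s) g. \<exists>c :: nat \<Rightarrow> rat.
        (\<forall>u \<in> Eset (r+s) g. (\<Sum>i\<in>Tset r \<alpha>. c i * lam \<alpha> i u) = 0) \<and>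
        (\<forall>i\<in>I'. lam \<alpha> i e > 0 \<and> c i = 0) \<and>
        (\<forall>j\<in>J. lam \<alpha> j e = 0 \<and> c j > 0))"

definition sign_configuration ::
    "nat \<Rightarrow> nat \<Rightarrow> (nat \<Rightarrow> 'k::field_char_0) set \<Rightarrow> (nat \<Rightarrow> rat) \<Rightarrow> nat set \<Rightarrow> nat set \<Rightarrow> nat set \<Rightarrow> bool"
  where
  "sign_configuration r s g \<alpha> J Jp Jm \<longleftrightarrow>
     sign_decomposition r s g \<alpha> (Tset r \<alpha> - J) J \<and>
     Jp = {j\<in>J. \<alpha> j \<ge> 0} \<and> Jm = {j\<in>J. \<alpha> j < 0}"

definition of_type ::
    "nat \<Rightarrow> nat \<Rightarrow> (nat \<Rightarrow> 'k::field_char_0) set \<Rightarrow> (nat \<Rightarrow> rat) \<Rightarrow> nat set \<Rightarrow> nat set \<Rightarrow> nat set \<Rightarrow> bool"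
  where
  "of_type r s g \<alpha> J Jp Jm \<longleftrightarrow>
     rational_subspace (r+s) g \<and> \<alpha> \<in> coord_space {1..r+s} \<and> sign_configuration r s g \<alpha> J Jp Jm \<and>
     dual_space g =
       {f + h | f h. f \<in> fun_space.span (eta g ` J) \<and> h \<in> fun_space.span (eta g ` ({1..r+s} - J))} \<and>
     fun_space.span (eta g ` J) \<inter> fun_space.span (eta g ` ({1..r+s} - J)) = {0}"


section \<open>Polytopes and Ehrhart quasi-polynomials\<close>

definition V0set :: "(nat \<Rightarrow> 'k::field_char_0) set \<Rightarrow> nat set \<Rightarrow> (nat \<Rightarrow> rat) set" where
  "V0set g J = {v \<in> coord_space J. eta_comb g J (of_rat_vec v) = 0}"

definition zvec :: "nat set \<Rightarrow> nat \<Rightarrow> rat" where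
  "zvec Jm = (\<lambda>j. if j \<in> Jm then -1 else 0)"

text \<open>Sums \<open>eta_comb g J\<close> only see coordinates in \<open>J\<close>, so \<open>\<alpha>\<close> need not be restricted to \<open>J\<close> here.\<close>

definition PJ ::
    "(nat \<Rightarrow> 'k::field_char_0) set \<Rightarrow> (nat \<Rightarrow> rat) \<Rightarrow> nat set \<Rightarrow> nat set \<Rightarrow> nat set \<Rightarrow> (nat \<Rightarrow> rat) set" where
  "PJ g \<alpha> J Jp Jm =
     {d \<in> coord_space J. eta_comb g J (of_rat_vec d) = eta_comb g J (of_rat_vec \<alpha>) \<and>
        (\<forall>j\<in>Jp. d j \<ge> 0) \<and> (\<forall>j\<in>Jm. d j \<le> -1)}"

definition int_lattice :: "nat set \<Rightarrow> (nat \<Rightarrow> rat) set" where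
  "int_lattice J = {d \<in> coord_space J. \<forall>j. d j \<in> \<int>}"

text \<open>A quasi-polynomial is determined by its values at positive integers, hence the definite
  description in \<open>EHP\<close>; its existence for rational polytopes is Ehrhart's theorem.\<close>

definition quasi_polynomial :: "(int \<Rightarrow> rat) \<Rightarrow> bool" where
  "quasi_polynomial q \<longleftrightarrow>
     (\<exists>N :: nat. \<exists>c :: nat \<Rightarrow> int \<Rightarrow> rat.
        (\<forall>i\<le>N. \<exists>p>0. \<forall>t. c i (t + p) = c i t) \<and>
        (\<forall>t. q t = (\<Sum>i\<le>N. c i t * of_int t ^ i)))"

definition EHP :: "nat set \<Rightarrow> (nat \<Rightarrow> rat) set \<Rightarrow> int \<Rightarrow> rat" where
  "EHP J Q = (THE q. quasi_polynomial q \<and>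
     (\<forall>t>0. q t = of_nat (card (fscale (of_int t) ` Q \<inter> int_lattice J))))"

end

theory Submission
  imports Defs Complex_Main
begin

text \<open>
  The module \<open>L(\<alpha>)\<close> is realised on the weights in \<open>\<alpha> + E \<inter> \<int>\<^sup>n\<close> with the same signs as
  \<open>\<alpha>\<close> in the coordinates in \<open>T\<^sub>\<alpha>\<close>, and \<open>B / J(\<alpha>)\<close> is a ring of difference operators on
  this set. Since \<open>\<alpha>\<close> has type \<open>J\<close>, the set is the product of the finite set
  \<open>P\<^sub>J \<inter> \<int>\<^sup>J\<close> and a Zariski dense cone, so that \<open>B / J(\<alpha>)\<close> behaves like a ring of matrices of
  size \<open>N = # (P\<^sub>J \<inter> \<int>\<^sup>J)\<close> over a domain \<open>D\<close>. The \<open>N\<close> diagonal idempotents give a direct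
  sum of \<open>N\<close> left ideals. A direct sum of more than \<open>N\<close> left ideals would force the space of
  operators of degree at most \<open>t\<close> to grow exponentially in \<open>t\<close>, but its dimension is at most
  \<open>(2t + 1)\<^sup>2\<^sup>n\<close>. This replaces the Ore condition for \<open>D\<close>.

  For the Ehrhart side, counting lattice points is iterated summation over the coordinates. The
  functions of several integers that are generated by linear forms, congruences and indicators of
  homogeneous linear inequalities are closed under such sums, and on the ray \<open>t > 0\<close> they are
  quasi-polynomials.
\<close>


section \<open>Quasi-polynomials in one variable\<close>

section \<open>Ehrhart theory\<close>

text \<open>The argument \<open>aN * x - aZ\<close> comes from homogeneity. Translating by
  \<open>zvec Jm\<close> makes the bounds d_j \<le> -1 homogeneous, so the polytopes of all
  multiples of \<alpha> become slices of one cone. The slice for x has height x - a0 = (aN x -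
  aZ)/aN, and Q is the slice of height 1/aN. On the algebraic side an element of the free algebra
  represents zero in B/J(\<alpha>) exactly when its operator kills every function supported on the
  weight set \<open>S\<close>, so all claims are pulled back to matrix entries of such operators.
  The growth estimate for m left ideals works column by column. Column b of the elements of length
  at most t is mapped into the i-th ideal by multiplication with a fixed transition element and the
  i-th generator. This is injective since operators composed through a transition have a nonzero
  product: coefficients are polynomials in the weight, the cone is Zariski dense, and extreme sums
  of weights in Z^n are attained only once. Summing over the N blocks gives m g(t) \<le> N g(t + c)
  for the dimensions g, and iteration yields (m/N)^k \<le> g(kc).\<close>

inductive quasi_poly :: "(int \<Rightarrow> rat) \<Rightarrow> bool" where
  quasi_poly_ident: "quasi_poly of_int"
| quasi_poly_periodic: "p > 0 \<Longrightarrow> (\<And>t. h (t + p) = h t) \<Longrightarrow> quasi_poly h"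
| quasi_poly_add: "quasi_poly f \<Longrightarrow> quasi_poly h \<Longrightarrow> quasi_poly (\<lambda>t. f t + h t)"
| quasi_poly_mult: "quasi_poly f \<Longrightarrow> quasi_poly h \<Longrightarrow> quasi_poly (\<lambda>t. f t * h t)"

lemma periodic_add_mult:
  fixes h :: "int \<Rightarrow> 'a"
  assumes "\<And>t. h (t + p) = h t"
  shows "h (t + p * k) = h t"
proof -
  have pos: "h (t + p * int n) = h t" for n t
  proof (induction n)
    case (Suc n)
    have "h (t + p * int (Suc n)) = h ((t + p * int n) + p)" by (simp add: algebra_simps)
    then show ?case using assms Suc by simp
  qed simp
  show ?thesis
  proof (cases "k \<ge> 0")
    case True
    then show ?thesis using pos[of t "nat k"] by simp
  next
    case False
    then show ?thesis using pos[of "t + p * k" "nat (- k)"] by (simp add: algebra_simps)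
  qed
qed

lemma quasi_poly_const: "quasi_poly (\<lambda>_. c)"
  by (rule quasi_poly_periodic[of 1]) auto

lemma quasi_poly_diff:
  assumes "quasi_poly f" "quasi_poly h"
  shows "quasi_poly (\<lambda>t. f t - h t)"
  using quasi_poly_add[OF assms(1) quasi_poly_mult[OF quasi_poly_const[of "-1"] assms(2)]] by simp

lemma quasi_poly_sum:
  assumes "finite S" "\<And>i. i \<in> S \<Longrightarrow> quasi_poly (f i)"
  shows "quasi_poly (\<lambda>t. \<Sum>i\<in>S. f i t)"
  using assms by (induction S) (auto intro: quasi_poly_const quasi_poly_add)

lemma quasi_poly_power: "quasi_poly f \<Longrightarrow> quasi_poly (\<lambda>t. f t ^ n)"
  by (induction n) (auto intro: quasi_poly_const quasi_poly_mult)

lemma quasi_poly_poly: "quasi_poly f \<Longrightarrow> quasi_poly (\<lambda>t. poly P (f t))"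
  by (induction P) (auto intro: quasi_poly_const quasi_poly_mult quasi_poly_add)

text \<open>Both coefficient lists are padded with zeros to a common length, and the product of two
  periods is a common period.\<close>

lemma quasi_polynomial_add:
  assumes "quasi_polynomial f" "quasi_polynomial h"
  shows "quasi_polynomial (\<lambda>t. f t + h t)"
proof -
  obtain N c where c: "\<forall>i\<le>N. \<exists>p>0. \<forall>t. c i (t + p) = c i t" "\<And>t. f t = (\<Sum>i\<le>N. c i t * of_int t ^ i)"
    using assms(1) unfolding quasi_polynomial_def by blast
  obtain M d where d: "\<forall>i\<le>M. \<exists>p>0. \<forall>t. d i (t + p) = d i t" "\<And>t. h t = (\<Sum>i\<le>M. d i t * of_int t ^ i)"
    using assms(2) unfolding quasi_polynomial_def by blast
  define c' where "c' i t = (if i \<le> N then c i t else 0)" for i t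
  define d' where "d' i t = (if i \<le> M then d i t else 0)" for i t
  have f: "f t = (\<Sum>i\<le>N+M. c' i t * of_int t ^ i)" for t
    unfolding c(2) by (rule sum.mono_neutral_cong_left) (auto simp: c'_def)
  have h: "h t = (\<Sum>i\<le>N+M. d' i t * of_int t ^ i)" for t
    unfolding d(2) by (rule sum.mono_neutral_cong_left) (auto simp: d'_def)
  have per: "\<exists>p>0. \<forall>t. c' i (t + p) + d' i (t + p) = c' i t + d' i t" for i
  proof -
    obtain p where p: "p > 0" "\<And>t. c' i (t + p) = c' i t"
      using c(1) by (cases "i \<le> N") (auto simp: c'_def intro: exI[of _ 1])
    obtain q where q: "q > 0" "\<And>t. d' i (t + q) = d' i t"
      using d(1) by (cases "i \<le> M") (auto simp: d'_def intro: exI[of _ 1])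
    have "c' i (t + p * q) = c' i t" "d' i (t + q * p) = d' i t" for t
      by (rule periodic_add_mult, rule p q)+
    then show ?thesis using p(1) q(1) by (intro exI[of _ "p * q"]) (simp add: mult.commute)
  qed
  show ?thesis unfolding quasi_polynomial_def
    using per by (intro exI[of _ "N+M"] exI[of _ "\<lambda>i t. c' i t + d' i t"])
       (simp add: f h algebra_simps sum.distrib)
qed

lemma quasi_polynomial_0: "quasi_polynomial (\<lambda>_. 0)"
  unfolding quasi_polynomial_def by (intro exI[of _ 0] exI[of _ "\<lambda>_ _. 0"]) (auto intro: exI[of _ 1])

lemma quasi_polynomial_sum:
  assumes "finite S" "\<And>i. i \<in> S \<Longrightarrow> quasi_polynomial (f i)"
  shows "quasi_polynomial (\<lambda>t. \<Sum>i\<in>S. f i t)"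
  using assms by (induction S) (auto intro: quasi_polynomial_0 quasi_polynomial_add)

lemma quasi_polynomial_term:
  assumes "p > 0" "\<And>t. h (t + p) = h t"
  shows "quasi_polynomial (\<lambda>t. h t * of_int t ^ k)"
  unfolding quasi_polynomial_def
proof (intro exI[of _ k] exI[of _ "\<lambda>i t. if i = k then h t else 0"] conjI allI impI)
  fix i show "\<exists>p>0. \<forall>t. (if i = k then h (t + p) else 0) = (if i = k then h t else 0)"
    using assms by (intro exI[of _ p]) auto
qed (simp add: if_distrib[of "\<lambda>x. x * _"] cong: if_cong)

lemma quasi_polynomial_mult:
  assumes "quasi_polynomial f" "quasi_polynomial h"
  shows "quasi_polynomial (\<lambda>t. f t * h t)"
proof -
  obtain N c where c: "\<forall>i\<le>N. \<exists>p>0. \<forall>t. c i (t + p) = c i t" "\<And>t. f t = (\<Sum>i\<le>N. c i t * of_int t ^ i)"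
    using assms(1) unfolding quasi_polynomial_def by blast
  obtain M d where d: "\<forall>i\<le>M. \<exists>p>0. \<forall>t. d i (t + p) = d i t" "\<And>t. h t = (\<Sum>i\<le>M. d i t * of_int t ^ i)"
    using assms(2) unfolding quasi_polynomial_def by blast
  have "quasi_polynomial (\<lambda>t. (c i t * d j t) * of_int t ^ (i + j))" if ij: "i \<le> N" "j \<le> M" for i j
  proof -
    obtain p where p: "p > 0" "\<And>t. c i (t + p) = c i t" using c(1) ij by blast
    obtain q where q: "q > 0" "\<And>t. d j (t + q) = d j t" using d(1) ij by blast
    have "c i (t + p * q) = c i t" "d j (t + q * p) = d j t" for t
      by (rule periodic_add_mult, rule p q)+
    then show ?thesis using p(1) q(1)
      by (intro quasi_polynomial_term[of "p * q"]) (simp_all add: mult.commute)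
  qed
  then have "quasi_polynomial (\<lambda>t. \<Sum>i\<le>N. \<Sum>j\<le>M. (c i t * d j t) * of_int t ^ (i + j))"
    by (intro quasi_polynomial_sum) auto
  then show ?thesis by (simp add: c(2) d(2) sum_product power_add mult_ac)
qed

text \<open>With the converse below, the generated class agrees with the closed form. Inductions run
  over the former, while \<open>EHP\<close> is defined by the latter.\<close>

lemma quasi_poly_imp_quasi_polynomial: "quasi_poly f \<Longrightarrow> quasi_polynomial f"
proof (induction rule: quasi_poly.induct)
  case quasi_poly_ident
  show ?case using quasi_polynomial_term[of 1 "\<lambda>_. 1" 1] by simp
next
  case (quasi_poly_periodic p h)
  then show ?case using quasi_polynomial_term[of p h 0] by simp
qed (auto intro: quasi_polynomial_add quasi_polynomial_mult)

lemma quasi_polynomial_imp_quasi_poly: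
  assumes "quasi_polynomial f" shows "quasi_poly f"
proof -
  obtain N c where c: "\<forall>i\<le>N. \<exists>p>0. \<forall>t. c i (t + p) = c i t" "\<And>t. f t = (\<Sum>i\<le>N. c i t * of_int t ^ i)"
    using assms(1) unfolding quasi_polynomial_def by blast
  have "quasi_poly (c i)" if "i \<le> N" for i
    using c(1) that quasi_poly_periodic by blast
  then have "quasi_poly (\<lambda>t. \<Sum>i\<le>N. c i t * of_int t ^ i)"
    by (intro quasi_poly_sum quasi_poly_mult quasi_poly_power quasi_poly_ident) auto
  then show ?thesis by (simp add: c(2)[symmetric])
qed

text \<open>Turns the Ehrhart function of Q into a function of the multiplier x. A step by the
  period p changes the inner argument by a p, again a multiple of p, so periodicity
  survives.\<close>

lemma quasi_poly_compose_affine: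
  assumes "quasi_poly f" shows "quasi_poly (\<lambda>t. f (a * t + b))"
  using assms
proof (induction rule: quasi_poly.induct)
  case quasi_poly_ident
  have "quasi_poly (\<lambda>t. of_int a * of_int t + of_int b)"
    by (intro quasi_poly_add quasi_poly_mult quasi_poly_const quasi_poly.quasi_poly_ident)
  then show ?case by simp
next
  case (quasi_poly_periodic p h)
  have "h (a * (t + p) + b) = h (a * t + b)" for t
    using periodic_add_mult[of h p "a * t + b" a] quasi_poly_periodic by (simp add: algebra_simps)
  then show ?case by (rule quasi_poly.quasi_poly_periodic[OF quasi_poly_periodic(1)])
qed (auto intro: quasi_poly_add quasi_poly_mult)

text \<open>On each residue class modulo a common period a quasi-polynomial is a polynomial, which is
  determined by its values at positive integers.\<close>

lemma quasi_poly_residue_poly: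
  assumes "quasi_poly f"
  shows "\<exists>p>0. \<forall>\<rho>. \<exists>P. \<forall>k. f (\<rho> + p * k) = poly P (of_int k)"
  using assms
proof (induction rule: quasi_poly.induct)
  case quasi_poly_ident
  have "\<exists>P. \<forall>k. of_int (\<rho> + 1 * k) = poly P (of_int k :: rat)" for \<rho>
    by (rule exI[of _ "[:of_int \<rho>, 1:]"]) simp
  then show ?case using zero_less_one by blast
next
  case (quasi_poly_periodic p h)
  have "\<exists>P. \<forall>k. h (\<rho> + p * k) = poly P (of_int k)" for \<rho>
    using quasi_poly_periodic periodic_add_mult[of h p] by (intro exI[of _ "[:h \<rho>:]"]) simp
  then show ?case using quasi_poly_periodic by blast
next
  case (quasi_poly_add f h)
  obtain p q where p: "p > 0" "\<forall>\<rho>. \<exists>P. \<forall>k. f (\<rho> + p * k) = poly P (of_int k)"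
    and q: "q > 0" "\<forall>\<rho>. \<exists>P. \<forall>k. h (\<rho> + q * k) = poly P (of_int k)"
    using quasi_poly_add.IH by blast
  have "\<exists>P. \<forall>k. f (\<rho> + (p * q) * k) + h (\<rho> + (p * q) * k) = poly P (of_int k)" for \<rho>
  proof -
    obtain P Q where "\<And>k. f (\<rho> + p * k) = poly P (of_int k)" "\<And>k. h (\<rho> + q * k) = poly Q (of_int k)"
      using p q by blast
    \<comment> \<open>For the common period p q, k steps amount to q k steps of length p and to p k
      steps of length q; hence the compositions with linear polynomials.\<close>
    from this(1)[of "q * k" for k] this(2)[of "p * k" for k] show ?thesis
      by (intro exI[of _ "pcompose P [:0, of_int q:] + pcompose Q [:0, of_int p:]"])
        (simp add: poly_pcompose mult_ac)
  qed
  then show ?case using p(1) q(1) by (intro exI[of _ "p * q"]) auto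
next
  case (quasi_poly_mult f h)
  obtain p q where p: "p > 0" "\<forall>\<rho>. \<exists>P. \<forall>k. f (\<rho> + p * k) = poly P (of_int k)"
    and q: "q > 0" "\<forall>\<rho>. \<exists>P. \<forall>k. h (\<rho> + q * k) = poly P (of_int k)"
    using quasi_poly_mult.IH by blast
  have "\<exists>P. \<forall>k. f (\<rho> + (p * q) * k) * h (\<rho> + (p * q) * k) = poly P (of_int k)" for \<rho>
  proof -
    obtain P Q where "\<And>k. f (\<rho> + p * k) = poly P (of_int k)" "\<And>k. h (\<rho> + q * k) = poly Q (of_int k)"
      using p q by blast
    from this(1)[of "q * k" for k] this(2)[of "p * k" for k] show ?thesis
      by (intro exI[of _ "pcompose P [:0, of_int q:] * pcompose Q [:0, of_int p:]"])
        (simp add: poly_pcompose mult_ac)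
  qed
  then show ?case using p(1) q(1) by (intro exI[of _ "p * q"]) auto
qed

section \<open>Uniqueness of the Ehrhart quasi-polynomial\<close>

lemma infinite_of_int_image:
  assumes "infinite (S :: int set)" shows "infinite ((of_int :: int \<Rightarrow> 'a::ring_char_0) ` S)"
  using assms by (auto dest!: finite_imageD simp: inj_on_def)

text \<open>The progression t + p k is eventually positive even for t \<le> 0, so the polynomial
  along it has infinitely many roots; its value at k = 0 is f t. Vanishing at all integers is what
  makes the description in \<open>EHP\<close> definite.\<close>

lemma quasi_poly_eq_0:
  assumes "quasi_poly f" "\<And>t. t > 0 \<Longrightarrow> f t = 0"
  shows "f t = 0"
proof -
  obtain p P where p: "p > 0" and P: "\<And>k. f (t + p * k) = poly P (of_int k)"
    using quasi_poly_residue_poly[OF assms(1)] by blast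
  have "of_int ` {k. k > \<bar>t\<bar>} \<subseteq> {x. poly P x = 0}"
  proof safe
    fix k :: int assume k: "k > \<bar>t\<bar>"
    then have "p * k \<ge> k" using p mult_right_mono[of 1 p k] by simp
    then have "t + p * k > 0" using k by linarith
    then show "poly P (of_int k) = 0" using P[of k] assms(2) by simp
  qed
  moreover have "infinite {k. k > \<bar>t\<bar>}" by (fold greaterThan_def) (rule infinite_Ioi)
  ultimately have "infinite {x. poly P x = 0}"
    using infinite_of_int_image infinite_super by blast
  then have "P = 0" using poly_roots_finite by blast
  then show ?thesis using P[of 0] by simp
qed

lemma EHP_eqI:
  assumes "quasi_poly q"
    and "\<And>t. t > 0 \<Longrightarrow> q t = of_nat (card (fscale (of_int t) ` Q \<inter> int_lattice J))"
  shows "EHP J Q = q"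
  unfolding EHP_def
proof (rule the_equality)
  fix q' assume q': "quasi_polynomial q' \<and>
    (\<forall>t>0. q' t = of_nat (card (fscale (of_int t) ` Q \<inter> int_lattice J)))"
  have "quasi_poly (\<lambda>t. q' t - q t)"
    using q' assms(1) quasi_polynomial_imp_quasi_poly quasi_poly_diff by blast
  then have "q' t - q t = 0" for t
    by (rule quasi_poly_eq_0) (use q' assms(2) in auto)
  then show "q' = q" by auto
qed (use assms quasi_poly_imp_quasi_polynomial in auto)

section \<open>Discrete antiderivatives\<close>

text \<open>The difference of y^(i+1) is (i+1) y^i minus terms of degree below i. Antidifferences of
  those lower powers, available by induction, correct it.\<close>

lemma poly_antidifference_monom:
  "\<exists>S :: rat poly. \<forall>y. poly S y - poly S (y - 1) = y ^ i"
proof (induction i rule: less_induct)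
  case (less i)
  then have "\<forall>k. \<exists>S. k < i \<longrightarrow> (\<forall>y. poly S y - poly S (y - 1) = (y :: rat) ^ k)" by blast
  from choice[OF this] obtain S
    where S: "\<And>k y. k < i \<Longrightarrow> poly (S k) y - poly (S k) (y - 1) = (y :: rat) ^ k" by blast
  define c where "c k = of_nat (Suc i choose k) * (- 1 :: rat) ^ (Suc i - k)" for k
  define T where "T = smult (1 / of_nat (Suc i)) (monom 1 (Suc i) + (\<Sum>k<i. smult (c k) (S k)))"
  have bin: "(y - 1) ^ Suc i = y ^ Suc i - of_nat (Suc i) * y ^ i + (\<Sum>k<i. c k * y ^ k)" for y :: rat
  proof -
    have "(y + (-1)) ^ Suc i = (\<Sum>k\<le>Suc i. of_nat (Suc i choose k) * y ^ k * (-1) ^ (Suc i - k))"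
      by (rule binomial_ring)
    also have "\<dots> = (\<Sum>k\<le>Suc i. c k * y ^ k)" by (simp add: c_def mult_ac)
    also have "\<dots> = (\<Sum>k<i. c k * y ^ k) + c i * y ^ i + c (Suc i) * y ^ Suc i"
      by (simp add: lessThan_Suc_atMost[symmetric])
    finally show ?thesis by (simp add: c_def algebra_simps)
  qed
  have "poly T y - poly T (y - 1) = y ^ i" for y
  proof -
    have T: "of_nat (Suc i) * poly T y = y ^ Suc i + (\<Sum>k<i. c k * poly (S k) y)" for y
      unfolding T_def poly_smult poly_add poly_monom poly_sum by (simp del: of_nat_Suc power_Suc)
    have "of_nat (Suc i) * (poly T y - poly T (y - 1)) =
       y ^ Suc i - (y - 1) ^ Suc i + (\<Sum>k<i. c k * (poly (S k) y - poly (S k) (y - 1)))"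
      unfolding right_diff_distrib T sum_subtractf by simp
    also have "\<dots> = of_nat (Suc i) * y ^ i" using S by (simp add: bin del: of_nat_Suc power_Suc)
    finally show ?thesis by (simp del: of_nat_Suc)
  qed
  then show ?case by blast
qed

lemma poly_antidifference: "\<exists>S :: rat poly. \<forall>y. poly S y - poly S (y - 1) = poly P y"
proof -
  have "\<forall>i. \<exists>S. \<forall>y. poly S y - poly S (y - 1) = (y :: rat) ^ i"
    using poly_antidifference_monom by blast
  from choice[OF this] obtain S where S: "\<And>i y. poly (S i) y - poly (S i) (y - 1) = (y :: rat) ^ i"
    by blast
  have "poly (\<Sum>i\<le>degree P. smult (coeff P i) (S i)) y -
      poly (\<Sum>i\<le>degree P. smult (coeff P i) (S i)) (y - 1) = poly P y" for y
    unfolding poly_sum sum_subtractf[symmetric] poly_smult right_diff_distrib[symmetric] S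
    by (simp add: poly_altdef)
  then show ?thesis by blast
qed

lemma quasi_poly_mod:
  assumes "p > 0" shows "quasi_poly (\<lambda>t. h ((t + c) mod p))"
proof (rule quasi_poly_periodic[OF assms])
  fix t
  have "t + p + c = t + c + p" by simp
  then show "h ((t + p + c) mod p) = h ((t + c) mod p)" by (metis mod_add_self2)
qed

lemma quasi_poly_div:
  assumes "p > 0" shows "quasi_poly (\<lambda>t. of_int ((t + c) div p))"
proof -
  have "quasi_poly (\<lambda>t. (of_int t + of_int c - of_int ((t + c) mod p)) * (1 / of_int p))"
    using assms by (intro quasi_poly_mult quasi_poly_diff quasi_poly_add quasi_poly_const quasi_poly_ident quasi_poly_mod)
  moreover have "(of_int t + of_int c - of_int ((t + c) mod p)) * (1 / of_int p) = (of_int ((t + c) div p) :: rat)" for t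
  proof -
    have "t + c = p * ((t + c) div p) + (t + c) mod p" by simp
    then have "(of_int t + of_int c :: rat) = of_int p * of_int ((t + c) div p) + of_int ((t + c) mod p)"
      by (metis of_int_add of_int_mult)
    then show ?thesis using assms by (simp add: field_simps)
  qed
  ultimately show ?thesis by simp
qed

text \<open>On the residue class of \<rho> modulo p the function is a polynomial in the quotient (z
  - \<rho>)/p. The witness adds the polynomial antidifferences of all classes, evaluated at the
  floors of these quotients. From z - 1 to z only the floor belonging to the class of z jumps, so
  exactly one summand contributes.\<close>

lemma quasi_poly_antidifference:
  assumes "quasi_poly q"
  shows "\<exists>s. quasi_poly s \<and> (\<forall>z. s z - s (z - 1) = q z)"
proof -
  obtain p where p: "p > 0" and "\<forall>\<rho>. \<exists>P. \<forall>k. q (\<rho> + p * k) = poly P (of_int k)"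
    using quasi_poly_residue_poly[OF assms] by blast
  then obtain P where P: "\<And>\<rho> k. q (\<rho> + p * k) = poly (P \<rho>) (of_int k)" by metis
  have "\<forall>\<rho>. \<exists>S. \<forall>y. poly S y - poly S (y - 1) = poly (P \<rho>) y"
    using poly_antidifference by blast
  from choice[OF this] obtain S where S: "\<And>\<rho> y. poly (S \<rho>) y - poly (S \<rho>) (y - 1) = poly (P \<rho>) y"
    by blast
  define s where "s z = (\<Sum>\<rho>\<in>{0..<p}. poly (S \<rho>) (of_int ((z + (- \<rho>)) div p)))" for z
  have "quasi_poly s" unfolding s_def
    by (intro quasi_poly_sum quasi_poly_poly quasi_poly_div p) auto
  moreover have "s z - s (z - 1) = q z" for z
  proof -
    have dv: "(z - 1 - \<rho>) div p = (z - \<rho>) div p - (if p dvd z - \<rho> then 1 else 0)" for \<rho>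
    proof -
      define y where "y = z - \<rho>"
      have y: "y = p * (y div p) + y mod p" by simp
      have m: "0 \<le> y mod p" "y mod p < p" using p by simp_all
      have "(y - 1) div p = y div p - (if p dvd y then 1 else 0)"
      proof (cases "p dvd y")
        case True
        then obtain k where "y = p * k" by blast
        moreover have "(p * k - 1) div p = k - 1"
          using p by (intro int_div_pos_eq[of _ _ _ "p - 1"]) (auto simp: algebra_simps)
        ultimately show ?thesis using p by simp
      next
        case False
        then have "y mod p \<noteq> 0" by auto
        then have "(y - 1) div p = y div p"
          using y m by (intro int_div_pos_eq[of _ _ _ "y mod p - 1"]) auto
        then show ?thesis using False by simp
      qed
      then show ?thesis by (simp add: y_def algebra_simps)
    qed
    have dvd: "p dvd z - \<rho> \<longleftrightarrow> \<rho> = z mod p" if "\<rho> \<in> {0..<p}" for \<rho>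
      using that by (auto simp: mod_eq_dvd_iff[symmetric] dvd_minus_mod)
    have "s z - s (z - 1) = (\<Sum>\<rho>\<in>{0..<p}. if \<rho> = z mod p then poly (P \<rho>) (of_int ((z - \<rho>) div p)) else 0)"
      unfolding s_def sum_subtractf[symmetric]
    proof (rule sum.cong, goal_cases)
      case (2 \<rho>)
      have e: "z - 1 + (- \<rho>) = z - 1 - \<rho>" "z + (- \<rho>) = z - \<rho>" by simp_all
      show ?case unfolding e dv using dvd[OF 2] S[of \<rho> "of_int ((z - \<rho>) div p)"]
        by (cases "\<rho> = z mod p") auto
    qed simp
    also have "\<dots> = poly (P (z mod p)) (of_int ((z - z mod p) div p))"
      using p by simp
    also have "\<dots> = q (z mod p + p * ((z - z mod p) div p))" by (rule P[symmetric])
    also have "z mod p + p * ((z - z mod p) div p) = z" by (simp add: dvd_minus_mod)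
    finally show ?thesis .
  qed
  ultimately show ?thesis by blast
qed

text \<open>Telescoping. The case A = B + 1 is the empty interval, for which the right side vanishes
  as well; intervals without integer points rely on it.\<close>

lemma sum_quasi_poly_antidifference:
  fixes s q :: "int \<Rightarrow> rat"
  assumes "\<And>z. s z - s (z - 1) = q z" "A \<le> B + 1"
  shows "(\<Sum>z\<in>{A..B}. q z) = s B - s (A - 1)"
proof -
  have "(\<Sum>z\<in>{A..A + int n - 1}. q z) = s (A + int n - 1) - s (A - 1)" for n
  proof (induction n)
    case (Suc n)
    have "{A..A + int (Suc n) - 1} = insert (A + int n) {A..A + int n - 1}" by auto
    then show ?case using Suc assms(1)[of "A + int n"] by simp
  qed simp
  from this[of "nat (B + 1 - A)"] assms(2) show ?thesis by simp
qed

section \<open>Piecewise quasi-polynomial functions of several integers\<close>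

text \<open>There is no constant term: coordinate 0 is later the dilation factor t, and
  inhomogeneous conditions of a dilated polytope become homogeneous by using it.\<close>

definition lin_form :: "((nat \<Rightarrow> int) \<Rightarrow> int) \<Rightarrow> bool" where
  "lin_form l \<longleftrightarrow> (\<exists>I a. finite I \<and> l = (\<lambda>x. \<Sum>i\<in>I. a i * x i))"

lemma lin_formI: "finite I \<Longrightarrow> lin_form (\<lambda>x. \<Sum>i\<in>I. a i * x i)"
  unfolding lin_form_def by blast

lemma lin_formE:
  assumes "lin_form l" obtains I a where "finite I" "l = (\<lambda>x. \<Sum>i\<in>I. a i * x i)"
  using assms unfolding lin_form_def by blast

lemma lin_form_add:
  assumes "lin_form l" "lin_form m" shows "lin_form (\<lambda>x. l x + m x)"
proof -
  obtain I a K b where l: "finite I" "l = (\<lambda>x. \<Sum>i\<in>I. a i * x i)" and m: "finite K" "m = (\<lambda>x. \<Sum>i\<in>K. b i * x i)"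
    using assms unfolding lin_form_def by blast
  have "l x + m x = (\<Sum>i\<in>I \<union> K. ((if i \<in> I then a i else 0) + (if i \<in> K then b i else 0)) * x i)" for x
  proof -
    have "l x = (\<Sum>i\<in>I \<union> K. (if i \<in> I then a i else 0) * x i)"
      unfolding l(2) by (rule sum.mono_neutral_cong_left) (use l m in auto)
    moreover have "m x = (\<Sum>i\<in>I \<union> K. (if i \<in> K then b i else 0) * x i)"
      unfolding m(2) by (rule sum.mono_neutral_cong_left) (use l m in auto)
    ultimately show ?thesis by (simp add: distrib_right sum.distrib)
  qed
  then show ?thesis using l(1) m(1) by (simp add: lin_formI)
qed

lemma lin_form_scale:
  assumes "lin_form l" shows "lin_form (\<lambda>x. c * l x)"
proof -
  obtain I a where l: "finite I" "l = (\<lambda>x. \<Sum>i\<in>I. a i * x i)"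
    using assms unfolding lin_form_def by blast
  have "(\<lambda>x. c * l x) = (\<lambda>x. \<Sum>i\<in>I. (c * a i) * x i)" by (simp add: l(2) sum_distrib_left mult.assoc)
  then show ?thesis using lin_formI[OF l(1)] by metis
qed

lemma lin_form_0: "lin_form (\<lambda>x. 0)"
  using lin_formI[of "{}"] by simp

lemma lin_form_coord: "lin_form (\<lambda>x. x i)"
  using lin_formI[of "{i}" "\<lambda>_. 1"] by simp

lemma lin_form_sum: "finite S \<Longrightarrow> (\<And>i. i \<in> S \<Longrightarrow> lin_form (l i)) \<Longrightarrow> lin_form (\<lambda>x. \<Sum>i\<in>S. l i x)"
  by (induction S rule: finite_induct) (auto intro: lin_form_0 lin_form_add)

lemma lin_form_diff: "lin_form l \<Longrightarrow> lin_form m \<Longrightarrow> lin_form (\<lambda>x. l x - m x)"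
  using lin_form_add[of l "\<lambda>x. -1 * m x"] lin_form_scale[of m "-1"] by simp

lemma lin_form_upd:
  assumes "lin_form l"
  shows "\<exists>p m. lin_form m \<and> (\<forall>x z. l (x(i := z)) = p * z + m x)"
proof -
  obtain I a where l: "finite I" "l = (\<lambda>x. \<Sum>i\<in>I. a i * x i)"
    using assms unfolding lin_form_def by blast
  have "l (x(i := z)) = (if i \<in> I then a i else 0) * z + (\<Sum>j\<in>I - {i}. a j * x j)" for x z
  proof -
    have "(\<Sum>j\<in>I - {i}. a j * (x(i := z)) j) = (\<Sum>j\<in>I - {i}. a j * x j)"
      by (rule sum.cong) auto
    then show ?thesis
      by (cases "i \<in> I") (auto simp: l sum.remove[of I i])
  qed
  then show ?thesis using lin_formI[of "I - {i}" a] l(1) by blast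
qed

text \<open>The inequalities in the generators are homogeneous. On the ray \<open>t > 0\<close> they are therefore
  constant, and the functions of the class become quasi-polynomials in \<open>t\<close>.\<close>

inductive conic_quasi :: "((nat \<Rightarrow> int) \<Rightarrow> rat) \<Rightarrow> bool" where
  conic_quasi_const: "conic_quasi (\<lambda>_. c)"
| conic_quasi_lin: "lin_form l \<Longrightarrow> conic_quasi (\<lambda>x. of_int (l x))"
| conic_quasi_ge: "lin_form l \<Longrightarrow> conic_quasi (\<lambda>x. of_bool (0 \<le> l x))"
| conic_quasi_dvd: "lin_form l \<Longrightarrow> d > 0 \<Longrightarrow> conic_quasi (\<lambda>x. of_bool (d dvd c + l x))"
| conic_quasi_add: "conic_quasi F \<Longrightarrow> conic_quasi G \<Longrightarrow> conic_quasi (\<lambda>x. F x + G x)"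
| conic_quasi_mult: "conic_quasi F \<Longrightarrow> conic_quasi G \<Longrightarrow> conic_quasi (\<lambda>x. F x * G x)"

lemma conic_quasi_diff: "conic_quasi F \<Longrightarrow> conic_quasi G \<Longrightarrow> conic_quasi (\<lambda>x. F x - G x)"
  using conic_quasi_add[OF _ conic_quasi_mult[OF conic_quasi_const[of "-1"]]] by fastforce

lemma conic_quasi_sum:
  "finite S \<Longrightarrow> (\<And>i. i \<in> S \<Longrightarrow> conic_quasi (f i)) \<Longrightarrow> conic_quasi (\<lambda>x. \<Sum>i\<in>S. f i x)"
  by (induction S rule: finite_induct) (auto intro: conic_quasi_const conic_quasi_add)

lemma conic_quasi_Ball:
  assumes "finite S" "\<And>i. i \<in> S \<Longrightarrow> conic_quasi (\<lambda>x. of_bool (P i x))"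
  shows "conic_quasi (\<lambda>x. of_bool (\<forall>i\<in>S. P i x))"
  using assms
proof (induction S rule: finite_induct)
  case empty show ?case using conic_quasi_const[of 1] by simp
next
  case (insert i S)
  then have "conic_quasi (\<lambda>x. of_bool (P i x) * of_bool (\<forall>i\<in>S. P i x))"
    by (intro conic_quasi_mult) auto
  then show ?case by (simp add: of_bool_conj)
qed

text \<open>A function of a residue is a sum over the residues of its values times congruence
  indicators. The offset c is harmless, since congruences, unlike the inequalities, may carry a
  constant.\<close>

lemma conic_quasi_mod:
  assumes "lin_form l" "p > 0" shows "conic_quasi (\<lambda>x. h ((l x + c) mod p))"
proof -
  have "conic_quasi (\<lambda>x. \<Sum>\<rho>\<in>{0..<p}. h \<rho> * of_bool (p dvd (c - \<rho>) + l x))"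
    using assms by (intro conic_quasi_sum conic_quasi_mult conic_quasi_const conic_quasi_dvd) auto
  moreover have "(\<Sum>\<rho>\<in>{0..<p}. h \<rho> * of_bool (p dvd (c - \<rho>) + l x)) = h ((l x + c) mod p)" for x
  proof -
    have "p dvd (c - \<rho>) + l x \<longleftrightarrow> \<rho> = (l x + c) mod p" if "\<rho> \<in> {0..<p}" for \<rho>
    proof -
      have "(c - \<rho>) + l x = (l x + c) - \<rho>" by simp
      moreover have "\<rho> mod p = \<rho>" using that by simp
      ultimately show ?thesis by (metis mod_eq_dvd_iff)
    qed
    then have "(\<Sum>\<rho>\<in>{0..<p}. h \<rho> * of_bool (p dvd (c - \<rho>) + l x)) =
        (\<Sum>\<rho>\<in>{0..<p}. if \<rho> = (l x + c) mod p then h \<rho> else 0)"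
      by (intro sum.cong) auto
    then show ?thesis using assms by simp
  qed
  ultimately show ?thesis by simp
qed

lemma of_int_div_eq:
  assumes "(p::int) \<noteq> 0"
  shows "of_int (y div p) = (of_int y - of_int (y mod p)) * (1 / of_int p :: rat)"
proof -
  have "of_int y = (of_int p * of_int (y div p) + of_int (y mod p) :: rat)"
    by (metis of_int_add of_int_mult mult_div_mod_eq)
  then show ?thesis using assms by simp
qed

lemma conic_quasi_div:
  assumes "lin_form l" "p > 0" shows "conic_quasi (\<lambda>x. of_int ((l x + c) div p))"
proof -
  have "conic_quasi (\<lambda>x. ((of_int (l x) + of_int c) - of_int ((l x + c) mod p)) * (1 / of_int p))"
    using assms
    by (intro conic_quasi_mult conic_quasi_diff conic_quasi_add conic_quasi_const conic_quasi_lin conic_quasi_mod)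
  then show ?thesis using assms by (simp add: of_int_div_eq)
qed

text \<open>Rounded bounds of summation enter a quasi-polynomial through this lemma. A function of
  period p, evaluated at y div P, depends only on y modulo p P.\<close>

lemma conic_quasi_compose_div:
  assumes "quasi_poly q" "lin_form l" "P > 0"
  shows "conic_quasi (\<lambda>x. q ((l x + c) div P))"
  using assms(1)
proof (induction rule: quasi_poly.induct)
  case quasi_poly_ident
  show ?case using conic_quasi_div assms by blast
next
  case (quasi_poly_periodic p h)
  have "h (y div P) = h ((y mod (p * P)) div P)" for y
  proof -
    have "y = (y mod (p * P)) + P * (p * (y div (p * P)))"
      by (metis mod_mult_div_eq mult.assoc mult.commute)
    then have "y div P = (y mod (p * P)) div P + p * (y div (p * P))"
      using assms(3) by (metis add.commute div_mult_self2 less_numeral_extra(3))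
    then show ?thesis using periodic_add_mult[of h p] quasi_poly_periodic(2) by metis
  qed
  then show ?case
    using conic_quasi_mod[OF assms(2), of "p * P" "\<lambda>y. h (y div P)" c] assms(3) quasi_poly_periodic(1)
    by simp
qed (auto intro: conic_quasi_add conic_quasi_mult)

text \<open>A bound on the summation variable z with parameters x. By the sign of its second
  component it is a lower bound, an upper bound, or a condition on x alone.\<close>

definition satisfies :: "((nat \<Rightarrow> int) \<Rightarrow> int) \<times> int \<Rightarrow> (nat \<Rightarrow> int) \<Rightarrow> int \<Rightarrow> bool" where
  "satisfies b x z \<longleftrightarrow> 0 \<le> snd b * z + fst b x"

lemma le_div_iff_mult:
  assumes p: "(p::int) > 0" shows "z \<le> y div p \<longleftrightarrow> p * z \<le> y"
proof
  assume "z \<le> y div p"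
  then have "p * z \<le> p * (y div p)" using p by (intro mult_left_mono) auto
  also have "\<dots> = y - y mod p" by (simp add: minus_mod_eq_mult_div)
  also have "\<dots> \<le> y" using p by simp
  finally show "p * z \<le> y" .
next
  assume "p * z \<le> y"
  then show "z \<le> y div p" using p zdiv_mono1[of "p * z" y p] by simp
qed

text \<open>With an antidifference s the sum is s(B) - s(A - 1), where A and B are the rounded
  endpoints. Testing A \<le> B would not be a homogeneous condition. Instead the real endpoints are
  compared: if they are in order, then A - 1 \<le> B, and telescoping is valid even when no integer
  lies between them; otherwise the sum is empty.\<close>

lemma conic_quasi_interval_sum:
  assumes "quasi_poly q" "lin_form l" "lin_form m" "p > 0" "p' > 0"
  shows "conic_quasi (\<lambda>x. \<Sum>z | satisfies (l, p) x z \<and> satisfies (m, - p') x z. q z)"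
proof -
  obtain s where s: "quasi_poly s" "\<And>z. s z - s (z - 1) = q z"
    using quasi_poly_antidifference[OF assms(1)] by blast
  define A B where "A x = - (l x div p)" and "B x = m x div p'" for x
  have set: "{z. satisfies (l, p) x z \<and> satisfies (m, - p') x z} = {A x..B x}" for x
  proof -
    have "A x \<le> z \<longleftrightarrow> 0 \<le> p * z + l x" for z
    proof -
      have "A x \<le> z \<longleftrightarrow> - z \<le> l x div p" unfolding A_def by linarith
      then show ?thesis using le_div_iff_mult[OF assms(4), of "- z" "l x"] by auto
    qed
    moreover have "z \<le> B x \<longleftrightarrow> 0 \<le> - p' * z + m x" for z
      using le_div_iff_mult[OF assms(5), of z "m x"] by (auto simp: B_def)
    ultimately show ?thesis by (auto simp: satisfies_def)
  qed
  have eq: "(\<Sum>z | satisfies (l, p) x z \<and> satisfies (m, - p') x z. q z) =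
      of_bool (0 \<le> p * m x + p' * l x) * (s ((m x + 0) div p') - s (((-1) * l x + (-1)) div p))" for x
  proof (cases "0 \<le> p * m x + p' * l x")
    case True
    \<comment> \<open>The predecessor of a ceiling is a floor of a shifted argument, which brings
      the lower endpoint into a form with one division.\<close>
    have 1: "(- l x - 1) div p = A x - 1"
    proof -
      have "z \<le> (- l x - 1) div p \<longleftrightarrow> z \<le> A x - 1" for z
      proof -
        have "z \<le> A x - 1 \<longleftrightarrow> \<not> (- z \<le> l x div p)" by (auto simp: A_def)
        then show ?thesis using le_div_iff_mult[OF assms(4), of "- z" "l x"] le_div_iff_mult[OF assms(4), of z "- l x - 1"]
          by auto
      qed
      then show ?thesis by (meson order_antisym order_refl)
    qed
    have "A x - 1 \<le> B x"
    proof -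
      define y where "y = A x - 1"
      have "y \<le> (- l x - 1) div p" using 1 by (simp add: y_def)
      then have "p * y \<le> - l x - 1" using le_div_iff_mult[OF assms(4)] by blast
      then have "p' * (p * y) \<le> p' * (- l x)" using assms(5) by (intro mult_left_mono) auto
      also have "\<dots> \<le> p * m x" using True by simp
      finally have "p * (p' * y) \<le> p * m x" by (simp add: mult_ac)
      then have "p' * y \<le> m x" using assms(4) by simp
      then show ?thesis using le_div_iff_mult[OF assms(5)] by (simp add: B_def y_def)
    qed
    then have "(\<Sum>z\<in>{A x..B x}. q z) = s (B x) - s (A x - 1)"
      by (intro sum_quasi_poly_antidifference s) auto
    then show ?thesis using True 1 by (simp add: set B_def)
  next
    case False
    have "{A x..B x} = {}"
    proof (rule ccontr)
      assume "{A x..B x} \<noteq> {}"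
      then obtain z where "satisfies (l, p) x z" "satisfies (m, - p') x z" using set[of x] by blast
      then have "p' * (- l x) \<le> p' * (p * z)" "p * (p' * z) \<le> p * m x"
        using assms(4,5) by (intro mult_left_mono; simp add: satisfies_def)+
      then show False using False by (simp add: mult_ac)
    qed
    then show ?thesis using False by (simp add: set)
  qed
  have "conic_quasi (\<lambda>x. of_bool (0 \<le> p * m x + p' * l x) *
      (s ((m x + 0) div p') - s (((-1) * l x + (-1)) div p)))"
    using assms s(1)
    by (intro conic_quasi_mult conic_quasi_diff conic_quasi_ge conic_quasi_compose_div lin_form_add lin_form_scale)
  then show ?thesis by (simp add: eq)
qed

text \<open>Of two bounds on the same side one is implied by the other, on complementary half-spaces.\<close>

lemma conic_quasi_redundant:
  assumes "lin_form l" "lin_form l'" "p * p' > 0"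
    and "conic_quasi (\<lambda>x. \<Sum>z | satisfies (l, p) x z \<and> R x z. q z)"
    and "conic_quasi (\<lambda>x. \<Sum>z | satisfies (l', p') x z \<and> R x z. q z)"
  shows "conic_quasi (\<lambda>x. \<Sum>z | satisfies (l, p) x z \<and> satisfies (l', p') x z \<and> R x z. q z)"
proof -
  \<comment> \<open>The two bounds compared after clearing denominators: for nonnegative D the first
    implies the second, for negative D the converse.\<close>
  define D where "D x = \<bar>p\<bar> * l' x - \<bar>p'\<bar> * l x" for x
  have imp: "satisfies b' x z" if b: "satisfies b x z" "snd b * snd b' > 0" "\<bar>snd b'\<bar> * fst b x \<le> \<bar>snd b\<bar> * fst b' x"
    for b b' x z
  proof -
    obtain m p where bm: "b = (m, p)" by (cases b)
    obtain m' p' where bm': "b' = (m', p')" by (cases b')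
    have z: "0 \<le> p * z + m x" and pp: "p * p' > 0" and le: "\<bar>p'\<bar> * m x \<le> \<bar>p\<bar> * m' x"
      using b by (auto simp: bm bm' satisfies_def)
    have "0 \<le> \<bar>p'\<bar> * (p * z + m x)" using z by simp
    also have "\<dots> \<le> \<bar>p'\<bar> * (p * z) + \<bar>p\<bar> * m' x" using le by (simp add: algebra_simps)
    also have "\<bar>p'\<bar> * (p * z) = \<bar>p\<bar> * (p' * z)"
      using pp by (auto simp: zero_less_mult_iff)
    finally have "0 \<le> \<bar>p\<bar> * (p' * z + m' x)" by (simp add: algebra_simps)
    moreover have "\<bar>p\<bar> > 0" using pp by (auto simp: zero_less_mult_iff)
    ultimately show ?thesis by (simp add: bm' satisfies_def zero_le_mult_iff)
  qed
  have "(\<Sum>z | satisfies (l, p) x z \<and> satisfies (l', p') x z \<and> R x z. q z) =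
     of_bool (0 \<le> D x) * (\<Sum>z | satisfies (l, p) x z \<and> R x z. q z) +
     (1 - of_bool (0 \<le> D x)) * (\<Sum>z | satisfies (l', p') x z \<and> R x z. q z)" for x
  proof (cases "0 \<le> D x")
    case True
    then have "satisfies (l', p') x z" if "satisfies (l, p) x z" for z
      using imp[OF that, of "(l', p')"] assms(3) by (simp add: D_def)
    then have "{z. satisfies (l, p) x z \<and> satisfies (l', p') x z \<and> R x z} = {z. satisfies (l, p) x z \<and> R x z}"
      by blast
    then show ?thesis using True by simp
  next
    case False
    then have "satisfies (l, p) x z" if "satisfies (l', p') x z" for z
      using imp[OF that, of "(l, p)"] assms(3) by (simp add: D_def mult.commute)
    then have "{z. satisfies (l, p) x z \<and> satisfies (l', p') x z \<and> R x z} = {z. satisfies (l', p') x z \<and> R x z}"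
      by blast
    then show ?thesis using False by simp
  qed
  moreover have "conic_quasi (\<lambda>x. of_bool (0 \<le> D x) * (\<Sum>z | satisfies (l, p) x z \<and> R x z. q z) +
     (1 - of_bool (0 \<le> D x)) * (\<Sum>z | satisfies (l', p') x z \<and> R x z. q z))"
    unfolding D_def using assms
    by (intro conic_quasi_add conic_quasi_mult conic_quasi_diff conic_quasi_const conic_quasi_ge lin_form_diff lin_form_scale)
  ultimately show ?thesis by simp
qed

text \<open>Pairs of bounds on the same side are reduced until one lower and one upper bound are
  left. Nonempty lists keep the range of summation finite.\<close>

lemma conic_quasi_lower_upper_sum:
  assumes "quasi_poly q"
    and "\<And>b. b \<in> set Lo \<Longrightarrow> lin_form (fst b) \<and> snd b > 0"
    and "\<And>b. b \<in> set Up \<Longrightarrow> lin_form (fst b) \<and> snd b < 0"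
    and "Lo \<noteq> []" "Up \<noteq> []"
  shows "conic_quasi (\<lambda>x. \<Sum>z | \<forall>b\<in>set Lo \<union> set Up. satisfies b x z. q z)"
  using assms(2-)
proof (induction "length Lo + length Up" arbitrary: Lo Up rule: less_induct)
  case less
  have reduce: "conic_quasi (\<lambda>x. \<Sum>z | \<forall>b\<in>insert b1 (insert b2 S). satisfies b x z. q z)"
    if "conic_quasi (\<lambda>x. \<Sum>z | \<forall>b\<in>insert b1 S. satisfies b x z. q z)"
       "conic_quasi (\<lambda>x. \<Sum>z | \<forall>b\<in>insert b2 S. satisfies b x z. q z)"
       "lin_form (fst b1)" "lin_form (fst b2)" "snd b1 * snd b2 > 0" for b1 b2 S
    using conic_quasi_redundant[of "fst b1" "fst b2" "snd b1" "snd b2" q "\<lambda>x z. \<forall>b\<in>S. satisfies b x z"] that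
    by simp
  consider (Lo) b1 b2 L where "Lo = b1 # b2 # L" | (Up) b1 b2 L where "Up = b1 # b2 # L"
    | (one) b1 b2 where "Lo = [b1]" "Up = [b2]"
    using less.prems(3,4) by (metis list.exhaust)
  then show ?case
  proof cases
    case Lo
    have "conic_quasi (\<lambda>x. \<Sum>z | \<forall>b\<in>set (b # L) \<union> set Up. satisfies b x z. q z)" if "b \<in> {b1, b2}" for b
      using less.prems that by (intro less.hyps) (auto simp: Lo)
    from this[of b1] this[of b2] have
      "conic_quasi (\<lambda>x. \<Sum>z | \<forall>b\<in>insert b1 (insert b2 (set L \<union> set Up)). satisfies b x z. q z)"
      using less.prems(1)[of b1] less.prems(1)[of b2] by (intro reduce) (auto simp: Lo)
    then show ?thesis by (simp add: Lo)
  next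
    case Up
    have "conic_quasi (\<lambda>x. \<Sum>z | \<forall>b\<in>set Lo \<union> set (b # L). satisfies b x z. q z)" if "b \<in> {b1, b2}" for b
      using less.prems that by (intro less.hyps) (auto simp: Up)
    from this[of b1] this[of b2] have
      "conic_quasi (\<lambda>x. \<Sum>z | \<forall>b\<in>insert b1 (insert b2 (set Lo \<union> set L)). satisfies b x z. q z)"
      using less.prems(2)[of b1] less.prems(2)[of b2]
      by (intro reduce) (auto simp: Up mult_neg_neg)
    then show ?thesis by (simp add: Up insert_commute)
  next
    case one
    then show ?thesis
      using conic_quasi_interval_sum[OF assms(1), of "fst b1" "fst b2" "snd b1" "- snd b2"]
        less.prems(1)[of b1] less.prems(2)[of b2] by (simp add: conj_commute)
  qed
qed

text \<open>Normal form for eliminating the variable z: in each term z occurs only in a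
  quasi-polynomial of one variable and in linear bounds.\<close>

inductive separated :: "((nat \<Rightarrow> int) \<Rightarrow> int \<Rightarrow> rat) \<Rightarrow> bool" where
  separated_term: "conic_quasi g \<Longrightarrow> quasi_poly q \<Longrightarrow> (\<And>b. b \<in> set L \<Longrightarrow> lin_form (fst b)) \<Longrightarrow>
    separated (\<lambda>x z. g x * q z * of_bool (\<forall>b\<in>set L. satisfies b x z))"
| separated_add: "separated H \<Longrightarrow> separated K \<Longrightarrow> separated (\<lambda>x z. H x z + K x z)"

lemma separated_mult_term:
  assumes "separated H" "conic_quasi g" "quasi_poly q" "\<And>b. b \<in> set L \<Longrightarrow> lin_form (fst b)"
  shows "separated (\<lambda>x z. H x z * (g x * q z * of_bool (\<forall>b\<in>set L. satisfies b x z)))"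
  using assms(1)
proof (induction rule: separated.induct)
  case (separated_term g' q' L')
  have "separated (\<lambda>x z. (g' x * g x) * (q' z * q z) * of_bool (\<forall>b\<in>set (L' @ L). satisfies b x z))"
    using assms separated_term
    by (intro separated.separated_term conic_quasi_mult quasi_poly_mult) auto
  moreover have "(g' x * g x) * (q' z * q z) * of_bool (\<forall>b\<in>set (L' @ L). satisfies b x z) =
    g' x * q' z * of_bool (\<forall>b\<in>set L'. satisfies b x z) * (g x * q z * of_bool (\<forall>b\<in>set L. satisfies b x z))" for x z
    by (auto simp: ball_Un)
  ultimately show ?case by (simp only:)
qed (auto simp: distrib_right intro: separated_add)

lemma separated_mult:
  assumes "separated H" "separated K" shows "separated (\<lambda>x z. H x z * K x z)"
  using assms(2)
  by (induction rule: separated.induct)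
    (auto simp: distrib_left intro: separated_add separated_mult_term assms(1))

lemma separated_prod: "conic_quasi g \<Longrightarrow> quasi_poly q \<Longrightarrow> separated (\<lambda>x z. g x * q z)"
  using separated_term[of g q "[]"] by simp

lemma separated_sum:
  assumes "finite S" "\<And>i. i \<in> S \<Longrightarrow> separated (f i)"
  shows "separated (\<lambda>x z. \<Sum>i\<in>S. f i x z)"
  using assms
proof (induction S rule: finite_induct)
  case empty
  show ?case using separated_prod[OF conic_quasi_const[of 0] quasi_poly_const[of 0]] by simp
qed (auto intro: separated_add)

text \<open>The only generator that mixes x and z in an inseparable way is the congruence. It is
  split by the residue of z modulo d; for a fixed residue it is a congruence in x alone.\<close>

lemma conic_quasi_separated:
  assumes "conic_quasi F" shows "separated (\<lambda>x z. F (x(i := z)))"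
  using assms
proof (induction rule: conic_quasi.induct)
  case (conic_quasi_const c)
  show ?case using separated_prod[OF conic_quasi.conic_quasi_const[of c] quasi_poly_const[of 1]] by simp
next
  case (conic_quasi_lin l)
  obtain p m where m: "lin_form m" "\<And>x z. l (x(i := z)) = p * z + m x"
    using lin_form_upd[OF conic_quasi_lin] by metis
  have "separated (\<lambda>x z. of_int p * of_int z + of_int (m x) * 1)"
    by (intro separated_add separated_prod conic_quasi.conic_quasi_const conic_quasi.conic_quasi_lin m(1)
        quasi_poly_const quasi_poly_ident)
  then show ?case unfolding m(2) by simp
next
  case (conic_quasi_ge l)
  obtain p m where m: "lin_form m" "\<And>x z. l (x(i := z)) = p * z + m x"
    using lin_form_upd[OF conic_quasi_ge] by metis
  have "separated (\<lambda>x z. 1 * 1 * of_bool (\<forall>b\<in>set [(m, p)]. satisfies b x z))"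
    by (intro separated_term conic_quasi_const quasi_poly_const) (auto simp: m)
  then show ?case unfolding m(2) by (simp add: satisfies_def)
next
  case (conic_quasi_dvd l d c)
  obtain p m where m: "lin_form m" "\<And>x z. l (x(i := z)) = p * z + m x"
    using lin_form_upd[OF conic_quasi_dvd(1)] by metis
  have sep: "separated (\<lambda>x z. \<Sum>\<rho>\<in>{0..<d}. of_bool (d dvd (c + p * \<rho>) + m x) * of_bool ((z + 0) mod d = \<rho>))"
    using conic_quasi_dvd(2)
    by (intro separated_sum separated_prod conic_quasi.conic_quasi_dvd m(1) quasi_poly_mod[where h = "\<lambda>y. of_bool (y = _)"]) auto
  have "(\<Sum>\<rho>\<in>{0..<d}. of_bool (d dvd (c + p * \<rho>) + m x) * of_bool ((z + 0) mod d = \<rho>)) =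
      (of_bool (d dvd c + l (x(i := z))) :: rat)" for x z
  proof -
    have "(\<Sum>\<rho>\<in>{0..<d}. of_bool (d dvd (c + p * \<rho>) + m x) * of_bool ((z + 0) mod d = \<rho>)) =
      (\<Sum>\<rho>\<in>{0..<d}. if \<rho> = z mod d then of_bool (d dvd (c + p * \<rho>) + m x) else (0 :: rat))"
      by (intro sum.cong) auto
    also have "\<dots> = of_bool (d dvd (c + p * (z mod d)) + m x)" using conic_quasi_dvd(2) by simp
    also have "d dvd (c + p * (z mod d)) + m x \<longleftrightarrow> d dvd c + l (x(i := z))"
    proof -
      have "d dvd p * (z - z mod d)" by (simp add: dvd_minus_mod)
      moreover have "c + l (x(i := z)) = (c + p * (z mod d)) + m x + p * (z - z mod d)"
        by (simp add: m(2) algebra_simps)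
      ultimately show ?thesis by (metis dvd_add_left_iff)
    qed
    finally show ?thesis .
  qed
  then show ?case using sep by (simp only:)
qed (auto intro: separated_add separated_mult)

lemma separated_bounded_sum:
  assumes "separated H"
  shows "\<exists>G. conic_quasi G \<and> (\<forall>x. G x = (\<Sum>z\<in>{- K * x 0..K * x 0}. H x z))"
  using assms
proof (induction rule: separated.induct)
  case (separated_term g q L)
  \<comment> \<open>The range of summation itself supplies one lower and one upper bound, so neither
    list is empty; both are homogeneous because the range is a multiple of coordinate 0. Bounds with
    zero coefficient at z factor out of the sum.\<close>
  define Lo where "Lo = ((\<lambda>x. K * x 0), 1) # filter (\<lambda>b. snd b > 0) L"
  define Up where "Up = ((\<lambda>x. K * x 0), -1) # filter (\<lambda>b. snd b < 0) L"
  define Z where "Z = {b \<in> set L. snd b = 0}"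
  define G where "G x = g x * of_bool (\<forall>b\<in>Z. 0 \<le> fst b x) * (\<Sum>z | \<forall>b\<in>set Lo \<union> set Up. satisfies b x z. q z)" for x
  have "conic_quasi G" unfolding G_def
    by (intro conic_quasi_mult separated_term conic_quasi_Ball conic_quasi_ge conic_quasi_lower_upper_sum)
      (use separated_term in \<open>force simp: Z_def Lo_def Up_def intro: lin_form_scale lin_form_coord\<close>)+
  moreover have "G x = (\<Sum>z\<in>{- K * x 0..K * x 0}. g x * q z * of_bool (\<forall>b\<in>set L. satisfies b x z))" for x
  proof -
    have all: "(\<forall>b\<in>set L. satisfies b x z) \<and> z \<in> {- K * x 0..K * x 0} \<longleftrightarrow>
        (\<forall>b\<in>Z. 0 \<le> fst b x) \<and> (\<forall>b\<in>set Lo \<union> set Up. satisfies b x z)" for z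
    proof -
      have "(\<forall>b\<in>set L. satisfies b x z) \<longleftrightarrow> (\<forall>b\<in>Z. satisfies b x z) \<and>
         (\<forall>b\<in>set L. snd b > 0 \<longrightarrow> satisfies b x z) \<and> (\<forall>b\<in>set L. snd b < 0 \<longrightarrow> satisfies b x z)"
      proof -
        have "snd b = 0 \<or> snd b > 0 \<or> snd b < 0" for b :: "((nat \<Rightarrow> int) \<Rightarrow> int) \<times> int" by linarith
        then show ?thesis unfolding Z_def by blast
      qed
      moreover have "(\<forall>b\<in>Z. satisfies b x z) \<longleftrightarrow> (\<forall>b\<in>Z. 0 \<le> fst b x)"
        by (auto simp: Z_def satisfies_def)
      ultimately show ?thesis by (auto simp: Lo_def Up_def satisfies_def)
    qed
    have "(\<Sum>z\<in>{- K * x 0..K * x 0}. g x * q z * of_bool (\<forall>b\<in>set L. satisfies b x z)) =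
      (\<Sum>z\<in>{z\<in>{- K * x 0..K * x 0}. \<forall>b\<in>set L. satisfies b x z}. g x * q z)"
      by (rule sum.mono_neutral_cong_right) auto
    also have "{z\<in>{- K * x 0..K * x 0}. \<forall>b\<in>set L. satisfies b x z} =
      {z. (\<forall>b\<in>Z. 0 \<le> fst b x) \<and> (\<forall>b\<in>set Lo \<union> set Up. satisfies b x z)}" using all by blast
    also have "(\<Sum>z\<in>\<dots>. g x * q z) = G x"
    proof (cases "\<forall>b\<in>Z. 0 \<le> fst b x")
      case False
      then have "{z. (\<forall>b\<in>Z. 0 \<le> fst b x) \<and> (\<forall>b\<in>set Lo \<union> set Up. satisfies b x z)} = {}" by blast
      then show ?thesis using False by (simp only: G_def) simp
    qed (simp add: G_def sum_distrib_left)
    finally show ?thesis by simp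
  qed
  ultimately show ?case by blast
next
  case (separated_add H1 H2)
  then obtain G1 G2 where G: "conic_quasi G1" "\<forall>x. G1 x = (\<Sum>z\<in>{- K * x 0..K * x 0}. H1 x z)"
    "conic_quasi G2" "\<forall>x. G2 x = (\<Sum>z\<in>{- K * x 0..K * x 0}. H2 x z)" by metis
  show ?case
  proof (intro exI conjI allI)
    show "conic_quasi (\<lambda>x. G1 x + G2 x)" by (rule conic_quasi_add[OF G(1,3)])
  qed (simp add: G(2,4) sum.distrib)
qed

lemma conic_quasi_bounded_sum:
  assumes "conic_quasi F"
  shows "\<exists>G. conic_quasi G \<and> (\<forall>x. G x = (\<Sum>z\<in>{- K * x 0..K * x 0}. F (x(i := z))))"
  by (rule separated_bounded_sum[OF conic_quasi_separated[OF assms]])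

section \<open>Lattice points of dilated polytopes\<close>

definition box :: "nat set \<Rightarrow> int \<Rightarrow> (nat \<Rightarrow> int) set" where
  "box J b = {e. (\<forall>j\<in>J. e j \<in> {- b..b}) \<and> (\<forall>j. j \<notin> J \<longrightarrow> e j = 0)}"

text \<open>Lattice coordinate j sits at position j + 1, which leaves position 0 for the dilation
  factor.\<close>

definition ray_point :: "(nat \<Rightarrow> int) \<Rightarrow> nat set \<Rightarrow> (nat \<Rightarrow> int) \<Rightarrow> nat \<Rightarrow> int" where
  "ray_point x J e i = (case i of 0 \<Rightarrow> x 0 | Suc j \<Rightarrow> if j \<in> J then e j else x i)"

lemma bij_betw_box_insert:
  assumes "j \<notin> J"
  shows "bij_betw (\<lambda>(z, e). e(j := z)) ({- b..b} \<times> box J b) (box (insert j J) b)"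
  by (rule bij_betwI[where g = "\<lambda>e. (e j, e(j := 0))"])
    (use assms in \<open>auto simp: box_def split: if_splits\<close>)

lemma finite_box: "finite J \<Longrightarrow> finite (box J b)"
proof (induction J rule: finite_induct)
  case empty
  have "box {} b = {\<lambda>_. 0}" by (auto simp: box_def)
  then show ?case by simp
next
  case (insert j J)
  then show ?case using bij_betw_finite[OF bij_betw_box_insert[of j J b]] by simp
qed

text \<open>One coordinate is summed out at a time. The size of the box depends on position 0 only,
  which these substitutions never change.\<close>

lemma conic_quasi_box_sum:
  assumes "finite J" "conic_quasi F"
  shows "\<exists>G. conic_quasi G \<and> (\<forall>x. G x = (\<Sum>e\<in>box J (K * x 0). F (ray_point x J e)))"
  using assms
proof (induction J arbitrary: F rule: finite_induct)
  case empty
  have "box {} b = {\<lambda>_. 0}" for b by (auto simp: box_def)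
  moreover have "ray_point x {} e = x" for x e by (auto simp: ray_point_def split: nat.splits)
  ultimately show ?case using empty by auto
next
  case (insert j J)
  obtain F' where F': "conic_quasi F'" "\<And>x. F' x = (\<Sum>z\<in>{- K * x 0..K * x 0}. F (x(Suc j := z)))"
    using conic_quasi_bounded_sum[OF insert.prems] by metis
  obtain G where G: "conic_quasi G" "\<And>x. G x = (\<Sum>e\<in>box J (K * x 0). F' (ray_point x J e))"
    using insert.IH[OF F'(1)] by metis
  have "G x = (\<Sum>e\<in>box (insert j J) (K * x 0). F (ray_point x (insert j J) e))" for x
  proof -
    have upd: "(ray_point x J e)(Suc j := z) = ray_point x (insert j J) (e(j := z))" for e z
      using insert.hyps by (auto simp: ray_point_def fun_eq_iff split: nat.splits)
    have 0: "ray_point x J e 0 = x 0" for e by (simp add: ray_point_def)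
    have "G x = (\<Sum>e\<in>box J (K * x 0). \<Sum>z\<in>{- (K * x 0)..K * x 0}. F (ray_point x (insert j J) (e(j := z))))"
      by (simp add: G(2) F'(2) upd 0)
    also have "\<dots> = (\<Sum>z\<in>{- (K * x 0)..K * x 0}. \<Sum>e\<in>box J (K * x 0). F (ray_point x (insert j J) (e(j := z))))"
      by (rule sum.swap)
    also have "\<dots> = (\<Sum>(z, e)\<in>{- (K * x 0)..K * x 0} \<times> box J (K * x 0). F (ray_point x (insert j J) (e(j := z))))"
      by (simp add: sum.cartesian_product)
    also have "\<dots> = (\<Sum>e\<in>box (insert j J) (K * x 0). F (ray_point x (insert j J) e))"
      using sum.reindex_bij_betw[OF bij_betw_box_insert[OF insert.hyps(2), of "K * x 0"],
          of "\<lambda>e. F (ray_point x (insert j J) e)"]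
      by (simp add: case_prod_beta)
    finally show ?thesis .
  qed
  then show ?case using G(1) by blast
qed

lemma conic_quasi_ray:
  assumes "conic_quasi F"
  shows "\<exists>q. quasi_poly q \<and> (\<forall>t>0. q t = F (\<lambda>i. if i = 0 then t else 0))"
proof -
  have ray: "\<exists>a. \<forall>t. l (\<lambda>i. if i = 0 then t else 0) = a * t" if lf: "lin_form l" for l
  proof -
    obtain I a where l: "finite I" "l = (\<lambda>x. \<Sum>i\<in>I. a i * x i)"
      using lf by (rule lin_formE)
    have "l (\<lambda>i. if i = 0 then t else 0) = (if 0 \<in> I then a 0 else 0) * t" for t
    proof -
      have "l (\<lambda>i. if i = 0 then t else 0) = (\<Sum>i\<in>I. if i = 0 then a 0 * t else 0)"
        unfolding l(2) by (rule sum.cong) auto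
      then show ?thesis using l(1) by (simp only: sum.delta) simp
    qed
    then show ?thesis by blast
  qed
  show ?thesis using assms
  proof (induction rule: conic_quasi.induct)
    case (conic_quasi_const c)
    show ?case using quasi_poly_const by blast
  next
    case (conic_quasi_lin l)
    obtain a where "\<And>t. l (\<lambda>i. if i = 0 then t else 0) = a * t" using ray[OF conic_quasi_lin] by blast
    then show ?case
      by (intro exI[of _ "\<lambda>t. of_int a * of_int t"]) (simp add: quasi_poly_mult quasi_poly_const quasi_poly_ident)
  next
    case (conic_quasi_ge l)
    obtain a where "\<And>t. l (\<lambda>i. if i = 0 then t else 0) = a * t" using ray[OF conic_quasi_ge] by blast
    then show ?case
      by (intro exI[of _ "\<lambda>t. of_bool (0 \<le> a)"]) (auto simp: quasi_poly_const zero_le_mult_iff)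
  next
    case (conic_quasi_dvd l d c)
    obtain a where a: "\<And>t. l (\<lambda>i. if i = 0 then t else 0) = a * t" using ray[OF conic_quasi_dvd(1)] by blast
    have "quasi_poly (\<lambda>t. of_bool (d dvd c + a * t))"
    proof (rule quasi_poly_periodic[OF conic_quasi_dvd(2)])
      fix t
      have e: "c + a * (t + d) = (c + a * t) + a * d" by (simp add: algebra_simps)
      show "(of_bool (d dvd c + a * (t + d)) :: rat) = of_bool (d dvd c + a * t)"
        unfolding e by (simp add: dvd_add_left_iff del: add.assoc)
    qed
    then show ?case by (auto simp: a)
  next
    case (conic_quasi_add F G)
    obtain q where q: "quasi_poly q" "\<forall>t>0. q t = F (\<lambda>i. if i = 0 then t else 0)"
      using conic_quasi_add.IH(1) by (elim exE conjE)
    obtain q' where q': "quasi_poly q'" "\<forall>t>0. q' t = G (\<lambda>i. if i = 0 then t else 0)"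
      using conic_quasi_add.IH(2) by (elim exE conjE)
    show ?case using q(2) q'(2) quasi_poly_add[OF q(1) q'(1)]
      by (intro exI[of _ "\<lambda>t. q t + q' t"] conjI) simp_all
  next
    case (conic_quasi_mult F G)
    obtain q where q: "quasi_poly q" "\<forall>t>0. q t = F (\<lambda>i. if i = 0 then t else 0)"
      using conic_quasi_mult.IH(1) by (elim exE conjE)
    obtain q' where q': "quasi_poly q'" "\<forall>t>0. q' t = G (\<lambda>i. if i = 0 then t else 0)"
      using conic_quasi_mult.IH(2) by (elim exE conjE)
    show ?case using q(2) q'(2) quasi_poly_mult[OF q(1) q'(1)]
      by (intro exI[of _ "\<lambda>t. q t * q' t"] conjI) simp_all
  qed
qed

lemma common_denominator:
  fixes S :: "rat set"
  assumes "finite S"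
  shows "\<exists>D::int. D > 0 \<and> (\<forall>s\<in>S. of_int D * s \<in> \<int>)"
  using assms
proof (induction S rule: finite_induct)
  case empty show ?case by (intro exI[of _ 1]) auto
next
  case (insert s S)
  then obtain D :: int where D: "D > 0" "\<forall>s\<in>S. of_int D * s \<in> \<int>" by blast
  obtain a b where s: "s = of_int a / of_int b" "b > 0"
    by (metis quotient_of_div quotient_of_denom_pos surj_pair)
  have "of_int (b * D) * s' \<in> \<int>" if "s' \<in> insert s S" for s'
  proof (cases "s' = s")
    case True
    then have "of_int (b * D) * s' = of_int (D * a)" using s by simp
    then show ?thesis by (metis Ints_of_int)
  next
    case False
    then have "of_int D * s' \<in> \<int>" using D that by auto
    from Ints_mult[OF Ints_of_int[of b] this] show ?thesis by (simp only: mult.assoc of_int_mult)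
  qed
  then show ?case using D(1) s(2) by (intro exI[of _ "b * D"]) auto
qed

text \<open>Denominators are cleared in the coefficients and in the constant term together, so the
  condition becomes an integral linear form in (t, e) without constant.\<close>

lemma integral_linear_equation:
  fixes c v :: "nat \<Rightarrow> rat"
  assumes "finite J"
  shows "\<exists>a b. \<forall>e t. (\<Sum>j\<in>J. c j * (of_int (e j) - of_int t * v j)) = 0 \<longleftrightarrow> (\<Sum>j\<in>J. a j * e j) - b * t = (0 :: int)"
proof -
  obtain D :: int where D: "D > 0" "\<forall>s\<in>insert (\<Sum>j\<in>J. c j * v j) (c ` J). of_int D * s \<in> \<int>"
    using common_denominator[of "insert (\<Sum>j\<in>J. c j * v j) (c ` J)"] assms by auto
  then have "\<forall>j. \<exists>a. j \<in> J \<longrightarrow> of_int D * c j = of_int a" by (auto elim!: Ints_cases)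
  then obtain a where a: "\<And>j. j \<in> J \<Longrightarrow> of_int D * c j = of_int (a j)" by metis
  obtain b where b: "of_int D * (\<Sum>j\<in>J. c j * v j) = of_int b" using D by (auto elim!: Ints_cases)
  have "(\<Sum>j\<in>J. c j * (of_int (e j) - of_int t * v j)) = 0 \<longleftrightarrow> (\<Sum>j\<in>J. a j * e j) - b * t = 0" for e t
  proof -
    have "of_int D * (\<Sum>j\<in>J. c j * (of_int (e j) - of_int t * v j)) =
       (\<Sum>j\<in>J. (of_int D * c j) * of_int (e j)) - of_int t * (of_int D * (\<Sum>j\<in>J. c j * v j))"
      by (simp add: sum_distrib_left sum_subtractf algebra_simps)
    also have "(\<Sum>j\<in>J. (of_int D * c j) * of_int (e j)) = (\<Sum>j\<in>J. of_int (a j) * of_int (e j))"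
      using a by (intro sum.cong) auto
    also have "\<dots> - of_int t * (of_int D * (\<Sum>j\<in>J. c j * v j)) = (of_int ((\<Sum>j\<in>J. a j * e j) - b * t) :: rat)"
      unfolding b by (simp add: mult.commute)
    finally have "of_int D * (\<Sum>j\<in>J. c j * (of_int (e j) - of_int t * v j)) =
      (of_int ((\<Sum>j\<in>J. a j * e j) - b * t) :: rat)" .
    moreover have "(of_int D :: rat) \<noteq> 0" using D(1) by simp
    moreover have "x = 0 \<longleftrightarrow> y = 0" if "d * x = of_int y" "d \<noteq> 0" for d x :: rat and y :: int
      using that by auto
    ultimately show ?thesis by blast
  qed
  then show ?thesis by blast
qed

text \<open>The bound K t lets the count be written as a sum over a box whose size is linear in t;
  the sum stays in the conic class and is then restricted to the ray.\<close>

lemma quasi_poly_lattice_points: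
  fixes v :: "nat \<Rightarrow> rat" and C :: "(nat \<Rightarrow> rat) set"
  assumes J: "finite J" "Jp \<subseteq> J" "Jm \<subseteq> J" and C: "finite C"
  defines "A t \<equiv> {e \<in> int_lattice J. (\<forall>j\<in>Jp. 0 \<le> e j) \<and> (\<forall>j\<in>Jm. e j \<le> 0) \<and>
      (\<forall>c\<in>C. (\<Sum>j\<in>J. c j * (e j - of_int t * v j)) = 0)}"
  assumes bound: "\<And>t e j. t > 0 \<Longrightarrow> e \<in> A t \<Longrightarrow> j \<in> J \<Longrightarrow> \<bar>e j\<bar> \<le> of_int (K * t)"
  shows "\<exists>q. quasi_poly q \<and> (\<forall>t>0. q t = of_nat (card (A t)))"
proof -
  have "\<forall>c. \<exists>a b. \<forall>e t. (\<Sum>j\<in>J. c j * (of_int (e j) - of_int t * v j)) = 0 \<longleftrightarrow> (\<Sum>j\<in>J. a j * e j) - b * t = (0 :: int)"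
    using integral_linear_equation[OF J(1)] by blast
  from choice[OF this] obtain a where
    "\<forall>c. \<exists>b. \<forall>e t. (\<Sum>j\<in>J. c j * (of_int (e j) - of_int t * v j)) = 0 \<longleftrightarrow> (\<Sum>j\<in>J. a c j * e j) - b * t = (0 :: int)"
    by (rule exE)
  from choice[OF this] obtain b where ab:
    "\<forall>c e t. (\<Sum>j\<in>J. c j * (of_int (e j) - of_int t * v j)) = 0 \<longleftrightarrow> (\<Sum>j\<in>J. a c j * e j) - b c * t = (0 :: int)"
    by (rule exE)
  define l where "l c x = (\<Sum>j\<in>J. a c j * x (Suc j)) - b c * x 0" for c and x :: "nat \<Rightarrow> int"
  have l: "lin_form (l c)" for c
    unfolding l_def by (intro lin_form_diff lin_form_sum lin_form_scale lin_form_coord J)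
  \<comment> \<open>An equation is encoded by two opposite inequalities.\<close>
  define F where "F x = of_bool (\<forall>c\<in>C. 0 \<le> l c x) * (of_bool (\<forall>c\<in>C. 0 \<le> (-1) * l c x) *
      (of_bool (\<forall>j\<in>Jp. 0 \<le> x (Suc j)) * (of_bool (\<forall>j\<in>Jm. 0 \<le> (-1) * x (Suc j)) :: rat)))" for x
  have "finite Jp" "finite Jm" using J finite_subset by auto
  then have "conic_quasi F" unfolding F_def
    by (intro conic_quasi_mult conic_quasi_Ball conic_quasi_ge C l lin_form_scale lin_form_coord)
  then obtain G where G: "conic_quasi G" "\<And>x. G x = (\<Sum>e\<in>box J (K * x 0). F (ray_point x J e))"
    using conic_quasi_box_sum[OF J(1)] by metis
  obtain q where q: "quasi_poly q" "\<And>t. t > 0 \<Longrightarrow> q t = G (\<lambda>i. if i = 0 then t else 0)"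
    using conic_quasi_ray[OF G(1)] by blast
  have "q t = of_nat (card (A t))" if t: "t > 0" for t
  proof -
    define S where "S = {e \<in> box J (K * t). F (ray_point (\<lambda>i. if i = 0 then t else 0) J e) = 1}"
    have F01: "F x = of_bool (F x = 1)" for x by (auto simp: F_def)
    have "q t = (\<Sum>e\<in>box J (K * t). of_bool (F (ray_point (\<lambda>i. if i = 0 then t else 0) J e) = 1))"
      unfolding q(2)[OF t] G(2) by (subst F01) simp
    also have "\<dots> = of_nat (card S)"
      using finite_box[OF J(1)] by (simp add: S_def Int_def)
    also have "card S = card (A t)"
    proof (rule bij_betw_same_card, rule bij_betwI')
      fix e e' :: "nat \<Rightarrow> int"
      show "((\<lambda>j. of_int (e j)) = (\<lambda>j. of_int (e' j) :: rat)) = (e = e')"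
        by (auto simp: fun_eq_iff)
    next
      have iff: "e \<in> S \<longleftrightarrow> e \<in> box J (K * t) \<and> (\<lambda>j. of_int (e j)) \<in> A t" for e
      proof (cases "e \<in> box J (K * t)")
        case True
        define x where "x = ray_point (\<lambda>i. if i = 0 then t else 0) J e"
        have x: "x 0 = t" "x (Suc j) = e j" for j
          using True by (auto simp: x_def ray_point_def box_def)
        have "F x = 1 \<longleftrightarrow> (\<forall>c\<in>C. 0 \<le> l c x) \<and> (\<forall>c\<in>C. 0 \<le> (-1) * l c x) \<and>
            (\<forall>j\<in>Jp. 0 \<le> x (Suc j)) \<and> (\<forall>j\<in>Jm. 0 \<le> (-1) * x (Suc j))"
          by (simp add: F_def)
        also have "\<dots> \<longleftrightarrow> (\<forall>c\<in>C. l c x = 0) \<and> (\<forall>j\<in>Jp. 0 \<le> e j) \<and> (\<forall>j\<in>Jm. e j \<le> 0)"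
          by (force simp: x)
        also have "(\<forall>c\<in>C. l c x = 0) \<longleftrightarrow> (\<forall>c\<in>C. (\<Sum>j\<in>J. c j * (of_int (e j) - of_int t * v j)) = 0)"
          by (simp only: ab l_def x)
        also have "\<dots> \<and> (\<forall>j\<in>Jp. 0 \<le> e j) \<and> (\<forall>j\<in>Jm. e j \<le> 0) \<longleftrightarrow> (\<lambda>j. of_int (e j)) \<in> A t"
          using True by (auto simp: A_def int_lattice_def coord_space_def box_def)
        finally show ?thesis using True by (simp add: S_def x_def)
      qed (simp add: S_def)
      {
        fix e assume "e \<in> S" then show "(\<lambda>j. of_int (e j)) \<in> A t" using iff by blast
      next
        fix d assume d: "d \<in> A t"
        then have "\<forall>j. d j \<in> \<int>" "d \<in> coord_space J" by (auto simp: A_def int_lattice_def)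
        then have fl: "of_int \<lfloor>d j\<rfloor> = d j" for j by (simp add: of_int_floor)
        have "\<lfloor>d j\<rfloor> \<in> {- (K * t)..K * t}" if "j \<in> J" for j
        proof -
          have "\<bar>of_int \<lfloor>d j\<rfloor>\<bar> \<le> (of_int (K * t) :: rat)" using bound[OF t d that] by (simp add: fl)
          then have "\<bar>\<lfloor>d j\<rfloor>\<bar> \<le> K * t" by linarith
          then show ?thesis by (simp add: abs_le_iff)
        qed
        then have "(\<lambda>j. \<lfloor>d j\<rfloor>) \<in> box J (K * t)"
          using \<open>d \<in> coord_space J\<close> by (auto simp: box_def coord_space_def)
        moreover have "(\<lambda>j. of_int \<lfloor>d j\<rfloor>) = d" by (rule ext) (rule fl)
        ultimately have "(\<lambda>j. \<lfloor>d j\<rfloor>) \<in> S" using d by (simp only: iff simp_thms)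
        then show "\<exists>e\<in>S. d = (\<lambda>j. of_int (e j))"
          by (rule bexI[rotated]) (rule ext, rule fl[symmetric])
      }
    qed
    finally show ?thesis .
  qed
  then show ?thesis using q(1) by blast
qed

section \<open>Points of a given type\<close>

lemma sum_fun_apply: "(\<Sum>i\<in>S. f i) x = (\<Sum>i\<in>S. f i x)"
  by (induction S rule: infinite_finite_induct) auto

lemma eta_comb_apply: "eta_comb g S \<gamma> t = (if t \<in> g then \<Sum>i\<in>S. \<gamma> i * t i else 0)"
  by (auto simp: eta_comb_def sum_fun_apply fscale_def eta_def)

lemma eta_comb_eq_0_iff: "eta_comb g S \<gamma> = 0 \<longleftrightarrow> (\<forall>t\<in>g. (\<Sum>i\<in>S. \<gamma> i * t i) = 0)"
  by (auto simp: fun_eq_iff eta_comb_apply)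

lemma eta_comb_mono:
  assumes "finite T" "S \<subseteq> T" "\<And>i. i \<in> T - S \<Longrightarrow> \<gamma> i = 0"
  shows "eta_comb g T \<gamma> = eta_comb g S \<gamma>"
proof -
  have "(\<Sum>i\<in>T. \<gamma> i * t i) = (\<Sum>i\<in>S. \<gamma> i * t i)" for t
    using assms by (intro sum.mono_neutral_right) auto
  then show ?thesis by (auto simp: fun_eq_iff eta_comb_apply)
qed

lemma of_rat_sum_eq: "(of_rat (\<Sum>i\<in>S. f i) :: 'a::field_char_0) = (\<Sum>i\<in>S. of_rat (f i))"
  by (induction S rule: infinite_finite_induct) (auto simp: of_rat_add)

text \<open>Used at two kinds of points: at \<alpha> for the polytope, and at each multiple
  x\<alpha> of the same type for the algebra.\<close>

locale typed_point =
  fixes r s :: nat and g :: "(nat \<Rightarrow> 'k::{alg_closed_field, field_char_0}) set"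
    and \<alpha> :: "nat \<Rightarrow> rat" and J Jp Jm :: "nat set"
  assumes g_subspace: "fun_space.subspace g" and g_coord: "g \<subseteq> coord_space {1..r+s}"
    and type: "of_type r s g \<alpha> J Jp Jm"
begin

abbreviation "E \<equiv> Eset (r + s) g"

lemma decomposition: "sign_decomposition r s g \<alpha> (Tset r \<alpha> - J) J"
  using type by (simp add: of_type_def sign_configuration_def)

lemma J_subset_T: "J \<subseteq> Tset r \<alpha>"
  using decomposition by (auto simp: sign_decomposition_def)

lemma J_subset: "J \<subseteq> {1..r}"
  using J_subset_T by (auto simp: Tset_def)

lemma J_subset': "J \<subseteq> {1..r+s}"
  using J_subset by auto

lemma finite_J [simp]: "finite J"
  using J_subset finite_subset by blast

lemma Jp_eq: "Jp = {j \<in> J. 0 \<le> \<alpha> j}" and Jm_eq: "Jm = {j \<in> J. \<alpha> j < 0}"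
  using type by (auto simp: of_type_def sign_configuration_def)

lemma Jp_subset: "Jp \<subseteq> J" and Jm_subset: "Jm \<subseteq> J"
  by (auto simp: Jp_eq Jm_eq)

lemma J_integral: "j \<in> J \<Longrightarrow> \<alpha> j \<in> \<int>"
  using J_subset_T by (auto simp: Tset_def)

lemma mem_E_iff: "u \<in> E \<longleftrightarrow> u \<in> coord_space {1..r+s} \<and> (\<forall>t\<in>g. (\<Sum>i\<in>{1..r+s}. of_rat (u i) * t i) = 0)"
  by (auto simp: Eset_def Vset_def eta_comb_eq_0_iff of_rat_vec_def coord_space_def)

lemma V0_subset_E: "V0set g J \<subseteq> E"
proof
  fix v assume v: "v \<in> V0set g J"
  then have "eta_comb g {1..r+s} (of_rat_vec v) = (eta_comb g J (of_rat_vec v) :: (nat \<Rightarrow> 'k) \<Rightarrow> 'k)"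
    using J_subset' by (intro eta_comb_mono) (auto simp: V0set_def coord_space_def of_rat_vec_def)
  then show "v \<in> E" using v J_subset'
    by (auto simp: V0set_def Eset_def Vset_def coord_space_def of_rat_vec_def)
qed

text \<open>Conditions modulo V_0 can thus be tested in E, where the sign configuration
  lives.\<close>

lemma V0_eq: "V0set g J = {v \<in> coord_space J. v \<in> E}"
proof -
  have "v \<in> V0set g J" if "v \<in> coord_space J" "v \<in> E" for v
  proof -
    have "eta_comb g {1..r+s} (of_rat_vec v) = (eta_comb g J (of_rat_vec v) :: (nat \<Rightarrow> 'k) \<Rightarrow> 'k)"
      using J_subset' that by (intro eta_comb_mono) (auto simp: coord_space_def of_rat_vec_def)
    then show ?thesis using that by (auto simp: V0set_def Eset_def Vset_def)
  qed
  then show ?thesis using V0_subset_E by (auto simp: V0set_def)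
qed

lemma E_add: "u \<in> E \<Longrightarrow> v \<in> E \<Longrightarrow> u + v \<in> E"
  by (auto simp: mem_E_iff coord_space_def of_rat_add distrib_right sum.distrib)

lemma E_scale: "u \<in> E \<Longrightarrow> fscale c u \<in> E"
  by (auto simp: mem_E_iff coord_space_def fscale_def of_rat_mult mult.assoc sum_distrib_left[symmetric])

lemma E_0: "0 \<in> E"
  by (auto simp: mem_E_iff coord_space_def)

lemma E_minus: "u \<in> E \<Longrightarrow> - u \<in> E"
  using E_scale[of u "-1"] by (simp add: fscale_def fun_Compl_def)

lemma E_diff: "u \<in> E \<Longrightarrow> v \<in> E \<Longrightarrow> u - v \<in> E"
  using E_add[OF _ E_minus] by fastforce

text \<open>Rationality of g enters here: it supplies finitely many equations with rational
  coefficients, as counting lattice points demands.\<close>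

lemma V0_equations: "\<exists>C :: (nat \<Rightarrow> rat) set. finite C \<and> V0set g J = {v \<in> coord_space J. \<forall>c\<in>C. (\<Sum>j\<in>J. c j * v j) = 0}"
proof -
  obtain C :: "(nat \<Rightarrow> rat) set" where C: "finite C"
    "Vset (r+s) g = {\<gamma> \<in> coord_space {1..r+s}. \<forall>c\<in>C. (\<Sum>i\<in>{1..r+s}. of_rat (c i) * \<gamma> i) = 0}"
    using type unfolding of_type_def rational_subspace_def by blast
  have "v \<in> E \<longleftrightarrow> (\<forall>c\<in>C. (\<Sum>j\<in>J. c j * v j) = 0)" if v: "v \<in> coord_space J" for v
  proof -
    have "(\<Sum>i\<in>{1..r+s}. of_rat (c i) * of_rat (v i)) = (of_rat (\<Sum>j\<in>J. c j * v j) :: 'k)" for c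
    proof -
      have "(\<Sum>i\<in>{1..r+s}. of_rat (c i) * of_rat (v i)) = (\<Sum>i\<in>J. of_rat (c i) * (of_rat (v i) :: 'k))"
        using v J_subset' by (intro sum.mono_neutral_right) (auto simp: coord_space_def)
      then show ?thesis by (simp add: of_rat_sum_eq of_rat_mult)
    qed
    moreover have "v \<in> coord_space {1..r+s}" "of_rat_vec v \<in> (coord_space {1..r+s} :: (nat \<Rightarrow> 'k) set)"
      using v J_subset' by (auto simp: coord_space_def of_rat_vec_def)
    ultimately show ?thesis unfolding Eset_def C(2) by (simp add: of_rat_vec_def)
  qed
  then show ?thesis using C(1) V0_eq by (intro exI[of _ C]) auto
qed

text \<open>The relation among the \<lambda>_i in the sign configuration is supported on J with
  positive coefficients. Up to a global sign it says that a weighted signed sum vanishes on E; on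
  the orthant of \<alpha> that sum is a weighted l1-norm, and this is why the polytopes are
  bounded.\<close>

lemma positive_relation:
  "\<exists>c :: nat \<Rightarrow> rat. (\<forall>j\<in>J. c j > 0) \<and>
     (\<forall>v\<in>E. (\<Sum>j\<in>J. c j * ((if j \<in> Jm then -1 else 1) * v j)) = 0)"
proof -
  obtain c where c: "\<And>u. u \<in> E \<Longrightarrow> (\<Sum>i\<in>Tset r \<alpha>. c i * lam \<alpha> i u) = 0"
    "\<forall>i\<in>Tset r \<alpha> - J. c i = 0" "\<forall>j\<in>J. c j > 0"
    using decomposition unfolding sign_decomposition_def by blast
  have "(\<Sum>j\<in>J. c j * ((if j \<in> Jm then -1 else 1) * v j)) = 0" if v: "v \<in> E" for v
  proof -
    have "(\<Sum>i\<in>Tset r \<alpha>. c i * lam \<alpha> i v) = (\<Sum>i\<in>J. c i * lam \<alpha> i v)"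
      using J_subset_T c(2) by (intro sum.mono_neutral_right) (auto simp: Tset_def)
    also have "\<dots> = - (\<Sum>j\<in>J. c j * ((if j \<in> Jm then -1 else 1) * v j))"
      unfolding sum_negf[symmetric] by (rule sum.cong) (auto simp: lam_def Jm_eq)
    finally show ?thesis using c(1)[OF v] by simp
  qed
  then show ?thesis using c(3) by blast
qed

section \<open>Slices of the sign cone\<close>

text \<open>The part of the closed sign orthant lying in \<kappa> \<alpha>_J + V_0, a slice of a
  cone at height \<kappa>. Translated polytopes and dilates of Q are all of this form.\<close>

definition orthant_slice :: "rat \<Rightarrow> (nat \<Rightarrow> rat) set" where
  "orthant_slice \<kappa> = {e \<in> coord_space J. (\<forall>j\<in>Jp. 0 \<le> e j) \<and> (\<forall>j\<in>Jm. e j \<le> 0) \<and>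
     e - fscale \<kappa> (restrict_coord J \<alpha>) \<in> E}"

lemma zvec_coord: "zvec Jm \<in> coord_space J"
  using Jm_subset by (auto simp: zvec_def coord_space_def)

lemma restrict_coord_\<alpha>_sign: "j \<in> J \<Longrightarrow> (if j \<in> Jm then -1 else 1) * \<alpha> j = \<bar>\<alpha> j\<bar>"
  by (auto simp: Jm_eq)

lemma PJ_iff:
  "d \<in> PJ g (fscale x \<alpha>) J Jp Jm \<longleftrightarrow> d \<in> coord_space J \<and> d - fscale x (restrict_coord J \<alpha>) \<in> E \<and>
     (\<forall>j\<in>Jp. 0 \<le> d j) \<and> (\<forall>j\<in>Jm. d j \<le> -1)"
proof (cases "d \<in> coord_space J")
  case True
  have diff: "d - fscale x (restrict_coord J \<alpha>) \<in> coord_space J"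
    using True by (auto simp: coord_space_def fscale_def restrict_coord_def)
  then have "d - fscale x (restrict_coord J \<alpha>) \<in> E \<longleftrightarrow> d - fscale x (restrict_coord J \<alpha>) \<in> V0set g J"
    using V0_eq by blast
  also have "\<dots> \<longleftrightarrow> (\<forall>t\<in>g. (\<Sum>i\<in>J. of_rat ((d - fscale x (restrict_coord J \<alpha>)) i) * t i) = 0)"
    using diff by (simp add: V0set_def eta_comb_eq_0_iff of_rat_vec_def)
  also have "\<dots> \<longleftrightarrow> (\<forall>t\<in>g. (\<Sum>i\<in>J. of_rat (d i) * t i) = (\<Sum>i\<in>J. of_rat (fscale x \<alpha> i) * t i))"
    by (simp add: restrict_coord_def fscale_def of_rat_diff left_diff_distrib sum_subtractf)
  also have "\<dots> \<longleftrightarrow> eta_comb g J (of_rat_vec d) = eta_comb g J (of_rat_vec (fscale x \<alpha>))"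
    by (auto simp: fun_eq_iff eta_comb_apply of_rat_vec_def)
  finally show ?thesis using True by (auto simp: PJ_def)
qed (simp add: PJ_def)

text \<open>The relation is applied to e - \<kappa> \<alpha>_J. Both e and \<alpha>_J lie in the
  orthant, so the signs turn their coordinates into absolute values.\<close>

lemma orthant_slice_bound:
  assumes c: "\<forall>j\<in>J. c j > 0" "\<forall>v\<in>E. (\<Sum>j\<in>J. c j * ((if j \<in> Jm then -1 else 1) * v j)) = 0"
    and e: "e \<in> orthant_slice \<kappa>"
  shows "(\<Sum>j\<in>J. c j * \<bar>e j\<bar>) = \<kappa> * (\<Sum>j\<in>J. c j * \<bar>\<alpha> j\<bar>)"
proof -
  have "0 = (\<Sum>j\<in>J. c j * ((if j \<in> Jm then -1 else 1) * (e - fscale \<kappa> (restrict_coord J \<alpha>)) j))"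
    using e c(2) unfolding orthant_slice_def by fastforce
  also have "\<dots> = (\<Sum>j\<in>J. c j * \<bar>e j\<bar> - \<kappa> * (c j * \<bar>\<alpha> j\<bar>))"
  proof (rule sum.cong[OF refl])
    fix j assume j: "j \<in> J"
    have "(if j \<in> Jm then -1 else 1) * e j = \<bar>e j\<bar>"
    proof (cases "j \<in> Jm")
      case False
      then have "j \<in> Jp" using j by (simp add: Jp_eq Jm_eq)
      then show ?thesis using False e by (simp add: orthant_slice_def)
    qed (use e in \<open>simp add: orthant_slice_def\<close>)
    with restrict_coord_\<alpha>_sign[OF j] j
    show "c j * ((if j \<in> Jm then -1 else 1) * (e - fscale \<kappa> (restrict_coord J \<alpha>)) j) = c j * \<bar>e j\<bar> - \<kappa> * (c j * \<bar>\<alpha> j\<bar>)"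
      by (auto simp: fscale_def restrict_coord_def algebra_simps split: if_splits)
  qed
  finally show ?thesis by (simp add: sum_subtractf sum_distrib_left)
qed

end

section \<open>The polytope Q and its dilates\<close>

locale polytope_data = typed_point +
  fixes a0 :: rat and aZ aN :: int and Q :: "(nat \<Rightarrow> rat) set"
  assumes \<alpha>_neq_z: "restrict_coord J \<alpha> \<noteq> zvec Jm"
    and z_mem: "zvec Jm \<in> {fscale a0 (restrict_coord J \<alpha>) + v | v. v \<in> V0set g J}"
    and a0_eq: "a0 = of_int aZ / of_int aN" and aN_pos: "aN > 0"
    and Q_eq: "Q = (\<lambda>d. fscale (1 / of_int (aN - aZ)) (d - zvec Jm)) ` PJ g \<alpha> J Jp Jm"
begin

lemma z_E: "zvec Jm - fscale a0 (restrict_coord J \<alpha>) \<in> E"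
  using z_mem V0_subset_E by (auto simp: algebra_simps)

text \<open>The vector \<alpha>_J - z lies in the slice of height 1 - a0, so its weighted norm is 1
  - a0 times that of \<alpha>_J. It is nonzero, hence its norm and therefore 1 - a0 are
  positive.\<close>

lemma a0_less_1: "a0 < 1"
proof -
  obtain c where c: "\<forall>j\<in>J. c j > 0" "\<forall>v\<in>E. (\<Sum>j\<in>J. c j * ((if j \<in> Jm then -1 else 1) * v j)) = 0"
    using positive_relation by blast
  define e where "e = restrict_coord J \<alpha> - zvec Jm"
  \<comment> \<open>Integrality on J: a negative integer is at most -1, so subtracting z does not
    leave the orthant.\<close>
  have int: "\<alpha> j \<le> -1" if "j \<in> Jm" for j
  proof -
    have "\<alpha> j \<in> \<int>" "\<alpha> j < 0" using that J_integral by (auto simp: Jm_eq)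
    then obtain m where "\<alpha> j = of_int m" "m < 0" by (auto elim!: Ints_cases)
    then show ?thesis by simp
  qed
  have "e - fscale (1 - a0) (restrict_coord J \<alpha>) = - (zvec Jm - fscale a0 (restrict_coord J \<alpha>))"
    by (auto simp: e_def fscale_def fun_eq_iff algebra_simps)
  then have "e - fscale (1 - a0) (restrict_coord J \<alpha>) \<in> E" using E_minus[OF z_E] by simp
  moreover have "e \<in> coord_space J" using zvec_coord by (auto simp: e_def coord_space_def restrict_coord_def)
  moreover have "\<forall>j\<in>Jp. 0 \<le> e j" by (auto simp: e_def Jp_eq Jm_eq zvec_def restrict_coord_def)
  moreover have "\<forall>j\<in>Jm. e j \<le> 0" using int Jm_subset by (force simp: e_def zvec_def restrict_coord_def)
  ultimately have "e \<in> orthant_slice (1 - a0)" by (simp add: orthant_slice_def)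
  from orthant_slice_bound[OF c this] have eq: "(\<Sum>j\<in>J. c j * \<bar>e j\<bar>) = (1 - a0) * (\<Sum>j\<in>J. c j * \<bar>\<alpha> j\<bar>)" .
  have "e \<noteq> 0" using \<alpha>_neq_z by (auto simp: e_def)
  then obtain j where "e j \<noteq> 0" by (auto simp: fun_eq_iff)
  moreover have "j \<in> J" using \<open>e \<in> coord_space J\<close> \<open>e j \<noteq> 0\<close> by (auto simp: coord_space_def)
  ultimately have "0 < (\<Sum>j\<in>J. c j * \<bar>e j\<bar>)" using c(1)
    by (intro sum_pos2[of _ j]) auto
  moreover have "0 \<le> (\<Sum>j\<in>J. c j * \<bar>\<alpha> j\<bar>)" using c(1) by (intro sum_nonneg) auto
  ultimately have "0 < 1 - a0" unfolding eq by (auto simp: zero_less_mult_iff)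
  then show ?thesis by simp
qed

lemma aN_aZ: "aN - aZ > 0"
proof -
  have "(of_int aZ :: rat) < of_int aN" using a0_less_1 aN_pos by (simp add: a0_eq divide_less_eq)
  then show ?thesis by simp
qed

text \<open>Subtracting z turns d_j \<le> -1 into d_j \<le> 0, and since z lies in a0 \<alpha>_J +
  V_0 it lowers the height from x to x - a0.\<close>

lemma PJ_translate:
  "d \<in> PJ g (fscale x \<alpha>) J Jp Jm \<longleftrightarrow> d - zvec Jm \<in> orthant_slice (x - a0)"
proof -
  have "d - zvec Jm - fscale (x - a0) (restrict_coord J \<alpha>) =
     (d - fscale x (restrict_coord J \<alpha>)) - (zvec Jm - fscale a0 (restrict_coord J \<alpha>))"
    by (auto simp: fscale_def fun_eq_iff algebra_simps)
  then have "d - zvec Jm - fscale (x - a0) (restrict_coord J \<alpha>) \<in> E \<longleftrightarrow> d - fscale x (restrict_coord J \<alpha>) \<in> E"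
    using E_diff[OF _ z_E] E_add[OF _ z_E] by (metis diff_add_cancel)
  moreover have "d - zvec Jm \<in> coord_space J \<longleftrightarrow> d \<in> coord_space J"
    using zvec_coord by (auto simp: coord_space_def)
  moreover have "(d - zvec Jm) j = d j" if "j \<in> Jp" for j
    using that by (auto simp: zvec_def Jp_eq Jm_eq)
  moreover have "(d - zvec Jm) j = d j + 1" if "j \<in> Jm" for j
    using that by (auto simp: zvec_def)
  ultimately show ?thesis unfolding PJ_iff orthant_slice_def by force
qed

lemma orthant_slice_scale:
  assumes "\<tau> > 0"
  shows "fscale \<tau> e \<in> orthant_slice (\<tau> * \<kappa>) \<longleftrightarrow> e \<in> orthant_slice \<kappa>"
proof -
  have "fscale \<tau> e - fscale (\<tau> * \<kappa>) (restrict_coord J \<alpha>) = fscale \<tau> (e - fscale \<kappa> (restrict_coord J \<alpha>))"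
    by (auto simp: fscale_def fun_eq_iff algebra_simps)
  moreover have "fscale \<tau> v \<in> E \<longleftrightarrow> v \<in> E" for v
  proof
    assume "fscale \<tau> v \<in> E"
    then have "fscale (1 / \<tau>) (fscale \<tau> v) \<in> E" by (rule E_scale)
    then show "v \<in> E" using assms by (simp add: fscale_def)
  qed (rule E_scale)
  moreover have "fscale \<tau> e \<in> coord_space J \<longleftrightarrow> e \<in> coord_space J"
    using assms by (auto simp: fscale_def coord_space_def)
  moreover have "0 \<le> fscale \<tau> e j \<longleftrightarrow> 0 \<le> e j" "fscale \<tau> e j \<le> 0 \<longleftrightarrow> e j \<le> 0" for j
    using assms by (auto simp: fscale_def zero_le_mult_iff mult_le_0_iff)
  ultimately show ?thesis by (simp add: orthant_slice_def)
qed

text \<open>P_J - z has height 1 - a0 = (aN - aZ)/aN. Dividing by aN - aZ leaves height 1/aN for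
  Q.\<close>

lemma Q_dilate:
  assumes "t > 0"
  shows "fscale (of_int t) ` Q = orthant_slice (of_int t / of_int aN)"
proof -
  define m where "m = (of_int (aN - aZ) :: rat)"
  have m: "m > 0" using aN_aZ by (simp add: m_def)
  have 1: "1 - a0 = m / of_int aN" using aN_pos by (simp add: a0_eq m_def field_simps)
  define \<tau> where "\<tau> = of_int t / m"
  have \<tau>: "\<tau> > 0" using assms m by (simp add: \<tau>_def)
  have eq: "\<tau> * (1 - a0) = of_int t / of_int aN" using m by (simp add: 1 \<tau>_def)
  have "fscale (of_int t) ` Q = fscale \<tau> ` (\<lambda>d. d - zvec Jm) ` PJ g \<alpha> J Jp Jm"
    unfolding Q_eq image_image by (simp add: fscale_def \<tau>_def m_def)
  also have "(\<lambda>d. d - zvec Jm) ` PJ g \<alpha> J Jp Jm = orthant_slice (1 - a0)"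
  proof -
    have "fscale 1 \<alpha> = \<alpha>" by (simp add: fscale_def)
    then have "d \<in> PJ g \<alpha> J Jp Jm \<longleftrightarrow> d - zvec Jm \<in> orthant_slice (1 - a0)" for d
      using PJ_translate[of d 1] by simp
    note iff = this
    show ?thesis
    proof safe
      fix e assume "e \<in> orthant_slice (1 - a0)"
      then have "e + zvec Jm \<in> PJ g \<alpha> J Jp Jm" by (simp add: iff)
      then show "e \<in> (\<lambda>d. d - zvec Jm) ` PJ g \<alpha> J Jp Jm" by (rule rev_image_eqI) simp
    qed (simp add: iff)
  qed
  also have "fscale \<tau> ` orthant_slice (1 - a0) = orthant_slice (\<tau> * (1 - a0))"
  proof safe
    fix e assume e: "e \<in> orthant_slice (\<tau> * (1 - a0))"
    have "fscale \<tau> (fscale (1 / \<tau>) e) = e" using \<tau> by (simp add: fscale_def)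
    then show "e \<in> fscale \<tau> ` orthant_slice (1 - a0)"
      using e orthant_slice_scale[OF \<tau>, of "fscale (1 / \<tau>) e"] by (metis image_eqI)
  qed (use orthant_slice_scale[OF \<tau>] in blast)
  finally show ?thesis unfolding eq .
qed

lemma EHP_quasi_poly:
  "quasi_poly (EHP J Q)"
  "t > 0 \<Longrightarrow> EHP J Q t = of_nat (card (orthant_slice (of_int t / of_int aN) \<inter> int_lattice J))"
proof -
  obtain C :: "(nat \<Rightarrow> rat) set"
    where C: "finite C" "V0set g J = {v \<in> coord_space J. \<forall>c\<in>C. (\<Sum>j\<in>J. c j * v j) = 0}"
    using V0_equations by blast
  define v where "v = (\<lambda>j. \<alpha> j / of_int aN)"
  define A where "A t = {e \<in> int_lattice J. (\<forall>j\<in>Jp. 0 \<le> e j) \<and> (\<forall>j\<in>Jm. e j \<le> 0) \<and>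
      (\<forall>c\<in>C. (\<Sum>j\<in>J. c j * (e j - of_int t * v j)) = 0)}" for t :: int
  have A: "A t = orthant_slice (of_int t / of_int aN) \<inter> int_lattice J" for t
  proof -
    have "(\<forall>c\<in>C. (\<Sum>j\<in>J. c j * (e j - of_int t * v j)) = 0) \<longleftrightarrow>
        e - fscale (of_int t / of_int aN) (restrict_coord J \<alpha>) \<in> E" if "e \<in> coord_space J" for e
    proof -
      let ?w = "e - fscale (of_int t / of_int aN) (restrict_coord J \<alpha>)"
      have w: "?w \<in> coord_space J" using that by (auto simp: coord_space_def fscale_def restrict_coord_def)
      have "(\<Sum>j\<in>J. c j * (e j - of_int t * v j)) = (\<Sum>j\<in>J. c j * ?w j)" for c
        by (rule sum.cong) (auto simp: v_def fscale_def restrict_coord_def)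
      moreover have "?w \<in> E \<longleftrightarrow> ?w \<in> V0set g J" using w V0_eq by blast
      moreover have "?w \<in> V0set g J \<longleftrightarrow> (\<forall>c\<in>C. (\<Sum>j\<in>J. c j * ?w j) = 0)" unfolding C(2) using w by blast
      ultimately show ?thesis by (simp only:)
    qed
    then show ?thesis by (auto simp: A_def orthant_slice_def int_lattice_def)
  qed
  obtain c where c: "\<forall>j\<in>J. c j > 0" "\<forall>v\<in>E. (\<Sum>j\<in>J. c j * ((if j \<in> Jm then -1 else 1) * v j)) = 0"
    using positive_relation by blast
  \<comment> \<open>The weighted norm on tQ is t M, whence |e_j| \<le> t M / c_j. The integer K
    dominates all M / c_j.\<close>
  define M where "M = (\<Sum>j\<in>J. c j * \<bar>\<alpha> j\<bar>) / of_int aN"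
  define K where "K = (\<Sum>j\<in>J. \<bar>\<lceil>M / c j\<rceil>\<bar>)"
  have "\<bar>e j\<bar> \<le> of_int (K * t)" if t: "t > 0" and e: "e \<in> A t" and j: "j \<in> J" for t e j
  proof -
    have "c j * \<bar>e j\<bar> \<le> (\<Sum>j\<in>J. c j * \<bar>e j\<bar>)"
      using j c(1) by (intro member_le_sum) auto
    also have "\<dots> = of_int t * M"
      using orthant_slice_bound[OF c, of e "of_int t / of_int aN"] e by (simp add: A M_def)
    finally have "\<bar>e j\<bar> \<le> of_int t * (M / c j)" using c(1) j by (simp add: field_simps)
    also have "M / c j \<le> of_int \<bar>\<lceil>M / c j\<rceil>\<bar>" by linarith
    also have "\<bar>\<lceil>M / c j\<rceil>\<bar> \<le> K" unfolding K_def using j by (intro member_le_sum) auto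
    finally show ?thesis using t by (simp add: mult.commute)
  qed
  then obtain q where q: "quasi_poly q" "\<And>t. t > 0 \<Longrightarrow> q t = of_nat (card (A t))"
    using quasi_poly_lattice_points[OF finite_J Jp_subset Jm_subset C(1), of v K] unfolding A_def by blast
  have "EHP J Q = q"
    by (rule EHP_eqI[OF q(1)]) (simp add: q(2) A Q_dilate)
  then show "quasi_poly (EHP J Q)"
    "t > 0 \<Longrightarrow> EHP J Q t = of_nat (card (orthant_slice (of_int t / of_int aN) \<inter> int_lattice J))"
    using q A by auto
qed

text \<open>The height x - a0 of the translated polytope of x\<alpha> is that of the dilate by aN x
  - aZ. The translation vector z is integral and preserves the lattice.\<close>

lemma EHP_eq_card_PJ:
  assumes "x > 0"
  shows "EHP J Q (aN * x - aZ) = of_nat (card (PJ g (fscale (of_int x) \<alpha>) J Jp Jm \<inter> int_lattice J))"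
proof -
  have "aN * x \<ge> aN" using assms aN_pos by simp
  then have pos: "aN * x - aZ > 0" using aN_aZ by linarith
  have eq: "of_int (aN * x - aZ) / of_int aN = of_int x - a0" using aN_pos by (simp add: a0_eq field_simps)
  have z: "zvec Jm \<in> int_lattice J" using zvec_coord by (auto simp: int_lattice_def zvec_def)
  have "bij_betw (\<lambda>d. d - zvec Jm) (PJ g (fscale (of_int x) \<alpha>) J Jp Jm \<inter> int_lattice J)
      (orthant_slice (of_int x - a0) \<inter> int_lattice J)"
  proof (rule bij_betwI[where g = "\<lambda>d. d + zvec Jm"])
    have "d - zvec Jm \<in> int_lattice J \<longleftrightarrow> d \<in> int_lattice J" for d
    proof
      assume "d - zvec Jm \<in> int_lattice J"
      then have "d j - zvec Jm j + zvec Jm j \<in> \<int>" "d j - zvec Jm j \<in> \<int>" for j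
        using z unfolding int_lattice_def by (auto intro: Ints_add Ints_diff)
      then show "d \<in> int_lattice J" using \<open>d - zvec Jm \<in> int_lattice J\<close> z
        by (auto simp: int_lattice_def coord_space_def)
    qed (use z in \<open>auto simp: int_lattice_def coord_space_def intro: Ints_diff\<close>)
    from this[of d for d] this[of "d + zvec Jm" for d]
    show "(\<lambda>d. d - zvec Jm) \<in> PJ g (fscale (of_int x) \<alpha>) J Jp Jm \<inter> int_lattice J \<rightarrow> orthant_slice (of_int x - a0) \<inter> int_lattice J"
      "(\<lambda>d. d + zvec Jm) \<in> orthant_slice (of_int x - a0) \<inter> int_lattice J \<rightarrow> PJ g (fscale (of_int x) \<alpha>) J Jp Jm \<inter> int_lattice J"
      by (auto simp: PJ_translate)
  qed auto
  then show ?thesis using EHP_quasi_poly(2)[OF pos] unfolding eq by (simp only: bij_betw_same_card)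
qed

end

section \<open>Computations in the Weyl algebra\<close>

definition mon :: "weyl_gen list \<Rightarrow> 'k::field free_alg" where
  "mon l = Poly_Mapping.single (Word l) 1"

lemma mon_append: "mon (l @ m) = mon l * mon m"
  by (simp add: mon_def mult_single plus_word_def)

lemma mon_Nil: "mon [] = 1"
  by (simp add: mon_def zero_word_def[symmetric])

lemma fgen_eq_mon: "fgen a = mon [a]"
  by (simp add: fgen_def mon_def)

lemma mon_Cons: "mon (a # l) = fgen a * mon l"
  using mon_append[of "[a]" l] by (simp add: fgen_eq_mon)

lemma single_eq_mon: "Poly_Mapping.single w c = fconst c * mon (letters w)"
  by (simp add: fconst_def mon_def mult_single)

lemma fconst_add: "fconst (c + d) = fconst c + fconst d"
  by (simp add: fconst_def single_add)

lemma fconst_mult: "fconst (c * d) = fconst c * fconst d"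
  by (simp add: fconst_def mult_single)

lemma fconst_0: "fconst 0 = 0" and fconst_1: "fconst 1 = 1"
  by (simp_all add: fconst_def)

lemma fconst_minus: "fconst (- c) = - fconst c"
  by (simp add: fconst_def single_uminus)

lemma fconst_diff: "fconst (c - d) = fconst c - fconst d"
  by (simp add: fconst_def single_diff)

lemma fconst_sum: "fconst (\<Sum>i\<in>S. c i) = (\<Sum>i\<in>S. fconst (c i))"
  by (induction S rule: infinite_finite_induct) (auto simp: fconst_0 fconst_add)

lemma free_alg_expand:
  fixes p :: "'a \<Rightarrow>\<^sub>0 'b::comm_monoid_add"
  shows "p = (\<Sum>w\<in>Poly_Mapping.keys p. Poly_Mapping.single w (Poly_Mapping.lookup p w))"
proof (rule poly_mapping_eqI)
  fix v
  have "(\<Sum>w\<in>Poly_Mapping.keys p. Poly_Mapping.lookup (Poly_Mapping.single w (Poly_Mapping.lookup p w)) v) =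
    (\<Sum>w\<in>Poly_Mapping.keys p. if w = v then Poly_Mapping.lookup p v else 0)"
    by (intro sum.cong) (auto simp: lookup_single when_def)
  also have "\<dots> = Poly_Mapping.lookup p v"
    by (simp add: in_keys_iff)
  finally show "Poly_Mapping.lookup p v =
      Poly_Mapping.lookup (\<Sum>w\<in>Poly_Mapping.keys p. Poly_Mapping.single w (Poly_Mapping.lookup p w)) v"
    by (simp add: lookup_sum)
qed

lemma fconst_commute: "fconst c * p = p * fconst c"
proof -
  have "fconst c * (\<Sum>w\<in>Poly_Mapping.keys p. Poly_Mapping.single w (Poly_Mapping.lookup p w)) =
      (\<Sum>w\<in>Poly_Mapping.keys p. Poly_Mapping.single w (Poly_Mapping.lookup p w)) * fconst c"
    unfolding sum_distrib_left sum_distrib_right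
    by (intro sum.cong) (auto simp: fconst_def mult_single mult.commute)
  then show ?thesis by (simp flip: free_alg_expand)
qed

lemma lookup_fconst_mult: "Poly_Mapping.lookup (fconst c * p) w = c * Poly_Mapping.lookup p w"
  unfolding fconst_def mult_map_scale_conv_mult[symmetric] by (simp add: map.rep_eq when_def)

text \<open>The eigenvalues of the commutators with the \<pi>_i, that is, the Z^n-grading of the
  Weyl algebra.\<close>

fun gen_wt :: "weyl_gen \<Rightarrow> nat \<Rightarrow> int" where
  "gen_wt (GX i) = (\<lambda>j. if j = i then 1 else 0)"
| "gen_wt (GXinv i) = (\<lambda>j. if j = i then - 1 else 0)"
| "gen_wt (GD i) = (\<lambda>j. if j = i then - 1 else 0)"

fun gen_idx :: "weyl_gen \<Rightarrow> nat" where
  "gen_idx (GX i) = i" | "gen_idx (GXinv i) = i" | "gen_idx (GD i) = i"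

definition list_wt :: "weyl_gen list \<Rightarrow> nat \<Rightarrow> int" where
  "list_wt l i = (\<Sum>a\<leftarrow>l. gen_wt a i)"

lemma list_wt_Nil [simp]: "list_wt [] = 0"
  and list_wt_Cons: "list_wt (a # l) = gen_wt a + list_wt l"
  and list_wt_append: "list_wt (l @ m) = list_wt l + list_wt m"
  by (auto simp: list_wt_def)

definition tor :: "nat \<Rightarrow> (nat \<Rightarrow> 'k::field) \<Rightarrow> 'k free_alg" where
  "tor n t = (\<Sum>i\<in>{1..n}. fconst (t i) * fgen (GX i) * fgen (GD i))"

definition pairing :: "nat \<Rightarrow> (nat \<Rightarrow> 'k::field) \<Rightarrow> (nat \<Rightarrow> int) \<Rightarrow> 'k" where
  "pairing n t u = (\<Sum>i\<in>{1..n}. t i * of_int (u i))"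

lemma pairing_add: "pairing n t (u + v) = pairing n t u + pairing n t v"
  by (simp add: pairing_def distrib_left sum.distrib)

section \<open>Calculation modulo the relations\<close>

text \<open>The numbers r and s do not mention the field; the \<open>itself\<close> parameter fixes
  it.\<close>

locale weyl_alg =
  fixes r s :: nat and field_type :: "'k::field_char_0 itself"
begin

abbreviation F :: "'k free_alg ring" where "F \<equiv> free_weyl r s"
abbreviation A :: "'k free_alg set" where "A \<equiv> carrier F"
abbreviation I :: "'k free_alg set" where "I \<equiv> weyl_ideal r s"

lemma A_eq: "A = {p. \<forall>w\<in>Poly_Mapping.keys p. set (letters w) \<subseteq> weyl_gens r s}"
  by (simp add: free_weyl_def ring_of_type_algebra_def)

lemma F_simps [simp]:
  "monoid.mult F = (*)" "ring.add F = (+)" "\<one>\<^bsub>F\<^esub> = 1" "\<zero>\<^bsub>F\<^esub> = 0"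
  by (simp_all add: free_weyl_def ring_of_type_algebra_def)

lemma A_add: "p \<in> A \<Longrightarrow> q \<in> A \<Longrightarrow> p + q \<in> A"
  using keys_add[of p q] by (auto simp: A_eq)

lemma A_mult: assumes "p \<in> A" "q \<in> A" shows "p * q \<in> A"
proof -
  have "set (letters w) \<subseteq> weyl_gens r s" if w: "w \<in> Poly_Mapping.keys (p * q)" for w
  proof -
    obtain u v where "w = u + v" "u \<in> Poly_Mapping.keys p" "v \<in> Poly_Mapping.keys q"
      using w keys_mult[of p q] by blast
    then show ?thesis using assms by (simp add: A_eq plus_word_def)
  qed
  then show ?thesis by (simp add: A_eq)
qed

lemma A_uminus: "p \<in> A \<Longrightarrow> - p \<in> A"
  by (simp add: A_eq in_keys_iff)

lemma A_diff: "p \<in> A \<Longrightarrow> q \<in> A \<Longrightarrow> p - q \<in> A"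
  using A_add[OF _ A_uminus] by fastforce

lemma A_fconst: "fconst c \<in> A"
  by (simp add: A_eq fconst_def zero_word_def)

lemma A_0: "0 \<in> A" and A_1: "1 \<in> A"
  using A_fconst[of 0] A_fconst[of 1] by (simp_all add: fconst_0 fconst_1)

lemma A_sum: "(\<And>i. i \<in> S \<Longrightarrow> f i \<in> A) \<Longrightarrow> (\<Sum>i\<in>S. f i) \<in> A"
  by (induction S rule: infinite_finite_induct) (auto intro: A_0 A_add)

lemma A_mon: "set l \<subseteq> weyl_gens r s \<Longrightarrow> mon l \<in> A"
  by (simp add: A_eq mon_def)

lemma A_fgen: "a \<in> weyl_gens r s \<Longrightarrow> fgen a \<in> A"
  by (simp add: A_mon fgen_eq_mon)

lemma gens_mem:
  "i \<in> {1..r+s} \<Longrightarrow> GX i \<in> weyl_gens r s" "i \<in> {1..r+s} \<Longrightarrow> GD i \<in> weyl_gens r s"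
  "i \<in> {r+1..r+s} \<Longrightarrow> GXinv i \<in> weyl_gens r s"
  by (auto simp: weyl_gens_def)

lemma A_tor: "tor (r+s) t \<in> A"
  unfolding tor_def by (intro A_sum A_mult A_fconst A_fgen gens_mem)

sublocale F: ring F
proof -
  have "\<exists>y. x + y = 0" for x :: "'k free_alg"
    using add.right_inverse by blast
  then interpret R: ring "ring_of_type_algebra :: 'k free_alg ring"
    unfolding ring_of_type_algebra_def using add.right_inverse
    by unfold_locales (auto simp: algebra_simps Units_def)
  have "\<ominus>\<^bsub>ring_of_type_algebra\<^esub> p = - p" for p :: "'k free_alg"
    by (rule R.minus_equality) (simp_all add: ring_of_type_algebra_def)
  then have "subring A (ring_of_type_algebra :: 'k free_alg ring)"
    by (intro R.subringI) (auto simp: ring_of_type_algebra_def intro: A_1 A_uminus A_mult A_add)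
  then show "ring F"
    using R.subring_is_ring[of A] by (simp add: free_weyl_def)
qed

lemma F_a_inv: "p \<in> A \<Longrightarrow> \<ominus>\<^bsub>F\<^esub> p = - p"
  by (rule F.minus_equality) (simp_all add: A_uminus)

lemma relators_subset: "weyl_relators r s \<subseteq> A"
  unfolding weyl_relators_def
  by (auto intro!: A_diff A_mult A_fgen gens_mem A_1 A_0)

sublocale I: ideal I F
  unfolding weyl_ideal_def by (rule F.genideal_ideal[OF relators_subset])

lemma relators_I: "weyl_relators r s \<subseteq> I"
  unfolding weyl_ideal_def by (rule F.genideal_self[OF relators_subset])

lemma I_subset: "I \<subseteq> A" by (rule I.a_subset)

lemma I_A: "p \<in> I \<Longrightarrow> p \<in> A" using I_subset by blast

lemma I_add: "p \<in> I \<Longrightarrow> q \<in> I \<Longrightarrow> p + q \<in> I"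
  using I.a_closed[of p q] by simp

lemma I_0: "0 \<in> I"
  using I.zero_closed by simp

lemma I_uminus: "p \<in> I \<Longrightarrow> - p \<in> I"
  using I.a_inv_closed[of p] I_A F_a_inv by simp

lemma I_diff: "p \<in> I \<Longrightarrow> q \<in> I \<Longrightarrow> p - q \<in> I"
  using I_add[OF _ I_uminus] by fastforce

lemma I_mult_left: "a \<in> A \<Longrightarrow> p \<in> I \<Longrightarrow> a * p \<in> I"
  using I.I_l_closed by simp

lemma I_mult_right: "a \<in> A \<Longrightarrow> p \<in> I \<Longrightarrow> p * a \<in> I"
  using I.I_r_closed by simp

definition weq :: "'k free_alg \<Rightarrow> 'k free_alg \<Rightarrow> bool" (infix "\<approx>" 50) where
  "p \<approx> q \<longleftrightarrow> p - q \<in> I"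

lemma weq_refl [simp]: "p \<approx> p"
  by (simp add: weq_def I_0)

lemma weq_sym: "p \<approx> q \<Longrightarrow> q \<approx> p"
  using I_uminus[of "p - q"] by (simp add: weq_def)

lemma weq_trans [trans]: "p \<approx> q \<Longrightarrow> q \<approx> v \<Longrightarrow> p \<approx> v"
  using I_add[of "p - q" "q - v"] by (simp add: weq_def)

lemma weq_add: "p \<approx> q \<Longrightarrow> p' \<approx> q' \<Longrightarrow> p + p' \<approx> q + q'"
  using I_add[of "p - q" "p' - q'"] by (simp add: weq_def algebra_simps)

lemma weq_diff: "p \<approx> q \<Longrightarrow> p' \<approx> q' \<Longrightarrow> p - p' \<approx> q - q'"
  using I_diff[of "p - q" "p' - q'"] by (simp add: weq_def algebra_simps)

lemma weq_mult_left: "a \<in> A \<Longrightarrow> p \<approx> q \<Longrightarrow> a * p \<approx> a * q"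
  using I_mult_left[of a "p - q"] by (simp add: weq_def algebra_simps)

lemma weq_mult_right: "a \<in> A \<Longrightarrow> p \<approx> q \<Longrightarrow> p * a \<approx> q * a"
  using I_mult_right[of a "p - q"] by (simp add: weq_def algebra_simps)

lemma weq_sum: "(\<And>i. i \<in> S \<Longrightarrow> f i \<approx> h i) \<Longrightarrow> (\<Sum>i\<in>S. f i) \<approx> (\<Sum>i\<in>S. h i)"
  by (induction S rule: infinite_finite_induct) (auto intro: weq_add)

lemma weq_A: "p \<approx> q \<Longrightarrow> q \<in> A \<Longrightarrow> p \<in> A"
  using A_add[of "p - q" q] I_A by (simp add: weq_def)

lemma comm_XX: "i \<in> {1..r+s} \<Longrightarrow> j \<in> {1..r+s} \<Longrightarrow> fgen (GX i) * fgen (GX j) \<approx> fgen (GX j) * fgen (GX i)"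
  unfolding weq_def by (rule subsetD[OF relators_I]) (unfold weyl_relators_def, blast)

lemma comm_DD: "i \<in> {1..r+s} \<Longrightarrow> j \<in> {1..r+s} \<Longrightarrow> fgen (GD i) * fgen (GD j) \<approx> fgen (GD j) * fgen (GD i)"
  unfolding weq_def by (rule subsetD[OF relators_I]) (unfold weyl_relators_def, blast)

lemma comm_DX:
  assumes "i \<in> {1..r+s}" "j \<in> {1..r+s}"
  shows "fgen (GD i) * fgen (GX j) \<approx> fgen (GX j) * fgen (GD i) + (if i = j then 1 else 0)"
proof -
  have "fgen (GD i) * fgen (GX j) - fgen (GX j) * fgen (GD i) - (if i = j then 1 else 0) \<in> weyl_relators r s"
    using assms unfolding weyl_relators_def by blast
  then show ?thesis using relators_I by (auto simp: weq_def algebra_simps)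
qed

lemma X_Xinv: "i \<in> {r+1..r+s} \<Longrightarrow> fgen (GX i) * fgen (GXinv i) \<approx> 1"
  unfolding weq_def by (rule subsetD[OF relators_I]) (unfold weyl_relators_def, blast)

lemma Xinv_X: "i \<in> {r+1..r+s} \<Longrightarrow> fgen (GXinv i) * fgen (GX i) \<approx> 1"
  unfolding weq_def by (rule subsetD[OF relators_I]) (unfold weyl_relators_def, blast)

text \<open>With v the inverse of x: b v = v x b v = v b x v = v b.\<close>

lemma comm_Xinv:
  assumes i: "i \<in> {r+1..r+s}" and b: "b \<in> A" and comm: "b * fgen (GX i) \<approx> fgen (GX i) * b"
  shows "b * fgen (GXinv i) \<approx> fgen (GXinv i) * b"
proof -
  define x v :: "'k free_alg" where "x = fgen (GX i)" and "v = fgen (GXinv i)"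
  have "i \<in> {1..r+s}" using i by auto
  then have A: "x \<in> A" "v \<in> A" using i by (simp_all add: x_def v_def A_fgen gens_mem)
  have "b * v = 1 * (b * v)" by simp
  also have "\<dots> \<approx> v * x * (b * v)"
    by (intro weq_mult_right weq_sym[OF Xinv_X[OF i, folded x_def v_def]] A A_mult b)
  also have "\<dots> = v * (x * b) * v" by (simp add: mult.assoc)
  also have "\<dots> \<approx> v * (b * x) * v"
    by (intro weq_mult_right weq_mult_left weq_sym[OF comm[folded x_def]] A)
  also have "\<dots> = v * b * (x * v)" by (simp add: mult.assoc)
  also have "\<dots> \<approx> v * b * 1"
    by (intro weq_mult_left A_mult A b X_Xinv[OF i, folded x_def v_def])
  finally show ?thesis by (simp add: x_def v_def)
qed

lemma gen_cases:
  assumes "a \<in> weyl_gens r s"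
  obtains (X) i where "a = GX i" "i \<in> {1..r+s}" | (D) i where "a = GD i" "i \<in> {1..r+s}"
    | (V) i where "a = GXinv i" "i \<in> {r+1..r+s}" "i \<in> {1..r+s}"
  using assms by (auto simp: weyl_gens_def)

lemma comm_gens:
  assumes "a \<in> weyl_gens r s" "b \<in> weyl_gens r s" "gen_idx a \<noteq> gen_idx b"
  shows "fgen a * fgen b \<approx> fgen b * fgen a"
proof -
  have comm_X: "fgen b * fgen (GX i) \<approx> fgen (GX i) * fgen b"
    if i: "i \<in> {1..r+s}" "i \<noteq> gen_idx b" and b: "b \<in> weyl_gens r s" for i b
    using b
  proof (cases rule: gen_cases)
    case (X j)
    then show ?thesis using comm_XX i by simp
  next
    case (D j)
    then show ?thesis using comm_DX[of j i] i by simp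
  next
    case (V j)
    then show ?thesis using i weq_sym[OF comm_Xinv[OF V(2) A_fgen[OF gens_mem(1)] comm_XX]] by simp
  qed
  have comm_V: "fgen b * fgen (GXinv i) \<approx> fgen (GXinv i) * fgen b"
    if i: "i \<in> {r+1..r+s}" "i \<in> {1..r+s}" "i \<noteq> gen_idx b" and b: "b \<in> weyl_gens r s" for i b
    using comm_Xinv[OF i(1) A_fgen[OF b] comm_X[OF i(2,3) b]] .
  from assms(1) show ?thesis
  proof (cases rule: gen_cases)
    case (X i)
    then show ?thesis using assms weq_sym[OF comm_X[of i b]] by simp
  next
    case (V i)
    then show ?thesis using assms weq_sym[OF comm_V[of i b]] by simp
  next
    case a: (D i)
    from assms(2) show ?thesis
    proof (cases rule: gen_cases)
      case (X j)
      then show ?thesis using assms a comm_X[of j a] by simp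
    next
      case (D j)
      then show ?thesis using comm_DD a by simp
    next
      case b: (V j)
      then show ?thesis using assms a comm_V[of j a] by simp
    qed
  qed
qed

lemma comm_gen_mon:
  assumes "a \<in> weyl_gens r s" "set l \<subseteq> weyl_gens r s" "\<And>b. b \<in> set l \<Longrightarrow> gen_idx a \<noteq> gen_idx b"
  shows "fgen a * mon l \<approx> mon l * fgen a"
  using assms(2,3)
proof (induction l)
  case (Cons b l)
  have A: "fgen a \<in> A" "fgen b \<in> A" "mon l \<in> A" using Cons assms by (auto intro: A_fgen A_mon)
  have "fgen a * mon (b # l) = fgen a * fgen b * mon l" by (simp add: mon_Cons mult.assoc)
  also have "\<dots> \<approx> fgen b * fgen a * mon l"
    using Cons assms by (intro weq_mult_right A comm_gens) auto
  also have "\<dots> = fgen b * (fgen a * mon l)" by (simp add: mult.assoc)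
  also have "\<dots> \<approx> fgen b * (mon l * fgen a)" using Cons by (intro weq_mult_left A) auto
  finally show ?case by (simp add: mon_Cons mult.assoc)
qed (simp add: mon_Nil)

definition euler_op :: "nat \<Rightarrow> 'k free_alg" where "euler_op i = fgen (GX i) * fgen (GD i)"

lemma A_pi: "i \<in> {1..r+s} \<Longrightarrow> euler_op i \<in> A"
  unfolding euler_op_def by (intro A_mult A_fgen gens_mem)

text \<open>Moving \<pi>_i across a letter costs the weight of the letter. For the inverse of x_i
  this follows from the case of x_i by multiplying with the inverse on both sides.\<close>

lemma pi_gen:
  assumes i: "i \<in> {1..r+s}" and a: "a \<in> weyl_gens r s"
  shows "fgen a * euler_op i \<approx> (euler_op i - fconst (of_int (gen_wt a i))) * fgen a"
proof (cases "gen_idx a = i")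
  case False
  have A: "fgen (GX i) \<in> A" "fgen (GD i) \<in> A" using i by (intro A_fgen gens_mem; simp)+
  have "fgen a * euler_op i = fgen a * fgen (GX i) * fgen (GD i)" by (simp add: euler_op_def mult.assoc)
  also have "\<dots> \<approx> fgen (GX i) * fgen a * fgen (GD i)"
    using False i by (intro weq_mult_right A comm_gens a gens_mem) auto
  also have "\<dots> = fgen (GX i) * (fgen a * fgen (GD i))" by (simp add: mult.assoc)
  also have "\<dots> \<approx> fgen (GX i) * (fgen (GD i) * fgen a)"
    using False i by (intro weq_mult_left A comm_gens a gens_mem) auto
  finally have "fgen a * euler_op i \<approx> euler_op i * fgen a" by (simp add: euler_op_def mult.assoc)
  moreover have "gen_wt a i = 0" using False by (cases a) auto
  ultimately show ?thesis by (simp add: fconst_0)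
next
  case idx: True
  define x d :: "'k free_alg" where "x = fgen (GX i)" and "d = fgen (GD i)"
  have A: "x \<in> A" "d \<in> A" using i by (simp_all only: x_def d_def A_fgen gens_mem)
  have DX: "d * x \<approx> x * d + 1" using comm_DX[OF i i] by (simp add: x_def d_def)
  have euler_op: "euler_op i = x * d" by (simp add: euler_op_def x_def d_def)
  have Xpi: "x * euler_op i \<approx> (euler_op i - fconst 1) * x"
  proof -
    have "(euler_op i - fconst 1) * x = x * (d * x) - x" by (simp add: euler_op fconst_1 algebra_simps)
    also have "\<dots> \<approx> x * (x * d + 1) - x" by (intro weq_diff weq_mult_left A DX weq_refl)
    also have "\<dots> = x * euler_op i" by (simp add: euler_op algebra_simps)
    finally show ?thesis by (rule weq_sym)
  qed
  from a show ?thesis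
  proof (cases rule: gen_cases)
    case (X j)
    then show ?thesis using idx Xpi by (simp add: x_def)
  next
    case (D j)
    have "d * euler_op i = (d * x) * d" by (simp add: euler_op mult.assoc)
    also have "\<dots> \<approx> (x * d + 1) * d" by (intro weq_mult_right A DX)
    also have "\<dots> = (euler_op i - fconst (-1)) * d" by (simp add: euler_op fconst_minus fconst_1 algebra_simps)
    finally show ?thesis using idx D by (simp add: d_def)
  next
    case (V j)
    define v :: "'k free_alg" where "v = fgen (GXinv i)"
    have j: "j = i" using V idx by simp
    have v: "v \<in> A" using V(2) unfolding j v_def by (intro A_fgen gens_mem)
    have inv: "x * v \<approx> 1" "v * x \<approx> 1"
      using X_Xinv Xinv_X V by (auto simp: j x_def v_def)
    have pA: "euler_op i \<in> A" using A_pi i .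
    have "(euler_op i - fconst (-1)) * v = 1 * (euler_op i + 1) * v" by (simp add: fconst_minus fconst_1)
    also have "\<dots> \<approx> (v * x) * (euler_op i + 1) * v"
      by (intro weq_mult_right weq_sym[OF inv(2)] A_add pA A_1 v)
    also have "\<dots> = v * (x * euler_op i) * v + v * x * v" by (simp add: algebra_simps)
    also have "\<dots> \<approx> v * ((euler_op i - fconst 1) * x) * v + v * x * v"
      by (intro weq_add weq_mult_right weq_mult_left v Xpi weq_refl)
    also have "\<dots> = v * euler_op i * (x * v)" by (simp add: fconst_1 algebra_simps)
    also have "\<dots> \<approx> v * euler_op i * 1" by (intro weq_mult_left A_mult v pA inv)
    finally have "v * euler_op i \<approx> (euler_op i - fconst (-1)) * v" by (simp add: weq_sym)
    then show ?thesis using V by (simp add: v_def j)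
  qed
qed

lemma pi_mon:
  assumes i: "i \<in> {1..r+s}" and l: "set l \<subseteq> weyl_gens r s"
  shows "mon l * euler_op i \<approx> (euler_op i - fconst (of_int (list_wt l i))) * mon l"
  using l
proof (induction l)
  case (Cons a l)
  have A: "fgen a \<in> A" "mon l \<in> A" using Cons by (auto intro: A_fgen A_mon)
  have "mon (a # l) * euler_op i = fgen a * (mon l * euler_op i)" by (simp add: mon_Cons mult.assoc)
  also have "\<dots> \<approx> fgen a * ((euler_op i - fconst (of_int (list_wt l i))) * mon l)"
    using Cons by (intro weq_mult_left A) auto
  also have "\<dots> = (fgen a * euler_op i) * mon l - fconst (of_int (list_wt l i)) * fgen a * mon l"
    by (simp add: algebra_simps fconst_commute[of _ "fgen a"])
  also have "\<dots> \<approx> ((euler_op i - fconst (of_int (gen_wt a i))) * fgen a) * mon l - fconst (of_int (list_wt l i)) * fgen a * mon l"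
    using Cons by (intro weq_diff weq_mult_right A pi_gen i weq_refl) auto
  also have "\<dots> = (euler_op i - fconst (of_int (list_wt (a # l) i))) * mon (a # l)"
    by (simp add: mon_Cons list_wt_Cons fconst_add algebra_simps)
  finally show ?case .
qed (simp add: mon_Nil fconst_0)

lemma tor_eq: "tor (r+s) t = (\<Sum>i\<in>{1..r+s}. fconst (t i) * euler_op i)"
  by (simp add: tor_def euler_op_def mult.assoc)

lemma tor_mon:
  assumes l: "set l \<subseteq> weyl_gens r s"
  shows "tor (r+s) t * mon l - mon l * tor (r+s) t \<approx> fconst (pairing (r+s) t (list_wt l)) * mon l"
proof -
  have A: "mon l \<in> A" using l by (rule A_mon)
  have "mon l * tor (r+s) t = (\<Sum>i\<in>{1..r+s}. fconst (t i) * (mon l * euler_op i))"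
    by (simp add: tor_eq sum_distrib_left mult.assoc[symmetric] fconst_commute[of _ "mon l"])
  also have "\<dots> \<approx> (\<Sum>i\<in>{1..r+s}. fconst (t i) * ((euler_op i - fconst (of_int (list_wt l i))) * mon l))"
    by (intro weq_sum weq_mult_left A_fconst pi_mon l)
  also have "\<dots> = tor (r+s) t * mon l - fconst (pairing (r+s) t (list_wt l)) * mon l"
    by (simp add: tor_eq pairing_def sum_distrib_right sum_subtractf fconst_sum fconst_mult algebra_simps)
  finally have "mon l * tor (r+s) t \<approx> tor (r+s) t * mon l - fconst (pairing (r+s) t (list_wt l)) * mon l" .
  then show ?thesis
    using I_uminus by (fastforce simp: weq_def algebra_simps)
qed


section \<open>Invariants of the torus\<close>

text \<open>A lift of the commutator with t to the free algebra that is diagonal on words.\<close>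

definition weight_derivation :: "(nat \<Rightarrow> 'k) \<Rightarrow> 'k free_alg \<Rightarrow> 'k free_alg" where
  "weight_derivation t p = (\<Sum>w\<in>Poly_Mapping.keys p.
     Poly_Mapping.single w (pairing (r+s) t (list_wt (letters w)) * Poly_Mapping.lookup p w))"

lemma lookup_weight_derivation:
  "Poly_Mapping.lookup (weight_derivation t p) w = pairing (r+s) t (list_wt (letters w)) * Poly_Mapping.lookup p w"
proof -
  have "Poly_Mapping.lookup (weight_derivation t p) w =
    (\<Sum>v\<in>Poly_Mapping.keys p. if v = w then pairing (r+s) t (list_wt (letters w)) * Poly_Mapping.lookup p w else 0)"
    unfolding weight_derivation_def lookup_sum by (intro sum.cong) (auto simp: lookup_single when_def)
  then show ?thesis by (simp add: in_keys_iff)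
qed

lemma tor_commutator:
  assumes "p \<in> A"
  shows "tor (r+s) t * p - p * tor (r+s) t \<approx> weight_derivation t p"
proof -
  let ?c = "Poly_Mapping.lookup p"
  have p: "p = (\<Sum>w\<in>Poly_Mapping.keys p. fconst (?c w) * mon (letters w))"
    using free_alg_expand[of p] by (simp add: single_eq_mon)
  have "tor (r+s) t * p - p * tor (r+s) t =
    (\<Sum>w\<in>Poly_Mapping.keys p. fconst (?c w) * (tor (r+s) t * mon (letters w) - mon (letters w) * tor (r+s) t))"
    by (subst (1 2) p) (simp add: sum_distrib_left sum_distrib_right sum_subtractf right_diff_distrib
        mult.assoc[symmetric] fconst_commute[of _ "tor (r+s) t"])
  also have "\<dots> \<approx> (\<Sum>w\<in>Poly_Mapping.keys p.
      fconst (?c w) * (fconst (pairing (r+s) t (list_wt (letters w))) * mon (letters w)))"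
    using assms by (intro weq_sum weq_mult_left A_fconst tor_mon) (auto simp: A_eq)
  also have "\<dots> = weight_derivation t p"
    by (simp add: weight_derivation_def single_eq_mon fconst_mult mult.assoc[symmetric]
        fconst_commute[of "_ :: 'k" "fconst _"])
  finally show ?thesis .
qed

text \<open>Representatives of the invariant algebra. Weight zero is imposed on every word, which is
  stronger than invariance modulo the relations but reaches every invariant class.\<close>

definition homogeneous_part :: "(nat \<Rightarrow> 'k) set \<Rightarrow> 'k free_alg set" where
  "homogeneous_part g = {p \<in> A. \<forall>w\<in>Poly_Mapping.keys p. \<forall>t\<in>g. pairing (r+s) t (list_wt (letters w)) = 0}"

text \<open>If \<open>w\<close> has nonzero weight \<open>\<lambda>\<close> under \<open>t\<close>, subtracting the multiple \<open>[t, p] / \<lambda>\<close>, which vanishes in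
  the Weyl algebra, removes the word \<open>w\<close> from \<open>p\<close>.\<close>

lemma invariant_homogeneous:
  assumes "p \<in> A" "\<And>t. t \<in> g \<Longrightarrow> tor (r+s) t * p - p * tor (r+s) t \<in> I"
  shows "\<exists>q\<in>homogeneous_part g. p \<approx> q"
  using assms
proof (induction "card {w \<in> Poly_Mapping.keys p. \<exists>t\<in>g. pairing (r+s) t (list_wt (letters w)) \<noteq> 0}"
    arbitrary: p rule: less_induct)
  case less
  let ?bad = "\<lambda>p. {w \<in> Poly_Mapping.keys p. \<exists>t\<in>g. pairing (r+s) t (list_wt (letters w)) \<noteq> 0}"
  show ?case
  proof (cases "?bad p = {}")
    case True
    then show ?thesis using less.prems by (intro bexI[of _ p]) (auto simp: homogeneous_part_def)
  next
    case False
    then obtain w t where w: "w \<in> Poly_Mapping.keys p" "t \<in> g" and nz: "pairing (r+s) t (list_wt (letters w)) \<noteq> 0"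
      by blast
    define c where "c = 1 / pairing (r+s) t (list_wt (letters w))"
    define q where "q = p - fconst c * weight_derivation t p"
    have "weight_derivation t p \<in> I"
      using I_diff[OF less.prems(2)[OF w(2)] tor_commutator[OF less.prems(1), of t, unfolded weq_def]] by simp
    then have pq: "p \<approx> q" using I_mult_left[OF A_fconst] by (simp add: q_def weq_def)
    have lookup: "Poly_Mapping.lookup q v = (1 - c * pairing (r+s) t (list_wt (letters v))) * Poly_Mapping.lookup p v" for v
      by (simp add: q_def lookup_minus lookup_fconst_mult lookup_weight_derivation algebra_simps)
    have "w \<notin> Poly_Mapping.keys q" "Poly_Mapping.keys q \<subseteq> Poly_Mapping.keys p"
      using nz by (auto simp: in_keys_iff lookup c_def)
    then have "?bad q \<subset> ?bad p" using w nz by blast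
    then have "card (?bad q) < card (?bad p)" by (intro psubset_card_mono) auto
    moreover have qA: "q \<in> A" using weq_A[OF weq_sym[OF pq] less.prems(1)] .
    moreover have "tor (r+s) t' * q - q * tor (r+s) t' \<in> I" if "t' \<in> g" for t'
    proof -
      have "tor (r+s) t' * q - q * tor (r+s) t' \<approx> tor (r+s) t' * p - p * tor (r+s) t'"
        by (intro weq_diff weq_mult_left weq_mult_right A_tor weq_sym[OF pq])
      then have "(tor (r+s) t' * q - q * tor (r+s) t') - (tor (r+s) t' * p - p * tor (r+s) t') \<in> I"
        by (simp only: weq_def)
      from I_add[OF this less.prems(2)[OF that]] show ?thesis by (simp only: diff_add_cancel)
    qed
    ultimately obtain q' where "q' \<in> homogeneous_part g" "q \<approx> q'" using less.hyps[of q] by blast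
    then show ?thesis using weq_trans[OF pq] by blast
  qed
qed

section \<open>Normal forms over the symmetric algebra\<close>

inductive_set sym_algebra :: "'k free_alg set" where
  sym_const: "fconst c \<in> sym_algebra"
| sym_pi: "i \<in> {1..r+s} \<Longrightarrow> euler_op i \<in> sym_algebra"
| sym_add: "p \<in> sym_algebra \<Longrightarrow> q \<in> sym_algebra \<Longrightarrow> p + q \<in> sym_algebra"
| sym_mult: "p \<in> sym_algebra \<Longrightarrow> q \<in> sym_algebra \<Longrightarrow> p * q \<in> sym_algebra"

lemma sym_A: "p \<in> sym_algebra \<Longrightarrow> p \<in> A"
  by (induction rule: sym_algebra.induct) (auto intro: A_fconst A_pi A_add A_mult simp del: atLeastAtMost_iff)

definition blk :: "nat \<Rightarrow> int \<Rightarrow> weyl_gen list" where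
  "blk i m = (if m \<ge> 0 then replicate (nat m) (GX i)
     else if i \<le> r then replicate (nat (- m)) (GD i) else replicate (nat (- m)) (GXinv i))"

text \<open>One word for each weight; modulo the relations they generate the Weyl algebra as a left
  module over Sym(t).\<close>

definition normal_word :: "(nat \<Rightarrow> int) \<Rightarrow> weyl_gen list" where
  "normal_word u = concat (map (\<lambda>i. blk i (u i)) [1..<Suc (r+s)])"

lemma set_blk: "i \<in> {1..r+s} \<Longrightarrow> set (blk i m) \<subseteq> weyl_gens r s"
  by (auto simp: blk_def weyl_gens_def split: if_splits)

lemma idx_blk: "a \<in> set (blk i m) \<Longrightarrow> gen_idx a = i"
  by (auto simp: blk_def split: if_splits)

lemma list_wt_replicate: "list_wt (replicate k a) i = int k * gen_wt a i"
  by (induction k) (auto simp: list_wt_Cons algebra_simps)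

lemma list_wt_blk: "list_wt (blk i m) j = (if j = i then m else 0)"
  by (auto simp: blk_def list_wt_replicate)

lemma list_wt_concat: "list_wt (concat ls) i = (\<Sum>l\<leftarrow>ls. list_wt l i)"
  by (induction ls) (auto simp: list_wt_append)

lemma set_normal_word: "set (normal_word u) \<subseteq> weyl_gens r s"
  using set_blk by (fastforce simp: normal_word_def)

lemma list_wt_normal_word: "list_wt (normal_word u) j = (if j \<in> {1..r+s} then u j else 0)"
proof -
  have "list_wt (normal_word u) j = (\<Sum>i\<leftarrow>[1..<Suc (r+s)]. if j = i then u i else 0)"
    by (simp add: normal_word_def list_wt_concat comp_def list_wt_blk del: upt_Suc)
  also have "\<dots> = (\<Sum>i\<in>{1..<Suc (r+s)}. if j = i then u i else 0)"
    by (subst sum_list_distinct_conv_sum_set) (simp_all del: upt_Suc)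
  finally show ?thesis by auto
qed

lemma normal_word_0: "normal_word 0 = []"
  by (auto simp: normal_word_def blk_def)

lemma mon_snoc: "mon (replicate k a) * fgen a = mon (replicate (Suc k) a)"
  by (simp add: fgen_eq_mon mon_append[symmetric] replicate_append_same)

lemma A_mon_replicate: "a \<in> weyl_gens r s \<Longrightarrow> mon (replicate k a) \<in> A"
  by (rule A_mon) auto

lemma mon_replicate_Suc: "mon (replicate (Suc k) a) * p = mon (replicate k a) * (fgen a * p)"
  by (simp only: mon_snoc[symmetric] mult.assoc)

text \<open>A letter appended to the block of its own index lengthens it, cancels a letter, or meets
  one with which it forms \<pi>_i up to a constant. In the last case the factor is moved to the left
  of the block, which only changes the constant.\<close>

lemma blk_gen:
  assumes a: "a \<in> weyl_gens r s" "gen_idx a = i"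
  shows "\<exists>b c. mon (blk i m) * fgen a \<approx> (fconst b * euler_op i + fconst c) * mon (blk i (m + gen_wt a i))"
proof -
  have exact: ?thesis if "mon (blk i m) * fgen a \<approx> mon (blk i (m + gen_wt a i))"
    using that by (intro exI[of _ 0] exI[of _ 1]) (simp add: fconst_0 fconst_1)
  have shift: ?thesis if 1: "mon (blk i m) * fgen a \<approx> mon l * (euler_op i + fconst c)"
      and l: "l = blk i (m + gen_wt a i)" and i: "i \<in> {1..r+s}" for l c
  proof -
    have lA: "set l \<subseteq> weyl_gens r s" using set_blk[OF i] l by blast
    note 1
    also have "mon l * (euler_op i + fconst c) = mon l * euler_op i + fconst c * mon l"
      by (simp add: distrib_left fconst_commute[of c])
    also have "\<dots> \<approx> (euler_op i - fconst (of_int (list_wt l i))) * mon l + fconst c * mon l"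
      by (intro weq_add pi_mon i lA weq_refl)
    also have "\<dots> = (fconst 1 * euler_op i + fconst (c - of_int (list_wt l i))) * mon l"
      by (simp add: fconst_1 fconst_diff algebra_simps)
    finally show ?thesis using l by blast
  qed
  from a(1) show ?thesis
  proof (cases rule: gen_cases)
    case (X j)
    have i: "i \<in> {1..r+s}" "a = GX i" using X a by auto
    show ?thesis
    proof (cases "m \<ge> 0")
      case True
      then have "nat (m + 1) = Suc (nat m)" by simp
      then show ?thesis using True by (intro exact) (simp add: i blk_def mon_snoc del: replicate.simps)
    next
      case False
      define k where "k = nat (- m) - 1"
      have k: "nat (- m) = Suc k" "nat (- (m + 1)) = k" using False by (auto simp: k_def)
      show ?thesis
      proof (cases "i \<le> r")
        case True
        have l: "replicate k (GD i) = blk i (m + 1)" using False k(2) True by (auto simp: blk_def)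
        have "blk i m = replicate (Suc k) (GD i)" using False True k(1) by (simp only: blk_def if_False if_True)
        then have "mon (blk i m) * fgen a = mon (replicate k (GD i)) * (fgen (GD i) * fgen (GX i))"
          by (simp only: i mon_replicate_Suc)
        also have "\<dots> \<approx> mon (replicate k (GD i)) * (euler_op i + fconst 1)"
          using comm_DX[OF i(1,1)]
          by (intro weq_mult_left A_mon_replicate gens_mem i) (simp add: euler_op_def fconst_1)
        finally show ?thesis by (rule shift) (use l i in auto)
      next
        case ir: False
        have V: "i \<in> {r+1..r+s}" using ir i by auto
        have l: "replicate k (GXinv i) = blk i (m + 1)" using False k(2) ir by (auto simp: blk_def)
        have "blk i m = replicate (Suc k) (GXinv i)" using False ir k(1) by (simp only: blk_def if_False)
        then have "mon (blk i m) * fgen a = mon (replicate k (GXinv i)) * (fgen (GXinv i) * fgen (GX i))"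
          by (simp only: i mon_replicate_Suc)
        also have "\<dots> \<approx> mon (replicate k (GXinv i)) * 1"
          by (intro weq_mult_left A_mon_replicate Xinv_X V gens_mem)
        finally show ?thesis by (intro exact) (simp add: l i)
      qed
    qed
  next
    case (D j)
    have i: "i \<in> {1..r+s}" "a = GD i" using D a by auto
    have xpos: ?thesis if "m > 0"
    proof -
      define k where "k = nat m - 1"
      have k: "nat m = Suc k" "nat (m - 1) = k" using that by (auto simp: k_def)
      have l: "replicate k (GX i) = blk i (m + gen_wt a i)" using that k(2) by (auto simp: blk_def i)
      have "blk i m = replicate (Suc k) (GX i)" using that k(1) by (simp only: blk_def less_imp_le if_True)
      then have "mon (blk i m) * fgen a = mon (replicate k (GX i)) * (euler_op i + fconst 0)"
        by (simp only: i mon_replicate_Suc euler_op_def fconst_0 add_0_right)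
      then show ?thesis by (intro shift[OF _ l i(1), of 0]) simp
    qed
    show ?thesis
    proof (cases "m > 0")
      case False
      define k where "k = nat (- m)"
      have k: "nat (- (m - 1)) = Suc k" using False by (auto simp: k_def)
      show ?thesis
      proof (cases "i \<le> r")
        case True
        have "blk i m = replicate k (GD i)" "blk i (m + gen_wt a i) = replicate (Suc k) (GD i)"
          using False True k by (auto simp: blk_def k_def i)
        then show ?thesis by (intro exact) (simp add: i mon_snoc del: replicate.simps)
      next
        case ir: False
        have V: "i \<in> {r+1..r+s}" using ir i by auto
        have l: "blk i m = replicate k (GXinv i)" "replicate (Suc k) (GXinv i) = blk i (m + gen_wt a i)"
          using False ir k by (auto simp: blk_def k_def i)
        have A: "mon (replicate k (GXinv i)) \<in> A" "fgen (GD i) \<in> A"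
          by (intro A_mon_replicate A_fgen gens_mem V i)+
        have "mon (blk i m) * fgen a = mon (replicate k (GXinv i)) * (1 * fgen (GD i))"
          by (simp add: l(1) i)
        \<comment> \<open>For i > r normal words contain no \<partial>_i. Inserting the inverse of
          x_i and x_i in front of it produces \<pi>_i together with one more inverse.\<close>
        also have "\<dots> \<approx> mon (replicate k (GXinv i)) * ((fgen (GXinv i) * fgen (GX i)) * fgen (GD i))"
          using V by (intro weq_mult_left weq_mult_right A weq_sym[OF Xinv_X])
        also have "\<dots> = mon (replicate (Suc k) (GXinv i)) * (euler_op i + fconst 0)"
          by (simp only: mon_replicate_Suc euler_op_def fconst_0 mult.assoc add_0_right)
        finally show ?thesis by (rule shift[OF _ l(2) i(1)])
      qed
    qed (rule xpos)
  next
    case (V j)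
    have i: "i \<in> {1..r+s}" "i \<in> {r+1..r+s}" "a = GXinv i" using V a by auto
    show ?thesis
    proof (cases "m > 0")
      case True
      define k where "k = nat m - 1"
      have k: "nat m = Suc k" "nat (m - 1) = k" using True by (auto simp: k_def)
      have l: "replicate k (GX i) = blk i (m + gen_wt a i)" using True k(2) by (auto simp: blk_def i)
      have "blk i m = replicate (Suc k) (GX i)" using True k(1) by (simp only: blk_def less_imp_le if_True)
      then have "mon (blk i m) * fgen a = mon (replicate k (GX i)) * (fgen (GX i) * fgen (GXinv i))"
        by (simp only: i mon_replicate_Suc)
      also have "\<dots> \<approx> mon (replicate k (GX i)) * 1"
        by (intro weq_mult_left A_mon_replicate X_Xinv i gens_mem)
      finally show ?thesis by (intro exact) (simp add: l)
    next
      case False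
      define k where "k = nat (- m)"
      have k: "nat (- (m - 1)) = Suc k" using False by (auto simp: k_def)
      have "blk i m = replicate k (GXinv i)" "blk i (m + gen_wt a i) = replicate (Suc k) (GXinv i)"
        using False i k by (auto simp: blk_def k_def)
      then show ?thesis by (intro exact) (simp add: i mon_snoc del: replicate.simps)
    qed
  qed
qed

lemma gen_wt_other: "j \<noteq> gen_idx a \<Longrightarrow> gen_wt a j = 0"
  by (cases a) auto

text \<open>The letter commutes with all blocks of larger index and is absorbed by its own block.
  The resulting \<pi>_i then passes the blocks of smaller index without shift, as these have weight
  zero in coordinate i.\<close>

lemma normal_word_gen:
  assumes a: "a \<in> weyl_gens r s"
  shows "\<exists>q\<in>sym_algebra. mon (normal_word u) * fgen a \<approx> q * mon (normal_word (u + gen_wt a))"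
proof -
  define i where "i = gen_idx a"
  have i: "i \<in> {1..r+s}" using a unfolding i_def by (cases rule: gen_cases) auto
  define L R where "L u = concat (map (\<lambda>i. blk i (u i)) [1..<i])"
    and "R u = concat (map (\<lambda>i. blk i (u i)) [Suc i..<Suc (r+s)])" for u :: "nat \<Rightarrow> int"
  have split: "normal_word u = L u @ blk i (u i) @ R u" for u
  proof -
    have "[1..<Suc (r+s)] = [1..<i] @ i # [Suc i..<Suc (r+s)]"
      using i by (metis atLeastAtMost_iff le_imp_less_Suc less_imp_le upt_add_eq_append upt_conv_Cons le_iff_add)
    then show ?thesis by (simp add: normal_word_def L_def R_def)
  qed
  let ?u = "u + gen_wt a"
  have same: "L ?u = L u" "R ?u = R u"
    unfolding L_def R_def by (auto intro!: arg_cong[where f = concat] simp: gen_wt_other i_def simp del: upt_Suc)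
  have gens: "set (L u) \<subseteq> weyl_gens r s" "set (R u) \<subseteq> weyl_gens r s"
    using set_normal_word[of u] by (simp_all add: split)
  have idx: "gen_idx b \<noteq> i" if "b \<in> set (L u) \<or> b \<in> set (R u)" for b
    using that idx_blk by (fastforce simp: L_def R_def simp del: upt_Suc)
  have A: "mon (L u) \<in> A" "mon (R u) \<in> A" "mon (blk i (u i)) \<in> A" "mon (blk i (?u i)) \<in> A"
    by (intro A_mon gens set_blk[OF i])+
  obtain b c where bc: "mon (blk i (u i)) * fgen a \<approx> (fconst b * euler_op i + fconst c) * mon (blk i (?u i))"
    using blk_gen[OF a, of i "u i"] by (auto simp: i_def)
  have wt0: "list_wt (L u) i = 0"
  proof -
    have "list_wt (L u) i = (\<Sum>a\<leftarrow>L u. 0)"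
      unfolding list_wt_def using idx by (intro arg_cong[where f = sum_list] map_cong) (auto intro!: gen_wt_other)
    then show ?thesis by simp
  qed
  have "mon (normal_word u) * fgen a = mon (L u) * mon (blk i (u i)) * (mon (R u) * fgen a)"
    by (simp add: split mon_append mult.assoc)
  also have "\<dots> \<approx> mon (L u) * mon (blk i (u i)) * (fgen a * mon (R u))"
    by (intro weq_mult_left A_mult A weq_sym[OF comm_gen_mon] a gens) (use idx i_def in metis)
  also have "\<dots> = mon (L u) * (mon (blk i (u i)) * fgen a) * mon (R u)" by (simp add: mult.assoc)
  also have "\<dots> \<approx> mon (L u) * ((fconst b * euler_op i + fconst c) * mon (blk i (?u i))) * mon (R u)"
    by (intro weq_mult_left weq_mult_right A bc)
  also have "\<dots> = fconst b * (mon (L u) * euler_op i) * (mon (blk i (?u i)) * mon (R u)) +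
      fconst c * mon (L u) * (mon (blk i (?u i)) * mon (R u))"
    by (simp add: distrib_left distrib_right mult.assoc[symmetric] fconst_commute[of _ "mon (L u)"])
  also have "\<dots> \<approx> fconst b * ((euler_op i - fconst (of_int (list_wt (L u) i))) * mon (L u)) * (mon (blk i (?u i)) * mon (R u)) +
      fconst c * mon (L u) * (mon (blk i (?u i)) * mon (R u))"
    by (intro weq_add weq_mult_left weq_mult_right A A_mult A_fconst pi_mon i gens weq_refl)
  also have "\<dots> = (fconst b * euler_op i + fconst c) * mon (normal_word ?u)"
    by (simp add: wt0 fconst_0 split same mon_append distrib_right mult.assoc)
  finally show ?thesis
    by (rule bexI) (intro sym_add sym_mult sym_const sym_pi i)
qed

lemma mon_normal_form:
  assumes "set l \<subseteq> weyl_gens r s"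
  shows "\<exists>q\<in>sym_algebra. mon l \<approx> q * mon (normal_word (list_wt l))"
  using assms
proof (induction l rule: rev_induct)
  case Nil
  show ?case
    by (rule bexI[OF _ sym_const[of 1]]) (simp only: list_wt_Nil normal_word_0 mon_Nil fconst_1 mult_1_left weq_refl)
next
  case (snoc a l)
  then obtain q where q: "q \<in> sym_algebra" "mon l \<approx> q * mon (normal_word (list_wt l))" by auto
  obtain q' where q': "q' \<in> sym_algebra"
    "mon (normal_word (list_wt l)) * fgen a \<approx> q' * mon (normal_word (list_wt l + gen_wt a))"
    using normal_word_gen[of a "list_wt l"] snoc.prems by auto
  have "mon (l @ [a]) = mon l * fgen a" by (simp add: mon_append fgen_eq_mon)
  also have "\<dots> \<approx> q * mon (normal_word (list_wt l)) * fgen a"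
    using snoc.prems by (intro weq_mult_right q A_fgen) auto
  also have "\<dots> = q * (mon (normal_word (list_wt l)) * fgen a)" by (simp add: mult.assoc)
  also have "\<dots> \<approx> q * (q' * mon (normal_word (list_wt l + gen_wt a)))"
    by (intro weq_mult_left q' sym_A q)
  finally show ?case using sym_mult[OF q(1) q'(1)]
    by (intro bexI[of _ "q * q'"]) (simp_all only: list_wt_append list_wt_Cons list_wt_Nil add_0_right mult.assoc)
qed

lemma mon_weight_0:
  assumes "set l \<subseteq> weyl_gens r s" "list_wt l = 0"
  shows "\<exists>q\<in>sym_algebra. mon l \<approx> q"
  using mon_normal_form[OF assms(1)] by (simp add: assms(2) normal_word_0 mon_Nil)

end

section \<open>The action on functions of the weight\<close>

definition rwt :: "(nat \<Rightarrow> int) \<Rightarrow> nat \<Rightarrow> rat" where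
  "rwt u = (\<lambda>i. of_int (u i))"

lemma rwt_add: "rwt (u + v) = rwt u + rwt v" and rwt_0: "rwt 0 = 0"
  and rwt_diff: "rwt (u - v) = rwt u - rwt v" and rwt_minus: "rwt (- u) = - rwt u"
  by (auto simp: rwt_def)

lemma rwt_inject: "rwt u = rwt v \<longleftrightarrow> u = v"
  by (auto simp: rwt_def fun_eq_iff)

text \<open>Coefficients are indexed by the target \<gamma>: \<partial>_i maps the monomial of
  exponent \<gamma> + e_i to \<gamma>_i + 1 times that of exponent \<gamma>.\<close>

fun gen_coeff :: "weyl_gen \<Rightarrow> (nat \<Rightarrow> rat) \<Rightarrow> 'k::field_char_0" where
  "gen_coeff (GX i) \<gamma> = 1"
| "gen_coeff (GXinv i) \<gamma> = 1"
| "gen_coeff (GD i) \<gamma> = of_rat (\<gamma> i + 1)"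

fun list_coeff :: "weyl_gen list \<Rightarrow> (nat \<Rightarrow> rat) \<Rightarrow> 'k::field_char_0" where
  "list_coeff [] \<gamma> = 1"
| "list_coeff (a # l) \<gamma> = gen_coeff a \<gamma> * list_coeff l (\<gamma> - rwt (gen_wt a))"

lemma list_coeff_append: "list_coeff (l @ m) \<gamma> = list_coeff l \<gamma> * list_coeff m (\<gamma> - rwt (list_wt l))"
  by (induction l arbitrary: \<gamma>) (simp_all only: append.simps list_coeff.simps list_wt_Nil list_wt_Cons rwt_add rwt_0
      diff_0_right mult_1_left mult.assoc diff_diff_eq)

text \<open>A function \<open>f\<close> stands for the formal sum of the \<open>f \<gamma> x\<^sup>\<gamma>\<close>, on which the Weyl algebra acts by
  differential operators. The coefficient of \<open>x\<^sup>\<gamma>\<close> in \<open>w f\<close>, for a word \<open>w\<close>, is a polynomial in \<open>\<gamma>\<close>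
  times \<open>f (\<gamma> - wt w)\<close>.\<close>

definition act :: "'k::field_char_0 free_alg \<Rightarrow> ((nat \<Rightarrow> rat) \<Rightarrow> 'k) \<Rightarrow> (nat \<Rightarrow> rat) \<Rightarrow> 'k" where
  "act p f \<gamma> = (\<Sum>w\<in>Poly_Mapping.keys p. Poly_Mapping.lookup p w * list_coeff (letters w) \<gamma> *
     f (\<gamma> - rwt (list_wt (letters w))))"

lemma act_superset:
  assumes "finite K" "Poly_Mapping.keys p \<subseteq> K"
  shows "act p f \<gamma> = (\<Sum>w\<in>K. Poly_Mapping.lookup p w * list_coeff (letters w) \<gamma> *
     f (\<gamma> - rwt (list_wt (letters w))))"
  unfolding act_def using assms by (intro sum.mono_neutral_left) (auto simp: in_keys_iff)

lemma act_add: "act (p + q) f = act p f + act q f"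
proof
  fix \<gamma>
  let ?K = "Poly_Mapping.keys p \<union> Poly_Mapping.keys q"
  have "act (p + q) f \<gamma> = (\<Sum>w\<in>?K. Poly_Mapping.lookup (p + q) w * list_coeff (letters w) \<gamma> * f (\<gamma> - rwt (list_wt (letters w))))"
    by (rule act_superset) (use keys_add[of p q] in auto)
  also have "\<dots> = act p f \<gamma> + act q f \<gamma>"
    using act_superset[of ?K p f \<gamma>] act_superset[of ?K q f \<gamma>] by (simp add: lookup_add distrib_right sum.distrib)
  finally show "act (p + q) f \<gamma> = (act p f + act q f) \<gamma>" by simp
qed

lemma act_0: "act 0 f = 0"
  by (auto simp: act_def)

lemma act_uminus: "act (- p) f = - act p f"
  using act_add[of p "- p" f] by (simp add: act_0 eq_neg_iff_add_eq_0 add.commute)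

lemma act_diff: "act (p - q) f = act p f - act q f"
  using act_add[of p "- q" f] by (simp add: act_uminus)

lemma act_sum: "act (\<Sum>i\<in>S. p i) f = (\<Sum>i\<in>S. act (p i) f)"
  by (induction S rule: infinite_finite_induct) (auto simp: act_0 act_add)

lemma act_single: "act (Poly_Mapping.single w c) f \<gamma> = c * list_coeff (letters w) \<gamma> * f (\<gamma> - rwt (list_wt (letters w)))"
  using act_superset[of "{w}" "Poly_Mapping.single w c" f \<gamma>] by simp

lemma act_mon: "act (mon l) f \<gamma> = list_coeff l \<gamma> * f (\<gamma> - rwt (list_wt l))"
  by (simp add: mon_def act_single)

lemma act_fgen: "act (fgen a) f \<gamma> = gen_coeff a \<gamma> * f (\<gamma> - rwt (gen_wt a))"
proof -
  have "list_wt [a] = gen_wt a" by (auto simp: list_wt_def)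
  then show ?thesis by (simp add: fgen_eq_mon act_mon)
qed

lemma act_fconst: "act (fconst c) f \<gamma> = c * f \<gamma>"
proof -
  have "list_wt (letters 0) = 0" by (simp only: zero_word_def word.sel list_wt_Nil)
  then show ?thesis by (simp only: fconst_def act_single rwt_0 diff_0_right) (simp add: zero_word_def)
qed

lemma act_add_right: "act p (f + h) = act p f + act p h"
  by (auto simp: act_def fun_eq_iff distrib_left sum.distrib)

lemma act_scale_right: "act p (\<lambda>\<gamma>. c * f \<gamma>) \<gamma> = c * act p f \<gamma>"
  by (simp add: act_def sum_distrib_left mult_ac)

lemma act_sum_right: "act p (\<Sum>i\<in>S. f i) = (\<Sum>i\<in>S. act p (f i))"
proof (induction S rule: infinite_finite_induct)
  case (insert x F)
  then show ?case by (simp only: sum.insert[OF insert(1,2)] act_add_right)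
qed (auto simp: act_def fun_eq_iff)

lemma act_mult: "act (p * q) f = act p (act q f)"
proof -
  have single: "act (Poly_Mapping.single v c * Poly_Mapping.single w d) f =
      act (Poly_Mapping.single v c) (act (Poly_Mapping.single w d) f)" for v w c d
    by (auto simp: mult_single act_single plus_word_def list_coeff_append list_wt_append rwt_add diff_diff_eq mult_ac fun_eq_iff)
  let ?p = "\<lambda>v. Poly_Mapping.single v (Poly_Mapping.lookup p v)"
  let ?q = "\<lambda>w. Poly_Mapping.single w (Poly_Mapping.lookup q w)"
  have "act ((\<Sum>v\<in>Poly_Mapping.keys p. ?p v) * (\<Sum>w\<in>Poly_Mapping.keys q. ?q w)) f =
      act (\<Sum>v\<in>Poly_Mapping.keys p. ?p v) (act (\<Sum>w\<in>Poly_Mapping.keys q. ?q w) f)"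
    by (simp only: sum_distrib_left sum_distrib_right act_sum single act_sum_right)
  then show ?thesis by (simp flip: free_alg_expand)
qed

definition delta :: "(nat \<Rightarrow> rat) \<Rightarrow> (nat \<Rightarrow> rat) \<Rightarrow> 'k::field_char_0" where
  "delta \<xi> = (\<lambda>\<gamma>. if \<gamma> = \<xi> then 1 else 0)"

text \<open>Each value of p f depends on finitely many values of f, so an operator is determined by
  its matrix entries even on functions of infinite support.\<close>

lemma act_eq_sum_delta:
  "act p f \<zeta> = (\<Sum>\<xi>\<in>(\<lambda>w. \<zeta> - rwt (list_wt (letters w))) ` Poly_Mapping.keys p. f \<xi> * act p (delta \<xi>) \<zeta>)"
proof -
  let ?P = "(\<lambda>w. \<zeta> - rwt (list_wt (letters w))) ` Poly_Mapping.keys p"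
  define f' where "f' = (\<Sum>\<xi>\<in>?P. (\<lambda>\<gamma>. f \<xi> * delta \<xi> \<gamma>))"
  have f': "f' \<gamma> = f \<gamma>" if "\<gamma> \<in> ?P" for \<gamma>
  proof -
    have "f' \<gamma> = (\<Sum>\<xi>\<in>?P. if \<xi> = \<gamma> then f \<gamma> else 0)"
      unfolding f'_def sum_fun_apply by (intro sum.cong) (auto simp: delta_def)
    then show ?thesis using that by (simp add: sum.delta)
  qed
  have "act p f \<zeta> = act p f' \<zeta>"
    unfolding act_def by (intro sum.cong) (auto simp: f')
  also have "\<dots> = (\<Sum>\<xi>\<in>?P. f \<xi> * act p (delta \<xi>) \<zeta>)"
    unfolding f'_def act_sum_right sum_fun_apply act_scale_right ..
  finally show ?thesis .
qed

section \<open>Descent of the action to the Weyl algebra\<close>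

context weyl_alg
begin

definition act_kernel :: "'k free_alg set" where
  "act_kernel = {p \<in> A. \<forall>f. act p f = 0}"

lemma act_0_right: "act p 0 = 0"
  by (auto simp: act_def)

lemma act_kernel_ideal: "ideal act_kernel F"
proof (rule idealI)
  show "subgroup act_kernel (add_monoid F)"
  proof (rule F.add.subgroupI)
    show "\<ominus>\<^bsub>F\<^esub> p \<in> act_kernel" if "p \<in> act_kernel" for p
      using that by (simp add: act_kernel_def F_a_inv A_uminus act_uminus)
  qed (auto simp: act_kernel_def act_add A_add intro!: exI[of _ 0] A_0 act_0)
qed (auto simp: act_kernel_def act_mult act_0_right A_mult F.ring_axioms)

lemma diff_swap: "(x :: nat \<Rightarrow> rat) - y - z = x - z - y"
  by (simp add: diff_diff_eq add.commute)

lemma relators_act_kernel: "weyl_relators r s \<subseteq> act_kernel"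
proof -
  have D: "act (fgen (GD i) * fgen (GX j) - fgen (GX j) * fgen (GD i) - (if i = j then 1 else 0)) f \<gamma> = 0"
    for i j f \<gamma>
  proof -
    have one: "act (if i = j then 1 else 0) f \<gamma> = (if i = j then f \<gamma> else 0)"
      using act_fconst[of 1 f \<gamma>] by (simp add: fconst_1 act_0)
    show ?thesis
    proof (cases "i = j")
      case True
      have w: "rwt (gen_wt (GD j)) = - rwt (gen_wt (GX j))" by (auto simp: rwt_def)
      have c: "rwt (gen_wt (GX j)) j = 1" by (simp add: rwt_def)
      show ?thesis unfolding act_diff act_mult fun_diff_def one
        by (simp add: act_fgen True w c of_rat_add algebra_simps del: gen_wt.simps)
    next
      case False
      then have c: "rwt (gen_wt (GX j)) i = 0" by (simp add: rwt_def)
      show ?thesis unfolding act_diff act_mult fun_diff_def one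
        using False by (simp add: act_fgen c diff_swap[of \<gamma> "rwt (gen_wt (GD i))"] del: gen_wt.simps)
    qed
  qed
  have XX: "act (fgen (GX i) * fgen (GX j) - fgen (GX j) * fgen (GX i)) f \<gamma> = 0" for i j f \<gamma>
    unfolding act_diff act_mult fun_diff_def
    by (simp add: act_fgen diff_swap[of \<gamma> "rwt (gen_wt (GX i))"] del: gen_wt.simps)
  have DD: "act (fgen (GD i) * fgen (GD j) - fgen (GD j) * fgen (GD i)) f \<gamma> = 0" for i j f \<gamma>
  proof (cases "i = j")
    case False
    then have "rwt (gen_wt (GD i)) j = 0" "rwt (gen_wt (GD j)) i = 0"
      by (simp_all add: rwt_def)
    then show ?thesis unfolding act_diff act_mult fun_diff_def
      by (simp add: act_fgen mult_ac diff_swap[of \<gamma> "rwt (gen_wt (GD i))"] del: gen_wt.simps)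
  qed (simp add: act_0)
  have w: "rwt (gen_wt (GXinv i)) = - rwt (gen_wt (GX i))" for i by (auto simp: rwt_def)
  have V: "act (fgen (GX i) * fgen (GXinv i) - 1) f \<gamma> = 0" "act (fgen (GXinv i) * fgen (GX i) - 1) f \<gamma> = 0" for i f \<gamma>
    using act_fconst[of 1 f \<gamma>] unfolding act_diff act_mult fun_diff_def
    by (simp_all add: act_fgen w fconst_1 del: gen_wt.simps)
  show ?thesis
  proof (rule subsetI)
    fix p :: "'k free_alg" assume p: "p \<in> weyl_relators r s"
    have "act p f \<gamma> = 0" for f \<gamma>
      using p unfolding weyl_relators_def by (elim UnE CollectE exE conjE; hypsubst) (rule XX DD D V)+
    then have "act p f = 0" for f by (intro ext) simp
    then show "p \<in> act_kernel" using p relators_subset by (auto simp: act_kernel_def)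
  qed
qed

text \<open>The annihilator of the action is a two-sided ideal containing the relators, hence it
  contains the ideal that they generate.\<close>

lemma act_I: "p \<in> I \<Longrightarrow> act p f = 0"
  using F.genideal_minimal[OF act_kernel_ideal relators_act_kernel]
  by (auto simp: weyl_ideal_def act_kernel_def)

lemma act_weq: "p \<approx> q \<Longrightarrow> act p f = act q f"
  using act_I[of "p - q" f] by (simp add: weq_def act_diff)

lemma act_pi: "act (euler_op i) f \<gamma> = of_rat (\<gamma> i) * f \<gamma>"
proof -
  have w: "rwt (gen_wt (GD i)) = - rwt (gen_wt (GX i))" by (auto simp: rwt_def)
  have c: "(\<gamma> - rwt (gen_wt (GX i))) i + 1 = \<gamma> i" by (simp add: rwt_def)
  have wi: "rwt (gen_wt (GX i)) i = 1" by (simp add: rwt_def)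
  show ?thesis by (simp add: euler_op_def act_mult act_fgen w wi del: gen_wt.simps)
qed

lemma act_tor: "act (tor (r+s) t) f \<gamma> = (\<Sum>i\<in>{1..r+s}. t i * of_rat (\<gamma> i)) * (f \<gamma> :: 'k)"
  unfolding tor_eq act_sum sum_fun_apply act_mult act_fconst act_pi sum_distrib_right
  by (simp only: mult.assoc)

lemma list_coeff_replicate_GD:
  "list_coeff (replicate k (GD i)) \<gamma> = (\<Prod>j<k. of_rat (\<gamma> i + 1 + of_nat j) :: 'k)"
proof (induction k arbitrary: \<gamma>)
  case (Suc k)
  have c: "(\<gamma> - rwt (gen_wt (GD i))) i = \<gamma> i + 1" by (simp add: rwt_def)
  show ?case unfolding replicate_Suc list_coeff.simps Suc.IH c
    by (subst prod.lessThan_Suc_shift) (simp add: add_ac)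
qed simp

lemma list_coeff_replicate_1: "(\<And>\<gamma>. gen_coeff a \<gamma> = (1 :: 'k)) \<Longrightarrow> list_coeff (replicate k a) \<gamma> = (1 :: 'k)"
  by (induction k arbitrary: \<gamma>) auto

lemma list_coeff_blk:
  "list_coeff (blk i m) \<gamma> = (if m < 0 \<and> i \<le> r then \<Prod>j<nat (- m). of_rat (\<gamma> i + 1 + of_nat j) else 1 :: 'k)"
  by (auto simp: blk_def list_coeff_replicate_GD list_coeff_replicate_1)

lemma list_coeff_concat_blk:
  "distinct is \<Longrightarrow> list_coeff (concat (map (\<lambda>i. blk i (u i)) is)) \<gamma> = (\<Prod>i\<in>set is. list_coeff (blk i (u i)) \<gamma> :: 'k)"
proof (induction "is" arbitrary: \<gamma>)
  case (Cons k ks)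
  have "list_coeff (blk i (u i)) (\<gamma> - rwt (list_wt (blk k (u k)))) = (list_coeff (blk i (u i)) \<gamma> :: 'k)" if "i \<in> set ks" for i
  proof -
    have "(\<gamma> - rwt (list_wt (blk k (u k)))) i = \<gamma> i" using that Cons.prems by (auto simp: rwt_def list_wt_blk)
    then show ?thesis by (simp only: list_coeff_blk)
  qed
  then show ?case using Cons by (simp add: list_coeff_append)
qed simp

lemma list_coeff_normal_word:
  "list_coeff (normal_word u) \<gamma> = (\<Prod>i\<in>{1..r+s}. list_coeff (blk i (u i)) \<gamma> :: 'k)"
  unfolding normal_word_def by (subst list_coeff_concat_blk) (simp_all del: upt_Suc add: atLeastLessThanSuc_atLeastAtMost)

lemma homogeneous_A: "p \<in> homogeneous_part g \<Longrightarrow> p \<in> A"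
  by (simp add: homogeneous_part_def)

lemma homogeneous_add: "p \<in> homogeneous_part g \<Longrightarrow> q \<in> homogeneous_part g \<Longrightarrow> p + q \<in> homogeneous_part g"
  using keys_add[of p q] by (auto simp: homogeneous_part_def A_add)

lemma homogeneous_uminus: "p \<in> homogeneous_part g \<Longrightarrow> - p \<in> homogeneous_part g"
  by (auto simp: homogeneous_part_def A_uminus in_keys_iff)

lemma homogeneous_diff: "p \<in> homogeneous_part g \<Longrightarrow> q \<in> homogeneous_part g \<Longrightarrow> p - q \<in> homogeneous_part g"
  using homogeneous_add[OF _ homogeneous_uminus] by fastforce

lemma homogeneous_mult:
  assumes "p \<in> homogeneous_part g" "q \<in> homogeneous_part g"
  shows "p * q \<in> homogeneous_part g"
proof -
  have "pairing (r+s) t (list_wt (letters w)) = 0" if w: "w \<in> Poly_Mapping.keys (p * q)" and t: "t \<in> g" for w t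
  proof -
    obtain u v where "w = u + v" "u \<in> Poly_Mapping.keys p" "v \<in> Poly_Mapping.keys q"
      using w keys_mult[of p q] by blast
    then show ?thesis using assms t
      by (simp add: homogeneous_part_def plus_word_def list_wt_append pairing_add)
  qed
  then show ?thesis using assms by (simp add: homogeneous_part_def A_mult)
qed

lemma homogeneous_fconst: "fconst c \<in> homogeneous_part g"
  using A_fconst[of c] by (auto simp: homogeneous_part_def fconst_def zero_word_def pairing_def split: if_splits)

lemma homogeneous_0: "0 \<in> homogeneous_part g" and homogeneous_1: "1 \<in> homogeneous_part g"
  using homogeneous_fconst[of 0] homogeneous_fconst[of 1] by (simp_all add: fconst_0 fconst_1)

lemma homogeneous_sum: "(\<And>i. i \<in> S \<Longrightarrow> f i \<in> homogeneous_part g) \<Longrightarrow> (\<Sum>i\<in>S. f i) \<in> homogeneous_part g"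
  by (induction S rule: infinite_finite_induct) (auto intro: homogeneous_0 homogeneous_add)

lemma homogeneous_mon:
  assumes "set l \<subseteq> weyl_gens r s" "\<And>t. t \<in> g \<Longrightarrow> pairing (r+s) t (list_wt l) = 0"
  shows "mon l \<in> homogeneous_part g"
  using assms A_mon[OF assms(1)] by (simp add: homogeneous_part_def mon_def)

lemma homogeneous_pi: "i \<in> {1..r+s} \<Longrightarrow> euler_op i \<in> homogeneous_part g"
proof -
  assume i: "i \<in> {1..r+s}"
  have "list_wt [GX i, GD i] = 0" by (auto simp: list_wt_def)
  then have "mon [GX i, GD i] \<in> homogeneous_part g"
    using i by (intro homogeneous_mon) (auto simp: pairing_def weyl_gens_def)
  then show ?thesis by (simp add: mon_Cons mon_Nil euler_op_def)
qed

lemma homogeneous_sym: "p \<in> sym_algebra \<Longrightarrow> p \<in> homogeneous_part g"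
  by (induction rule: sym_algebra.induct)
    (auto intro: homogeneous_fconst homogeneous_pi homogeneous_add homogeneous_mult simp del: atLeastAtMost_iff)

lemma homogeneous_tor: "tor (r+s) t \<in> homogeneous_part g"
  unfolding tor_eq by (intro homogeneous_sum homogeneous_mult homogeneous_fconst homogeneous_pi)

end

section \<open>The simple module\<close>

definition supported :: "('a \<Rightarrow> 'b::zero) \<Rightarrow> 'a set \<Rightarrow> bool" where
  "supported f Y \<longleftrightarrow> (\<forall>\<gamma>. \<gamma> \<notin> Y \<longrightarrow> f \<gamma> = 0)"

lemma supported_delta: "\<xi> \<in> Y \<Longrightarrow> supported (delta \<xi>) Y"
  by (auto simp: supported_def delta_def)

context typed_point
begin

sublocale weyl_alg r s "TYPE('k)" .

abbreviation "G \<equiv> homogeneous_part g"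

abbreviation "T \<equiv> Tset r \<alpha>"

definition lattice_coset :: "(nat \<Rightarrow> rat) set" where
  "lattice_coset = {\<gamma>. \<gamma> - \<alpha> \<in> E}"

definition sub_support :: "(nat \<Rightarrow> rat) set" where
  "sub_support = {\<gamma>. (\<forall>i. \<gamma> i - \<alpha> i \<in> \<int>) \<and> (\<forall>i\<in>T. 0 \<le> \<alpha> i \<longrightarrow> 0 \<le> \<gamma> i)}"

definition sub_sub_support :: "(nat \<Rightarrow> rat) set" where
  "sub_sub_support = {\<gamma> \<in> sub_support. \<exists>i\<in>T. \<alpha> i < 0 \<and> 0 \<le> \<gamma> i}"

text \<open>The weights of \<open>L(\<alpha>)\<close>. The functions supported in \<open>sub_support\<close> form a submodule, those
  supported in \<open>sub_sub_support\<close> a submodule of it, and \<open>L(\<alpha>)\<close> is the part of the quotient with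
  weights in \<open>\<alpha> + E\<close>.\<close>

definition S :: "(nat \<Rightarrow> rat) set" where
  "S = {\<gamma>. \<gamma> - \<alpha> \<in> E \<and> (\<forall>i. \<gamma> i - \<alpha> i \<in> \<int>) \<and> (\<forall>i\<in>T. (0 \<le> \<gamma> i) = (0 \<le> \<alpha> i))}"

lemma S_eq: "S = lattice_coset \<inter> sub_support - sub_sub_support"
  unfolding S_def lattice_coset_def sub_support_def sub_sub_support_def by (auto simp: not_le not_less)

lemma T_integral: "i \<in> T \<Longrightarrow> \<alpha> i \<in> \<int>" and T_le: "i \<in> T \<Longrightarrow> i \<le> r"
  by (auto simp: Tset_def)

lemma sub_support_integral: "\<gamma> i - \<alpha> i \<in> \<int> \<Longrightarrow> i \<in> T \<Longrightarrow> \<gamma> i \<in> \<int>"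
  using Ints_add[OF _ T_integral, of "\<gamma> i - \<alpha> i" i] by simp

lemma int_neg: "(x::rat) \<in> \<int> \<Longrightarrow> x < 0 \<Longrightarrow> x = -1 \<or> x + 1 < 0"
  by (elim Ints_cases) (simp, linarith)

lemma shift_integral: "(\<gamma> - rwt u) i - \<alpha> i \<in> \<int> \<longleftrightarrow> \<gamma> i - \<alpha> i \<in> \<int>"
proof -
  have e: "(\<gamma> - rwt u) i - \<alpha> i = (\<gamma> i - \<alpha> i) - of_int (u i)" by (simp add: rwt_def)
  show ?thesis unfolding e
    by (metis Ints_diff Ints_add Ints_of_int diff_add_cancel)
qed

text \<open>A letter could take coordinate i from nonnegative to negative only as \<partial>_i
  passing from 0 to -1, and there its coefficient \<gamma>_i + 1 vanishes. Inverses of x_i do not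
  exist, because i \<le> r.\<close>

lemma fgen_step:
  assumes a: "a \<in> weyl_gens r s" and i: "i \<in> T" and int: "\<gamma> i \<in> \<int>"
    and neg: "\<gamma> i < 0" and pos: "0 \<le> (\<gamma> - rwt (gen_wt a)) i"
  shows "gen_coeff a \<gamma> = (0 :: 'k)"
  using a
proof (cases rule: gen_cases)
  case (X j)
  then show ?thesis using neg pos by (auto simp: rwt_def split: if_splits)
next
  case (D j)
  show ?thesis
  proof (cases "j = i")
    case True
    then have "\<gamma> i + 1 \<ge> 0" using pos D by (simp add: rwt_def)
    then have "\<gamma> i = -1" using int_neg[OF int neg] by auto
    then show ?thesis using D True by simp
  next
    case False
    then show ?thesis using D neg pos by (simp add: rwt_def)
  qed
next
  case (V j)
  then have "j \<noteq> i" using T_le[OF i] by auto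
  then show ?thesis using V neg pos by (simp add: rwt_def)
qed

lemma supported_fgen:
  assumes a: "a \<in> weyl_gens r s" and f: "supported f sub_support"
  shows "supported (act (fgen a) f :: _ \<Rightarrow> 'k) sub_support"
  unfolding supported_def
proof (intro allI impI)
  fix \<gamma> assume \<gamma>: "\<gamma> \<notin> sub_support"
  have "gen_coeff a \<gamma> = (0 :: 'k)" if sub: "\<gamma> - rwt (gen_wt a) \<in> sub_support"
  proof -
    have int: "\<gamma> i - \<alpha> i \<in> \<int>" for i using sub shift_integral by (auto simp: sub_support_def)
    then obtain i where i: "i \<in> T" "0 \<le> \<alpha> i" "\<gamma> i < 0" using \<gamma> by (auto simp: sub_support_def)
    then have "0 \<le> (\<gamma> - rwt (gen_wt a)) i" using sub by (simp add: sub_support_def)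
    moreover have "\<gamma> i \<in> \<int>" using int i(1) by (rule sub_support_integral)
    ultimately show ?thesis using fgen_step[OF a i(1)] i(3) by blast
  qed
  then show "act (fgen a) f \<gamma> = 0"
    using f unfolding act_fgen supported_def by (metis mult_eq_0_iff)
qed

lemma supported_mono: "supported f Z \<Longrightarrow> Z \<subseteq> Y \<Longrightarrow> supported f Y"
  by (auto simp: supported_def)

lemma sub_sub_support_subset: "sub_sub_support \<subseteq> sub_support"
  by (auto simp: sub_sub_support_def)

text \<open>The wall at zero is crossed only upwards, so a coordinate witnessing membership stays
  nonnegative.\<close>

lemma supported_fgen_sub:
  assumes a: "a \<in> weyl_gens r s" and f: "supported f sub_sub_support"
  shows "supported (act (fgen a) f :: _ \<Rightarrow> 'k) sub_sub_support"
  unfolding supported_def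
proof (intro allI impI)
  fix \<gamma> assume \<gamma>: "\<gamma> \<notin> sub_sub_support"
  show "act (fgen a) f \<gamma> = 0"
  proof (cases "\<gamma> \<in> sub_support")
    case False
    then show ?thesis
      using supported_fgen[OF a supported_mono[OF f sub_sub_support_subset]] by (simp add: supported_def)
  next
    case True
    have "gen_coeff a \<gamma> = (0 :: 'k)" if sub: "\<gamma> - rwt (gen_wt a) \<in> sub_sub_support"
    proof -
      obtain i where i: "i \<in> T" "\<alpha> i < 0" "0 \<le> (\<gamma> - rwt (gen_wt a)) i"
        using sub by (auto simp: sub_sub_support_def)
      then have "\<gamma> i < 0" using \<gamma> True by (auto simp: sub_sub_support_def not_le)
      moreover have "\<gamma> i - \<alpha> i \<in> \<int>" using True by (simp add: sub_support_def)
      moreover from this i(1) have "\<gamma> i \<in> \<int>" by (rule sub_support_integral)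
      ultimately show ?thesis using fgen_step[OF a i(1)] i(3) by blast
    qed
    then show ?thesis using f unfolding act_fgen supported_def by (metis mult_eq_0_iff)
  qed
qed

lemma supported_act:
  assumes step: "\<And>a f. a \<in> weyl_gens r s \<Longrightarrow> supported f Y \<Longrightarrow> supported (act (fgen a) f :: _ \<Rightarrow> 'k) Y"
    and p: "p \<in> A" and f: "supported f Y"
  shows "supported (act p f :: _ \<Rightarrow> 'k) Y"
proof -
  have mon: "supported (act (mon l) f :: _ \<Rightarrow> 'k) Y" if "set l \<subseteq> weyl_gens r s" for l
    using that
  proof (induction l)
    case Nil
    have "act (mon []) f = f" using act_fconst[of 1 f] by (auto simp: mon_Nil fconst_1 fun_eq_iff)
    then show ?case using f by simp
  next
    case (Cons a l)
    then show ?case using step by (simp add: mon_Cons act_mult)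
  qed
  show ?thesis unfolding supported_def
  proof (intro allI impI)
    fix \<gamma> assume \<gamma>: "\<gamma> \<notin> Y"
    have "act p f \<gamma> = (\<Sum>w\<in>Poly_Mapping.keys p. Poly_Mapping.lookup p w * act (mon (letters w)) f \<gamma>)"
      by (simp add: act_def[of p] act_mon mult.assoc)
    also have "\<dots> = 0" using mon p \<gamma> by (intro sum.neutral) (auto simp: A_eq supported_def)
    finally show "act p f \<gamma> = 0" .
  qed
qed

lemma list_wt_outside: "set l \<subseteq> weyl_gens r s \<Longrightarrow> i \<notin> {1..r+s} \<Longrightarrow> list_wt l i = 0"
proof (induction l)
  case (Cons a l)
  then have "gen_idx a \<noteq> i" by (auto elim: gen_cases)
  then show ?case using Cons gen_wt_other[of i a] by (auto simp: list_wt_Cons)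
qed simp

lemma rwt_E_iff:
  assumes "\<And>i. i \<notin> {1..r+s} \<Longrightarrow> u i = 0"
  shows "rwt u \<in> E \<longleftrightarrow> (\<forall>t\<in>g. pairing (r+s) t u = 0)"
  using assms by (auto simp: mem_E_iff rwt_def coord_space_def pairing_def mult.commute)

lemma G_weight_E: "p \<in> G \<Longrightarrow> w \<in> Poly_Mapping.keys p \<Longrightarrow> rwt (list_wt (letters w)) \<in> E"
  using list_wt_outside[of "letters w"] by (subst rwt_E_iff) (auto simp: homogeneous_part_def A_eq)

lemma lattice_coset_shift: "u \<in> E \<Longrightarrow> \<gamma> - u \<in> lattice_coset \<longleftrightarrow> \<gamma> \<in> lattice_coset"
proof -
  assume u: "u \<in> E"
  have "\<gamma> - u - \<alpha> = (\<gamma> - \<alpha>) - u" "\<gamma> - \<alpha> = (\<gamma> - u - \<alpha>) + u" by auto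
  then show ?thesis using E_diff[OF _ u] E_add[OF _ u] unfolding lattice_coset_def by (metis mem_Collect_eq)
qed

lemma supported_act_coset:
  assumes p: "p \<in> G" and f: "supported f lattice_coset"
  shows "supported (act p f :: _ \<Rightarrow> 'k) lattice_coset"
  using f unfolding supported_def act_def
  by (auto intro!: sum.neutral simp: lattice_coset_shift[OF G_weight_E[OF p]])

text \<open>The action on the subquotient, with functions supported on \<open>S\<close> as
  representatives of its elements; truncation picks the representative of the result.\<close>

definition rho :: "'k free_alg \<Rightarrow> ((nat \<Rightarrow> rat) \<Rightarrow> 'k) \<Rightarrow> (nat \<Rightarrow> rat) \<Rightarrow> 'k" where
  "rho p f = (\<lambda>\<gamma>. if \<gamma> \<in> S then act p f \<gamma> else 0)"

lemma supported_rho: "supported (rho p f) S"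
  by (simp add: supported_def rho_def)

lemma rho_add: "rho (p + q) f = rho p f + rho q f"
  by (auto simp: rho_def act_add)

lemma rho_diff: "rho (p - q) f = rho p f - rho q f"
  by (auto simp: rho_def act_diff)

lemma rho_0: "rho 0 f = 0"
  by (auto simp: rho_def act_0)

lemma rho_0_right: "rho p 0 = 0"
  by (auto simp: rho_def act_0_right)

lemma rho_weq: "p \<approx> q \<Longrightarrow> rho p f = rho q f"
  using act_weq[of p q f] by (simp add: rho_def cong: if_cong)

lemma rho_fconst: "supported f S \<Longrightarrow> rho (fconst c) f = (\<lambda>\<gamma>. c * f \<gamma>)"
  by (auto simp: rho_def act_fconst supported_def)

lemma rho_1: "supported f S \<Longrightarrow> rho 1 f = f"
  using rho_fconst[of f 1] by (simp add: fconst_1)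

text \<open>Truncating the intermediate result discards a function supported in
  \<open>sub_sub_support\<close>. Such functions form a submodule, so the discarded part cannot
  return to \<open>S\<close>.\<close>

lemma rho_mult:
  assumes "p \<in> G" "q \<in> G" "supported f S"
  shows "rho (p * q) f = rho p (rho q f)"
proof -
  define h where "h = act q f - rho q f"
  have "supported f lattice_coset" "supported f sub_support"
    using assms(3) by (auto simp: S_eq supported_def)
  then have "supported (act q f) lattice_coset" "supported (act q f) sub_support"
    using supported_act_coset[OF assms(2)] supported_act[OF supported_fgen homogeneous_A[OF assms(2)]] by auto
  then have "supported h sub_sub_support"
    by (auto simp: h_def supported_def rho_def S_eq)
  then have "supported (act p h) sub_sub_support"
    using supported_act[OF supported_fgen_sub homogeneous_A[OF assms(1)]] by blast
  then have "act p h \<gamma> = 0" if "\<gamma> \<in> S" for \<gamma>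
    using that by (auto simp: supported_def S_eq)
  moreover have "act p (act q f) = act p (rho q f) + act p h"
    unfolding act_add_right[symmetric] h_def by simp
  ultimately show ?thesis by (auto simp: rho_def act_mult)
qed

definition kills :: "'k free_alg \<Rightarrow> bool" where
  "kills p \<longleftrightarrow> (\<forall>f. supported f S \<longrightarrow> rho p f = 0)"

lemma kills_iff: "kills p \<longleftrightarrow> (\<forall>\<zeta>\<in>S. \<forall>\<xi>\<in>S. act p (delta \<xi>) \<zeta> = 0)"
proof
  assume "kills p"
  then have "rho p (delta \<xi>) \<zeta> = 0" if "\<zeta> \<in> S" "\<xi> \<in> S" for \<zeta> \<xi>
    using supported_delta[OF that(2)] unfolding kills_def by (metis zero_fun_apply)
  then show "\<forall>\<zeta>\<in>S. \<forall>\<xi>\<in>S. act p (delta \<xi>) \<zeta> = 0" by (auto simp: rho_def)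
next
  assume r: "\<forall>\<zeta>\<in>S. \<forall>\<xi>\<in>S. act p (delta \<xi>) \<zeta> = 0"
  show "kills p" unfolding kills_def
  proof (intro allI impI ext)
    fix f :: "(nat \<Rightarrow> rat) \<Rightarrow> 'k" and \<zeta> assume f: "supported f S"
    have "act p f \<zeta> = 0" if "\<zeta> \<in> S"
    proof (subst act_eq_sum_delta, rule sum.neutral, rule ballI)
      fix \<xi>
      show "f \<xi> * act p (delta \<xi>) \<zeta> = 0"
        using r f that by (cases "\<xi> \<in> S") (auto simp: supported_def)
    qed
    then show "rho p f \<zeta> = 0 \<zeta>" by (simp add: rho_def)
  qed
qed

lemma \<alpha>_S: "\<alpha> \<in> S"
  by (simp add: S_def E_0)

text \<open>The weights without sign conditions. Density arguments pass through points of this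
  larger set before they return to \<open>S\<close>.\<close>

definition coset :: "(nat \<Rightarrow> rat) set" where
  "coset = {\<gamma>. \<gamma> - \<alpha> \<in> E \<and> (\<forall>i. \<gamma> i - \<alpha> i \<in> \<int>)}"

lemma S_coset: "\<gamma> \<in> S \<Longrightarrow> \<gamma> \<in> coset"
  by (simp add: S_def coset_def)

lemma coset_diff_rwt:
  assumes "\<zeta> \<in> coset" "\<xi> \<in> coset" obtains u where "rwt u = \<zeta> - \<xi>" "rwt u \<in> E"
proof
  have int: "(\<zeta> - \<xi>) i \<in> \<int>" for i
  proof -
    have "(\<zeta> - \<xi>) i = (\<zeta> i - \<alpha> i) - (\<xi> i - \<alpha> i)" by simp
    then show ?thesis using assms unfolding coset_def by (metis (mono_tags, lifting) Ints_diff mem_Collect_eq)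
  qed
  show eq: "rwt (\<lambda>i. \<lfloor>(\<zeta> - \<xi>) i\<rfloor>) = \<zeta> - \<xi>"
    unfolding rwt_def using of_int_floor[OF int] by (rule ext)
  have "\<zeta> - \<xi> = (\<zeta> - \<alpha>) - (\<xi> - \<alpha>)" by simp
  then show "rwt (\<lambda>i. \<lfloor>(\<zeta> - \<xi>) i\<rfloor>) \<in> E"
    using E_diff[of "\<zeta> - \<alpha>" "\<xi> - \<alpha>"] assms unfolding eq by (simp add: coset_def)
qed

lemma S_diff:
  assumes "\<zeta> \<in> S" "\<xi> \<in> S" obtains u where "rwt u = \<zeta> - \<xi>" "rwt u \<in> E"
  using coset_diff_rwt[OF S_coset S_coset] assms .

lemma normal_word_wt: "rwt u \<in> E \<Longrightarrow> list_wt (normal_word u) = u"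
  by (auto simp: list_wt_normal_word mem_E_iff coord_space_def rwt_def fun_eq_iff)

lemma normal_word_G:
  assumes "rwt u \<in> E" shows "mon (normal_word u) \<in> G"
proof (rule homogeneous_mon[OF set_normal_word])
  fix t assume "t \<in> g"
  have "u i = 0" if "i \<notin> {1..r+s}" for i
    using assms that by (auto simp: mem_E_iff coord_space_def rwt_def)
  then show "pairing (r+s) t (list_wt (normal_word u)) = 0"
    using rwt_E_iff assms \<open>t \<in> g\<close> unfolding normal_word_wt[OF assms] by blast
qed

text \<open>For i in T the factors of the coefficient lie between coordinates of the same sign: they
  are all positive, or all at most a negative endpoint. For i \<le> r outside T they are not
  integral. Hence none of them is zero.\<close>

lemma list_coeff_nonzero:
  assumes "\<gamma> \<in> S" "\<gamma> - rwt u \<in> S"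
  shows "list_coeff (normal_word u) \<gamma> \<noteq> (0 :: 'k)"
proof -
  have "\<gamma> i + 1 + of_nat j \<noteq> 0" if i: "i \<in> {1..r+s}" "u i < 0" "i \<le> r" and j: "j < nat (- u i)" for i j
  proof (cases "i \<in> T")
    case True
    have s: "(0 \<le> \<gamma> i) = (0 \<le> \<alpha> i)" "(0 \<le> (\<gamma> - rwt u) i) = (0 \<le> \<alpha> i)"
      using assms True by (auto simp: S_def)
    have le: "\<gamma> i + 1 + of_nat j \<le> (\<gamma> - rwt u) i"
    proof -
      have "int j + 1 \<le> - u i" using j by linarith
      then have "(of_int (int j + 1) :: rat) \<le> of_int (- u i)" by (simp only: of_int_le_iff)
      then show ?thesis by (simp add: rwt_def)
    qed
    show ?thesis
    proof (cases "0 \<le> \<alpha> i")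
      case True
      then have "0 \<le> \<gamma> i" using s by simp
      then show ?thesis by (simp add: add_nonneg_eq_0_iff)
    next
      case False
      then show ?thesis using s le by simp
    qed
  next
    case False
    then have "\<alpha> i \<notin> \<int>" using i by (auto simp: Tset_def)
    moreover have "\<gamma> i - \<alpha> i \<in> \<int>" using assms by (simp add: S_def)
    ultimately have "\<gamma> i \<notin> \<int>" using Ints_diff[of "\<gamma> i" "\<gamma> i - \<alpha> i"] by auto
    moreover have "\<gamma> i \<in> \<int>" if "\<gamma> i + 1 + of_nat j = 0"
    proof -
      have "\<gamma> i = - (1 + of_nat j)" using that by (simp add: eq_neg_iff_add_eq_0 add.assoc)
      then show ?thesis by simp
    qed
    ultimately show ?thesis by blast
  qed
  then have nz: "of_rat (\<gamma> i + 1 + of_nat j) \<noteq> (0 :: 'k)" if "i \<in> {1..r+s}" "u i < 0" "i \<le> r" "j < nat (- u i)" for i j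
    using that by (simp only: of_rat_eq_0_iff) blast
  show ?thesis
    unfolding list_coeff_normal_word prod_zero_iff[OF finite_atLeastAtMost] list_coeff_blk
    using nz by (auto split: if_splits simp del: atLeastAtMost_iff)
qed

text \<open>Any two weights of \<open>S\<close> are joined by a normal word with nonzero
  coefficient, which is the reason for the simplicity of L(\<alpha>).\<close>

lemma rho_normal_word:
  assumes u: "rwt u = \<zeta> - \<xi>" "rwt u \<in> E" and "\<zeta> \<in> S" "\<xi> \<in> S"
  shows "rho (mon (normal_word u)) (delta \<xi>) = (\<lambda>\<gamma>. list_coeff (normal_word u) \<zeta> * delta \<zeta> \<gamma>)"
proof
  fix \<gamma>
  have "delta \<xi> (\<gamma> - rwt u) = (delta \<zeta> \<gamma> :: 'k)"
    unfolding u(1) delta_def by (auto simp: algebra_simps)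
  then show "rho (mon (normal_word u)) (delta \<xi>) \<gamma> = list_coeff (normal_word u) \<zeta> * delta \<zeta> \<gamma>"
    unfolding rho_def act_mon normal_word_wt[OF u(2)] using assms(3) by (auto simp: delta_def)
qed

end

section \<open>Simple quotients of left modules\<close>

locale lmodule = R?: ring R + M?: abelian_group M for R :: "('a, 'n) ring_scheme" (structure) and M :: "('a, 'b, 'm) module_scheme" (structure) +
  assumes smult_closed [simp, intro]: "a \<in> carrier R \<Longrightarrow> x \<in> carrier M \<Longrightarrow> a \<odot>\<^bsub>M\<^esub> x \<in> carrier M"
    and smult_r_distr: "a \<in> carrier R \<Longrightarrow> x \<in> carrier M \<Longrightarrow> y \<in> carrier M \<Longrightarrow>
      a \<odot>\<^bsub>M\<^esub> (x \<oplus>\<^bsub>M\<^esub> y) = a \<odot>\<^bsub>M\<^esub> x \<oplus>\<^bsub>M\<^esub> a \<odot>\<^bsub>M\<^esub> y"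
begin

lemma submoduleI':
  assumes "N \<subseteq> carrier M" "\<zero>\<^bsub>M\<^esub> \<in> N" "\<And>x. x \<in> N \<Longrightarrow> \<ominus>\<^bsub>M\<^esub> x \<in> N"
    "\<And>x y. x \<in> N \<Longrightarrow> y \<in> N \<Longrightarrow> x \<oplus>\<^bsub>M\<^esub> y \<in> N"
    "\<And>a x. a \<in> carrier R \<Longrightarrow> x \<in> N \<Longrightarrow> a \<odot>\<^bsub>M\<^esub> x \<in> N"
  shows "submodule N R M"
  using assms by (intro submodule.intro subgroup.intro) (auto simp: submodule_axioms_def a_inv_def)

lemma submodule_abelian_subgroup: "submodule N R M \<Longrightarrow> abelian_subgroup N M"
  by (intro abelian_subgroupI3 additive_subgroupI submodule.axioms(1) M.abelian_group_axioms)

lemma submoduleE':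
  assumes "submodule N R M"
  shows "N \<subseteq> carrier M" "\<zero>\<^bsub>M\<^esub> \<in> N" "\<And>x. x \<in> N \<Longrightarrow> \<ominus>\<^bsub>M\<^esub> x \<in> N"
    "\<And>x y. x \<in> N \<Longrightarrow> y \<in> N \<Longrightarrow> x \<oplus>\<^bsub>M\<^esub> y \<in> N"
    "\<And>a x. a \<in> carrier R \<Longrightarrow> x \<in> N \<Longrightarrow> a \<odot>\<^bsub>M\<^esub> x \<in> N"
proof -
  interpret N: abelian_subgroup N M by (rule submodule_abelian_subgroup[OF assms])
  show "N \<subseteq> carrier M" "\<zero>\<^bsub>M\<^esub> \<in> N" "\<And>x. x \<in> N \<Longrightarrow> \<ominus>\<^bsub>M\<^esub> x \<in> N"
    "\<And>x y. x \<in> N \<Longrightarrow> y \<in> N \<Longrightarrow> x \<oplus>\<^bsub>M\<^esub> y \<in> N"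
    using N.a_subset by auto
  show "\<And>a x. a \<in> carrier R \<Longrightarrow> x \<in> N \<Longrightarrow> a \<odot>\<^bsub>M\<^esub> x \<in> N"
    using submodule.smult_closed[OF assms] .
qed

lemma coset_eq_iff:
  assumes N: "submodule N R M" and "x \<in> carrier M" "y \<in> carrier M"
  shows "N +>\<^bsub>M\<^esub> x = N +>\<^bsub>M\<^esub> y \<longleftrightarrow> x \<oplus>\<^bsub>M\<^esub> \<ominus>\<^bsub>M\<^esub> y \<in> N"
proof -
  interpret N: abelian_subgroup N M by (rule submodule_abelian_subgroup[OF N])
  have "x \<oplus>\<^bsub>M\<^esub> \<ominus>\<^bsub>M\<^esub> y \<in> N \<longleftrightarrow> x \<in> N +>\<^bsub>M\<^esub> y"
    using N.a_rcos_module[of y x] assms by simp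
  then show ?thesis
    using N.a_rcos_self[of x] M.a_repr_independence[of x N y] assms submodule.axioms(1)[OF N] by auto
qed

lemma coset_eq_zero_iff:
  assumes "submodule N R M" "x \<in> carrier M"
  shows "N +>\<^bsub>M\<^esub> x = N \<longleftrightarrow> x \<in> N"
proof -
  have "\<ominus>\<^bsub>M\<^esub> \<zero>\<^bsub>M\<^esub> = \<zero>\<^bsub>M\<^esub>" by (rule M.minus_equality) auto
  then have "x \<oplus>\<^bsub>M\<^esub> \<ominus>\<^bsub>M\<^esub> \<zero>\<^bsub>M\<^esub> = x" using M.r_zero[OF assms(2)] by metis
  moreover have "N +>\<^bsub>M\<^esub> \<zero>\<^bsub>M\<^esub> = N" using submoduleE'(1)[OF assms(1)] by (rule M.a_coset_add_zero)
  ultimately show ?thesis using coset_eq_iff[OF assms, of "\<zero>\<^bsub>M\<^esub>"] by (metis M.zero_closed)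
qed

lemma quotient_carrier: "carrier (quotient_module M N) = (+>\<^bsub>M\<^esub>) N ` carrier M"
  by (auto simp: quotient_module_def A_RCOSETS_def' a_r_coset_def')

lemma quotient_simps [simp]:
  "\<zero>\<^bsub>quotient_module M N\<^esub> = N" "ring.add (quotient_module M N) = set_add M"
  by (simp_all add: quotient_module_def)

lemma quotient_add:
  assumes "submodule N R M" "x \<in> carrier M" "y \<in> carrier M"
  shows "(N +>\<^bsub>M\<^esub> x) <+>\<^bsub>M\<^esub> (N +>\<^bsub>M\<^esub> y) = N +>\<^bsub>M\<^esub> (x \<oplus>\<^bsub>M\<^esub> y)"
  using abelian_subgroup.a_rcos_sum[OF submodule_abelian_subgroup[OF assms(1)] assms(2,3)] .

lemma quotient_smult:
  assumes N: "submodule N R M" and a: "a \<in> carrier R" and x: "x \<in> carrier M"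
  shows "a \<odot>\<^bsub>quotient_module M N\<^esub> (N +>\<^bsub>M\<^esub> x) = N +>\<^bsub>M\<^esub> (a \<odot>\<^bsub>M\<^esub> x)"
proof -
  interpret N: abelian_subgroup N M by (rule submodule_abelian_subgroup[OF N])
  have "N +>\<^bsub>M\<^esub> (a \<odot>\<^bsub>M\<^esub> y) = N +>\<^bsub>M\<^esub> (a \<odot>\<^bsub>M\<^esub> x)" if y: "y \<in> N +>\<^bsub>M\<^esub> x" for y
  proof -
    obtain h where h: "h \<in> N" "y = h \<oplus>\<^bsub>M\<^esub> x" using y by (auto simp: a_r_coset_def')
    then have hM: "h \<in> carrier M" by simp
    have "N +>\<^bsub>M\<^esub> (a \<odot>\<^bsub>M\<^esub> y) = N +>\<^bsub>M\<^esub> (a \<odot>\<^bsub>M\<^esub> h \<oplus>\<^bsub>M\<^esub> a \<odot>\<^bsub>M\<^esub> x)"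
      using h hM a x by (simp add: smult_r_distr)
    also have "\<dots> = (N +>\<^bsub>M\<^esub> (a \<odot>\<^bsub>M\<^esub> h)) <+>\<^bsub>M\<^esub> (N +>\<^bsub>M\<^esub> (a \<odot>\<^bsub>M\<^esub> x))"
      using quotient_add[OF N] a hM x by simp
    also have "N +>\<^bsub>M\<^esub> (a \<odot>\<^bsub>M\<^esub> h) = N +>\<^bsub>M\<^esub> \<zero>\<^bsub>M\<^esub>"
      using coset_eq_zero_iff[OF N, of "a \<odot>\<^bsub>M\<^esub> h"] submoduleE'(5)[OF N a h(1)] a hM
        M.a_coset_add_zero[OF N.a_subset] by (metis smult_closed)
    also have "\<dots> <+>\<^bsub>M\<^esub> (N +>\<^bsub>M\<^esub> (a \<odot>\<^bsub>M\<^esub> x)) = N +>\<^bsub>M\<^esub> (\<zero>\<^bsub>M\<^esub> \<oplus>\<^bsub>M\<^esub> a \<odot>\<^bsub>M\<^esub> x)"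
      using a x by (intro quotient_add[OF N]) auto
    finally show ?thesis using a x by simp
  qed
  note const = this
  have "a \<odot>\<^bsub>quotient_module M N\<^esub> (N +>\<^bsub>M\<^esub> x) = (\<Union>y\<in>N +>\<^bsub>M\<^esub> x. N +>\<^bsub>M\<^esub> (a \<odot>\<^bsub>M\<^esub> y))"
    by (simp add: quotient_module_def)
  also have "\<dots> = N +>\<^bsub>M\<^esub> (a \<odot>\<^bsub>M\<^esub> x)"
    by (rule SUP_eq_const) (use N.a_rcos_self[OF x] in blast, rule const)
  finally show ?thesis .
qed

lemma quotient_lmodule:
  assumes N: "submodule N R M" shows "lmodule R (quotient_module M N)"
proof -
  interpret N: abelian_subgroup N M by (rule submodule_abelian_subgroup[OF N])
  have zero: "N = N +>\<^bsub>M\<^esub> \<zero>\<^bsub>M\<^esub>" using N.a_subset by simp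
  have "abelian_group (quotient_module M N)"
  proof (rule abelian_groupI)
    show "\<zero>\<^bsub>quotient_module M N\<^esub> \<in> carrier (quotient_module M N)"
      unfolding quotient_simps quotient_carrier using zero M.zero_closed by (metis imageI)
    fix x assume "x \<in> carrier (quotient_module M N)"
    then obtain x' where x: "x = N +>\<^bsub>M\<^esub> x'" "x' \<in> carrier M" by (auto simp: quotient_carrier)
    show "\<zero>\<^bsub>quotient_module M N\<^esub> \<oplus>\<^bsub>quotient_module M N\<^esub> x = x"
      using quotient_add[OF N M.zero_closed x(2)] x by (simp flip: zero)
    have "(N +>\<^bsub>M\<^esub> \<ominus>\<^bsub>M\<^esub> x') <+>\<^bsub>M\<^esub> x = N"
      using quotient_add[OF N _ x(2), of "\<ominus>\<^bsub>M\<^esub> x'"] x zero by (simp add: M.l_neg)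
    then show "\<exists>y\<in>carrier (quotient_module M N). y \<oplus>\<^bsub>quotient_module M N\<^esub> x = \<zero>\<^bsub>quotient_module M N\<^esub>"
      using x by (auto simp: quotient_carrier)
    fix y assume "y \<in> carrier (quotient_module M N)"
    then obtain y' where y: "y = N +>\<^bsub>M\<^esub> y'" "y' \<in> carrier M" by (auto simp: quotient_carrier)
    show "x \<oplus>\<^bsub>quotient_module M N\<^esub> y \<in> carrier (quotient_module M N)"
      using x y by (auto simp: quotient_carrier quotient_add[OF N])
    show "x \<oplus>\<^bsub>quotient_module M N\<^esub> y = y \<oplus>\<^bsub>quotient_module M N\<^esub> x"
      using x y by (simp add: quotient_add[OF N] M.a_comm)
    fix z assume "z \<in> carrier (quotient_module M N)"
    then obtain z' where "z = N +>\<^bsub>M\<^esub> z'" "z' \<in> carrier M" by (auto simp: quotient_carrier)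
    then show "x \<oplus>\<^bsub>quotient_module M N\<^esub> y \<oplus>\<^bsub>quotient_module M N\<^esub> z =
        x \<oplus>\<^bsub>quotient_module M N\<^esub> (y \<oplus>\<^bsub>quotient_module M N\<^esub> z)"
      using x y by (simp add: quotient_add[OF N] M.a_assoc)
  qed
  moreover have "ring R" by (rule R.ring_axioms)
  moreover have "lmodule_axioms R (quotient_module M N)"
    by (rule lmodule_axioms.intro) (auto simp: quotient_carrier quotient_smult[OF N] quotient_add[OF N] smult_r_distr)
  ultimately show ?thesis by (simp add: lmodule_def)
qed

lemma quotient_a_inv:
  assumes N: "submodule N R M" and x: "x \<in> carrier M"
  shows "\<ominus>\<^bsub>quotient_module M N\<^esub> (N +>\<^bsub>M\<^esub> x) = N +>\<^bsub>M\<^esub> (\<ominus>\<^bsub>M\<^esub> x)"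
proof -
  interpret Q: lmodule R "quotient_module M N" by (rule quotient_lmodule[OF N])
  show ?thesis
    using x coset_eq_zero_iff[OF N, of "\<zero>\<^bsub>M\<^esub>"] submoduleE'(2)[OF N]
    by (intro Q.M.minus_equality) (auto simp: quotient_carrier quotient_add[OF N] M.l_neg)
qed

lemma submodule_preimage:
  assumes N: "submodule N R M" and Y: "submodule Y R (quotient_module M N)"
  shows "submodule {x \<in> carrier M. N +>\<^bsub>M\<^esub> x \<in> Y} R M" "N \<subseteq> {x \<in> carrier M. N +>\<^bsub>M\<^esub> x \<in> Y}"
proof -
  interpret Q: lmodule R "quotient_module M N" by (rule quotient_lmodule[OF N])
  have zero: "N +>\<^bsub>M\<^esub> x = N" if "x \<in> N" for x
    using coset_eq_zero_iff[OF N] that submoduleE'(1)[OF N] by auto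
  have "N \<in> Y" using Q.submoduleE'(2)[OF Y] by simp
  then show "N \<subseteq> {x \<in> carrier M. N +>\<^bsub>M\<^esub> x \<in> Y}" using zero submoduleE'(1)[OF N] by auto
  show "submodule {x \<in> carrier M. N +>\<^bsub>M\<^esub> x \<in> Y} R M"
  proof (rule submoduleI')
    fix x assume x: "x \<in> {x \<in> carrier M. N +>\<^bsub>M\<^esub> x \<in> Y}"
    then show "\<ominus>\<^bsub>M\<^esub> x \<in> {x \<in> carrier M. N +>\<^bsub>M\<^esub> x \<in> Y}"
      using Q.submoduleE'(3)[OF Y, of "N +>\<^bsub>M\<^esub> x"] by (simp add: quotient_a_inv[OF N])
    fix y assume "y \<in> {x \<in> carrier M. N +>\<^bsub>M\<^esub> x \<in> Y}"
    with x show "x \<oplus>\<^bsub>M\<^esub> y \<in> {x \<in> carrier M. N +>\<^bsub>M\<^esub> x \<in> Y}"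
      using Q.submoduleE'(4)[OF Y, of "N +>\<^bsub>M\<^esub> x" "N +>\<^bsub>M\<^esub> y"] by (simp add: quotient_add[OF N])
  next
    fix a x assume "a \<in> carrier R" "x \<in> {x \<in> carrier M. N +>\<^bsub>M\<^esub> x \<in> Y}"
    then show "a \<odot>\<^bsub>M\<^esub> x \<in> {x \<in> carrier M. N +>\<^bsub>M\<^esub> x \<in> Y}"
      using Q.submoduleE'(5)[OF Y, of a "N +>\<^bsub>M\<^esub> x"] by (simp add: quotient_smult[OF N])
  qed (use zero[OF submoduleE'(2)[OF N]] \<open>N \<in> Y\<close> in auto)
qed

lemma submodule_image:
  assumes N: "submodule N R M" and N': "submodule N' R M"
  shows "submodule ((+>\<^bsub>M\<^esub>) N ` N') R (quotient_module M N)"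
proof -
  interpret Q: lmodule R "quotient_module M N" by (rule quotient_lmodule[OF N])
  note sub = submoduleE'(1)[OF N', THEN subsetD]
  show ?thesis
  proof (rule Q.submoduleI')
    have "N +>\<^bsub>M\<^esub> \<zero>\<^bsub>M\<^esub> = N" using coset_eq_zero_iff[OF N] submoduleE'(2)[OF N] by simp
    then show "\<zero>\<^bsub>quotient_module M N\<^esub> \<in> (+>\<^bsub>M\<^esub>) N ` N'"
      using submoduleE'(2)[OF N'] by (auto intro!: image_eqI[of _ _ "\<zero>\<^bsub>M\<^esub>"])
  qed (use sub submoduleE'(3-5)[OF N'] in
      \<open>auto simp: quotient_carrier quotient_add[OF N] quotient_smult[OF N] quotient_a_inv[OF N]\<close>)
qed

text \<open>If N has a simple quotient, then N is proper and so lies in K. The image of K in that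
  quotient is zero, which gives N = K, or everything, which would make K the whole module.\<close>

lemma the_simple_quotient_eq:
  assumes K: "submodule K R M" "K \<noteq> carrier M"
    and max: "\<And>N. submodule N R M \<Longrightarrow> N = carrier M \<or> N \<subseteq> K"
  shows "the_simple_quotient R M = quotient_module M K"
proof -
  have simple: "simple_module R (quotient_module M K)"
    unfolding simple_module_def
  proof (intro conjI allI impI)
    show "carrier (quotient_module M K) \<noteq> {\<zero>\<^bsub>quotient_module M K\<^esub>}"
    proof
      assume "carrier (quotient_module M K) = {\<zero>\<^bsub>quotient_module M K\<^esub>}"
      then have "K +>\<^bsub>M\<^esub> x = K" if "x \<in> carrier M" for x using that by (auto simp: quotient_carrier)
      then show False using coset_eq_zero_iff[OF K(1)] K(2) submoduleE'(1)[OF K(1)] by auto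
    qed
  next
    fix Y assume Y: "submodule Y R (quotient_module M K)"
    interpret Q: lmodule R "quotient_module M K" by (rule quotient_lmodule[OF K(1)])
    let ?N = "{x \<in> carrier M. K +>\<^bsub>M\<^esub> x \<in> Y}"
    have YQ: "Y \<subseteq> (+>\<^bsub>M\<^esub>) K ` carrier M" using Q.submoduleE'(1)[OF Y] by (simp add: quotient_carrier)
    consider "?N = carrier M" | "?N \<subseteq> K" using max[OF submodule_preimage(1)[OF K(1) Y]] by blast
    then show "Y = {\<zero>\<^bsub>quotient_module M K\<^esub>} \<or> Y = carrier (quotient_module M K)"
    proof cases
      case 1
      then show ?thesis using YQ by (auto simp: quotient_carrier)
    next
      case 2
      have "K \<in> Y" using Q.submoduleE'(2)[OF Y] by simp
      moreover have "y = K" if "y \<in> Y" for y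
      proof -
        obtain x where x: "x \<in> carrier M" "y = K +>\<^bsub>M\<^esub> x" using YQ \<open>y \<in> Y\<close> by blast
        then have "x \<in> K" using 2 \<open>y \<in> Y\<close> by blast
        then show ?thesis using coset_eq_zero_iff[OF K(1)] x by blast
      qed
      ultimately have "Y = {K}" by blast
      then show ?thesis by simp
    qed
  qed
  have "(THE N. submodule N R M \<and> simple_module R (quotient_module M N)) = K"
  proof (rule the_equality)
    fix N assume "submodule N R M \<and> simple_module R (quotient_module M N)"
    then have N: "submodule N R M" and sN: "simple_module R (quotient_module M N)" by auto
    have "N \<noteq> carrier M"
    proof
      assume "N = carrier M"
      then have "carrier (quotient_module M N) = {N}"
        using coset_eq_zero_iff[OF N] M.zero_closed by (auto simp: quotient_carrier)
      then show False using sN by (simp add: simple_module_def)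
    qed
    then have NK: "N \<subseteq> K" using max[OF N] by blast
    have "(+>\<^bsub>M\<^esub>) N ` K = {N} \<or> (+>\<^bsub>M\<^esub>) N ` K = carrier (quotient_module M N)"
      using sN submodule_image[OF N K(1)] by (simp add: simple_module_def)
    then show "N = K"
    proof
      assume "(+>\<^bsub>M\<^esub>) N ` K = {N}"
      then have "x \<in> N" if "x \<in> K" for x
        using that coset_eq_zero_iff[OF N, of x] submoduleE'(1)[OF K(1)] by blast
      then show "N = K" using NK by blast
    next
      assume img: "(+>\<^bsub>M\<^esub>) N ` K = carrier (quotient_module M N)"
      have "x \<in> K" if x: "x \<in> carrier M" for x
      proof -
        have "N +>\<^bsub>M\<^esub> x \<in> (+>\<^bsub>M\<^esub>) N ` K" using x by (simp add: img quotient_carrier)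
        then obtain y where y: "y \<in> K" "N +>\<^bsub>M\<^esub> x = N +>\<^bsub>M\<^esub> y" by blast
        then have yM: "y \<in> carrier M" using submoduleE'(1)[OF K(1)] by blast
        have "x \<oplus>\<^bsub>M\<^esub> \<ominus>\<^bsub>M\<^esub> y \<in> K" using coset_eq_iff[OF N x yM] y NK by blast
        then have "x \<oplus>\<^bsub>M\<^esub> \<ominus>\<^bsub>M\<^esub> y \<oplus>\<^bsub>M\<^esub> y \<in> K" using y submoduleE'(4)[OF K(1)] by blast
        then show ?thesis using x yM by (simp add: M.a_assoc M.l_neg)
      qed
      then show "N = K" using K(2) submoduleE'(1)[OF K(1)] by blast
    qed
  qed (use K(1) simple in blast)
  then show ?thesis by (simp add: the_simple_quotient_def)
qed

end

context ring
begin

lemma regular_simps [simp]: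
  "carrier (regular_module R) = carrier R" "\<zero>\<^bsub>regular_module R\<^esub> = \<zero>"
  "ring.add (regular_module R) = ring.add R" "module.smult (regular_module R) = monoid.mult R"
  by (simp_all add: regular_module_def)

lemma regular_lmodule: "lmodule R (regular_module R)"
proof -
  have "abelian_group (regular_module R)"
  proof (rule abelian_groupI)
    fix x assume "x \<in> carrier (regular_module R)"
    then show "\<exists>y\<in>carrier (regular_module R). y \<oplus>\<^bsub>regular_module R\<^esub> x = \<zero>\<^bsub>regular_module R\<^esub>"
      by (intro bexI[of _ "\<ominus> x"]) (simp_all add: l_neg)
  qed (auto simp: a_assoc intro: a_comm)
  then show ?thesis
    by (intro lmodule.intro lmodule_axioms.intro ring_axioms) (auto simp: r_distr)
qed

lemma regular_a_inv: "x \<in> carrier R \<Longrightarrow> \<ominus>\<^bsub>regular_module R\<^esub> x = \<ominus> x"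
proof -
  interpret M: lmodule R "regular_module R" by (rule regular_lmodule)
  show "x \<in> carrier R \<Longrightarrow> \<ominus>\<^bsub>regular_module R\<^esub> x = \<ominus> x"
    by (rule M.M.minus_equality) (auto simp: l_neg)
qed

lemma left_idealI:
  assumes "N \<subseteq> carrier R" "\<zero> \<in> N" "\<And>x y. x \<in> N \<Longrightarrow> y \<in> N \<Longrightarrow> x \<oplus> y \<in> N"
    "\<And>a x. a \<in> carrier R \<Longrightarrow> x \<in> N \<Longrightarrow> a \<otimes> x \<in> N"
  shows "left_ideal N R"
proof -
  interpret M: lmodule R "regular_module R" by (rule regular_lmodule)
  have "\<ominus> x \<in> N" if "x \<in> N" for x
    using assms(4)[of "\<ominus> \<one>" x] that assms(1) by (auto simp: l_minus)
  then show ?thesis unfolding left_ideal_def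
    using assms by (intro M.submoduleI') (auto simp: regular_a_inv)
qed

lemma left_idealE:
  assumes "left_ideal N R"
  shows "N \<subseteq> carrier R" "\<zero> \<in> N" "\<And>x y. x \<in> N \<Longrightarrow> y \<in> N \<Longrightarrow> x \<oplus> y \<in> N"
    "\<And>a x. a \<in> carrier R \<Longrightarrow> x \<in> N \<Longrightarrow> a \<otimes> x \<in> N"
proof -
  interpret M: lmodule R "regular_module R" by (rule regular_lmodule)
  show "N \<subseteq> carrier R" "\<zero> \<in> N" "\<And>x y. x \<in> N \<Longrightarrow> y \<in> N \<Longrightarrow> x \<oplus> y \<in> N"
    "\<And>a x. a \<in> carrier R \<Longrightarrow> x \<in> N \<Longrightarrow> a \<otimes> x \<in> N"
    using M.submoduleE'[OF assms[unfolded left_ideal_def]] by auto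
qed

lemma left_ideal_generated_left_ideal:
  assumes "S \<subseteq> carrier R"
  shows "left_ideal (left_ideal_generated R S) R" "S \<subseteq> left_ideal_generated R S"
proof -
  have c: "left_ideal (carrier R) R" by (rule left_idealI) auto
  show "left_ideal (left_ideal_generated R S) R"
  proof (rule left_idealI)
    show "left_ideal_generated R S \<subseteq> carrier R" using c assms by (auto simp: left_ideal_generated_def)
  qed (use left_idealE in \<open>auto simp: left_ideal_generated_def\<close>)
  show "S \<subseteq> left_ideal_generated R S" by (auto simp: left_ideal_generated_def)
qed

text \<open>The simple quotient of R/I is R/N, written as a quotient of a quotient. An element b
  annihilates it exactly when b R lies in N.\<close>

lemma annihilator_the_simple_quotient:
  assumes I: "left_ideal I R" and N: "left_ideal N R" "I \<subseteq> N" "N \<noteq> carrier R"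
    and max: "\<And>N'. left_ideal N' R \<Longrightarrow> I \<subseteq> N' \<Longrightarrow> N' = carrier R \<or> N' \<subseteq> N"
  shows "annihilator R (the_simple_quotient R (quotient_module (regular_module R) I)) =
    {b \<in> carrier R. \<forall>c\<in>carrier R. b \<otimes> c \<in> N}"
proof -
  let ?P = "regular_module R"
  let ?M = "quotient_module ?P I"
  interpret P: lmodule R ?P by (rule regular_lmodule)
  have IP: "submodule I R ?P" and NP: "submodule N R ?P" using I N by (simp_all add: left_ideal_def)
  interpret M: lmodule R ?M by (rule P.quotient_lmodule[OF IP])
  let ?K = "(+>\<^bsub>?P\<^esub>) I ` N"
  have K: "submodule ?K R ?M" by (rule P.submodule_image[OF IP NP])
  have mem_K: "I +>\<^bsub>?P\<^esub> x \<in> ?K \<longleftrightarrow> x \<in> N" if x: "x \<in> carrier R" for x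
  proof
    \<comment> \<open>Membership in the image of N does not depend on the representative, because I
      is contained in N.\<close>
    assume "I +>\<^bsub>?P\<^esub> x \<in> ?K"
    then obtain y where y: "y \<in> N" "I +>\<^bsub>?P\<^esub> x = I +>\<^bsub>?P\<^esub> y" by blast
    then have yR: "y \<in> carrier R" using left_idealE(1)[OF N(1)] by blast
    have "x \<oplus> \<ominus> y \<in> N" using P.coset_eq_iff[OF IP, of x y] x y yR N(2) by (auto simp: regular_a_inv)
    then have "x \<oplus> \<ominus> y \<oplus> y \<in> N" using y left_idealE(3)[OF N(1)] by blast
    then show "x \<in> N" using x yR by (simp add: a_assoc l_neg)
  qed blast
  have the: "the_simple_quotient R ?M = quotient_module ?M ?K"
  proof (rule M.the_simple_quotient_eq[OF K])
    show "?K \<noteq> carrier ?M"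
      using mem_K N(3) left_idealE(1)[OF N(1)] by (auto simp: P.quotient_carrier)
  next
    fix Y assume Y: "submodule Y R ?M"
    let ?N' = "{x \<in> carrier ?P. I +>\<^bsub>?P\<^esub> x \<in> Y}"
    have YM: "Y \<subseteq> (+>\<^bsub>?P\<^esub>) I ` carrier R" using M.submoduleE'(1)[OF Y] by (simp add: P.quotient_carrier)
    consider "?N' = carrier R" | "?N' \<subseteq> N"
      using max[of ?N'] P.submodule_preimage[OF IP Y] by (auto simp: left_ideal_def)
    then show "Y = carrier ?M \<or> Y \<subseteq> ?K"
    proof cases
      case 1
      then show ?thesis using YM by (auto simp: P.quotient_carrier)
    next
      case 2
      then show ?thesis using YM by auto
    qed
  qed
  have "b \<odot>\<^bsub>quotient_module ?M ?K\<^esub> (?K +>\<^bsub>?M\<^esub> (I +>\<^bsub>?P\<^esub> c)) = ?K \<longleftrightarrow> b \<otimes> c \<in> N"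
    if "b \<in> carrier R" "c \<in> carrier R" for b c
  proof -
    have cM: "I +>\<^bsub>?P\<^esub> c \<in> carrier ?M" "I +>\<^bsub>?P\<^esub> (b \<otimes> c) \<in> carrier ?M"
      using that by (auto simp: P.quotient_carrier)
    then have "b \<odot>\<^bsub>quotient_module ?M ?K\<^esub> (?K +>\<^bsub>?M\<^esub> (I +>\<^bsub>?P\<^esub> c)) = ?K +>\<^bsub>?M\<^esub> (I +>\<^bsub>?P\<^esub> (b \<otimes> c))"
      using that P.quotient_smult[OF IP, of b c] M.quotient_smult[OF K, of b] by simp
    then show ?thesis using M.coset_eq_zero_iff[OF K cM(2)] mem_K[of "b \<otimes> c"] that by simp
  qed
  note smult = this
  have carr: "carrier (quotient_module ?M ?K) = (\<lambda>c. ?K +>\<^bsub>?M\<^esub> (I +>\<^bsub>?P\<^esub> c)) ` carrier R"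
    by (simp add: M.quotient_carrier P.quotient_carrier image_image)
  have "(\<forall>x\<in>carrier (quotient_module ?M ?K). b \<odot>\<^bsub>quotient_module ?M ?K\<^esub> x = \<zero>\<^bsub>quotient_module ?M ?K\<^esub>) \<longleftrightarrow>
      (\<forall>c\<in>carrier R. b \<otimes> c \<in> N)" if b: "b \<in> carrier R" for b
    unfolding carr M.quotient_simps by (simp only: ball_simps smult[OF b] cong: ball_cong)
  then show ?thesis unfolding the annihilator_def by blast
qed

end

section \<open>The primitive quotient as a ring of operators\<close>

lemma (in ring) idealI':
  assumes "K \<subseteq> carrier R" "\<zero> \<in> K" "\<And>x y. x \<in> K \<Longrightarrow> y \<in> K \<Longrightarrow> x \<oplus> y \<in> K"
    "\<And>a x. a \<in> carrier R \<Longrightarrow> x \<in> K \<Longrightarrow> a \<otimes> x \<in> K"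
    "\<And>a x. a \<in> carrier R \<Longrightarrow> x \<in> K \<Longrightarrow> x \<otimes> a \<in> K"
  shows "ideal K R"
proof (rule idealI[OF ring_axioms])
  have "\<ominus> x \<in> K" if "x \<in> K" for x
    using assms(4)[of "\<ominus> \<one>" x] that assms(1) by (auto simp: l_minus)
  then show "subgroup K (add_monoid R)"
    using assms by (intro add.subgroupI) auto
qed (use assms in auto)

context typed_point
begin

abbreviation "W \<equiv> (weyl r s :: 'k free_alg set ring)"
abbreviation "AG \<equiv> weyl_invariants r s g"
definition \<chi> :: "(nat \<Rightarrow> 'k) \<Rightarrow> 'k" where "\<chi> = eta_comb g {1..r+s} (of_rat_vec \<alpha>)"
abbreviation "CI \<equiv> character_ideal r s g \<chi>"
abbreviation "B \<equiv> Bring r s g \<chi>"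
abbreviation "\<alpha>' \<equiv> (of_rat_vec \<alpha> :: nat \<Rightarrow> 'k)"

text \<open>The residue maps \<open>cl\<close>, \<open>h\<close> and \<open>k\<close> lead from
  representatives to the Weyl algebra, to B^\<chi>, and to B^\<chi> modulo J(\<alpha>). Statements
  about these rings are pulled back along them.\<close>

definition cl :: "'k free_alg \<Rightarrow> 'k free_alg set" where
  "cl p = I +>\<^bsub>F\<^esub> p"

lemma W_ring: "ring W"
  unfolding weyl_def by (rule I.quotient_is_ring)

sublocale W: ring W by (rule W_ring)

lemma cl_hom: "cl \<in> ring_hom F W"
  unfolding weyl_def cl_def[abs_def] by (rule I.rcos_ring_hom)

lemma cl_mult: "p \<in> A \<Longrightarrow> q \<in> A \<Longrightarrow> cl (p * q) = cl p \<otimes>\<^bsub>W\<^esub> cl q"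
  using ring_hom_mult[OF cl_hom] by simp

lemma cl_add: "p \<in> A \<Longrightarrow> q \<in> A \<Longrightarrow> cl (p + q) = cl p \<oplus>\<^bsub>W\<^esub> cl q"
  using ring_hom_add[OF cl_hom] by simp

lemma cl_1: "cl 1 = \<one>\<^bsub>W\<^esub>"
  using ring_hom_one[OF cl_hom] by simp

lemma cl_closed: "p \<in> A \<Longrightarrow> cl p \<in> carrier W"
  using ring_hom_closed[OF cl_hom] by simp

lemma cl_0: "cl 0 = \<zero>\<^bsub>W\<^esub>"
proof -
  have "cl 0 \<oplus>\<^bsub>W\<^esub> cl 0 = cl 0" using cl_add[OF A_0 A_0] by simp
  then show ?thesis using cl_closed[OF A_0] by (metis W.add.r_cancel_one)
qed

lemma cl_uminus: "p \<in> A \<Longrightarrow> cl (- p) = \<ominus>\<^bsub>W\<^esub> cl p"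
  using cl_add[of "- p" p] by (intro W.minus_equality[symmetric]) (auto simp: A_uminus cl_0 cl_closed)

lemma cl_diff: "p \<in> A \<Longrightarrow> q \<in> A \<Longrightarrow> cl (p - q) = cl p \<ominus>\<^bsub>W\<^esub> cl q"
  using cl_add[of p "- q"] by (simp add: A_uminus cl_uminus a_minus_def)

lemma cl_eq_0_iff: "p \<in> A \<Longrightarrow> cl p = \<zero>\<^bsub>W\<^esub> \<longleftrightarrow> p \<in> I"
proof -
  assume p: "p \<in> A"
  have "\<zero>\<^bsub>W\<^esub> = I" by (simp add: weyl_def FactRing_def)
  then show ?thesis using p I.a_rcos_self[of p] I.a_rcos_const[of p] by (auto simp: cl_def)
qed

lemma cl_eq_iff: "p \<in> A \<Longrightarrow> q \<in> A \<Longrightarrow> cl p = cl q \<longleftrightarrow> p \<approx> q"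
proof -
  assume pq: "p \<in> A" "q \<in> A"
  have "cl p = cl q \<longleftrightarrow> cl (p - q) = \<zero>\<^bsub>W\<^esub>"
    using pq cl_closed by (auto simp: cl_diff W.r_right_minus_eq)
  then show ?thesis using pq by (simp add: cl_eq_0_iff A_diff weq_def)
qed

lemma carrier_W: "carrier W = cl ` A"
  by (auto simp: weyl_def FactRing_def A_RCOSETS_def' cl_def a_r_coset_def')

lemma torus_eq: "torus r s t = cl (tor (r+s) t)"
  by (simp add: torus_def cl_def tor_def)

lemma weyl_const_eq: "weyl_const r s c = cl (fconst c)"
  by (simp add: weyl_const_def cl_def)

lemma AG_simps [simp]:
  "monoid.mult AG = monoid.mult W" "ring.add AG = ring.add W" "\<one>\<^bsub>AG\<^esub> = \<one>\<^bsub>W\<^esub>" "\<zero>\<^bsub>AG\<^esub> = \<zero>\<^bsub>W\<^esub>"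
  by (simp_all add: weyl_invariants_def)

lemma G_A: "p \<in> G \<Longrightarrow> p \<in> A"
  by (rule homogeneous_A)

text \<open>Every invariant has a representative whose words have weight zero. Conversely the lifted
  commutator annihilates such words.\<close>

lemma carrier_AG: "carrier AG = cl ` G"
proof
  show "carrier AG \<subseteq> cl ` G"
  proof
    fix a assume a: "a \<in> carrier AG"
    then obtain p where p: "p \<in> A" "a = cl p" by (auto simp: weyl_invariants_def carrier_W)
    have "tor (r+s) t * p - p * tor (r+s) t \<in> I" if "t \<in> g" for t
    proof -
      have "torus r s t \<otimes>\<^bsub>W\<^esub> a \<ominus>\<^bsub>W\<^esub> a \<otimes>\<^bsub>W\<^esub> torus r s t = \<zero>\<^bsub>W\<^esub>"
        using a that by (simp add: weyl_invariants_def)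
      then have "cl (tor (r+s) t * p - p * tor (r+s) t) = \<zero>\<^bsub>W\<^esub>"
        using p by (simp add: torus_eq cl_diff cl_mult A_mult A_tor)
      then show ?thesis using p by (simp add: cl_eq_0_iff A_diff A_mult A_tor)
    qed
    then obtain q where "q \<in> G" "p \<approx> q" using invariant_homogeneous[OF p(1)] by blast
    then show "a \<in> cl ` G" using p G_A cl_eq_iff by blast
  qed
  show "cl ` G \<subseteq> carrier AG"
  proof safe
    fix p assume p: "p \<in> G"
    have "torus r s t \<otimes>\<^bsub>W\<^esub> cl p \<ominus>\<^bsub>W\<^esub> cl p \<otimes>\<^bsub>W\<^esub> torus r s t = \<zero>\<^bsub>W\<^esub>" if "t \<in> g" for t
    proof -
      have "weight_derivation t p = 0"
        using p that by (intro poly_mapping_eqI) (auto simp: lookup_weight_derivation homogeneous_part_def in_keys_iff)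
      then have "tor (r+s) t * p - p * tor (r+s) t \<in> I"
        using tor_commutator[OF G_A[OF p], of t] by (simp add: weq_def)
      then show ?thesis using G_A[OF p]
        by (simp add: torus_eq cl_diff[symmetric] cl_mult[symmetric] A_mult A_tor cl_eq_0_iff A_diff)
    qed
    then show "cl p \<in> carrier AG" using cl_closed[OF G_A[OF p]] by (simp add: weyl_invariants_def)
  qed
qed

lemma AG_ring: "ring AG"
proof -
  have "subring (cl ` G) W"
  proof (rule W.subringI)
    show "cl ` G \<subseteq> carrier W" using G_A cl_closed by blast
    show "\<one>\<^bsub>W\<^esub> \<in> cl ` G" using cl_1 homogeneous_1 by (metis imageI)
    show "\<ominus>\<^bsub>W\<^esub> x \<in> cl ` G" if "x \<in> cl ` G" for x
      using that by (auto simp: cl_uminus[symmetric] G_A intro: homogeneous_uminus)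
    show "x \<otimes>\<^bsub>W\<^esub> y \<in> cl ` G" if "x \<in> cl ` G" "y \<in> cl ` G" for x y
      using that by (auto simp: cl_mult[symmetric] G_A intro: homogeneous_mult)
    show "x \<oplus>\<^bsub>W\<^esub> y \<in> cl ` G" if "x \<in> cl ` G" "y \<in> cl ` G" for x y
      using that by (auto simp: cl_add[symmetric] G_A intro: homogeneous_add)
  qed
  then have "ring (W\<lparr>carrier := cl ` G\<rparr>)" by (rule W.subring_is_ring)
  moreover have "AG = W\<lparr>carrier := cl ` G\<rparr>"
    using carrier_AG by (simp add: weyl_invariants_def)
  ultimately show ?thesis by simp
qed

sublocale AG: ring AG by (rule AG_ring)

abbreviation "character_gens \<equiv> {torus r s t \<ominus>\<^bsub>W\<^esub> weyl_const r s (\<chi> t) | t. t \<in> g}"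

lemma character_gen_eq: "torus r s t \<ominus>\<^bsub>W\<^esub> weyl_const r s c = cl (tor (r+s) t - fconst c)"
  by (simp add: torus_eq weyl_const_eq cl_diff A_tor A_fconst)

lemma character_gens_subset: "character_gens \<subseteq> carrier AG"
  unfolding character_gen_eq carrier_AG using homogeneous_tor homogeneous_fconst homogeneous_diff by blast

sublocale CI: ideal CI AG
  unfolding character_ideal_def by (rule AG.genideal_ideal[OF character_gens_subset])

definition h :: "'k free_alg \<Rightarrow> 'k free_alg set set" where
  "h p = CI +>\<^bsub>AG\<^esub> cl p"

lemma B_ring: "ring B"
  unfolding Bring_def by (rule CI.quotient_is_ring)

sublocale B: ring B by (rule B_ring)

lemma CI_hom: "(+>\<^bsub>AG\<^esub>) CI \<in> ring_hom AG B"
  unfolding Bring_def by (rule CI.rcos_ring_hom)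

lemma cl_G: "p \<in> G \<Longrightarrow> cl p \<in> carrier AG"
  by (simp add: carrier_AG)

lemma h_mult: "p \<in> G \<Longrightarrow> q \<in> G \<Longrightarrow> h (p * q) = h p \<otimes>\<^bsub>B\<^esub> h q"
  using ring_hom_mult[OF CI_hom, of "cl p" "cl q"] by (simp add: h_def cl_G cl_mult G_A)

lemma h_add: "p \<in> G \<Longrightarrow> q \<in> G \<Longrightarrow> h (p + q) = h p \<oplus>\<^bsub>B\<^esub> h q"
  using ring_hom_add[OF CI_hom, of "cl p" "cl q"] by (simp add: h_def cl_G cl_add G_A)

lemma h_1: "h 1 = \<one>\<^bsub>B\<^esub>"
  using ring_hom_one[OF CI_hom] by (simp add: h_def cl_1)

lemma carrier_B: "carrier B = h ` G"
  by (auto simp: Bring_def FactRing_def A_RCOSETS_def' h_def a_r_coset_def' carrier_AG)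

lemma h_closed: "p \<in> G \<Longrightarrow> h p \<in> carrier B"
  by (simp add: carrier_B)

lemma h_0: "h 0 = \<zero>\<^bsub>B\<^esub>"
proof -
  have "h 0 \<oplus>\<^bsub>B\<^esub> h 0 = h 0" using h_add[OF homogeneous_0 homogeneous_0] by simp
  then show ?thesis using h_closed[OF homogeneous_0] by (metis B.add.r_cancel_one)
qed

lemma h_uminus: "p \<in> G \<Longrightarrow> h (- p) = \<ominus>\<^bsub>B\<^esub> h p"
  using h_add[of "- p" p] by (intro B.minus_equality[symmetric]) (auto simp: homogeneous_uminus h_0 h_closed)

lemma h_diff: "p \<in> G \<Longrightarrow> q \<in> G \<Longrightarrow> h (p - q) = h p \<ominus>\<^bsub>B\<^esub> h q"
  using h_add[of p "- q"] by (simp add: homogeneous_uminus h_uminus a_minus_def)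

lemma h_weq: "p \<in> G \<Longrightarrow> q \<in> G \<Longrightarrow> p \<approx> q \<Longrightarrow> h p = h q"
  using cl_eq_iff[of p q] G_A by (simp add: h_def)

lemma rho_scale_right: "rho p (\<lambda>\<gamma>. c * f \<gamma>) = (\<lambda>\<gamma>. c * rho p f \<gamma>)"
  by (auto simp: rho_def act_scale_right)

lemma kills_mult_left: "p \<in> G \<Longrightarrow> q \<in> G \<Longrightarrow> kills q \<Longrightarrow> kills (p * q)"
  by (simp add: kills_def rho_mult rho_0_right)

lemma kills_mult_right: "p \<in> G \<Longrightarrow> q \<in> G \<Longrightarrow> kills p \<Longrightarrow> kills (p * q)"
  by (simp add: kills_def rho_mult supported_rho)

lemma kills_add: "kills p \<Longrightarrow> kills q \<Longrightarrow> kills (p + q)"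
  by (simp add: kills_def rho_add)

lemma kills_0: "kills 0"
  by (simp add: kills_def rho_0)

lemma kills_weq: "p \<approx> q \<Longrightarrow> kills p \<longleftrightarrow> kills q"
  by (simp add: kills_def rho_weq[of p q])

lemma S_pairing:
  assumes "\<gamma> \<in> S" "t \<in> g"
  shows "(\<Sum>i\<in>{1..r+s}. t i * of_rat (\<gamma> i)) = \<chi> t"
proof -
  have "\<gamma> - \<alpha> \<in> E" using assms by (simp add: S_def)
  then have "(\<Sum>i\<in>{1..r+s}. of_rat ((\<gamma> - \<alpha>) i) * t i) = 0" using assms(2) mem_E_iff by blast
  moreover have "(\<Sum>i\<in>{1..r+s}. of_rat ((\<gamma> - \<alpha>) i) * t i) =
      (\<Sum>i\<in>{1..r+s}. t i * of_rat (\<gamma> i)) - (\<Sum>i\<in>{1..r+s}. of_rat (\<alpha> i) * t i)"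
    unfolding sum_subtractf[symmetric] by (rule sum.cong) (simp_all add: of_rat_diff algebra_simps)
  ultimately show ?thesis using assms(2) by (simp add: \<chi>_def eta_comb_apply of_rat_vec_def)
qed

text \<open>Weights in \<open>S\<close> differ from \<alpha> by elements of E, so t acts on all of
  them by the scalar \<chi>(t). Since the elements acting as zero form an ideal, it suffices to look
  at the generators t - \<chi>(t).\<close>

lemma CI_kills:
  assumes "p \<in> G" "cl p \<in> CI" shows "kills p"
proof -
  let ?K = "cl ` {p \<in> G. kills p}"
  have "ideal ?K AG"
  proof (rule AG.idealI')
    show "?K \<subseteq> carrier AG" by (auto simp: carrier_AG)
    show "\<zero>\<^bsub>AG\<^esub> \<in> ?K" using homogeneous_0 kills_0 cl_0 by (auto intro!: image_eqI[of _ _ 0])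
    show "x \<oplus>\<^bsub>AG\<^esub> y \<in> ?K" if "x \<in> ?K" "y \<in> ?K" for x y
      using that by (auto simp: cl_add[symmetric] G_A intro!: imageI homogeneous_add kills_add)
    fix a x assume "a \<in> carrier AG" "x \<in> ?K"
    then obtain p q where pq: "p \<in> G" "a = cl p" "q \<in> G" "kills q" "x = cl q" by (auto simp: carrier_AG)
    show "a \<otimes>\<^bsub>AG\<^esub> x \<in> ?K" using pq kills_mult_left[OF pq(1,3,4)]
      by (auto simp: cl_mult[symmetric] G_A intro!: imageI homogeneous_mult)
    show "x \<otimes>\<^bsub>AG\<^esub> a \<in> ?K" using pq kills_mult_right[OF pq(3,1,4)]
      by (auto simp: cl_mult[symmetric] G_A intro!: imageI homogeneous_mult)
  qed
  moreover have "character_gens \<subseteq> ?K"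
  proof safe
    fix t assume t: "t \<in> g"
    have "rho (tor (r+s) t - fconst (\<chi> t)) f = 0" if "supported f S" for f
    proof
      fix \<gamma>
      show "rho (tor (r+s) t - fconst (\<chi> t)) f \<gamma> = 0 \<gamma>"
        using S_pairing[OF _ t, of \<gamma>] by (simp add: rho_def act_diff act_tor act_fconst)
    qed
    then have "kills (tor (r+s) t - fconst (\<chi> t))" by (simp add: kills_def)
    then show "torus r s t \<ominus>\<^bsub>W\<^esub> weyl_const r s (\<chi> t) \<in> ?K"
      unfolding character_gen_eq by (intro imageI) (simp add: homogeneous_diff homogeneous_tor homogeneous_fconst)
  qed
  ultimately have "CI \<subseteq> ?K" unfolding character_ideal_def by (rule AG.genideal_minimal)
  then obtain q where "q \<in> G" "kills q" "cl p = cl q" using assms by blast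
  then show ?thesis using assms cl_eq_iff G_A kills_weq by blast
qed

lemma h_eq_0_kills:
  assumes "p \<in> G" "h p = \<zero>\<^bsub>B\<^esub>" shows "kills p"
proof -
  have "\<zero>\<^bsub>B\<^esub> = CI" by (simp add: Bring_def FactRing_def)
  then have "cl p \<in> CI" using assms CI.a_rcos_self[OF cl_G[OF assms(1)]] by (simp add: h_def)
  then show ?thesis using CI_kills assms(1) by blast
qed

lemma h_eq_kills:
  assumes "p \<in> G" "q \<in> G" "h p = h q" shows "kills (p - q)"
proof (rule h_eq_0_kills)
  show "h (p - q) = \<zero>\<^bsub>B\<^esub>"
    using assms h_closed[of q] by (simp add: h_diff B.r_right_minus_eq)
qed (use assms in \<open>simp add: homogeneous_diff\<close>)

lemma h_eq_rho:
  assumes "p \<in> G" "q \<in> G" "h p = h q" "supported f S" shows "rho p f = rho q f"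
  using h_eq_kills[OF assms(1-3)] assms(4) by (simp add: kills_def rho_diff)

subsection \<open>The maximal submodule\<close>

abbreviation "Sy \<equiv> (sym_torus r s :: 'k free_alg set ring)"
abbreviation "point_gens \<equiv> {torus r s t \<ominus>\<^bsub>W\<^esub> weyl_const r s (\<Sum>i\<in>{1..r+s}. \<alpha>' i * t i) | t. t \<in> coord_space {1..r+s}}"

lemma Sy_simps [simp]:
  "monoid.mult Sy = monoid.mult W" "ring.add Sy = ring.add W" "\<one>\<^bsub>Sy\<^esub> = \<one>\<^bsub>W\<^esub>" "\<zero>\<^bsub>Sy\<^esub> = \<zero>\<^bsub>W\<^esub>"
  by (simp_all add: sym_torus_def)

abbreviation "Sy_gens \<equiv> range (weyl_const r s) \<union> torus r s ` coord_space {1..r+s}"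

lemma Sy_gens_subset: "Sy_gens \<subseteq> carrier W"
  by (auto simp: torus_eq weyl_const_eq intro!: cl_closed A_tor A_fconst)

lemma Sy_ring: "ring Sy"
  unfolding sym_torus_def by (rule W.generate_ring_is_ring[OF Sy_gens_subset])

sublocale Sy: ring Sy by (rule Sy_ring)

lemma carrier_Sy: "carrier Sy = generate_ring W Sy_gens"
  by (simp add: sym_torus_def)

text \<open>The delta function at \<alpha> is a common eigenvector of Sym(t). This makes the
  annihilator of that function in Sym(t) a two-sided ideal, as needed for the maximal ideal of
  \<alpha>.\<close>

lemma Sy_eigen:
  assumes "x \<in> carrier Sy"
  shows "\<exists>p\<in>G. x = cl p \<and> (\<exists>c. act p (delta \<alpha>) = (\<lambda>\<gamma>. c * delta \<alpha> \<gamma>))"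
  using assms unfolding carrier_Sy
proof (induction rule: generate_ring.induct)
  case one
  show ?case
    using act_fconst[of 1 "delta \<alpha>"] by (intro bexI[of _ 1] conjI exI[of _ 1]) (auto simp: cl_1 homogeneous_1 fconst_1)
next
  case (incl x)
  then show ?case
  proof
    assume "x \<in> range (weyl_const r s)"
    then obtain c where "x = cl (fconst c)" by (auto simp: weyl_const_eq)
    then show ?case by (intro bexI[of _ "fconst c"] conjI exI[of _ c]) (auto simp: act_fconst homogeneous_fconst)
  next
    assume "x \<in> torus r s ` coord_space {1..r+s}"
    then obtain t where "x = cl (tor (r+s) t)" by (auto simp: torus_eq)
    then show ?case
      by (intro bexI[of _ "tor (r+s) t"] conjI exI[of _ "\<Sum>i\<in>{1..r+s}. t i * of_rat (\<alpha> i)"])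
        (auto simp: act_tor homogeneous_tor delta_def)
  qed
next
  case (a_inv x)
  then obtain p c where "p \<in> G" "x = cl p" "act p (delta \<alpha>) = (\<lambda>\<gamma>. c * delta \<alpha> \<gamma>)" by blast
  then show ?case
    by (intro bexI[of _ "- p"] conjI exI[of _ "- c"]) (auto simp: cl_uminus G_A homogeneous_uminus act_uminus)
next
  case (eng_add x y)
  then obtain p c q d where "p \<in> G" "x = cl p" "act p (delta \<alpha>) = (\<lambda>\<gamma>. c * delta \<alpha> \<gamma>)"
    "q \<in> G" "y = cl q" "act q (delta \<alpha>) = (\<lambda>\<gamma>. d * delta \<alpha> \<gamma>)" by blast
  then show ?case
    by (intro bexI[of _ "p + q"] conjI exI[of _ "c + d"]) (auto simp: cl_add G_A homogeneous_add act_add distrib_right)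
next
  case (eng_mult x y)
  then obtain p c q d where pq: "p \<in> G" "x = cl p" "act p (delta \<alpha>) = (\<lambda>\<gamma>. c * delta \<alpha> \<gamma>)"
    "q \<in> G" "y = cl q" "act q (delta \<alpha>) = (\<lambda>\<gamma>. d * delta \<alpha> \<gamma>)" by blast
  have "act (p * q) (delta \<alpha>) = (\<lambda>\<gamma>. (d * c) * delta \<alpha> \<gamma>)"
  proof
    fix \<gamma>
    show "act (p * q) (delta \<alpha>) \<gamma> = (d * c) * delta \<alpha> \<gamma>"
      using act_scale_right[of p d "delta \<alpha>" \<gamma>] by (simp add: act_mult pq)
  qed
  then show ?case using pq
    by (intro bexI[of _ "p * q"] conjI exI[of _ "d * c"]) (auto simp: cl_mult G_A homogeneous_mult)
qed

lemma point_gens_eq: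
  "torus r s t \<ominus>\<^bsub>W\<^esub> weyl_const r s (\<Sum>i\<in>{1..r+s}. \<alpha>' i * t i) = cl (tor (r+s) t - fconst (\<Sum>i\<in>{1..r+s}. \<alpha>' i * t i))"
  by (rule character_gen_eq)

lemma Sy_const: "cl (fconst c) \<in> carrier Sy"
  unfolding carrier_Sy by (rule generate_ring.incl) (simp add: weyl_const_eq)

lemma Sy_torus: "t \<in> coord_space {1..r+s} \<Longrightarrow> cl (tor (r+s) t) \<in> carrier Sy"
  unfolding carrier_Sy by (rule generate_ring.incl) (simp add: torus_eq)

lemma Sy_add: "x \<in> carrier Sy \<Longrightarrow> y \<in> carrier Sy \<Longrightarrow> x \<oplus>\<^bsub>W\<^esub> y \<in> carrier Sy"
  using Sy.a_closed by simp

lemma Sy_mult: "x \<in> carrier Sy \<Longrightarrow> y \<in> carrier Sy \<Longrightarrow> x \<otimes>\<^bsub>W\<^esub> y \<in> carrier Sy"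
  using Sy.m_closed by simp

lemma point_gens_subset: "point_gens \<subseteq> carrier Sy"
proof safe
  fix t :: "nat \<Rightarrow> 'k" assume "t \<in> coord_space {1..r+s}"
  then have "cl (tor (r+s) t) \<oplus>\<^bsub>W\<^esub> cl (fconst (- c)) \<in> carrier Sy" for c
    by (intro Sy_add Sy_const Sy_torus)
  moreover have "cl (tor (r+s) t) \<oplus>\<^bsub>W\<^esub> cl (fconst (- c)) = cl (tor (r+s) t - fconst c)" for c
    by (simp add: cl_add[symmetric] A_tor A_fconst fconst_minus A_uminus)
  ultimately show "torus r s t \<ominus>\<^bsub>W\<^esub> weyl_const r s (\<Sum>i\<in>{1..r+s}. \<alpha>' i * t i) \<in> carrier Sy"
    unfolding point_gens_eq by simp
qed

sublocale PT: ideal "point_ideal r s \<alpha>'" Sy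
  unfolding point_ideal_def by (rule Sy.genideal_ideal[OF point_gens_subset])

lemma point_ideal_eigen:
  assumes "x \<in> point_ideal r s \<alpha>'"
  shows "\<exists>p\<in>G. x = cl p \<and> act p (delta \<alpha>) = 0"
proof -
  let ?K = "{x \<in> carrier Sy. \<exists>p\<in>G. x = cl p \<and> act p (delta \<alpha>) = 0}"
  have "ideal ?K Sy"
  proof (rule Sy.idealI')
    show "\<zero>\<^bsub>Sy\<^esub> \<in> ?K" using homogeneous_0 cl_0 act_0 Sy.zero_closed by auto
    show "x \<oplus>\<^bsub>Sy\<^esub> y \<in> ?K" if xy: "x \<in> ?K" "y \<in> ?K" for x y
    proof -
      obtain p q where pq: "p \<in> G" "x = cl p" "act p (delta \<alpha>) = 0" "q \<in> G" "y = cl q" "act q (delta \<alpha>) = 0"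
        using xy by blast
      have "act (p + q) (delta \<alpha>) = 0" by (simp only: act_add pq add_0)
      moreover have "x \<oplus>\<^bsub>Sy\<^esub> y = cl (p + q)" using cl_add[OF G_A G_A, OF pq(1,4)] by (simp only: pq Sy_simps)
      moreover have "x \<oplus>\<^bsub>Sy\<^esub> y \<in> carrier Sy" using xy by (intro Sy.a_closed) blast+
      ultimately show ?thesis using homogeneous_add[OF pq(1,4)] by blast
    qed
    fix a x assume a: "a \<in> carrier Sy" and x: "x \<in> ?K"
    obtain p where p: "p \<in> G" "x = cl p" "act p (delta \<alpha>) = 0" using x by blast
    obtain q c where q: "q \<in> G" "a = cl q" "act q (delta \<alpha>) = (\<lambda>\<gamma>. c * delta \<alpha> \<gamma>)" using Sy_eigen[OF a] by blast
    have "act (q * p) (delta \<alpha>) = 0" by (simp add: act_mult p act_0_right)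
    moreover have "act (p * q) (delta \<alpha>) = 0"
    proof
      fix \<gamma> show "act (p * q) (delta \<alpha>) \<gamma> = 0 \<gamma>"
        using act_scale_right[of p c "delta \<alpha>" \<gamma>] by (simp add: act_mult q p)
    qed
    moreover have "a \<otimes>\<^bsub>Sy\<^esub> x = cl (q * p)" "x \<otimes>\<^bsub>Sy\<^esub> a = cl (p * q)"
      using cl_mult[OF G_A G_A, OF q(1) p(1)] cl_mult[OF G_A G_A, OF p(1) q(1)] by (simp_all only: p q Sy_simps)
    moreover have "a \<otimes>\<^bsub>Sy\<^esub> x \<in> carrier Sy" "x \<otimes>\<^bsub>Sy\<^esub> a \<in> carrier Sy" using a x by (intro Sy.m_closed; blast)+
    ultimately show "a \<otimes>\<^bsub>Sy\<^esub> x \<in> ?K" "x \<otimes>\<^bsub>Sy\<^esub> a \<in> ?K"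
      using homogeneous_mult[OF p(1) q(1)] homogeneous_mult[OF q(1) p(1)] by blast+
  qed blast
  moreover have "point_gens \<subseteq> ?K"
  proof (intro subsetI CollectI conjI)
    fix x assume x: "x \<in> point_gens"
    then show "x \<in> carrier Sy" using point_gens_subset by blast
    obtain t where t: "x = cl (tor (r+s) t - fconst (\<Sum>i\<in>{1..r+s}. \<alpha>' i * t i))" using x point_gens_eq by blast
    have "act (tor (r+s) t - fconst (\<Sum>i\<in>{1..r+s}. \<alpha>' i * t i)) (delta \<alpha>) = 0"
      by (auto simp: act_diff act_tor act_fconst delta_def of_rat_vec_def mult.commute fun_eq_iff)
    then show "\<exists>p\<in>G. x = cl p \<and> act p (delta \<alpha>) = 0"
      using t homogeneous_diff[OF homogeneous_tor homogeneous_fconst] by blast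
  qed
  ultimately have "point_ideal r s \<alpha>' \<subseteq> ?K" unfolding point_ideal_def by (rule Sy.genideal_minimal)
  then show ?thesis using assms by blast
qed

text \<open>Sym(t) is the sum of the constants and the maximal ideal of \<alpha>. For products: p q
  - c d = p (q - d) + (p - c) d.\<close>

lemma sym_algebra_point:
  assumes "q \<in> sym_algebra"
  shows "cl q \<in> carrier Sy \<and> (\<exists>c. cl (q - fconst c) \<in> point_ideal r s \<alpha>')"
  using assms
proof (induction rule: sym_algebra.induct)
  case (sym_const c)
  show ?case using Sy_const PT.zero_closed cl_0 by (auto intro!: exI[of _ c])
next
  case (sym_pi i)
  define t :: "nat \<Rightarrow> 'k" where "t = (\<lambda>j. if j = i then 1 else 0)"
  have t: "t \<in> coord_space {1..r+s}" using sym_pi by (auto simp: t_def coord_space_def)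
  have "tor (r+s) t = (\<Sum>j\<in>{1..r+s}. if j = i then euler_op i else 0)"
    unfolding tor_eq by (rule sum.cong) (auto simp: t_def fconst_0 fconst_1)
  then have tor: "tor (r+s) t = euler_op i" using sym_pi by (simp del: atLeastAtMost_iff)
  have "torus r s t \<ominus>\<^bsub>W\<^esub> weyl_const r s (\<Sum>i\<in>{1..r+s}. \<alpha>' i * t i) \<in> point_ideal r s \<alpha>'"
    unfolding point_ideal_def by (rule subsetD[OF Sy.genideal_self[OF point_gens_subset]]) (use t in blast)
  then show ?case using Sy_torus[OF t] unfolding point_gens_eq tor by blast
next
  case (sym_add p q)
  then obtain c d where c: "cl (p - fconst c) \<in> point_ideal r s \<alpha>'" "cl (q - fconst d) \<in> point_ideal r s \<alpha>'" by blast
  have A: "p \<in> A" "q \<in> A" using sym_add sym_A by auto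
  have "cl (p - fconst c) \<oplus>\<^bsub>W\<^esub> cl (q - fconst d) = cl ((p + q) - fconst (c + d))"
    using A by (simp add: cl_add[symmetric] A_diff A_fconst fconst_add algebra_simps)
  then have "cl ((p + q) - fconst (c + d)) \<in> point_ideal r s \<alpha>'" using PT.a_closed[OF c] by simp
  moreover have "cl (p + q) \<in> carrier Sy" using sym_add A Sy_add by (simp add: cl_add)
  ultimately show ?case by blast
next
  case (sym_mult p q)
  then obtain c d where c: "cl (p - fconst c) \<in> point_ideal r s \<alpha>'" "cl (q - fconst d) \<in> point_ideal r s \<alpha>'" by blast
  have A: "p \<in> A" "q \<in> A" using sym_mult sym_A by auto
  have "cl p \<otimes>\<^bsub>W\<^esub> cl (q - fconst d) \<oplus>\<^bsub>W\<^esub> cl (p - fconst c) \<otimes>\<^bsub>W\<^esub> cl (fconst d) =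
      cl (p * (q - fconst d) + (p - fconst c) * fconst d)"
    using A by (simp add: cl_add cl_mult A_mult A_diff A_fconst)
  also have "p * (q - fconst d) + (p - fconst c) * fconst d = p * q - fconst (c * d)"
    by (simp add: algebra_simps fconst_mult)
  finally have eq: "cl p \<otimes>\<^bsub>W\<^esub> cl (q - fconst d) \<oplus>\<^bsub>W\<^esub> cl (p - fconst c) \<otimes>\<^bsub>W\<^esub> cl (fconst d) =
      cl (p * q - fconst (c * d))" .
  have clp: "cl p \<in> carrier Sy" using sym_mult by blast
  have "cl (p * q - fconst (c * d)) \<in> point_ideal r s \<alpha>'"
    using PT.a_closed[OF PT.I_l_closed[OF c(2) clp] PT.I_r_closed[OF c(1) Sy_const[of d]]] by (simp only: Sy_simps eq)
  moreover have "cl (p * q) \<in> carrier Sy" using sym_mult A Sy_mult by (simp add: cl_mult)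
  ultimately show ?case by blast
qed

end

context typed_point
begin

text \<open>The annihilator of the generator of L(\<alpha>), hence the preimage in B of the maximal
  proper submodule.\<close>

definition max_left_ideal :: "'k free_alg set set set" where
  "max_left_ideal = h ` {p \<in> G. rho p (delta \<alpha>) = 0}"

abbreviation "point_image \<equiv> (\<lambda>a. CI +>\<^bsub>AG\<^esub> a) ` point_ideal r s \<alpha>'"

abbreviation "verma_ideal \<equiv> left_ideal_generated B point_image"

lemma delta_\<alpha>_supported: "supported (delta \<alpha> :: _ \<Rightarrow> 'k) S"
  by (rule supported_delta[OF \<alpha>_S])

lemma mem_max_left_ideal: "p \<in> G \<Longrightarrow> h p \<in> max_left_ideal \<longleftrightarrow> rho p (delta \<alpha>) = 0"
proof
  assume p: "p \<in> G" and "h p \<in> max_left_ideal"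
  then obtain q where q: "q \<in> G" "rho q (delta \<alpha>) = 0" "h p = h q" by (auto simp: max_left_ideal_def)
  show "rho p (delta \<alpha>) = 0" using h_eq_rho[OF p q(1,3) delta_\<alpha>_supported] q(2) by (rule trans)
qed (auto simp: max_left_ideal_def)

lemma max_left_ideal_left_ideal: "left_ideal max_left_ideal B"
proof (rule B.left_idealI)
  show "max_left_ideal \<subseteq> carrier B" by (auto simp: max_left_ideal_def carrier_B)
  show "\<zero>\<^bsub>B\<^esub> \<in> max_left_ideal" using mem_max_left_ideal[OF homogeneous_0] by (simp add: h_0 rho_0)
  fix x y assume x: "x \<in> max_left_ideal" and y: "y \<in> max_left_ideal"
  obtain p where p: "p \<in> G" "x = h p" "rho p (delta \<alpha>) = 0" using x by (auto simp: max_left_ideal_def)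
  obtain q where q: "q \<in> G" "y = h q" "rho q (delta \<alpha>) = 0" using y by (auto simp: max_left_ideal_def)
  have "rho (p + q) (delta \<alpha>) = 0" by (simp only: rho_add p q add_0)
  then show "x \<oplus>\<^bsub>B\<^esub> y \<in> max_left_ideal"
    using mem_max_left_ideal[OF homogeneous_add[OF p(1) q(1)]] by (simp only: p q h_add[OF p(1) q(1)])
next
  fix a x assume a: "a \<in> carrier B" and x: "x \<in> max_left_ideal"
  obtain p where p: "p \<in> G" "x = h p" "rho p (delta \<alpha>) = 0" using x by (auto simp: max_left_ideal_def)
  obtain q where q: "q \<in> G" "a = h q" using a by (auto simp: carrier_B)
  have "rho (q * p) (delta \<alpha>) = 0"
    by (simp only: rho_mult[OF q(1) p(1) delta_\<alpha>_supported] p(3) rho_0_right)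
  then show "a \<otimes>\<^bsub>B\<^esub> x \<in> max_left_ideal"
    using mem_max_left_ideal[OF homogeneous_mult[OF q(1) p(1)]] by (simp only: p q h_mult[OF q(1) p(1)])
qed

lemma point_image_subset: "point_image \<subseteq> max_left_ideal"
proof safe
  fix a assume "a \<in> point_ideal r s \<alpha>'"
  then obtain p where p: "p \<in> G" "a = cl p" "act p (delta \<alpha>) = 0" using point_ideal_eigen by blast
  then have "rho p (delta \<alpha>) = 0" by (auto simp: rho_def fun_eq_iff)
  then show "CI +>\<^bsub>AG\<^esub> a \<in> max_left_ideal" using mem_max_left_ideal[OF p(1)] p by (simp add: h_def)
qed

lemma point_image_carrier: "point_image \<subseteq> carrier B"
  using point_image_subset B.left_idealE(1)[OF max_left_ideal_left_ideal] by blast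

lemma verma_ideal_subset: "verma_ideal \<subseteq> max_left_ideal"
  using max_left_ideal_left_ideal point_image_subset by (auto simp: left_ideal_generated_def)

lemma verma_ideal_left_ideal: "left_ideal verma_ideal B"
  by (rule B.left_ideal_generated_left_ideal(1)[OF point_image_carrier])

lemma point_verma: "p \<in> G \<Longrightarrow> cl p \<in> point_ideal r s \<alpha>' \<Longrightarrow> h p \<in> verma_ideal"
  using B.left_ideal_generated_left_ideal(2)[OF point_image_carrier] by (auto simp: h_def)

lemma sym_sum: "(\<And>i. i \<in> Y \<Longrightarrow> f i \<in> sym_algebra) \<Longrightarrow> (\<Sum>i\<in>Y. f i) \<in> sym_algebra"
  using sym_const[of 0] by (induction Y rule: infinite_finite_induct) (auto simp: fconst_0 intro: sym_add)

lemma rho_delta_\<alpha>: "rho p (delta \<alpha>) \<alpha> = act p (delta \<alpha>) \<alpha>"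
  using \<alpha>_S by (simp add: rho_def)

text \<open>The weight space of \<open>\<alpha>\<close> in \<open>B / B m\<^sub>\<alpha>\<close> is spanned by the generator. If a left ideal contains
  an element with nonzero component in it, the commutators with the \<open>\<pi>\<^sub>i\<close> remove the components of
  other weights one by one.\<close>

lemma one_mem_left_ideal:
  assumes N: "left_ideal N B" "verma_ideal \<subseteq> N"
    and "p \<in> G" "h p \<in> N" "act p (delta \<alpha>) \<alpha> \<noteq> 0"
  shows "\<one>\<^bsub>B\<^esub> \<in> N"
  using assms(3-)
proof (induction "card {u \<in> (\<lambda>w. list_wt (letters w)) ` Poly_Mapping.keys p. u \<noteq> 0}" arbitrary: p rule: less_induct)
  case less
  let ?wts = "\<lambda>p :: 'k free_alg. {u \<in> (\<lambda>w. list_wt (letters w)) ` Poly_Mapping.keys p. u \<noteq> 0}"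
  note pG = less.prems(1)
  show ?case
  proof (cases "?wts p = {}")
    case True
    have "\<exists>q\<in>sym_algebra. mon (letters w) \<approx> q" if "w \<in> Poly_Mapping.keys p" for w
      using True that pG by (intro mon_weight_0) (auto simp: homogeneous_part_def A_eq)
    then have "\<forall>w. \<exists>q. w \<in> Poly_Mapping.keys p \<longrightarrow> q \<in> sym_algebra \<and> mon (letters w) \<approx> q" by blast
    from choice[OF this] obtain f where
      f: "\<And>w. w \<in> Poly_Mapping.keys p \<Longrightarrow> f w \<in> sym_algebra \<and> mon (letters w) \<approx> f w" by blast
    define q where "q = (\<Sum>w\<in>Poly_Mapping.keys p. fconst (Poly_Mapping.lookup p w) * f w)"
    have q: "q \<in> sym_algebra" unfolding q_def using f by (intro sym_sum sym_mult sym_const) auto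
    have qG: "q \<in> G" by (rule homogeneous_sym[OF q])
    have "p = (\<Sum>w\<in>Poly_Mapping.keys p. fconst (Poly_Mapping.lookup p w) * mon (letters w))"
      using free_alg_expand[of p] by (simp add: single_eq_mon)
    also have "\<dots> \<approx> q" unfolding q_def using f by (intro weq_sum weq_mult_left A_fconst) auto
    finally have pq: "p \<approx> q" .
    obtain c where c: "cl (q - fconst c) \<in> point_ideal r s \<alpha>'" using sym_algebra_point[OF q] by blast
    have qcG: "q - fconst c \<in> G" by (intro homogeneous_diff qG homogeneous_fconst)
    have qcN: "h (q - fconst c) \<in> verma_ideal" using point_verma[OF qcG c] .
    then have "rho (q - fconst c) (delta \<alpha>) = 0" using verma_ideal_subset mem_max_left_ideal[OF qcG] by blast
    then have "act (q - fconst c) (delta \<alpha>) \<alpha> = 0" using rho_delta_\<alpha>[of "q - fconst c"] by simp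
    then have "act q (delta \<alpha>) \<alpha> = c" by (simp add: act_diff act_fconst delta_def)
    then have c0: "c \<noteq> 0" using less.prems(3) act_weq[OF pq] by simp
    have cG: "fconst (1 / c) \<in> G" "fconst (- 1 / c) \<in> G" by (rule homogeneous_fconst)+
    \<comment> \<open>Here p has been replaced by q in Sym(t), and q - c lies in the maximal ideal
      of \<alpha>. The constant c is the component at \<alpha>, which is nonzero and can be
      inverted.\<close>
    have "1 = fconst (1 / c) * q + fconst (- 1 / c) * (q - fconst c)"
      using c0 by (simp add: right_diff_distrib fconst_mult[symmetric] fconst_1 fconst_minus)
    then have "\<one>\<^bsub>B\<^esub> = h (fconst (1 / c) * q + fconst (- 1 / c) * (q - fconst c))" by (simp add: h_1)
    also have "\<dots> = h (fconst (1 / c)) \<otimes>\<^bsub>B\<^esub> h q \<oplus>\<^bsub>B\<^esub> h (fconst (- 1 / c)) \<otimes>\<^bsub>B\<^esub> h (q - fconst c)"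
      by (simp only: h_add h_mult homogeneous_mult cG qG qcG)
    also have "h q = h p" by (rule h_weq[OF qG pG weq_sym[OF pq]])
    also have "h (fconst (1 / c)) \<otimes>\<^bsub>B\<^esub> h p \<oplus>\<^bsub>B\<^esub> h (fconst (- 1 / c)) \<otimes>\<^bsub>B\<^esub> h (q - fconst c) \<in> N"
      using N(2) qcN less.prems(2) by (intro B.left_idealE(3,4)[OF N(1)] h_closed cG) auto
    finally show ?thesis .
  next
    case False
    then obtain u where u: "u \<in> ?wts p" by blast
    then obtain i where ui: "u i \<noteq> 0" by (auto simp: fun_eq_iff)
    have i: "i \<in> {1..r+s}"
      using u ui pG list_wt_outside by (fastforce simp: homogeneous_part_def A_eq)
    define t :: "nat \<Rightarrow> 'k" where "t = (\<lambda>j. if j = i then 1 else 0)"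
    have "tor (r+s) t = (\<Sum>j\<in>{1..r+s}. if j = i then euler_op i else 0)"
      unfolding tor_eq by (rule sum.cong) (auto simp: t_def fconst_0 fconst_1)
    then have tor: "tor (r+s) t = euler_op i" using i by (simp del: atLeastAtMost_iff)
    have pair: "pairing (r+s) t v = of_int (v i)" for v
    proof -
      have "pairing (r+s) t v = (\<Sum>j\<in>{1..r+s}. if j = i then of_int (v i) else 0)"
        unfolding pairing_def by (rule sum.cong) (auto simp: t_def)
      then show ?thesis using i by (simp del: atLeastAtMost_iff)
    qed
    \<comment> \<open>Removes the weights whose i-th coordinate is u_i, in particular u itself, and
      multiplies the component at \<alpha> by -u_i, which is nonzero.\<close>
    define q where "q = weight_derivation t p - fconst (of_int (u i)) * p"
    have lookup: "Poly_Mapping.lookup q w = of_int (list_wt (letters w) i - u i) * Poly_Mapping.lookup p w" for w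
      by (simp add: q_def lookup_minus lookup_fconst_mult lookup_weight_derivation pair algebra_simps)
    have keys: "Poly_Mapping.keys q \<subseteq> {w \<in> Poly_Mapping.keys p. list_wt (letters w) i \<noteq> u i}"
      by (auto simp: in_keys_iff lookup)
    then have qG: "q \<in> G" using pG by (auto simp: homogeneous_part_def A_eq)
    have wts: "v \<in> ?wts p \<and> v i \<noteq> u i" if v: "v \<in> ?wts q" for v
    proof -
      obtain w where "w \<in> Poly_Mapping.keys q" "v = list_wt (letters w)" "v \<noteq> 0" using v by blast
      then show ?thesis using subsetD[OF keys] by blast
    qed
    have "u \<notin> ?wts q" using wts[of u] by blast
    with u wts have "?wts q \<subset> ?wts p" by blast
    then have card: "card (?wts q) < card (?wts p)" by (intro psubset_card_mono) auto
    obtain c where c: "cl (euler_op i - fconst c) \<in> point_ideal r s \<alpha>'" using sym_algebra_point[OF sym_pi[OF i]] by blast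
    have piG: "euler_op i - fconst c \<in> G" "euler_op i - fconst (c + of_int (u i)) \<in> G"
      by (intro homogeneous_diff homogeneous_pi i homogeneous_fconst)+
    have comm: "euler_op i * p - p * euler_op i \<approx> weight_derivation t p" using tor_commutator[OF G_A[OF pG], of t] by (simp add: tor)
    \<comment> \<open>A commutator with \<pi>_i need not stay in a left ideal. Subtracting c from
      \<pi>_i leaves it unchanged and puts the right factor of the second product into the maximal
      ideal of \<alpha>, so that this product lies in N.\<close>
    have "(euler_op i - fconst (c + of_int (u i))) * p + - (p * (euler_op i - fconst c)) = (euler_op i * p - p * euler_op i) - fconst (of_int (u i)) * p"
      by (simp add: algebra_simps fconst_add fconst_commute[of _ p])
    also have "\<dots> \<approx> q" unfolding q_def by (intro weq_diff comm weq_refl)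
    finally have eq: "(euler_op i - fconst (c + of_int (u i))) * p + - (p * (euler_op i - fconst c)) \<approx> q" .
    have "h q = h ((euler_op i - fconst (c + of_int (u i))) * p + (- p) * (euler_op i - fconst c))"
    proof (rule h_weq[OF qG])
      show "(euler_op i - fconst (c + of_int (u i))) * p + (- p) * (euler_op i - fconst c) \<in> G"
        by (intro homogeneous_add homogeneous_mult homogeneous_uminus piG pG)
      show "q \<approx> (euler_op i - fconst (c + of_int (u i))) * p + (- p) * (euler_op i - fconst c)"
        using weq_sym[OF eq] by (simp only: mult_minus_left)
    qed
    also have "\<dots> = h (euler_op i - fconst (c + of_int (u i))) \<otimes>\<^bsub>B\<^esub> h p \<oplus>\<^bsub>B\<^esub> h (- p) \<otimes>\<^bsub>B\<^esub> h (euler_op i - fconst c)"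
      by (simp only: h_add h_mult homogeneous_mult homogeneous_uminus piG pG)
    also have "\<dots> \<in> N"
      using N(2) point_verma[OF piG(1) c] less.prems(2)
      by (intro B.left_idealE(3,4)[OF N(1)] h_closed piG homogeneous_uminus pG) auto
    finally have hq: "h q \<in> N" .
    have "act (weight_derivation t p) (delta \<alpha>) \<alpha> = act (euler_op i * p - p * euler_op i) (delta \<alpha>) \<alpha>"
      by (simp only: act_weq[OF comm])
    also have "\<dots> = 0"
    proof -
      have d: "act (euler_op i) (delta \<alpha>) = (\<lambda>\<gamma>. of_rat (\<alpha> i) * delta \<alpha> \<gamma>)"
        by (rule ext) (simp add: act_pi delta_def)
      show ?thesis unfolding act_diff act_mult fun_diff_def d act_pi act_scale_right by simp
    qed
    finally have "act q (delta \<alpha>) \<alpha> = - of_int (u i) * act p (delta \<alpha>) \<alpha>"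
      by (simp add: q_def act_diff act_mult act_fconst)
    then have "act q (delta \<alpha>) \<alpha> \<noteq> 0" using ui less.prems(3) by simp
    then show ?thesis using less.hyps[OF card qG hq] by blast
  qed
qed

text \<open>An element outside has a nonzero component at some weight of \<open>S\<close>. A normal
  word carries this component back to \<alpha> with nonzero coefficient, and then the left ideal
  contains 1.\<close>

lemma max_left_ideal_maximal:
  assumes N: "left_ideal N B" "verma_ideal \<subseteq> N" and not: "\<not> N \<subseteq> max_left_ideal"
  shows "N = carrier B"
proof -
  obtain p where p: "p \<in> G" "h p \<in> N" "rho p (delta \<alpha>) \<noteq> 0"
  proof -
    obtain b where b: "b \<in> N" "b \<notin> max_left_ideal" using not by blast
    then obtain p where "p \<in> G" "b = h p" using B.left_idealE(1)[OF N(1)] carrier_B by blast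
    then show ?thesis using that b mem_max_left_ideal by blast
  qed
  obtain \<zeta> where \<zeta>: "rho p (delta \<alpha>) \<zeta> \<noteq> 0" using p(3) by (auto simp: fun_eq_iff)
  then have \<zeta>S: "\<zeta> \<in> S" unfolding rho_def by presburger
  obtain u where u: "rwt u = \<alpha> - \<zeta>" "rwt u \<in> E" using S_diff[OF \<alpha>_S \<zeta>S] .
  have mG: "mon (normal_word u) \<in> G" by (rule normal_word_G[OF u(2)])
  have "rho (mon (normal_word u) * p) (delta \<alpha>) \<alpha> = list_coeff (normal_word u) \<alpha> * rho p (delta \<alpha>) \<zeta>"
    unfolding rho_mult[OF mG p(1) delta_\<alpha>_supported] rho_def[of "mon _"] act_mon normal_word_wt[OF u(2)]
    using \<alpha>_S by (simp add: u(1))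
  moreover have "list_coeff (normal_word u) \<alpha> \<noteq> (0::'k)"
    using \<alpha>_S \<zeta>S u(1) by (intro list_coeff_nonzero) auto
  ultimately have "act (mon (normal_word u) * p) (delta \<alpha>) \<alpha> \<noteq> 0"
    using \<zeta> by (simp add: rho_delta_\<alpha>)
  moreover have "h (mon (normal_word u) * p) \<in> N"
    unfolding h_mult[OF mG p(1)] by (intro B.left_idealE(4)[OF N(1)] h_closed mG p)
  ultimately have one: "\<one>\<^bsub>B\<^esub> \<in> N"
    using one_mem_left_ideal[OF N homogeneous_mult[OF mG p(1)]] by blast
  have "x \<in> N" if "x \<in> carrier B" for x
    using B.left_idealE(4)[OF N(1) that one] that by simp
  then show ?thesis using B.left_idealE(1)[OF N(1)] by blast
qed

abbreviation "J\<alpha> \<equiv> Jideal r s g \<chi> \<alpha>'"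

lemma J_eq: "J\<alpha> = {b \<in> carrier B. \<forall>c\<in>carrier B. b \<otimes>\<^bsub>B\<^esub> c \<in> max_left_ideal}"
  unfolding Jideal_def Lmod_def verma_def
proof (rule B.annihilator_the_simple_quotient)
  show "max_left_ideal \<noteq> carrier B"
  proof
    assume "max_left_ideal = carrier B"
    then have "rho 1 (delta \<alpha>) = 0"
      using mem_max_left_ideal[OF homogeneous_1] h_closed[OF homogeneous_1] by blast
    then have "delta \<alpha> \<alpha> = (0 :: 'k)" using rho_1[OF delta_\<alpha>_supported] by (metis zero_fun_apply)
    then show False by (simp add: delta_def)
  qed
  fix N assume "left_ideal N B" "verma_ideal \<subseteq> N"
  then show "N = carrier B \<or> N \<subseteq> max_left_ideal" using max_left_ideal_maximal by blast
qed (rule verma_ideal_left_ideal max_left_ideal_left_ideal verma_ideal_subset)+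

text \<open>Normal words send the delta function at \<alpha> to nonzero multiples of all delta
  functions on \<open>S\<close>. An element annihilating the orbit of the generator therefore has
  all its matrix entries zero.\<close>

lemma mem_J: "p \<in> G \<Longrightarrow> h p \<in> J\<alpha> \<longleftrightarrow> kills p"
proof -
  assume p: "p \<in> G"
  have "h p \<in> J\<alpha> \<longleftrightarrow> (\<forall>q\<in>G. h (p * q) \<in> max_left_ideal)"
    unfolding J_eq carrier_B using p by (auto simp: h_mult)
  also have "\<dots> \<longleftrightarrow> (\<forall>q\<in>G. rho p (rho q (delta \<alpha>)) = 0)"
    using p by (simp add: mem_max_left_ideal homogeneous_mult rho_mult delta_\<alpha>_supported)
  also have "\<dots> \<longleftrightarrow> kills p"
  proof
    assume r: "\<forall>q\<in>G. rho p (rho q (delta \<alpha>)) = 0"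
    show "kills p" unfolding kills_iff
    proof (intro ballI)
      fix \<zeta> \<xi> assume \<zeta>: "\<zeta> \<in> S" and \<xi>: "\<xi> \<in> S"
      obtain u where u: "rwt u = \<xi> - \<alpha>" "rwt u \<in> E" using S_diff[OF \<xi> \<alpha>_S] .
      define c where "c = (list_coeff (normal_word u) \<xi> :: 'k)"
      have c: "c \<noteq> 0" unfolding c_def using \<alpha>_S \<xi> u(1) by (intro list_coeff_nonzero) auto
      have "rho p (\<lambda>\<gamma>. c * delta \<xi> \<gamma>) = 0"
        using bspec[OF r normal_word_G[OF u(2)]] unfolding rho_normal_word[OF u \<xi> \<alpha>_S] c_def .
      then have "c * rho p (delta \<xi>) \<zeta> = 0" using fun_cong by (fastforce simp: rho_scale_right)
      then show "act p (delta \<xi>) \<zeta> = 0" using c \<zeta> by (simp add: rho_def)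
    qed
  next
    assume "kills p"
    then show "\<forall>q\<in>G. rho p (rho q (delta \<alpha>)) = 0" using supported_rho by (simp add: kills_def)
  qed
  finally show ?thesis .
qed

lemma J_image: "J\<alpha> = h ` {p \<in> G. kills p}"
  using mem_J J_eq carrier_B by auto

sublocale J: ideal "J\<alpha>" B
proof (rule B.idealI')
  show "J\<alpha> \<subseteq> carrier B" by (auto simp: J_eq)
  show "\<zero>\<^bsub>B\<^esub> \<in> J\<alpha>" using mem_J[OF homogeneous_0] kills_0 by (simp add: h_0)
  show "x \<oplus>\<^bsub>B\<^esub> y \<in> J\<alpha>" if "x \<in> J\<alpha>" "y \<in> J\<alpha>" for x y
    using that unfolding J_image by (auto simp: h_add[symmetric] intro!: imageI homogeneous_add kills_add)
  fix a x assume "a \<in> carrier B" "x \<in> J\<alpha>"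
  then obtain p q where pq: "p \<in> G" "a = h p" "q \<in> G" "kills q" "x = h q" by (auto simp: carrier_B J_image)
  show "a \<otimes>\<^bsub>B\<^esub> x \<in> J\<alpha>" using pq kills_mult_left[OF pq(1,3,4)] mem_J[OF homogeneous_mult[OF pq(1,3)]]
    by (simp add: h_mult)
  show "x \<otimes>\<^bsub>B\<^esub> a \<in> J\<alpha>" using pq kills_mult_right[OF pq(3,1,4)] mem_J[OF homogeneous_mult[OF pq(3,1)]]
    by (simp add: h_mult)
qed

abbreviation "R \<equiv> B Quot J\<alpha>"

sublocale R: ring R by (rule J.quotient_is_ring)

definition k :: "'k free_alg \<Rightarrow> 'k free_alg set set set" where
  "k p = J\<alpha> +>\<^bsub>B\<^esub> h p"

lemma k_mult: "p \<in> G \<Longrightarrow> q \<in> G \<Longrightarrow> k (p * q) = k p \<otimes>\<^bsub>R\<^esub> k q"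
  using ring_hom_mult[OF J.rcos_ring_hom, of "h p" "h q"] by (simp add: k_def h_closed h_mult)

lemma k_add: "p \<in> G \<Longrightarrow> q \<in> G \<Longrightarrow> k (p + q) = k p \<oplus>\<^bsub>R\<^esub> k q"
  using ring_hom_add[OF J.rcos_ring_hom, of "h p" "h q"] by (simp add: k_def h_closed h_add)

lemma carrier_R: "carrier R = k ` G"
  by (auto simp: FactRing_def A_RCOSETS_def' k_def a_r_coset_def' carrier_B)

lemma k_closed: "p \<in> G \<Longrightarrow> k p \<in> carrier R"
  unfolding carrier_R by (rule imageI)

lemma k_eq_0_iff: "p \<in> G \<Longrightarrow> k p = \<zero>\<^bsub>R\<^esub> \<longleftrightarrow> kills p"
proof -
  assume p: "p \<in> G"
  have "\<zero>\<^bsub>R\<^esub> = J\<alpha>" by (simp add: FactRing_def)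
  then show ?thesis using p J.a_rcos_self[OF h_closed[OF p]] J.a_rcos_const[of "h p"] mem_J[OF p] by (auto simp: k_def)
qed

lemma k_sum:
  fixes f :: "nat \<Rightarrow> 'k free_alg"
  shows "(\<And>i. i < m \<Longrightarrow> f i \<in> G) \<Longrightarrow> finsum R (\<lambda>i. k (f i)) {..<m} = k (\<Sum>i<m. f i)"
proof (induction m)
  case 0
  then show ?case using k_eq_0_iff[OF homogeneous_0] kills_0 by simp
next
  case (Suc m)
  have "finsum R (\<lambda>i. k (f i)) {..<Suc m} = k (f m) \<oplus>\<^bsub>R\<^esub> finsum R (\<lambda>i. k (f i)) {..<m}"
    unfolding lessThan_Suc using Suc.prems by (intro R.finsum_insert) (auto intro: k_closed)
  also have "\<dots> = k (f m + (\<Sum>i<m. f i))"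
    using Suc by (subst k_add) (auto intro: homogeneous_sum)
  finally show ?case by (simp add: add.commute)
qed

text \<open>Direct sums of left ideals in \<open>B / J(\<alpha>)\<close>, in terms of generators and representatives in the
  free algebra.\<close>

definition independent_generators :: "nat \<Rightarrow> (nat \<Rightarrow> 'k free_alg) \<Rightarrow> bool" where
  "independent_generators m p \<longleftrightarrow> (\<forall>i<m. p i \<in> G \<and> \<not> kills (p i)) \<and>
     (\<forall>q. (\<forall>i<m. q i \<in> G) \<longrightarrow> kills (\<Sum>i<m. q i * p i) \<longrightarrow> (\<forall>i<m. kills (q i * p i)))"

text \<open>A nonzero element is picked from each left ideal of a direct sum; in the other direction
  the principal left ideals are taken.\<close>

lemma has_direct_sum_iff: "has_direct_sum_of_left_ideals R m \<longleftrightarrow> (\<exists>p. independent_generators m p)"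
proof
  assume "has_direct_sum_of_left_ideals R m"
  then obtain L where L': "\<forall>i<m. left_ideal (L i) R \<and> L i \<noteq> {\<zero>\<^bsub>R\<^esub>}"
    and dir': "\<forall>a\<in>Pi {..<m} L. finsum R a {..<m} = \<zero>\<^bsub>R\<^esub> \<longrightarrow> (\<forall>i<m. a i = \<zero>\<^bsub>R\<^esub>)"
    unfolding has_direct_sum_of_left_ideals_def by (elim exE conjE)
  have L: "left_ideal (L i) R" "L i \<noteq> {\<zero>\<^bsub>R\<^esub>}" if "i < m" for i using L' that by simp_all
  have dir: "\<forall>i<m. a i = \<zero>\<^bsub>R\<^esub>" if "a \<in> Pi {..<m} L" "finsum R a {..<m} = \<zero>\<^bsub>R\<^esub>" for a
    using bspec[OF dir' that(1)] that(2) by (rule mp)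
  have "\<exists>p. p \<in> G \<and> k p \<in> L i \<and> \<not> kills p" if i: "i < m" for i
  proof -
    obtain x where x: "x \<in> L i" "x \<noteq> \<zero>\<^bsub>R\<^esub>" using L(2)[OF i] R.left_idealE(2)[OF L(1)[OF i]] by blast
    then obtain p where "p \<in> G" "x = k p" using R.left_idealE(1)[OF L(1)[OF i]] carrier_R by blast
    then show ?thesis using x k_eq_0_iff by blast
  qed
  then have "\<forall>i. \<exists>p. i < m \<longrightarrow> p \<in> G \<and> k p \<in> L i \<and> \<not> kills p" by blast
  from choice[OF this] obtain p where p: "\<And>i. i < m \<Longrightarrow> p i \<in> G \<and> k (p i) \<in> L i \<and> \<not> kills (p i)" by blast
  have "kills (q i * p i)" if q: "\<forall>i<m. q i \<in> G" "kills (\<Sum>i<m. q i * p i)" and i: "i < m" for q i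
  proof -
    have G: "q j * p j \<in> G" if "j < m" for j using p q that homogeneous_mult by blast
    have "(\<lambda>j. k (q j * p j)) \<in> Pi {..<m} L"
      using p q R.left_idealE(4)[OF L(1)] by (auto simp: k_mult k_closed)
    moreover have "finsum R (\<lambda>j. k (q j * p j)) {..<m} = \<zero>\<^bsub>R\<^esub>"
      using k_sum[of m "\<lambda>j. q j * p j"] G q(2) k_eq_0_iff[of "\<Sum>i<m. q i * p i"] homogeneous_sum[of "{..<m}"] by auto
    ultimately have "k (q i * p i) = \<zero>\<^bsub>R\<^esub>" using dir i by blast
    then show ?thesis using k_eq_0_iff G i by blast
  qed
  then have "independent_generators m p" using p unfolding independent_generators_def by blast
  then show "\<exists>p. independent_generators m p" by blast
next
  assume "\<exists>p. independent_generators m p"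
  then obtain p where p: "\<And>i. i < m \<Longrightarrow> p i \<in> G" "\<And>i. i < m \<Longrightarrow> \<not> kills (p i)"
    and ind: "\<And>q i. \<forall>i<m. q i \<in> G \<Longrightarrow> kills (\<Sum>i<m. q i * p i) \<Longrightarrow> i < m \<Longrightarrow> kills (q i * p i)"
    unfolding independent_generators_def by blast
  define L where "L i = (\<lambda>q. k (q * p i)) ` G" for i
  show "has_direct_sum_of_left_ideals R m"
    unfolding has_direct_sum_of_left_ideals_def
  proof (intro exI[of _ L] conjI allI impI ballI)
    fix i assume i: "i < m"
    show "left_ideal (L i) R"
    proof (rule R.left_idealI)
      show "L i \<subseteq> carrier R" using p i by (auto simp: L_def intro!: k_closed homogeneous_mult)
      have "kills (0 * p i)" using kills_0 by simp
      then have "k (0 * p i) = \<zero>\<^bsub>R\<^esub>" using k_eq_0_iff homogeneous_0 by simp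
      then show "\<zero>\<^bsub>R\<^esub> \<in> L i" unfolding L_def using homogeneous_0 by (metis imageI)
      show "x \<oplus>\<^bsub>R\<^esub> y \<in> L i" if xy: "x \<in> L i" "y \<in> L i" for x y
      proof -
        obtain q q' where q: "q \<in> G" "x = k (q * p i)" "q' \<in> G" "y = k (q' * p i)" using xy by (auto simp: L_def)
        then have "x \<oplus>\<^bsub>R\<^esub> y = k ((q + q') * p i)" using p(1)[OF i] by (simp add: distrib_right k_add homogeneous_mult)
        then show ?thesis using homogeneous_add[OF q(1,3)] by (auto simp: L_def)
      qed
      fix a x assume "a \<in> carrier R" "x \<in> L i"
      then obtain b q where q: "b \<in> G" "a = k b" "q \<in> G" "x = k (q * p i)" by (auto simp: L_def carrier_R)
      then have "a \<otimes>\<^bsub>R\<^esub> x = k ((b * q) * p i)" using p(1)[OF i] by (simp add: mult.assoc k_mult homogeneous_mult)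
      then show "a \<otimes>\<^bsub>R\<^esub> x \<in> L i" using homogeneous_mult[OF q(1,3)] by (auto simp: L_def)
    qed
    have "k (1 * p i) \<in> L i" using homogeneous_1 unfolding L_def by (rule imageI)
    moreover have "k (1 * p i) \<noteq> \<zero>\<^bsub>R\<^esub>" using k_eq_0_iff[OF p(1)[OF i]] p(2)[OF i] by simp
    ultimately show "L i \<noteq> {\<zero>\<^bsub>R\<^esub>}" by blast
  next
    fix a i assume a: "a \<in> Pi {..<m} L" "finsum R a {..<m} = \<zero>\<^bsub>R\<^esub>" and i: "i < m"
    have "\<exists>q. q \<in> G \<and> a j = k (q * p j)" if "j < m" for j
    proof -
      have "a j \<in> L j" using a(1) that by (auto simp: Pi_def)
      then show ?thesis unfolding L_def by blast
    qed
    then have "\<forall>j. \<exists>q. j < m \<longrightarrow> q \<in> G \<and> a j = k (q * p j)" by blast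
    from choice[OF this] obtain q where q: "\<And>j. j < m \<Longrightarrow> q j \<in> G \<and> a j = k (q j * p j)" by blast
    have G: "q j * p j \<in> G" if "j < m" for j using p q that homogeneous_mult by blast
    have "finsum R a {..<m} = finsum R (\<lambda>j. k (q j * p j)) {..<m}"
      using q G by (intro R.finsum_cong') (auto intro: k_closed)
    also have "\<dots> = k (\<Sum>j<m. q j * p j)" using G by (rule k_sum)
    finally have "kills (\<Sum>j<m. q j * p j)"
      using a(2) k_eq_0_iff[of "\<Sum>i<m. q i * p i"] G homogeneous_sum[of "{..<m}"] by auto
    then have "kills (q i * p i)" using ind q i by blast
    then show "a i = \<zero>\<^bsub>R\<^esub>" using q[OF i] k_eq_0_iff G i by simp
  qed
qed

end

section \<open>The blocks of the weights\<close>

context typed_point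
begin

abbreviation "res \<equiv> (restrict_coord J :: (nat \<Rightarrow> rat) \<Rightarrow> nat \<Rightarrow> rat)"

lemma res_add: "res (u + v) = res u + res v" and res_diff: "res (u - v) = res u - res v"
  and res_scale: "res (fscale c u) = fscale c (res u)"
  and res_idem: "res (res u) = res u" and res_coord: "res u \<in> coord_space J"
  by (auto simp: restrict_coord_def fscale_def coord_space_def)

text \<open>The decomposition of the dual of g in the definition of type enters here. A relation
  among the \<eta>_i splits into its part on J and its part on I, so E is compatible with projection
  to the J-coordinates.\<close>

lemma E_restrict:
  assumes "u \<in> E" shows "res u \<in> E"
proof -
  let ?a = "of_rat_vec u :: nat \<Rightarrow> 'k"
  have u: "eta_comb g {1..r+s} ?a = 0" using assms by (simp add: Eset_def Vset_def)
  have span: "eta_comb g Y ?a \<in> fun_space.span (eta g ` Y)" for Y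
    unfolding eta_comb_def by (intro fun_space.span_sum fun_space.span_scale fun_space.span_base) auto
  have "eta_comb g {1..r+s} ?a = eta_comb g J ?a + eta_comb g ({1..r+s} - J) ?a"
    unfolding eta_comb_def using sum.subset_diff[OF J_subset' finite_atLeastAtMost] by (simp add: add.commute)
  then have eq: "eta_comb g J ?a = - eta_comb g ({1..r+s} - J) ?a"
    using u by (simp add: eq_neg_iff_add_eq_0)
  have "eta_comb g J ?a \<in> fun_space.span (eta g ` ({1..r+s} - J))"
    unfolding eq by (rule fun_space.span_neg[OF span])
  then have "eta_comb g J ?a \<in> fun_space.span (eta g ` J) \<inter> fun_space.span (eta g ` ({1..r+s} - J))"
    using span[of J] by blast
  then have 0: "eta_comb g J ?a = 0" using type unfolding of_type_def by blast
  have "eta_comb g J (of_rat_vec (res u)) = eta_comb g J ?a"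
    unfolding eta_comb_def by (rule sum.cong) (auto simp: of_rat_vec_def restrict_coord_def)
  then have "res u \<in> V0set g J" using 0 res_coord by (simp add: V0set_def)
  then show ?thesis using V0_subset_E by blast
qed

text \<open>An integral direction that fixes the J-coordinates and drives the other coordinates in T
  away from the walls of the cone. It is a multiple of the vector e of the sign
  configuration.\<close>

lemma deep_direction:
  obtains w where "rwt w \<in> E" "res (rwt w) = 0"
    "\<And>i. i \<in> T - J \<Longrightarrow> (if 0 \<le> \<alpha> i then 0 < w i else w i < 0)"
proof -
  obtain e where e: "e \<in> E" "\<And>i. i \<in> T - J \<Longrightarrow> lam \<alpha> i e > 0" "\<And>j. j \<in> J \<Longrightarrow> lam \<alpha> j e = 0"
    using decomposition unfolding sign_decomposition_def by blast
  obtain D :: int where D: "D > 0" "\<forall>x\<in>e ` {1..r+s}. of_int D * x \<in> \<int>"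
    using common_denominator[of "e ` {1..r+s}"] by auto
  have e0: "e i = 0" if "i \<notin> {1..r+s}" for i using e(1) that by (auto simp: mem_E_iff coord_space_def)
  have int: "of_int D * e i \<in> \<int>" for i
    using D e0[of i] by (cases "i \<in> {1..r+s}") auto
  \<comment> \<open>The sign is reversed because \<lambda>_i is the negative coordinate where
    \<alpha>_i \<ge> 0.\<close>
  define w where "w i = - \<lfloor>of_int D * e i\<rfloor>" for i
  have w: "of_int (w i) = - (of_int D * e i)" for i
    unfolding w_def of_int_minus of_int_floor[OF int] ..
  have rw: "rwt w = fscale (- of_int D) e" by (simp add: rwt_def fscale_def w)
  have wpos: "0 < w i \<longleftrightarrow> e i < 0" "w i < 0 \<longleftrightarrow> 0 < e i" for i
  proof -
    have "0 < w i \<longleftrightarrow> (0::rat) < of_int (w i)" "w i < 0 \<longleftrightarrow> of_int (w i) < (0::rat)" by simp_all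
    then show "0 < w i \<longleftrightarrow> e i < 0" "w i < 0 \<longleftrightarrow> 0 < e i"
      unfolding w using D(1) by (auto simp: mult_less_0_iff zero_less_mult_iff)
  qed
  have lam0: "e j = 0" if "j \<in> J" for j using e(3)[OF that] by (auto simp: lam_def split: if_splits)
  show thesis
  proof (rule that)
    show "rwt w \<in> E" unfolding rw by (rule E_scale[OF e(1)])
    show "res (rwt w) = 0" unfolding rw by (auto simp: restrict_coord_def fscale_def lam0)
    show "if 0 \<le> \<alpha> i then 0 < w i else w i < 0" if "i \<in> T - J" for i
      using e(2)[OF that] wpos by (simp add: lam_def split: if_splits)
  qed
qed

lemma coset_add: "\<gamma> \<in> coset \<Longrightarrow> rwt u \<in> E \<Longrightarrow> \<gamma> + rwt u \<in> coset"
proof -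
  assume a: "\<gamma> \<in> coset" "rwt u \<in> E"
  have e: "\<gamma> + rwt u - \<alpha> = (\<gamma> - \<alpha>) + rwt u" by simp
  have "\<gamma> + rwt u - \<alpha> \<in> E" unfolding e using a E_add[of "\<gamma> - \<alpha>" "rwt u"] by (simp only: coset_def mem_Collect_eq)
  moreover have "(\<gamma> + rwt u) i - \<alpha> i \<in> \<int>" for i
  proof -
    have e: "(\<gamma> + rwt u) i - \<alpha> i = (\<gamma> i - \<alpha> i) + of_int (u i)" by (simp add: rwt_def)
    show ?thesis unfolding e using a by (intro Ints_add Ints_of_int) (simp add: coset_def)
  qed
  ultimately show ?thesis by (simp add: coset_def)
qed

lemma coset_diff: "\<gamma> \<in> coset \<Longrightarrow> rwt u \<in> E \<Longrightarrow> \<gamma> - rwt u \<in> coset"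
  using coset_add[of \<gamma> "- u"] E_minus[of "rwt u"] by (simp add: rwt_minus)

text \<open>The index set of the matrix rows and columns: one block for each value of the
  J-coordinates on \<open>S\<close>.\<close>

definition blocks :: "(nat \<Rightarrow> rat) set" where
  "blocks = res ` S"

lemma coset_S_iff: "\<gamma> \<in> coset \<Longrightarrow> \<gamma> \<in> S \<longleftrightarrow> (\<forall>i\<in>T. (0 \<le> \<gamma> i) = (0 \<le> \<alpha> i))"
  by (simp add: S_def coset_def)

lemma S_if_block:
  assumes "\<gamma> \<in> coset" "res \<gamma> \<in> blocks" "\<And>i. i \<in> T - J \<Longrightarrow> (0 \<le> \<gamma> i) = (0 \<le> \<alpha> i)"
  shows "\<gamma> \<in> S"
proof -
  obtain \<eta> where \<eta>: "\<eta> \<in> S" "res \<gamma> = res \<eta>" using assms(2) by (auto simp: blocks_def)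
  have "(0 \<le> \<gamma> i) = (0 \<le> \<alpha> i)" if "i \<in> T" for i
  proof (cases "i \<in> J")
    case True
    then have "\<gamma> i = \<eta> i" using fun_cong[OF \<eta>(2), of i] by (simp add: restrict_coord_def)
    then show ?thesis using \<eta>(1) that by (simp add: S_def)
  qed (use assms(3) that in auto)
  then show ?thesis using coset_S_iff[OF assms(1)] by blast
qed

lemma blocks_eq: "blocks = PJ g \<alpha> J Jp Jm \<inter> int_lattice J"
proof -
  have one: "fscale 1 \<alpha> = \<alpha>" "fscale 1 (res \<alpha>) = res \<alpha>" by (auto simp: fscale_def)
  have PJ: "d \<in> PJ g \<alpha> J Jp Jm \<longleftrightarrow> d \<in> coord_space J \<and> d - res \<alpha> \<in> E \<and> (\<forall>j\<in>Jp. 0 \<le> d j) \<and> (\<forall>j\<in>Jm. d j \<le> -1)" for d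
    using PJ_iff[of d 1] unfolding one .
  show ?thesis
  proof (intro equalityI subsetI)
    fix d assume "d \<in> blocks"
    then obtain \<gamma> where \<gamma>: "\<gamma> \<in> S" "d = res \<gamma>" by (auto simp: blocks_def)
    have int: "\<gamma> j \<in> \<int>" if "j \<in> J" for j
      using sub_support_integral[of \<gamma> j] \<gamma>(1) that J_subset_T by (auto simp: S_def)
    have sign: "(0 \<le> \<gamma> j) = (0 \<le> \<alpha> j)" if "j \<in> J" for j using \<gamma>(1) that J_subset_T by (auto simp: S_def)
    have "d - res \<alpha> \<in> E" using E_restrict[of "\<gamma> - \<alpha>"] \<gamma> by (simp add: S_def res_diff)
    moreover have "0 \<le> d j" if "j \<in> Jp" for j using that sign \<gamma>(2) by (simp add: Jp_eq restrict_coord_def)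
    moreover have "d j \<le> -1" if "j \<in> Jm" for j
    proof -
      have j: "j \<in> J" "\<alpha> j < 0" using that by (auto simp: Jm_eq)
      then have "\<gamma> j < 0" using sign[OF j(1)] by auto
      then have "\<gamma> j \<le> -1" using int_neg[OF int[OF j(1)]] by auto
      then show ?thesis using j \<gamma>(2) by (simp add: restrict_coord_def)
    qed
    moreover have "d \<in> int_lattice J" using int \<gamma>(2) by (auto simp: int_lattice_def restrict_coord_def coord_space_def)
    ultimately show "d \<in> PJ g \<alpha> J Jp Jm \<inter> int_lattice J" using PJ by (auto simp: int_lattice_def)
  next
    fix d assume "d \<in> PJ g \<alpha> J Jp Jm \<inter> int_lattice J"
    then have d: "d \<in> coord_space J" "d - res \<alpha> \<in> E" "\<forall>j\<in>Jp. 0 \<le> d j" "\<forall>j\<in>Jm. d j \<le> -1" "\<And>j. d j \<in> \<int>"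
      by (auto simp: PJ int_lattice_def)
    \<comment> \<open>A lattice point is lifted to a weight by keeping the coordinates of \<alpha>
      outside J.\<close>
    define \<gamma> where "\<gamma> = \<alpha> + (d - res \<alpha>)"
    have \<gamma>J: "\<gamma> j = d j" if "j \<in> J" for j using that by (simp add: \<gamma>_def restrict_coord_def)
    have \<gamma>n: "\<gamma> j = \<alpha> j" if "j \<notin> J" for j using that d(1) by (simp add: \<gamma>_def restrict_coord_def coord_space_def)
    have "\<gamma> - \<alpha> \<in> E" using d(2) by (simp add: \<gamma>_def)
    moreover have "\<gamma> j - \<alpha> j \<in> \<int>" for j
      using \<gamma>J[of j] \<gamma>n[of j] d(5)[of j] J_integral[of j] by (cases "j \<in> J") auto
    moreover have "(0 \<le> \<gamma> i) = (0 \<le> \<alpha> i)" for i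
    proof (cases "i \<in> J")
      case True
      show ?thesis
      proof (cases "0 \<le> \<alpha> i")
        case False
        then have "d i \<le> -1" using d(4) True by (auto simp: Jm_eq)
        then show ?thesis using False \<gamma>J[OF True] by simp
      qed (use d(3) True \<gamma>J in \<open>auto simp: Jp_eq\<close>)
    qed (simp add: \<gamma>n)
    ultimately have "\<gamma> \<in> S" by (simp add: S_def)
    moreover have "d = res \<gamma>" using d(1) \<gamma>J by (auto simp: restrict_coord_def coord_space_def)
    ultimately show "d \<in> blocks" by (auto simp: blocks_def)
  qed
qed

text \<open>Block labels lie in the slice of height 1, where the weighted norm bounds every
  coordinate, and they are integral.\<close>

lemma finite_blocks: "finite blocks"
proof -
  obtain c where c: "\<forall>j\<in>J. c j > 0" "\<forall>v\<in>E. (\<Sum>j\<in>J. c j * ((if j \<in> Jm then -1 else 1) * v j)) = 0"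
    using positive_relation by blast
  define M where "M = (\<Sum>j\<in>J. c j * \<bar>\<alpha> j\<bar>)"
  define K where "K = (\<Sum>j\<in>J. \<bar>\<lceil>M / c j\<rceil>\<bar>)"
  have "blocks \<subseteq> rwt ` box J K"
  proof
    fix d assume d: "d \<in> blocks"
    then have d': "d \<in> int_lattice J" using blocks_eq by blast
    then have dint: "d j \<in> \<int>" for j by (simp add: int_lattice_def)
    have one: "fscale 1 \<alpha> = \<alpha>" "fscale 1 (res \<alpha>) = res \<alpha>" by (auto simp: fscale_def)
    have "d \<in> PJ g \<alpha> J Jp Jm" using d blocks_eq by blast
    then have dP: "d \<in> coord_space J" "d - res \<alpha> \<in> E" "\<forall>j\<in>Jp. 0 \<le> d j" "\<forall>j\<in>Jm. d j \<le> -1"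
      using PJ_iff[of d 1] unfolding one by auto
    have "d j \<le> 0" if "j \<in> Jm" for j using dP(4) that by force
    then have "d \<in> orthant_slice 1" using dP by (simp add: orthant_slice_def one)
    from orthant_slice_bound[OF c this] have eq: "(\<Sum>j\<in>J. c j * \<bar>d j\<bar>) = M" by (simp add: M_def)
    have "\<lfloor>d j\<rfloor> \<in> {- K..K}" if j: "j \<in> J" for j
    proof -
      have "c j * \<bar>d j\<bar> \<le> M" unfolding eq[symmetric] using j c(1) by (intro member_le_sum) auto
      then have "\<bar>d j\<bar> \<le> M / c j" using c(1) j by (simp add: field_simps)
      also have "M / c j \<le> of_int \<bar>\<lceil>M / c j\<rceil>\<bar>" by linarith
      also have "\<bar>\<lceil>M / c j\<rceil>\<bar> \<le> K" unfolding K_def using j by (intro member_le_sum) auto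
      finally have "\<bar>of_int \<lfloor>d j\<rfloor>\<bar> \<le> (of_int K :: rat)" unfolding of_int_floor[OF dint] by simp
      then have "\<bar>\<lfloor>d j\<rfloor>\<bar> \<le> K" by linarith
      then show ?thesis by (simp add: abs_le_iff)
    qed
    then have "(\<lambda>j. \<lfloor>d j\<rfloor>) \<in> box J K" using dP(1) by (auto simp: box_def coord_space_def)
    moreover have "d = rwt (\<lambda>j. \<lfloor>d j\<rfloor>)" unfolding rwt_def of_int_floor[OF dint] ..
    ultimately show "d \<in> rwt ` box J K" by blast
  qed
  then show ?thesis using finite_box[OF finite_J] finite_subset by blast
qed

lemma res_\<alpha>_blocks: "res \<alpha> \<in> blocks"
  using \<alpha>_S by (simp add: blocks_def)

lemma block_diff:
  assumes "d \<in> blocks" "d' \<in> blocks" obtains u where "rwt u = d' - d" "rwt u \<in> E" "\<And>i. i \<notin> J \<Longrightarrow> u i = 0"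
proof -
  obtain \<gamma> \<gamma>' where \<gamma>: "\<gamma> \<in> S" "d = res \<gamma>" "\<gamma>' \<in> S" "d' = res \<gamma>'" using assms by (auto simp: blocks_def)
  obtain v where v: "rwt v = \<gamma>' - \<gamma>" "rwt v \<in> E" using S_diff[OF \<gamma>(3,1)] .
  define u where "u = (\<lambda>i. if i \<in> J then v i else 0)"
  have "rwt u = res (rwt v)" by (auto simp: u_def rwt_def restrict_coord_def)
  then have "rwt u = d' - d" "rwt u \<in> E" using E_restrict[OF v(2)] by (simp_all add: v(1) res_diff \<gamma>)
  moreover have "u i = 0" if "i \<notin> J" for i using that by (simp add: u_def)
  ultimately show thesis using that by blast
qed

lemma block_fixes_res: "d \<in> blocks \<Longrightarrow> res d = d"
  by (auto simp: blocks_def res_idem)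

text \<open>Interpolation with Euler operators: \<pi>_j acts on a block by its j-th label, and two
  different labels differ in some coordinate j in J.\<close>

lemma block_projection_aux:
  assumes "finite Z" "Z \<subseteq> blocks" "d \<in> blocks" "d \<notin> Z"
  shows "\<exists>p\<in>G. \<exists>c. (\<forall>f \<gamma>. act p f \<gamma> = c \<gamma> * f \<gamma>) \<and>
     (\<forall>\<gamma>. (res \<gamma> = d \<longrightarrow> c \<gamma> = 1) \<and> (res \<gamma> \<in> Z \<longrightarrow> c \<gamma> = 0))"
  using assms
proof (induction Z rule: finite_induct)
  case empty
  show ?case
    using homogeneous_1 act_fconst[of 1] by (intro bexI[of _ 1] exI[of _ "\<lambda>_. 1"]) (auto simp: fconst_1)
next
  case (insert e Z)
  then have "\<exists>p\<in>G. \<exists>c. (\<forall>f \<gamma>. act p f \<gamma> = c \<gamma> * f \<gamma>) \<and>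
     (\<forall>\<gamma>. (res \<gamma> = d \<longrightarrow> c \<gamma> = 1) \<and> (res \<gamma> \<in> Z \<longrightarrow> c \<gamma> = 0))" by blast
  then obtain p c where pG: "p \<in> G" and pact: "\<forall>f \<gamma>. act p f \<gamma> = c \<gamma> * f \<gamma>"
    and pc: "\<forall>\<gamma>. (res \<gamma> = d \<longrightarrow> c \<gamma> = 1) \<and> (res \<gamma> \<in> Z \<longrightarrow> c \<gamma> = 0)" by (elim bexE exE conjE)
  have p: "p \<in> G" "act p f \<gamma> = c \<gamma> * f \<gamma>" "res \<gamma> = d \<Longrightarrow> c \<gamma> = 1" "res \<gamma> \<in> Z \<Longrightarrow> c \<gamma> = 0" for f \<gamma>
    using pG pact pc by simp_all
  have "d \<noteq> e" using insert by auto
  moreover have ed: "res d = d" "res e = e" using block_fixes_res insert by auto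
  ultimately obtain j where j: "j \<in> J" "d j \<noteq> e j"
    by (metis (no_types, lifting) ext restrict_coord_def)
  define q where "q = fconst (1 / of_rat (d j - e j)) * (euler_op j - fconst (of_rat (e j)))"
  define b where "b \<gamma> = ((of_rat (\<gamma> j) - of_rat (e j)) / of_rat (d j - e j) :: 'k)" for \<gamma> :: "nat \<Rightarrow> rat"
  have qG: "q \<in> G" unfolding q_def using j(1) J_subset'
    by (intro homogeneous_mult homogeneous_diff homogeneous_fconst homogeneous_pi) auto
  have actq: "act q f \<gamma> = b \<gamma> * f \<gamma>" for f \<gamma>
    by (simp add: q_def b_def act_mult act_fconst act_diff act_pi algebra_simps diff_divide_distrib)
  have resj: "res \<gamma> = x \<Longrightarrow> \<gamma> j = x j" for \<gamma> x using j(1) by (auto simp: restrict_coord_def)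
  have "(of_rat (d j - e j) :: 'k) \<noteq> 0" using j(2) by simp
  then have b1: "b \<gamma> = 1" if "res \<gamma> = d" for \<gamma> using resj[OF that] by (simp add: b_def of_rat_diff)
  have b0: "b \<gamma> = 0" if "res \<gamma> = e" for \<gamma> using resj[OF that] by (simp add: b_def)
  show ?case
  proof (intro bexI[of _ "q * p"] exI[of _ "\<lambda>\<gamma>. b \<gamma> * c \<gamma>"] conjI allI impI)
    show "act (q * p) f \<gamma> = b \<gamma> * c \<gamma> * f \<gamma>" for f \<gamma> by (simp add: act_mult actq p(2))
  qed (use p b0 b1 qG in \<open>auto intro: homogeneous_mult\<close>)
qed

text \<open>The matrix unit between two blocks, up to a nonzero scalar.\<close>

definition is_transition :: "(nat \<Rightarrow> rat) \<Rightarrow> (nat \<Rightarrow> rat) \<Rightarrow> 'k \<Rightarrow> 'k free_alg \<Rightarrow> bool" where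
  "is_transition d' d \<kappa> p \<longleftrightarrow> p \<in> G \<and> \<kappa> \<noteq> 0 \<and>
     (\<forall>f \<gamma>. supported f S \<longrightarrow> \<gamma> \<in> S \<longrightarrow> rho p f \<gamma> = (if res \<gamma> = d' then \<kappa> * f (\<gamma> - (d' - d)) else 0))"

lemma block_projection:
  assumes "d \<in> blocks" shows "\<exists>p. is_transition d d 1 p"
proof -
  have "\<exists>p\<in>G. \<exists>c. (\<forall>f \<gamma>. act p f \<gamma> = c \<gamma> * f \<gamma>) \<and>
     (\<forall>\<gamma>. (res \<gamma> = d \<longrightarrow> c \<gamma> = 1) \<and> (res \<gamma> \<in> blocks - {d} \<longrightarrow> c \<gamma> = 0))"
    using finite_blocks assms by (intro block_projection_aux) auto
  then obtain p c where pG: "p \<in> G" and pact: "\<forall>f \<gamma>. act p f \<gamma> = c \<gamma> * f \<gamma>"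
    and pc: "\<forall>\<gamma>. (res \<gamma> = d \<longrightarrow> c \<gamma> = 1) \<and> (res \<gamma> \<in> blocks - {d} \<longrightarrow> c \<gamma> = 0)" by (elim bexE exE conjE)
  have p: "p \<in> G" "act p f \<gamma> = c \<gamma> * f \<gamma>" "res \<gamma> = d \<Longrightarrow> c \<gamma> = 1" "res \<gamma> \<in> blocks - {d} \<Longrightarrow> c \<gamma> = 0" for f \<gamma>
    using pG pact pc by simp_all
  have "rho p f \<gamma> = (if res \<gamma> = d then f \<gamma> else 0)" if "\<gamma> \<in> S" for f \<gamma>
    using p(3)[of \<gamma>] p(4)[of \<gamma>] that by (auto simp: rho_def p(2) blocks_def)
  then show ?thesis using p(1) by (auto simp: is_transition_def intro!: exI[of _ p])
qed

text \<open>All blocks are translates of the same cone, since sign conditions outside J do not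
  involve the label.\<close>

lemma S_block_shift:
  assumes "\<gamma> \<in> S" "d \<in> blocks" "d' \<in> blocks" "res \<gamma> = d'"
  shows "\<gamma> - (d' - d) \<in> S" "res (\<gamma> - (d' - d)) = d"
proof -
  obtain u where u: "rwt u = d' - d" "rwt u \<in> E" "\<And>i. i \<notin> J \<Longrightarrow> u i = 0" using block_diff[OF assms(2,3)] by blast
  show r: "res (\<gamma> - (d' - d)) = d" using assms block_fixes_res by (simp add: res_diff)
  have c: "\<gamma> - (d' - d) \<in> coset" using coset_diff[OF S_coset[OF assms(1)] u(2)] by (simp add: u(1))
  show "\<gamma> - (d' - d) \<in> S"
  proof (rule S_if_block[OF c])
    show "res (\<gamma> - (d' - d)) \<in> blocks" using r assms by simp
    fix i assume i: "i \<in> T - J"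
    then have "(d' - d) i = 0" using u by (metis DiffE of_int_0 rwt_def)
    then show "(0 \<le> (\<gamma> - (d' - d)) i) = (0 \<le> \<alpha> i)" using assms(1) i by (simp add: S_def)
  qed
qed

text \<open>The normal word of weight d' - d involves letters with index in J only, so its
  coefficient is constant on the block d'. Composing with the projection to this block removes all
  other rows.\<close>

lemma transition_exists:
  assumes d: "d \<in> blocks" "d' \<in> blocks"
  shows "\<exists>\<kappa> p. is_transition d' d \<kappa> p"
proof -
  obtain u where u: "rwt u = d' - d" "rwt u \<in> E" "\<And>i. i \<notin> J \<Longrightarrow> u i = 0" using block_diff[OF d] by blast
  obtain p where p: "is_transition d' d' 1 p" using block_projection[OF d(2)] by blast
  define m where "m = (mon (normal_word u) :: 'k free_alg)"
  have mG: "m \<in> G" unfolding m_def by (rule normal_word_G[OF u(2)])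
  define \<kappa> where "\<kappa> = (list_coeff (normal_word u) d' :: 'k)"
  have coeff: "list_coeff (normal_word u) \<gamma> = \<kappa>" if "res \<gamma> = d'" for \<gamma>
    unfolding \<kappa>_def list_coeff_normal_word
  proof (rule prod.cong[OF refl])
    fix i
    show "list_coeff (blk i (u i)) \<gamma> = (list_coeff (blk i (u i)) d' :: 'k)"
    proof (cases "i \<in> J")
      case True
      then have "\<gamma> i = d' i" using that by (auto simp: restrict_coord_def)
      then show ?thesis by (simp only: list_coeff_blk)
    qed (simp add: u(3) list_coeff_blk)
  qed
  obtain \<gamma>0 where \<gamma>0: "\<gamma>0 \<in> S" "res \<gamma>0 = d'" using d(2) by (auto simp: blocks_def)
  have "\<kappa> \<noteq> 0"
    using list_coeff_nonzero[OF \<gamma>0(1), of u] S_block_shift(1)[OF \<gamma>0(1) d \<gamma>0(2)] coeff[OF \<gamma>0(2)] u(1) by simp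
  moreover have "rho (p * m) f \<gamma> = (if res \<gamma> = d' then \<kappa> * f (\<gamma> - (d' - d)) else 0)"
    if f: "supported f S" and \<gamma>: "\<gamma> \<in> S" for f \<gamma>
  proof -
    have pG: "p \<in> G" using p by (simp add: is_transition_def)
    have "rho (p * m) f \<gamma> = (if res \<gamma> = d' then rho m f \<gamma> else 0)"
      using p \<gamma> supported_rho unfolding rho_mult[OF pG mG f] is_transition_def by simp
    also have "\<dots> = (if res \<gamma> = d' then \<kappa> * f (\<gamma> - (d' - d)) else 0)"
      using \<gamma> coeff by (simp add: rho_def m_def act_mon normal_word_wt[OF u(2)] u(1))
    finally show ?thesis .
  qed
  ultimately show ?thesis using p mG unfolding is_transition_def by (blast intro: homogeneous_mult)
qed

end

section \<open>Absence of zero divisors\<close>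

text \<open>Leading terms for a lexicographic order: one coordinate is maximised at a time, and a
  sum that attains both maxima must have both summands maximal.\<close>

lemma unique_sum:
  fixes P Q :: "(nat \<Rightarrow> int) set"
  assumes "finite I" "finite P" "P \<noteq> {}" "finite Q" "Q \<noteq> {}"
  shows "\<exists>a\<in>P. \<exists>b\<in>Q. \<forall>a'\<in>P. \<forall>b'\<in>Q. (\<forall>i\<in>I. a' i + b' i = a i + b i) \<longrightarrow> (\<forall>i\<in>I. a' i = a i \<and> b' i = b i)"
  using assms
proof (induction I arbitrary: P Q rule: finite_induct)
  case empty
  then show ?case by auto
next
  case (insert i I)
  define M N where "M = Max ((\<lambda>a. a i) ` P)" and "N = Max ((\<lambda>b. b i) ` Q)"
  define P' Q' where "P' = {a \<in> P. a i = M}" and "Q' = {b \<in> Q. b i = N}"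
  have le: "a i \<le> M" if "a \<in> P" for a unfolding M_def using that insert.prems by (intro Max_ge) auto
  have le': "b i \<le> N" if "b \<in> Q" for b unfolding N_def using that insert.prems by (intro Max_ge) auto
  have "M \<in> (\<lambda>a. a i) ` P" unfolding M_def using insert.prems by (intro Max_in) auto
  then have P': "P' \<noteq> {}" "finite P'" using insert.prems by (auto simp: P'_def)
  have "N \<in> (\<lambda>b. b i) ` Q" unfolding N_def using insert.prems by (intro Max_in) auto
  then have Q': "Q' \<noteq> {}" "finite Q'" using insert.prems by (auto simp: Q'_def)
  obtain a b where ab: "a \<in> P'" "b \<in> Q'"
    and uniq: "\<forall>a'\<in>P'. \<forall>b'\<in>Q'. (\<forall>i\<in>I. a' i + b' i = a i + b i) \<longrightarrow> (\<forall>i\<in>I. a' i = a i \<and> b' i = b i)"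
    using insert.IH[OF P'(2,1) Q'(2,1)] by blast
  have claim: "\<forall>j\<in>insert i I. a' j = a j \<and> b' j = b j"
    if a': "a' \<in> P" and b': "b' \<in> Q" and eq: "\<forall>j\<in>insert i I. a' j + b' j = a j + b j" for a' b'
  proof -
    have "a' i + b' i = M + N" using eq ab by (simp add: P'_def Q'_def)
    then have i: "a' i = M" "b' i = N" using le[OF a'] le'[OF b'] by linarith+
    have "a' \<in> P'" "b' \<in> Q'" using a' b' i by (simp_all add: P'_def Q'_def)
    from bspec[OF bspec[OF uniq this(1)] this(2)]
    have "\<forall>j\<in>I. a' j = a j \<and> b' j = b j" using eq by blast
    then show ?thesis using i ab by (simp add: P'_def Q'_def)
  qed
  have "a \<in> P" "b \<in> Q" using ab by (simp_all add: P'_def Q'_def)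
  moreover have "\<forall>a'\<in>P. \<forall>b'\<in>Q. (\<forall>j\<in>insert i I. a' j + b' j = a j + b j) \<longrightarrow> (\<forall>j\<in>insert i I. a' j = a j \<and> b' j = b j)"
    by (intro ballI impI) (rule claim[THEN bspec])
  ultimately show ?case by (intro bexI[of _ a P] bexI[of _ b Q])
qed

definition poly_fun :: "(rat \<Rightarrow> 'k::field_char_0) \<Rightarrow> bool" where
  "poly_fun \<phi> \<longleftrightarrow> (\<exists>P. \<forall>x. \<phi> x = poly P (of_rat x))"

lemma poly_fun_const: "poly_fun (\<lambda>_. c)"
  unfolding poly_fun_def by (rule exI[of _ "[:c:]"]) simp

lemma poly_fun_of_rat: "poly_fun (\<lambda>x. of_rat (a + x * b))"
  unfolding poly_fun_def by (rule exI[of _ "[:of_rat a, of_rat b:]"]) (simp add: of_rat_add of_rat_mult)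

lemma poly_fun_add: "poly_fun \<phi> \<Longrightarrow> poly_fun \<psi> \<Longrightarrow> poly_fun (\<lambda>x. \<phi> x + \<psi> x)"
  unfolding poly_fun_def by (metis poly_add)

lemma poly_fun_mult: "poly_fun \<phi> \<Longrightarrow> poly_fun \<psi> \<Longrightarrow> poly_fun (\<lambda>x. \<phi> x * \<psi> x)"
  unfolding poly_fun_def by (metis poly_mult)

lemma poly_fun_sum: "(\<And>i. i \<in> S \<Longrightarrow> poly_fun (\<phi> i)) \<Longrightarrow> poly_fun (\<lambda>x. \<Sum>i\<in>S. \<phi> i x)"
  by (induction S rule: infinite_finite_induct) (auto intro: poly_fun_const poly_fun_add)

text \<open>A product of two nonzero polynomials has finitely many roots, so a common nonvanishing
  point exists among arbitrarily large natural numbers.\<close>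

lemma poly_fun_common_nonzero:
  fixes \<phi> \<psi> :: "rat \<Rightarrow> 'a::field_char_0"
  assumes "poly_fun \<phi>" "poly_fun \<psi>" "\<phi> a \<noteq> 0" "\<psi> b \<noteq> 0"
  shows "\<exists>n\<ge>M. \<phi> (of_nat n) \<noteq> 0 \<and> \<psi> (of_nat n) \<noteq> 0"
proof (rule ccontr)
  assume not: "\<not> ?thesis"
  obtain P where P: "\<And>x. \<phi> x = poly P (of_rat x)" using assms(1) by (auto simp: poly_fun_def)
  obtain Q where Q: "\<And>x. \<psi> x = poly Q (of_rat x)" using assms(2) by (auto simp: poly_fun_def)
  have "P \<noteq> 0" "Q \<noteq> 0" using assms(3,4) by (auto simp: P Q)
  then have "finite {x. poly (P * Q) x = 0}" by (intro poly_roots_finite) simp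
  moreover have "of_nat ` {M..} \<subseteq> {x. poly (P * Q) x = 0}"
    using not by (auto simp: P Q)
  moreover have "infinite ((of_nat :: nat \<Rightarrow> 'a) ` {M..})"
    by (auto dest!: finite_imageD simp: inj_on_def infinite_Ici)
  ultimately show False using finite_subset by blast
qed

lemma poly_fun_gen_coeff: "poly_fun (\<lambda>x. gen_coeff a (\<zeta> + fscale x v))"
proof (cases a)
  case (GD i)
  have eq: "gen_coeff a (\<zeta> + fscale x v) = of_rat ((\<zeta> i + 1) + x * v i)" for x
    by (simp add: GD fscale_def algebra_simps)
  show ?thesis unfolding eq by (rule poly_fun_of_rat)
qed (simp_all add: poly_fun_const)

lemma poly_fun_list_coeff: "poly_fun (\<lambda>x. list_coeff l (\<zeta> + fscale x v))"
proof (induction l arbitrary: \<zeta>)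
  case (Cons a l)
  have "\<zeta> + fscale x v - rwt (gen_wt a) = (\<zeta> - rwt (gen_wt a)) + fscale x v" for x by simp
  then have eq: "list_coeff (a # l) (\<zeta> + fscale x v) =
      gen_coeff a (\<zeta> + fscale x v) * list_coeff l ((\<zeta> - rwt (gen_wt a)) + fscale x v)" for x
    by (simp only: list_coeff.simps)
  show ?case unfolding eq by (rule poly_fun_mult[OF poly_fun_gen_coeff Cons])
qed (simp add: poly_fun_const)

lemma fscale_zero [simp]: "fscale c 0 = 0" and fscale_one [simp]: "fscale 1 v = v"
  and fscale_0_left [simp]: "fscale 0 v = 0"
  by (auto simp: fscale_def)

context typed_point
begin

abbreviation wts :: "'k free_alg \<Rightarrow> (nat \<Rightarrow> int) set" where
  "wts p \<equiv> (\<lambda>w. list_wt (letters w)) ` Poly_Mapping.keys p"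

text \<open>The polynomial coefficient of the translation by u when p is written as a difference
  operator.\<close>

definition wt_coeff :: "'k free_alg \<Rightarrow> (nat \<Rightarrow> int) \<Rightarrow> (nat \<Rightarrow> rat) \<Rightarrow> 'k" where
  "wt_coeff p u \<zeta> = (\<Sum>w\<in>{w \<in> Poly_Mapping.keys p. list_wt (letters w) = u}. Poly_Mapping.lookup p w * list_coeff (letters w) \<zeta>)"

lemma act_wt_coeff: "act p f \<zeta> = (\<Sum>u\<in>wts p. wt_coeff p u \<zeta> * f (\<zeta> - rwt u))"
proof -
  have "act p f \<zeta> = (\<Sum>u\<in>wts p. \<Sum>w\<in>{w \<in> Poly_Mapping.keys p. list_wt (letters w) = u}.
      Poly_Mapping.lookup p w * list_coeff (letters w) \<zeta> * f (\<zeta> - rwt (list_wt (letters w))))"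
    unfolding act_def by (rule sum.image_gen) simp
  also have "\<dots> = (\<Sum>u\<in>wts p. wt_coeff p u \<zeta> * f (\<zeta> - rwt u))"
    unfolding wt_coeff_def sum_distrib_right by (intro sum.cong) auto
  finally show ?thesis .
qed

lemma wt_coeff_nonzero_wts: "wt_coeff p u \<zeta> \<noteq> 0 \<Longrightarrow> u \<in> wts p"
  unfolding wt_coeff_def using sum.not_neutral_contains_not_neutral by fastforce

lemma act_delta: "act p (delta (\<zeta> - rwt u)) \<zeta> = wt_coeff p u \<zeta>"
proof -
  have "act p (delta (\<zeta> - rwt u)) \<zeta> = (\<Sum>v\<in>wts p. if v = u then wt_coeff p u \<zeta> else 0)"
    unfolding act_wt_coeff by (intro sum.cong) (auto simp: delta_def rwt_inject)
  also have "\<dots> = wt_coeff p u \<zeta>"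
    using wt_coeff_nonzero_wts[of p u \<zeta>] by auto
  finally show ?thesis .
qed

lemma poly_fun_wt_coeff: "poly_fun (\<lambda>x. wt_coeff p u (\<zeta> + fscale x v))"
  unfolding wt_coeff_def by (intro poly_fun_sum poly_fun_mult poly_fun_const poly_fun_list_coeff)

lemma wts_E: "p \<in> G \<Longrightarrow> u \<in> wts p \<Longrightarrow> rwt u \<in> E"
  using G_weight_E by auto

lemma wts_outside: "p \<in> G \<Longrightarrow> u \<in> wts p \<Longrightarrow> i \<notin> {1..r+s} \<Longrightarrow> u i = 0"
  using wts_E[of p u] by (auto simp: mem_E_iff coord_space_def rwt_def)

lemma rwt_scale_int: "fscale (of_int n) (rwt u) = rwt (\<lambda>i. n * u i)"
  by (auto simp: fscale_def rwt_def)

lemma deep_S: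
  assumes "\<gamma> \<in> coset" "res \<gamma> \<in> blocks" "rwt w \<in> E" "res (rwt w) = 0"
    and w: "\<And>i. i \<in> T - J \<Longrightarrow> (if 0 \<le> \<alpha> i then 0 < w i else w i < 0)"
  shows "\<exists>M. \<forall>n\<ge>M. \<gamma> + fscale (of_nat n) (rwt w) \<in> S"
proof -
  define M where "M = (\<Sum>i\<in>T. nat \<lceil>\<bar>\<gamma> i\<bar>\<rceil> + 1)"
  have finT: "finite T" by (auto simp: Tset_def)
  have "\<gamma> + fscale (of_nat n) (rwt w) \<in> S" if n: "n \<ge> M" for n
  proof (rule S_if_block)
    have e: "fscale (of_nat n) (rwt w) = rwt (\<lambda>i. int n * w i)" using rwt_scale_int[of "int n" w] by simp
    have "rwt (\<lambda>i. int n * w i) \<in> E" using E_scale[OF assms(3), of "of_nat n"] by (simp only: e)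
    then show "\<gamma> + fscale (of_nat n) (rwt w) \<in> coset" unfolding e by (rule coset_add[OF assms(1)])
    show "res (\<gamma> + fscale (of_nat n) (rwt w)) \<in> blocks"
      unfolding res_add res_scale assms(4) fscale_zero add_0_right by (rule assms(2))
    fix i assume i: "i \<in> T - J"
    have "nat \<lceil>\<bar>\<gamma> i\<bar>\<rceil> + 1 \<le> M" unfolding M_def
      using i by (intro member_le_sum[where f = "\<lambda>i. nat \<lceil>\<bar>\<gamma> i\<bar>\<rceil> + 1"] finT) auto
    then have "int (nat \<lceil>\<bar>\<gamma> i\<bar>\<rceil>) + 1 \<le> int n" using n by linarith
    then have "\<lceil>\<bar>\<gamma> i\<bar>\<rceil> < int n" by linarith
    then have gn: "\<bar>\<gamma> i\<bar> < of_nat n" by linarith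
    show "(0 \<le> (\<gamma> + fscale (of_nat n) (rwt w)) i) = (0 \<le> \<alpha> i)"
    proof (cases "0 \<le> \<alpha> i")
      case True
      then have "1 \<le> w i" using w[OF i] by simp
      then have "(1::rat) \<le> of_int (w i)" by simp
      then have "of_nat n * 1 \<le> of_nat n * (of_int (w i) :: rat)" by (intro mult_left_mono) auto
      then show ?thesis using gn True by (simp add: fscale_def rwt_def)
    next
      case False
      then have "w i \<le> -1" using w[OF i] by simp
      then have "of_int (w i) \<le> (-1::rat)" by linarith
      then have "of_nat n * (of_int (w i) :: rat) \<le> of_nat n * (- 1)" by (intro mult_left_mono) auto
      then show ?thesis using gn False by (simp add: fscale_def rwt_def)
    qed
  qed
  then show ?thesis by blast
qed

text \<open>Zariski density: two coefficient functions, each nonzero at some point of a coset with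
  prescribed coordinates in \<open>J\<close>, are nonzero at a common point as deep as desired inside the cone.\<close>

lemma common_deep_point:
  assumes p: "\<zeta>1 \<in> coset" "res \<zeta>1 = d" "wt_coeff p v1 \<zeta>1 \<noteq> 0"
    and q: "\<zeta>2 \<in> coset" "res \<zeta>2 = d" "wt_coeff q v2 (\<zeta>2 - b) \<noteq> 0"
    and fin: "finite V" "\<And>v. v \<in> V \<Longrightarrow> rwt v \<in> E \<and> d - res (rwt v) \<in> blocks"
  shows "\<exists>\<zeta>\<in>coset. res \<zeta> = d \<and> wt_coeff p v1 \<zeta> \<noteq> 0 \<and> wt_coeff q v2 (\<zeta> - b) \<noteq> 0 \<and> (\<forall>v\<in>V. \<zeta> - rwt v \<in> S)"
proof -
  obtain y where y: "rwt y = \<zeta>2 - \<zeta>1" "rwt y \<in> E" using coset_diff_rwt[OF q(1) p(1)] .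
  have l2: "\<zeta>1 + fscale x v - b = (\<zeta>1 - b) + fscale x v" for \<zeta>1 x v by simp
  \<comment> \<open>Both coefficients are polynomials along the line through \<zeta>1 and \<zeta>2.
    One is nonzero at parameter 0, the other at parameter 1.\<close>
  have "\<exists>n\<ge>0. wt_coeff p v1 (\<zeta>1 + fscale (of_nat n) (rwt y)) \<noteq> 0 \<and>
     wt_coeff q v2 ((\<zeta>1 - b) + fscale (of_nat n) (rwt y)) \<noteq> 0"
  proof (rule poly_fun_common_nonzero[OF poly_fun_wt_coeff poly_fun_wt_coeff])
    show "wt_coeff p v1 (\<zeta>1 + fscale 0 (rwt y)) \<noteq> 0" using p(3) by simp
    have e: "(\<zeta>1 - b) + fscale 1 (rwt y) = \<zeta>2 - b" by (simp only: fscale_one y(1)) simp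
    show "wt_coeff q v2 ((\<zeta>1 - b) + fscale 1 (rwt y)) \<noteq> 0" unfolding e by (rule q(3))
  qed
  then obtain n where n: "wt_coeff p v1 (\<zeta>1 + fscale (of_nat n) (rwt y)) \<noteq> 0"
    "wt_coeff q v2 ((\<zeta>1 - b) + fscale (of_nat n) (rwt y)) \<noteq> 0" by blast
  define \<zeta>0 where "\<zeta>0 = \<zeta>1 + fscale (of_nat n) (rwt y)"
  have e: "fscale (of_nat n) (rwt y) = rwt (\<lambda>i. int n * y i)" using rwt_scale_int[of "int n" y] by simp
  have "rwt (\<lambda>i. int n * y i) \<in> E" using E_scale[OF y(2), of "of_nat n"] by (simp only: e)
  then have \<zeta>0: "\<zeta>0 \<in> coset" unfolding \<zeta>0_def e by (rule coset_add[OF p(1)])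
  have "res (rwt y) = 0" unfolding y(1) res_diff p(2) q(2) by simp
  then have res0: "res \<zeta>0 = d" unfolding \<zeta>0_def res_add res_scale p(2) by simp
  have nz0: "wt_coeff p v1 \<zeta>0 \<noteq> 0" "wt_coeff q v2 (\<zeta>0 - b) \<noteq> 0"
    using n unfolding \<zeta>0_def l2 by auto
  obtain w where w: "rwt w \<in> E" "res (rwt w) = 0"
    and wT: "\<And>i. i \<in> T - J \<Longrightarrow> (if 0 \<le> \<alpha> i then 0 < w i else w i < 0)" using deep_direction by blast
  have "\<exists>M. \<forall>n\<ge>M. (\<zeta>0 - rwt v) + fscale (of_nat n) (rwt w) \<in> S" if "v \<in> V" for v
    using fin(2)[OF that] res0
    by (intro deep_S coset_diff \<zeta>0 w wT) (auto simp: res_diff)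
  then have "\<forall>v. \<exists>M. v \<in> V \<longrightarrow> (\<forall>n\<ge>M. (\<zeta>0 - rwt v) + fscale (of_nat n) (rwt w) \<in> S)" by blast
  from choice[OF this] obtain M where
    M: "\<And>v n. v \<in> V \<Longrightarrow> n \<ge> M v \<Longrightarrow> (\<zeta>0 - rwt v) + fscale (of_nat n) (rwt w) \<in> S" by blast
  \<comment> \<open>The same argument in the direction w. The lower bound on n pushes all finitely
    many translates into \<open>S\<close>.\<close>
  have "\<exists>n\<ge>(\<Sum>v\<in>V. M v). wt_coeff p v1 (\<zeta>0 + fscale (of_nat n) (rwt w)) \<noteq> 0 \<and>
     wt_coeff q v2 ((\<zeta>0 - b) + fscale (of_nat n) (rwt w)) \<noteq> 0"
    by (rule poly_fun_common_nonzero[OF poly_fun_wt_coeff poly_fun_wt_coeff, where a = 0 and b = 0])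
      (use nz0 in simp_all)
  then obtain n where n: "n \<ge> (\<Sum>v\<in>V. M v)" "wt_coeff p v1 (\<zeta>0 + fscale (of_nat n) (rwt w)) \<noteq> 0"
    "wt_coeff q v2 ((\<zeta>0 - b) + fscale (of_nat n) (rwt w)) \<noteq> 0" by blast
  define \<zeta> where "\<zeta> = \<zeta>0 + fscale (of_nat n) (rwt w)"
  have e': "fscale (of_nat n) (rwt w) = rwt (\<lambda>i. int n * w i)" using rwt_scale_int[of "int n" w] by simp
  have "rwt (\<lambda>i. int n * w i) \<in> E" using E_scale[OF w(1), of "of_nat n"] by (simp only: e')
  then have "\<zeta> \<in> coset" unfolding \<zeta>_def e' by (rule coset_add[OF \<zeta>0])
  moreover have "res \<zeta> = d" unfolding \<zeta>_def res_add res_scale res0 w(2) by simp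
  moreover have "\<zeta> - rwt v \<in> S" if v: "v \<in> V" for v
  proof -
    have "M v \<le> (\<Sum>v\<in>V. M v)" using v fin(1) by (intro member_le_sum) auto
    then have "M v \<le> n" using n(1) by linarith
    moreover have e: "\<zeta> - rwt v = (\<zeta>0 - rwt v) + fscale (of_nat n) (rwt w)" by (simp add: \<zeta>_def)
    ultimately show ?thesis unfolding e by (intro M v)
  qed
  moreover have "wt_coeff p v1 \<zeta> \<noteq> 0" "wt_coeff q v2 (\<zeta> - b) \<noteq> 0"
    using n(2,3) unfolding \<zeta>_def l2 by auto
  ultimately show ?thesis by blast
qed

text \<open>The analogue of the absence of zero divisors: the leading coefficients multiply.\<close>

lemma transition_product_nonzero:
  assumes p: "p \<in> G" "\<gamma> \<in> S" "\<gamma>' \<in> S" "act p (delta \<gamma>) \<gamma>' \<noteq> 0"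
    and q: "q \<in> G" "\<eta> \<in> S" "\<eta>' \<in> S" "act q (delta \<eta>) \<eta>' \<noteq> 0"
    and tr: "is_transition (res \<gamma>) (res \<eta>') \<kappa> m"
  shows "\<not> kills (p * (m * q))"
proof -
  define d1 d' d d2 where "d1 = res \<gamma>'" and "d' = res \<gamma>" and "d = res \<eta>'" and "d2 = res \<eta>"
  have blocks: "d1 \<in> blocks" "d' \<in> blocks" "d \<in> blocks" "d2 \<in> blocks"
    using p q by (auto simp: blocks_def d1_def d'_def d_def d2_def)
  have mG: "m \<in> G" and \<kappa>: "\<kappa> \<noteq> 0"
    and m: "\<And>f \<gamma>. supported f S \<Longrightarrow> \<gamma> \<in> S \<Longrightarrow> rho m f \<gamma> = (if res \<gamma> = d' then \<kappa> * f (\<gamma> - (d' - d)) else 0)"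
    using tr by (auto simp: is_transition_def d'_def d_def)
  obtain u where u: "rwt u = d' - d" "rwt u \<in> E" using block_diff[OF blocks(3,2)] by blast
  define P where "P = {v \<in> wts p. res (rwt v) = d1 - d' \<and> (\<exists>\<zeta>\<in>coset. res \<zeta> = d1 \<and> wt_coeff p v \<zeta> \<noteq> 0)}"
  define Q where "Q = {v \<in> wts q. res (rwt v) = d - d2 \<and> (\<exists>\<zeta>\<in>coset. res \<zeta> = d \<and> wt_coeff q v \<zeta> \<noteq> 0)}"
  have P: "P \<noteq> {}"
  proof -
    obtain v where v: "rwt v = \<gamma>' - \<gamma>" using S_diff[OF p(3,2)] .
    then have "\<gamma> = \<gamma>' - rwt v" by simp
    then have "wt_coeff p v \<gamma>' \<noteq> 0" using p(4) act_delta[of p \<gamma>' v] by simp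
    moreover have "res (rwt v) = d1 - d'" by (simp add: v res_diff d1_def d'_def)
    ultimately have "v \<in> P" unfolding P_def using wt_coeff_nonzero_wts S_coset[OF p(3)] d1_def by blast
    then show ?thesis by blast
  qed
  have Q: "Q \<noteq> {}"
  proof -
    obtain v where v: "rwt v = \<eta>' - \<eta>" using S_diff[OF q(3,2)] .
    then have "\<eta> = \<eta>' - rwt v" by simp
    then have "wt_coeff q v \<eta>' \<noteq> 0" using q(4) act_delta[of q \<eta>' v] by simp
    moreover have "res (rwt v) = d - d2" by (simp add: v res_diff d_def d2_def)
    ultimately have "v \<in> Q" unfolding Q_def using wt_coeff_nonzero_wts S_coset[OF q(3)] d_def by blast
    then show ?thesis by blast
  qed
  have "finite P" "finite Q" by (auto simp: P_def Q_def)
  \<comment> \<open>P and Q collect the shifts of p and q between the prescribed blocks whose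
    coefficients do not vanish identically there. The chosen pair acts as a pair of leading terms:
    no other pair yields the same total shift.\<close>
  then obtain v1 v2 where v: "v1 \<in> P" "v2 \<in> Q" and uniq: "\<forall>a\<in>P. \<forall>b\<in>Q.
      (\<forall>i\<in>{1..r+s}. a i + b i = v1 i + v2 i) \<longrightarrow> (\<forall>i\<in>{1..r+s}. a i = v1 i \<and> b i = v2 i)"
    using unique_sum[OF finite_atLeastAtMost _ P _ Q, of 1 "r+s"] by blast
  have v1: "v1 \<in> wts p" "res (rwt v1) = d1 - d'" "rwt v1 \<in> E" and v2: "v2 \<in> wts q" "res (rwt v2) = d - d2" "rwt v2 \<in> E"
    using v wts_E p(1) q(1) by (auto simp: P_def Q_def)
  obtain \<zeta>1 where \<zeta>1: "\<zeta>1 \<in> coset" "res \<zeta>1 = d1" "wt_coeff p v1 \<zeta>1 \<noteq> 0" using v(1) by (auto simp: P_def)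
  obtain \<zeta>2 where \<zeta>2: "\<zeta>2 \<in> coset" "res \<zeta>2 = d" "wt_coeff q v2 \<zeta>2 \<noteq> 0" using v(2) by (auto simp: Q_def)
  have sumE: "rwt (v1 + u) \<in> E" "rwt (v1 + u + v2) \<in> E" unfolding rwt_add by (intro E_add v1 v2 u)+
  have resu: "res (rwt u) = d' - d" using block_fixes_res blocks by (simp add: u(1) res_diff)
  \<comment> \<open>The four stations of the path from \<zeta> back to \<xi>. All of them must lie
    in \<open>S\<close>, as truncation would otherwise destroy the matrix entry.\<close>
  let ?V = "{0, v1, v1 + u, v1 + u + v2}"
  have "\<exists>\<zeta>\<in>coset. res \<zeta> = d1 \<and> wt_coeff p v1 \<zeta> \<noteq> 0 \<and> wt_coeff q v2 (\<zeta> - rwt (v1 + u)) \<noteq> 0 \<and> (\<forall>v\<in>?V. \<zeta> - rwt v \<in> S)"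
  proof (rule common_deep_point[OF \<zeta>1])
    show "\<zeta>2 + rwt (v1 + u) \<in> coset" by (rule coset_add[OF \<zeta>2(1) sumE(1)])
    show "res (\<zeta>2 + rwt (v1 + u)) = d1" by (simp add: res_add rwt_add \<zeta>2 v1 resu)
    show "wt_coeff q v2 (\<zeta>2 + rwt (v1 + u) - rwt (v1 + u)) \<noteq> 0" using \<zeta>2(3) by simp
    have "d1 - res (rwt 0) = d1" by (simp add: rwt_0 restrict_coord_def fun_eq_iff)
    moreover have "d1 - res (rwt v1) = d'" "d1 - res (rwt (v1 + u)) = d" "d1 - res (rwt (v1 + u + v2)) = d2"
      by (simp_all add: rwt_add res_add v1 v2 resu)
    ultimately show "rwt v \<in> E \<and> d1 - res (rwt v) \<in> blocks" if "v \<in> ?V" for v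
      using that blocks sumE v1(3) E_0 rwt_0 by auto
  qed simp
  then obtain \<zeta> where \<zeta>: "\<zeta> \<in> coset" "res \<zeta> = d1" "wt_coeff p v1 \<zeta> \<noteq> 0" "wt_coeff q v2 (\<zeta> - rwt (v1 + u)) \<noteq> 0"
    and \<zeta>S: "\<forall>v\<in>?V. \<zeta> - rwt v \<in> S" by blast
  have S0: "\<zeta> \<in> S" "\<zeta> - rwt v1 \<in> S" "\<zeta> - rwt (v1 + u) \<in> S" "\<zeta> - rwt (v1 + u + v2) \<in> S"
    using \<zeta>S by (auto simp: rwt_0)
  define \<xi> where "\<xi> = \<zeta> - rwt (v1 + u + v2)"
  have \<xi>S: "supported (delta \<xi> :: _ \<Rightarrow> 'k) S" using S0(4) by (intro supported_delta) (simp add: \<xi>_def)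
  define f where "f = rho m (rho q (delta \<xi>))"
  have rho: "rho (p * (m * q)) (delta \<xi>) = rho p f"
    unfolding f_def by (simp add: rho_mult homogeneous_mult p q mG \<xi>S supported_rho)
  have f: "f y = (if res y = d' then \<kappa> * rho q (delta \<xi>) (y - (d' - d)) else 0)" if "y \<in> S" for y
    unfolding f_def using m[OF supported_rho that] .
  have "wt_coeff p v \<zeta> * f (\<zeta> - rwt v) = 0" if vp: "v \<in> wts p" "v \<noteq> v1" for v
  proof (rule ccontr)
    assume nz: "wt_coeff p v \<zeta> * f (\<zeta> - rwt v) \<noteq> 0"
    then have yS: "\<zeta> - rwt v \<in> S" by (auto simp: f_def rho_def split: if_splits)
    have ry: "res (\<zeta> - rwt v) = d'" and nzq: "rho q (delta \<xi>) (\<zeta> - rwt v - (d' - d)) \<noteq> 0"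
      using nz f[OF yS] by (auto split: if_splits)
    have vP: "v \<in> P" using vp(1) nz ry \<zeta> by (auto simp: P_def res_diff)
    define y where "y = \<zeta> - rwt v - rwt u"
    have yS': "y \<in> S" and ynz: "act q (delta \<xi>) y \<noteq> 0"
      using nzq unfolding rho_def y_def u(1) by (auto split: if_splits)
    \<comment> \<open>Any other contribution to the entry at (\<zeta>, \<xi>) would be a second pair
      with the same total shift, against the choice of v1 and v2.\<close>
    define v' where "v' = v1 + v2 - v"
    have \<xi>y: "\<xi> = y - rwt v'" by (simp add: \<xi>_def y_def v'_def rwt_add rwt_diff algebra_simps)
    have wq: "wt_coeff q v' y \<noteq> 0" using ynz act_delta[of q y v'] by (simp add: \<xi>y)
    have resy: "res y = d" using ry by (simp add: y_def res_diff resu)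
    have "res \<xi> = d2" by (simp add: \<xi>_def res_diff rwt_add res_add \<zeta>(2) v1 v2 resu)
    moreover have "rwt v' = y - \<xi>" by (simp add: \<xi>y)
    ultimately have "res (rwt v') = d - d2" by (simp add: res_diff resy)
    then have vQ: "v' \<in> Q" unfolding Q_def using wq wt_coeff_nonzero_wts resy S_coset[OF yS'] by blast
    have "v i + v' i = v1 i + v2 i" for i by (simp add: v'_def)
    then have "\<forall>i\<in>{1..r+s}. v i = v1 i" using uniq vP vQ by blast
    then have "v i = v1 i" for i
      using wts_outside[OF p(1) vp(1), of i] wts_outside[OF p(1) v1(1), of i] by (cases "i \<in> {1..r+s}") auto
    then show False using vp(2) by auto
  qed
  then have "(\<Sum>v\<in>wts p - {v1}. wt_coeff p v \<zeta> * f (\<zeta> - rwt v)) = 0" by (intro sum.neutral) blast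
  then have "act p f \<zeta> = wt_coeff p v1 \<zeta> * f (\<zeta> - rwt v1)"
    unfolding act_wt_coeff using sum.remove[OF _ v1(1), of "\<lambda>v. wt_coeff p v \<zeta> * f (\<zeta> - rwt v)"] by simp
  moreover have "f (\<zeta> - rwt v1) = \<kappa> * wt_coeff q v2 (\<zeta> - rwt (v1 + u))"
  proof -
    have "res (\<zeta> - rwt v1) = d'" by (simp add: res_diff \<zeta>(2) v1(2))
    then have "f (\<zeta> - rwt v1) = \<kappa> * rho q (delta \<xi>) (\<zeta> - rwt v1 - (d' - d))" using f[OF S0(2)] by simp
    also have "\<zeta> - rwt v1 - (d' - d) = \<zeta> - rwt (v1 + u)" by (simp add: rwt_add u(1) algebra_simps)
    also have "rho q (delta \<xi>) (\<zeta> - rwt (v1 + u)) = act q (delta \<xi>) (\<zeta> - rwt (v1 + u))"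
      using S0(3) by (simp add: rho_def)
    also have "\<xi> = (\<zeta> - rwt (v1 + u)) - rwt v2" by (simp add: \<xi>_def rwt_add algebra_simps)
    finally show ?thesis unfolding act_delta .
  qed
  ultimately have "rho p f \<zeta> \<noteq> 0" using \<zeta> \<kappa> S0(1) by (simp add: rho_def)
  then show ?thesis using rho \<xi>S unfolding kills_def by (metis zero_fun_apply)
qed

end

section \<open>Goldie rank\<close>

text \<open>If m > N, iterating the inequality with step c gives f(kc) \<ge> (m/N)^k, which outgrows
  every power of 2kc + 1.\<close>

lemma polynomial_growth_bound:
  fixes f :: "nat \<Rightarrow> nat"
  assumes "\<And>t. m * f t \<le> N * f (t + c)" "\<And>t. f t \<ge> 1" "\<And>t. f t \<le> (2 * t + 1) ^ D" "N > 0"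
  shows "m \<le> N"
proof (rule ccontr)
  assume "\<not> m \<le> N"
  define \<beta> where "\<beta> = real m / real N"
  have \<beta>: "\<beta> > 1" using \<open>\<not> m \<le> N\<close> assms(4) by (simp add: \<beta>_def)
  have lower: "\<beta> ^ k \<le> real (f (k * c))" for k
  proof (induction k)
    case 0
    then show ?case using assms(2)[of 0] by simp
  next
    case (Suc k)
    have "\<beta> ^ Suc k \<le> \<beta> * real (f (k * c))" using Suc \<beta> by (simp add: mult_left_mono)
    also have "\<dots> \<le> real (f (k * c + c))"
    proof -
      have "real m * real (f (k * c)) \<le> real N * real (f (k * c + c))"
        using assms(1)[of "k * c"] by (metis of_nat_le_iff of_nat_mult)
      then show ?thesis using assms(4) by (simp add: \<beta>_def field_simps)
    qed
    finally show ?case by (simp add: add.commute)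
  qed
  define a where "a = ln \<beta>"
  have a: "a > 0" using \<beta> by (simp add: a_def)
  \<comment> \<open>Chosen so that 2kc + 1 \<le> A x for x = k a \<ge> 1; the comparison becomes one
    of x^D with exp x.\<close>
  define A where "A = 2 * real c / a + 1"
  have A: "A \<ge> 1" using a by (simp add: A_def)
  have "((\<lambda>x::real. x ^ D / exp x) \<longlongrightarrow> 0) at_top" by (rule tendsto_power_div_exp_0)
  then have "\<forall>\<^sub>F x in at_top. x ^ D / exp x < 1 / A ^ D"
    by (rule order_tendstoD) (use A in auto)
  then obtain x0 where x0: "\<And>x::real. x \<ge> x0 \<Longrightarrow> x ^ D / exp x < 1 / A ^ D"
    by (auto simp: eventually_at_top_linorder)
  obtain k :: nat where k: "real k > max x0 1 / a" using reals_Archimedean2 by blast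
  define x where "x = real k * a"
  have x: "x \<ge> x0" "x \<ge> 1" using k a by (auto simp: x_def field_simps)
  have "real (2 * (k * c) + 1) \<le> A * x"
    using x(2) a by (simp add: A_def x_def field_simps)
  then have "real (2 * (k * c) + 1) ^ D \<le> (A * x) ^ D" by (intro power_mono) auto
  also have "\<dots> = A ^ D * x ^ D" by (simp add: power_mult_distrib)
  also have "\<dots> < exp x"
  proof -
    have "A ^ D > 0" using A by simp
    then show ?thesis using x0[OF x(1)] by (simp add: field_simps)
  qed
  also have "exp x = \<beta> ^ k" using \<beta> by (simp add: x_def a_def exp_of_nat_mult)
  also have "\<dots> \<le> real (f (k * c))" by (rule lower)
  also have "\<dots> \<le> real ((2 * (k * c) + 1) ^ D)" using assms(3) by (simp only: of_nat_le_iff)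
  finally show False by simp
qed

lemma span_linear_image:
  fixes \<Phi> :: "('a \<Rightarrow> 'k::field) \<Rightarrow> ('b \<Rightarrow> 'k)"
  assumes "\<And>f h. \<Phi> (f + h) = \<Phi> f + \<Phi> h" "\<And>c f. \<Phi> (fscale c f) = fscale c (\<Phi> f)"
    and "\<And>y. y \<in> Y \<Longrightarrow> \<Phi> y \<in> fun_space.span Z" "x \<in> fun_space.span Y"
  shows "\<Phi> x \<in> fun_space.span Z"
proof -
  have "\<Phi> 0 = 0" using assms(2)[of 0 0] by (simp add: fscale_def zero_fun_def)
  then have "fun_space.subspace {x. \<Phi> x \<in> fun_space.span Z}"
    by (intro fun_space.subspaceI)
      (auto simp: assms(1,2) intro: fun_space.span_add fun_space.span_scale fun_space.span_zero)
  then have "fun_space.span Y \<subseteq> {x. \<Phi> x \<in> fun_space.span Z}"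
    using assms(3) by (intro fun_space.span_minimal) auto
  then show ?thesis using assms(4) by blast
qed

text \<open>Independence is that of a family: equal vectors at two indices would give a relation
  with coefficients 1 and -1, so the index map is injective.\<close>

lemma independent_family_card_le:
  fixes v :: "'i \<Rightarrow> 'a \<Rightarrow> 'k::field"
  assumes "finite K" "finite Y" "\<And>k. k \<in> K \<Longrightarrow> v k \<in> fun_space.span Y"
    and ind: "\<And>a. (\<Sum>k\<in>K. fscale (a k) (v k)) = 0 \<Longrightarrow> \<forall>k\<in>K. a k = 0"
  shows "card K \<le> card Y"
proof -
  have inj: "inj_on v K"
  proof (rule inj_onI, rule ccontr)
    fix k l assume kl: "k \<in> K" "l \<in> K" "v k = v l" "k \<noteq> l"
    define a where "a j = (if j = k then 1 else if j = l then -1 else (0::'k))" for j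
    have "(\<Sum>j\<in>K. fscale (a j) (v j)) = (\<Sum>j\<in>{k, l}. fscale (a j) (v j))"
      using kl assms(1) by (intro sum.mono_neutral_right) (auto simp: a_def fscale_def zero_fun_def)
    also have "\<dots> = 0" using kl by (simp add: a_def fscale_def fun_eq_iff)
    finally have "a k = 0" using ind kl by blast
    then show False by (simp add: a_def)
  qed
  have "\<not> fun_space.dependent (v ` K)"
  proof
    assume "fun_space.dependent (v ` K)"
    then obtain u where u: "\<exists>x\<in>v ` K. u x \<noteq> 0" "(\<Sum>x\<in>v ` K. fscale (u x) x) = 0"
      using fun_space.dependent_finite[of "v ` K"] assms(1) by auto
    have "(\<Sum>k\<in>K. fscale (u (v k)) (v k)) = 0" using u(2) by (simp add: sum.reindex[OF inj])
    from ind[OF this] show False using u(1) by blast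
  qed
  then have "card (v ` K) \<le> card Y"
    using fun_space.independent_span_bound[OF assms(2), of "v ` K"] assms(3) by blast
  then show ?thesis by (simp add: card_image[OF inj])
qed

lemma card_box: "finite J \<Longrightarrow> b \<ge> 0 \<Longrightarrow> card (box J b) = (2 * nat b + 1) ^ card J"
proof (induction J rule: finite_induct)
  case empty
  have "box {} b = {\<lambda>_. 0}" by (auto simp: box_def)
  then show ?case by simp
next
  case (insert j J)
  have "card (box (insert j J) b) = card ({- b..b} \<times> box J b)"
    using bij_betw_same_card[OF bij_betw_box_insert[OF insert.hyps(2), of b]] by simp
  also have "\<dots> = (2 * nat b + 1) * (2 * nat b + 1) ^ card J"
    using insert by (simp add: card_cartesian_product) (simp add: nat_add_distrib)
  finally show ?case using insert.hyps by simp
qed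

context typed_point
begin

text \<open>The matrix of an operator on \<open>S\<close>, with the target as first index. It embeds
  B/J(\<alpha>) linearly into a space of functions, where dimensions can be compared.\<close>

definition mat :: "'k free_alg \<Rightarrow> (nat \<Rightarrow> rat) \<times> (nat \<Rightarrow> rat) \<Rightarrow> 'k" where
  "mat p = (\<lambda>(\<zeta>, \<xi>). if \<zeta> \<in> S \<and> \<xi> \<in> S then act p (delta \<xi>) \<zeta> else 0)"

lemma mat_add: "mat (p + q) = mat p + mat q"
  by (auto simp: mat_def act_add fun_eq_iff)

lemma mat_0: "mat 0 = 0"
  by (auto simp: mat_def act_0 fun_eq_iff)

lemma mat_scale: "mat (fconst c * p) = fscale c (mat p)"
  by (auto simp: mat_def act_mult act_fconst fun_eq_iff fscale_def)

lemma mat_sum: "mat (\<Sum>i\<in>Y. p i) = (\<Sum>i\<in>Y. mat (p i))"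
  by (induction Y rule: infinite_finite_induct) (simp_all only: mat_add mat_0 sum.infinite sum.empty sum.insert simp_thms)

lemma kills_mat: "kills p \<longleftrightarrow> mat p = 0"
  unfolding kills_iff by (auto simp: mat_def fun_eq_iff)

definition bounded_part :: "nat \<Rightarrow> 'k free_alg set" where
  "bounded_part t = {p \<in> G. \<forall>w\<in>Poly_Mapping.keys p. length (letters w) \<le> t}"

lemma bounded_G: "p \<in> bounded_part t \<Longrightarrow> p \<in> G"
  by (simp add: bounded_part_def)

lemma bounded_exists: "p \<in> G \<Longrightarrow> \<exists>t. p \<in> bounded_part t"
  by (rule exI[of _ "\<Sum>w\<in>Poly_Mapping.keys p. length (letters w)"])
    (auto simp: bounded_part_def intro!: member_le_sum)

lemma bounded_mono: "p \<in> bounded_part t \<Longrightarrow> t \<le> t' \<Longrightarrow> p \<in> bounded_part t'"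
  unfolding bounded_part_def by fastforce

lemma bounded_mult:
  assumes "p \<in> bounded_part t" "q \<in> bounded_part t'" shows "p * q \<in> bounded_part (t + t')"
proof -
  have "length (letters w) \<le> t + t'" if w: "w \<in> Poly_Mapping.keys (p * q)" for w
  proof -
    obtain u v where "w = u + v" "u \<in> Poly_Mapping.keys p" "v \<in> Poly_Mapping.keys q"
      using w keys_mult[of p q] by blast
    then show ?thesis using assms by (auto simp: bounded_part_def plus_word_def intro!: add_mono)
  qed
  then show ?thesis using homogeneous_mult[OF bounded_G[OF assms(1)] bounded_G[OF assms(2)]]
    by (simp add: bounded_part_def)
qed

lemma bounded_fconst: "fconst c \<in> bounded_part t"
  using homogeneous_fconst[of c g] by (auto simp: bounded_part_def fconst_def zero_word_def split: if_splits)

subsection \<open>Polynomial growth\<close>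

definition mono_fun :: "(nat \<Rightarrow> int) \<Rightarrow> (nat \<Rightarrow> rat) \<Rightarrow> 'k" where
  "mono_fun e \<zeta> = (\<Prod>i\<in>{1..r+s}. of_rat (\<zeta> i) ^ nat (e i))"

definition exponents :: "nat \<Rightarrow> (nat \<Rightarrow> int) set" where
  "exponents t = {e \<in> box {1..r+s} (int t). \<forall>i. 0 \<le> e i}"

lemma exponents_mono: "exponents t \<subseteq> exponents (Suc t)"
  unfolding exponents_def box_def by force

lemma mono_fun_upd:
  assumes "i \<in> {1..r+s}" "0 \<le> e i"
  shows "mono_fun e \<zeta> * of_rat (\<zeta> i) = mono_fun (e(i := e i + 1)) \<zeta>"
proof -
  have "mono_fun (e(i := e i + 1)) \<zeta> = of_rat (\<zeta> i) ^ nat (e i + 1) * (\<Prod>j\<in>{1..r+s} - {i}. of_rat (\<zeta> j) ^ nat ((e(i := e i + 1)) j))"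
    unfolding mono_fun_def by (subst prod.remove[OF _ assms(1)]) auto
  also have "(\<Prod>j\<in>{1..r+s} - {i}. of_rat (\<zeta> j) ^ nat ((e(i := e i + 1)) j)) = (\<Prod>j\<in>{1..r+s} - {i}. (of_rat (\<zeta> j) ^ nat (e j) :: 'k))"
    by (rule prod.cong) auto
  also have "nat (e i + 1) = Suc (nat (e i))" using assms(2) by simp
  also have "of_rat (\<zeta> i) ^ Suc (nat (e i)) * (\<Prod>j\<in>{1..r+s} - {i}. of_rat (\<zeta> j) ^ nat (e j)) =
      mono_fun e \<zeta> * of_rat (\<zeta> i)"
    unfolding mono_fun_def prod.remove[OF finite_atLeastAtMost assms(1)] by simp
  finally show ?thesis by (rule sym)
qed

lemma mono_span_mult:
  assumes f: "f \<in> fun_space.span (mono_fun ` exponents t)" and i: "i \<in> {1..r+s}"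
  shows "(\<lambda>\<zeta>. f \<zeta> * (of_rat (\<zeta> i) + c)) \<in> fun_space.span (mono_fun ` exponents (Suc t))"
proof (rule span_linear_image[OF _ _ _ f])
  fix y assume "y \<in> mono_fun ` exponents t"
  then obtain e where e: "e \<in> exponents t" "y = mono_fun e" by blast
  have e0: "0 \<le> e i" using e(1) by (simp add: exponents_def)
  have "(\<lambda>\<zeta>. y \<zeta> * (of_rat (\<zeta> i) + c)) = mono_fun (e(i := e i + 1)) + fscale c (mono_fun e)"
    using mono_fun_upd[of i e, OF i e0] by (auto simp: e(2) fun_eq_iff fscale_def distrib_left)
  moreover have "e(i := e i + 1) \<in> exponents (Suc t)"
    using e(1) i by (auto simp: exponents_def box_def)
  moreover have "e \<in> exponents (Suc t)" using e(1) exponents_mono by blast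
  ultimately show "(\<lambda>\<zeta>. y \<zeta> * (of_rat (\<zeta> i) + c)) \<in> fun_space.span (mono_fun ` exponents (Suc t))"
    by (simp only:) (intro fun_space.span_add fun_space.span_scale fun_space.span_base imageI)
qed (auto simp: fun_eq_iff fscale_def distrib_right)

text \<open>Only the letters \<partial>_i contribute nonconstant factors. These are linear in one
  coordinate, so each letter raises an exponent by at most one.\<close>

lemma list_coeff_span:
  "set l \<subseteq> weyl_gens r s \<Longrightarrow> list_coeff l \<in> fun_space.span (mono_fun ` exponents (length l))"
proof (induction l rule: rev_induct)
  case Nil
  have "(\<lambda>_. 0) \<in> exponents 0" by (auto simp: exponents_def box_def)
  moreover have "list_coeff [] = mono_fun (\<lambda>_. 0)" by (auto simp: mono_fun_def)
  ultimately show ?case by (intro fun_space.span_base) auto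
next
  case (snoc a l)
  then have IH: "list_coeff l \<in> fun_space.span (mono_fun ` exponents (length l))" by simp
  have app: "list_coeff (l @ [a]) = (\<lambda>\<zeta>. list_coeff l \<zeta> * gen_coeff a (\<zeta> - rwt (list_wt l)) :: 'k)"
    by (auto simp: list_coeff_append)
  have same: ?case if one: "\<And>\<gamma>. gen_coeff a \<gamma> = (1 :: 'k)"
  proof -
    have "list_coeff (l @ [a]) = (list_coeff l :: _ \<Rightarrow> 'k)" unfolding app one by simp
    moreover have "list_coeff l \<in> fun_space.span (mono_fun ` exponents (Suc (length l)))"
      using IH fun_space.span_mono[OF image_mono[OF exponents_mono]] by blast
    ultimately show ?thesis by simp
  qed
  have a: "a \<in> weyl_gens r s" using snoc by simp
  then show ?case
  proof (cases rule: gen_cases)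
    case (D i)
    have "list_coeff (l @ [a]) = (\<lambda>\<zeta>. list_coeff l \<zeta> * (of_rat (\<zeta> i) + of_rat (1 - of_int (list_wt l i))) :: 'k)"
      unfolding app by (auto simp: D rwt_def of_rat_add[symmetric] algebra_simps fun_eq_iff)
    then show ?thesis using mono_span_mult[OF IH D(2)] by simp
  qed (rule same, simp)+
qed

definition graph_fun :: "(nat \<Rightarrow> int) \<Rightarrow> ((nat \<Rightarrow> rat) \<Rightarrow> 'k) \<Rightarrow> (nat \<Rightarrow> rat) \<times> (nat \<Rightarrow> rat) \<Rightarrow> 'k" where
  "graph_fun u f = (\<lambda>(\<zeta>, \<xi>). if \<zeta> \<in> S \<and> \<xi> \<in> S \<and> \<xi> = \<zeta> - rwt u then f \<zeta> else 0)"

text \<open>For words of length at most t both the weight and the exponents of the coefficient lie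
  in a box of radius t in n coordinates. The two boxes account for the exponent 2n.\<close>

definition growth_span :: "nat \<Rightarrow> ((nat \<Rightarrow> rat) \<times> (nat \<Rightarrow> rat) \<Rightarrow> 'k) set" where
  "growth_span t = (\<lambda>(u, e). graph_fun u (mono_fun e)) ` (box {1..r+s} (int t) \<times> exponents t)"

lemma finite_growth_span: "finite (growth_span t)"
  unfolding growth_span_def exponents_def using finite_box[OF finite_atLeastAtMost] by auto

lemma card_growth_span: "card (growth_span t) \<le> (2 * t + 1) ^ (2 * (r + s))"
proof -
  let ?b = "box {1..r+s} (int t)"
  have fin: "finite ?b" by (rule finite_box) simp
  have "card (growth_span t) \<le> card (?b \<times> exponents t)"
    unfolding growth_span_def using fin by (intro card_image_le) (auto simp: exponents_def)
  also have "\<dots> \<le> card ?b * card ?b"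
    unfolding card_cartesian_product by (intro mult_left_mono card_mono fin) (auto simp: exponents_def)
  also have "card ?b = (2 * t + 1) ^ (r + s)" by (subst card_box) auto
  finally show ?thesis by (simp only: mult_2 power_add)
qed

lemma list_wt_box:
  assumes "set l \<subseteq> weyl_gens r s" "length l \<le> t"
  shows "list_wt l \<in> box {1..r+s} (int t)"
proof -
  have "\<bar>list_wt l i\<bar> \<le> int (length l)" for i
  proof (induction l)
    case (Cons a l)
    have "\<bar>gen_wt a i\<bar> \<le> 1" by (cases a) auto
    then show ?case using Cons by (simp add: list_wt_Cons)
  qed simp
  moreover have "int (length l) \<le> int t" using assms(2) by simp
  ultimately have "\<bar>list_wt l i\<bar> \<le> int t" for i by (rule order_trans)
  then have "list_wt l i \<in> {- int t..int t}" for i by (simp add: abs_le_iff minus_le_iff)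
  then show ?thesis unfolding box_def using list_wt_outside[OF assms(1)] by blast
qed

lemma mat_eq_sum: "mat p = (\<Sum>w\<in>Poly_Mapping.keys p. fscale (Poly_Mapping.lookup p w) (graph_fun (list_wt (letters w)) (list_coeff (letters w))))"
proof
  fix z :: "(nat \<Rightarrow> rat) \<times> (nat \<Rightarrow> rat)"
  obtain \<zeta> \<xi> where z: "z = (\<zeta>, \<xi>)" by (cases z)
  have "delta \<xi> (\<zeta> - rwt u) = (if \<xi> = \<zeta> - rwt u then 1 else 0 :: 'k)" for u by (auto simp: delta_def)
  then show "mat p z = (\<Sum>w\<in>Poly_Mapping.keys p. fscale (Poly_Mapping.lookup p w) (graph_fun (list_wt (letters w)) (list_coeff (letters w)))) z"
    unfolding sum_fun_apply z mat_def act_def graph_fun_def fscale_def by (auto intro!: sum.cong)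
qed

lemma mat_growth:
  assumes p: "p \<in> bounded_part t"
  shows "mat p \<in> fun_space.span (growth_span t)"
  unfolding mat_eq_sum
proof (intro fun_space.span_sum fun_space.span_scale)
  fix w assume w: "w \<in> Poly_Mapping.keys p"
  have gens: "set (letters w) \<subseteq> weyl_gens r s" and len: "length (letters w) \<le> t"
    using p w by (auto simp: bounded_part_def homogeneous_part_def A_eq)
  have "exponents a \<subseteq> exponents b" if "a \<le> b" for a b
    using that exponents_mono by (rule lift_Suc_mono_le[of exponents, rotated]) 
  then have "list_coeff (letters w) \<in> fun_space.span (mono_fun ` exponents t)"
    using list_coeff_span[OF gens] fun_space.span_mono[OF image_mono] len by blast
  then show "graph_fun (list_wt (letters w)) (list_coeff (letters w)) \<in> fun_space.span (growth_span t)"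
  proof (rule span_linear_image[rotated 3])
    fix y assume "y \<in> mono_fun ` exponents t"
    then show "graph_fun (list_wt (letters w)) y \<in> fun_space.span (growth_span t)"
      using list_wt_box[OF gens len] unfolding growth_span_def by (intro fun_space.span_base) auto
  qed (auto simp: graph_fun_def fun_eq_iff fscale_def)
qed

definition growth :: "nat \<Rightarrow> nat" where
  "growth t = fun_space.dim (mat ` bounded_part t)"

lemma growth_upper: "growth t \<le> (2 * t + 1) ^ (2 * (r + s))"
proof -
  have "growth t \<le> card (growth_span t)" unfolding growth_def
    by (rule fun_space.dim_le_card) (use mat_growth finite_growth_span in auto)
  then show ?thesis using card_growth_span by (rule le_trans)
qed

lemma growth_basis:
  obtains Y where "finite Y" "card Y = growth t" "mat ` bounded_part t \<subseteq> fun_space.span Y" "Y \<subseteq> mat ` bounded_part t"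
proof -
  obtain Y where Y: "Y \<subseteq> mat ` bounded_part t" "\<not> fun_space.dependent Y"
    "mat ` bounded_part t \<subseteq> fun_space.span Y" "card Y = growth t"
    unfolding growth_def by (rule fun_space.basis_exists)
  have "Y \<subseteq> fun_space.span (growth_span t)" using Y(1) mat_growth by blast
  then have "finite Y" using fun_space.independent_span_bound[OF finite_growth_span Y(2)] by blast
  then show thesis using that Y by blast
qed

lemma growth_lower: "1 \<le> growth t"
proof -
  obtain Y where Y: "finite Y" "card Y = growth t" "mat ` bounded_part t \<subseteq> fun_space.span Y" using growth_basis .
  have "\<not> kills 1"
  proof
    assume "kills 1"
    then have "rho 1 (delta \<alpha>) = (0 :: _ \<Rightarrow> 'k)" using delta_\<alpha>_supported by (simp add: kills_def)
    then have "delta \<alpha> \<alpha> = (0 :: 'k)" using rho_1[OF delta_\<alpha>_supported] by (metis zero_fun_apply)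
    then show False by (simp add: delta_def)
  qed
  then have "mat 1 \<noteq> 0" by (simp add: kills_mat)
  moreover have "mat 1 \<in> fun_space.span Y" using Y(3) bounded_fconst[of 1 t] by (auto simp: fconst_1)
  ultimately have "Y \<noteq> {}" by auto
  then have "card Y \<noteq> 0" using Y(1) by simp
  then show ?thesis using Y(2) by simp
qed

section \<open>Upper and lower bound for the rank\<close>

lemma act_projection:
  assumes x: "x \<in> G" and p: "is_transition d d 1 p" and S: "\<zeta> \<in> S" "\<xi> \<in> S"
  shows "act (x * p) (delta \<xi>) \<zeta> = (if res \<xi> = d then act x (delta \<xi>) \<zeta> else 0)"
proof -
  have pG: "p \<in> G" using p by (simp add: is_transition_def)
  have sup: "supported (delta \<xi> :: _ \<Rightarrow> 'k) S" by (rule supported_delta[OF S(2)])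
  have "rho p (delta \<xi>) = (if res \<xi> = d then delta \<xi> else 0)"
  proof
    fix \<gamma>
    show "rho p (delta \<xi>) \<gamma> = (if res \<xi> = d then delta \<xi> else 0) \<gamma>"
    proof (cases "\<gamma> \<in> S")
      case True
      then show ?thesis using p sup by (auto simp: is_transition_def delta_def)
    next
      case False
      then show ?thesis using S(2) by (auto simp: rho_def delta_def)
    qed
  qed
  then have "rho (x * p) (delta \<xi>) = (if res \<xi> = d then rho x (delta \<xi>) else 0)"
    by (simp add: rho_mult[OF x pG sup] rho_0_right)
  then have "rho (x * p) (delta \<xi>) \<zeta> = (if res \<xi> = d then rho x (delta \<xi>) else 0) \<zeta>" by (rule fun_cong)
  then show ?thesis using S(1) by (simp add: rho_def split: if_splits)
qed

text \<open>If \<open>R q\<^sub>1 + \<dots> + R q\<^sub>m\<close> is direct, then for every block \<open>d\<close> the \<open>m\<close>-fold sum of the column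
  space at \<open>d\<close> of the elements of length at most \<open>t\<close> embeds into the space of elements of length at
  most \<open>t + c\<close>.\<close>

lemma direct_sum_growth:
  assumes "independent_generators m p"
  shows "\<exists>c. \<forall>t. m * growth t \<le> card blocks * growth (t + c)"
proof -
  have pG: "\<And>i. i < m \<Longrightarrow> p i \<in> G" and nz: "\<And>i. i < m \<Longrightarrow> \<not> kills (p i)"
    and dir: "\<And>q i. \<forall>i<m. q i \<in> G \<Longrightarrow> kills (\<Sum>i<m. q i * p i) \<Longrightarrow> i < m \<Longrightarrow> kills (q i * p i)"
    using assms unfolding independent_generators_def by blast+
  have "\<exists>e. fst e \<in> S \<and> snd e \<in> S \<and> act (p i) (delta (fst e)) (snd e) \<noteq> 0" if i: "i < m" for i
  proof -
    obtain \<zeta> \<xi> where "\<zeta> \<in> S" "\<xi> \<in> S" "act (p i) (delta \<xi>) \<zeta> \<noteq> 0"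
      using nz[OF i] unfolding kills_iff by blast
    then show ?thesis by (intro exI[of _ "(\<xi>, \<zeta>)"]) simp
  qed
  then have "\<forall>i. \<exists>e. i < m \<longrightarrow> fst e \<in> S \<and> snd e \<in> S \<and> act (p i) (delta (fst e)) (snd e) \<noteq> 0" by blast
  from choice[OF this] obtain e where
    e: "\<And>i. i < m \<Longrightarrow> fst (e i) \<in> S \<and> snd (e i) \<in> S \<and> act (p i) (delta (fst (e i))) (snd (e i)) \<noteq> 0" by blast
  define d where "d i = res (snd (e i))" for i
  have dB: "d i \<in> blocks" if "i < m" for i using e[OF that] by (auto simp: d_def blocks_def)
  have "\<exists>y. is_transition b (d i) (fst y) (snd y)" if bi: "i < m" "b \<in> blocks" for b i
  proof -
    obtain \<kappa> q where "is_transition b (d i) \<kappa> q" using transition_exists[OF dB[OF bi(1)] bi(2)] by blast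
    then show ?thesis by (intro exI[of _ "(\<kappa>, q)"]) simp
  qed
  then have "\<forall>x. \<exists>y. snd x < m \<and> fst x \<in> blocks \<longrightarrow> is_transition (fst x) (d (snd x)) (fst y) (snd y)" by simp
  from choice[OF this] obtain tr' where
    tr': "\<forall>x. snd x < m \<and> fst x \<in> blocks \<longrightarrow> is_transition (fst x) (d (snd x)) (fst (tr' x)) (snd (tr' x))" by (rule exE)
  \<comment> \<open>The generator p_i has a nonzero entry ending in the block d_i;
    \<open>tr b i\<close> moves this block to b, where the columns under consideration
    begin.\<close>
  define \<kappa> tr where "\<kappa> b i = fst (tr' (b, i))" and "tr b i = snd (tr' (b, i))" for b i
  have tr: "is_transition b (d i) (\<kappa> b i) (tr b i)" if "i < m" "b \<in> blocks" for b i
    using spec[OF tr', of "(b, i)"] that by (simp add: \<kappa>_def tr_def)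
  have trG: "tr b i \<in> G" if "i < m" "b \<in> blocks" for b i using tr[OF that] by (simp add: is_transition_def)
  have "\<forall>b. \<exists>q. b \<in> blocks \<longrightarrow> is_transition b b 1 q" using block_projection by blast
  from choice[OF this] obtain pr where pr: "\<And>b. b \<in> blocks \<Longrightarrow> is_transition b b 1 (pr b)" by blast
  have prG: "pr b \<in> G" if "b \<in> blocks" for b using pr[OF that] by (simp add: is_transition_def)
  have "\<exists>c. tr b i * p i \<in> bounded_part c" if "b \<in> blocks" "i < m" for b i
    by (rule bounded_exists[OF homogeneous_mult[OF trG[OF that(2,1)] pG[OF that(2)]]])
  then have "\<forall>x. \<exists>c. fst x \<in> blocks \<and> snd x < m \<longrightarrow> tr (fst x) (snd x) * p (snd x) \<in> bounded_part c" by simp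
  from choice[OF this] obtain c' where
    c': "\<forall>x. fst x \<in> blocks \<and> snd x < m \<longrightarrow> tr (fst x) (snd x) * p (snd x) \<in> bounded_part (c' x)" by (rule exE)
  \<comment> \<open>A common length bound for the finitely many multipliers, independent of
    t.\<close>
  define c where "c = (\<Sum>x\<in>blocks \<times> {..<m}. c' x)"
  have c: "tr b i * p i \<in> bounded_part c" if "b \<in> blocks" "i < m" for b i
  proof -
    have "c' (b, i) \<le> c" unfolding c_def using that finite_blocks by (intro member_le_sum) auto
    then show ?thesis using spec[OF c', of "(b, i)"] that bounded_mono by auto
  qed
  have "m * growth t \<le> card blocks * growth (t + c)" for t
  proof -
    define V where "V b = (\<lambda>x. mat (x * pr b)) ` bounded_part t" for b
    have "\<exists>Y. Y \<subseteq> V b \<and> \<not> fun_space.dependent Y \<and> V b \<subseteq> fun_space.span Y \<and> finite Y" if b: "b \<in> blocks" for b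
    proof -
      obtain Y where Y: "Y \<subseteq> V b" "\<not> fun_space.dependent Y" "V b \<subseteq> fun_space.span Y"
        by (rule fun_space.basis_exists[of "V b"])
      obtain t' where "pr b \<in> bounded_part t'" using bounded_exists[OF prG[OF b]] by blast
      then have "V b \<subseteq> fun_space.span (growth_span (t + t'))"
        unfolding V_def using bounded_mult mat_growth by blast
      then have "finite Y" using fun_space.independent_span_bound[OF finite_growth_span Y(2)] Y(1) by blast
      then show ?thesis using Y by blast
    qed
    then have "\<forall>b. \<exists>Y. b \<in> blocks \<longrightarrow> Y \<subseteq> V b \<and> \<not> fun_space.dependent Y \<and> V b \<subseteq> fun_space.span Y \<and> finite Y" by blast
    from choice[OF this] obtain Y where Y': "\<forall>b. b \<in> blocks \<longrightarrow> Y b \<subseteq> V b \<and> \<not> fun_space.dependent (Y b) \<and> V b \<subseteq> fun_space.span (Y b) \<and> finite (Y b)"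
      by (rule exE)
    have Y: "Y b \<subseteq> V b" "\<not> fun_space.dependent (Y b)" "V b \<subseteq> fun_space.span (Y b)" "finite (Y b)" if "b \<in> blocks" for b
      using spec[OF Y', of b] that by simp_all
    obtain Z where Z: "finite Z" "card Z = growth (t + c)" "mat ` bounded_part (t + c) \<subseteq> fun_space.span Z"
      by (rule growth_basis[of "t + c"])
    have col: "m * card (Y b) \<le> growth (t + c)" if b: "b \<in> blocks" for b
    proof -
      have Yb: "Y b \<subseteq> V b" "\<not> fun_space.dependent (Y b)" "finite (Y b)" using Y[OF b] by simp_all
      have "\<forall>y. \<exists>x. y \<in> Y b \<longrightarrow> x \<in> bounded_part t \<and> y = mat (x * pr b)" using Yb(1) unfolding V_def by blast
      from choice[OF this] obtain x where x': "\<forall>y. y \<in> Y b \<longrightarrow> x y \<in> bounded_part t \<and> y = mat (x y * pr b)" by (rule exE)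
      have x: "x y \<in> bounded_part t" "mat (x y * pr b) = y" if "y \<in> Y b" for y
        using spec[OF x', of y] that by simp_all
      \<comment> \<open>The images of a basis of column b, one copy for each left ideal.\<close>
      define v where "v k = mat (x (snd k) * (tr b (fst k) * p (fst k)))" for k
      have "card ({..<m} \<times> Y b) \<le> card Z"
      proof (rule independent_family_card_le[where v = v])
        show "finite ({..<m} \<times> Y b)" "finite Z" using Yb(3) Z(1) by auto
        show "v k \<in> fun_space.span Z" if "k \<in> {..<m} \<times> Y b" for k
        proof -
          have "x (snd k) * (tr b (fst k) * p (fst k)) \<in> bounded_part (t + c)"
            using that x c[OF b] by (intro bounded_mult) auto
          then show ?thesis unfolding v_def using Z(3) by blast
        qed
        fix a assume 0: "(\<Sum>k\<in>{..<m} \<times> Y b. fscale (a k) (v k)) = 0"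
        define y where "y i = (\<Sum>z\<in>Y b. fconst (a (i, z)) * x z)" for i
        have yG: "y i \<in> G" for i
          unfolding y_def using x by (intro homogeneous_sum homogeneous_mult homogeneous_fconst) (auto intro: bounded_G)
        have "mat (\<Sum>i<m. (y i * tr b i) * p i) = (\<Sum>i<m. \<Sum>z\<in>Y b. fscale (a (i, z)) (v (i, z)))"
          by (simp add: mat_sum y_def sum_distrib_right mult.assoc mat_scale v_def)
        also have "\<dots> = (\<Sum>k\<in>{..<m} \<times> Y b. fscale (a k) (v k))" by (simp add: sum.cartesian_product)
        finally have kl: "kills (\<Sum>i<m. (y i * tr b i) * p i)" using 0 by (simp add: kills_mat)
        have G: "\<forall>i<m. y i * tr b i \<in> G" using yG trG b homogeneous_mult by blast
        show "\<forall>k\<in>{..<m} \<times> Y b. a k = 0"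
        proof
          fix k assume k: "k \<in> {..<m} \<times> Y b"
          obtain i z where iz: "k = (i, z)" "i < m" "z \<in> Y b" using k by auto
          \<comment> \<open>Directness separates the summands. If y_i had a nonzero entry in column
            b, the product through the transition would be nonzero; hence that column of y_i
            vanishes, and so do the basis coefficients.\<close>
          have ki: "kills (y i * (tr b i * p i))" using dir[OF G kl iz(2)] by (simp add: mult.assoc)
          have "kills (y i * pr b)" unfolding kills_iff
          proof (intro ballI, rule ccontr)
            fix \<zeta> \<xi> assume S: "\<zeta> \<in> S" "\<xi> \<in> S" and nz: "act (y i * pr b) (delta \<xi>) \<zeta> \<noteq> 0"
            then have "res \<xi> = b" "act (y i) (delta \<xi>) \<zeta> \<noteq> 0"
              using act_projection[OF yG pr[OF b] S] by (auto split: if_splits)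
            then show False
              using transition_product_nonzero[OF yG S(2,1) _ pG[OF iz(2)], of i "fst (e i)" "snd (e i)" "\<kappa> b i" "tr b i"]
                e[OF iz(2)] tr[OF iz(2) b] ki by (simp add: d_def)
          qed
          then have "mat (y i * pr b) = 0" by (simp add: kills_mat)
          moreover have "mat (y i * pr b) = (\<Sum>z\<in>Y b. fscale (a (i, z)) z)"
          proof -
            have "mat (y i * pr b) = (\<Sum>z\<in>Y b. fscale (a (i, z)) (mat (x z * pr b)))"
              by (simp add: y_def sum_distrib_right mat_sum mult.assoc mat_scale)
            also have "\<dots> = (\<Sum>z\<in>Y b. fscale (a (i, z)) z)" using x by (intro sum.cong) auto
            finally show ?thesis .
          qed
          ultimately have "(\<Sum>z\<in>Y b. fscale (a (i, z)) z) = 0" by simp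
          then have "a (i, z) = 0"
            using Yb(2) fun_space.dependent_finite[OF Yb(3)] iz(3) by auto
          then show "a k = 0" by (simp add: iz)
        qed
      qed
      then show ?thesis by (simp add: card_cartesian_product Z(2))
    qed
    \<comment> \<open>A matrix is the sum of its block columns, so bases of the columns together
      bound the growth from above.\<close>
    have "mat ` bounded_part t \<subseteq> fun_space.span (\<Union>b\<in>blocks. Y b)"
    proof safe
      fix x assume x: "x \<in> bounded_part t"
      have "mat x = (\<Sum>b\<in>blocks. mat (x * pr b))"
      proof
        fix z :: "(nat \<Rightarrow> rat) \<times> (nat \<Rightarrow> rat)"
        obtain \<zeta> \<xi> where z: "z = (\<zeta>, \<xi>)" by (cases z)
        show "mat x z = (\<Sum>b\<in>blocks. mat (x * pr b)) z"
        proof (cases "\<zeta> \<in> S \<and> \<xi> \<in> S")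
          case True
          have "(\<Sum>b\<in>blocks. mat (x * pr b)) z = (\<Sum>b\<in>blocks. if res \<xi> = b then act x (delta \<xi>) \<zeta> else 0)"
            unfolding sum_fun_apply using True by (intro sum.cong) (auto simp: mat_def z act_projection[OF bounded_G[OF x] pr])
          also have "\<dots> = act x (delta \<xi>) \<zeta>" using finite_blocks True by (simp add: blocks_def)
          finally show ?thesis using True by (simp add: mat_def z)
        next
          case False
          then show ?thesis unfolding sum_fun_apply mat_def z by auto
        qed
      qed
      moreover have "mat (x * pr b) \<in> fun_space.span (\<Union>b\<in>blocks. Y b)" if b: "b \<in> blocks" for b
      proof -
        have "mat (x * pr b) \<in> fun_space.span (Y b)" using Y(3)[OF b] imageI[OF x, of "\<lambda>x. mat (x * pr b)"] unfolding V_def by (rule subsetD)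
        moreover have "fun_space.span (Y b) \<subseteq> fun_space.span (\<Union>b\<in>blocks. Y b)"
          using b by (intro fun_space.span_mono) blast
        ultimately show ?thesis by blast
      qed
      ultimately show "mat x \<in> fun_space.span (\<Union>b\<in>blocks. Y b)" by (simp add: fun_space.span_sum)
    qed
    then have "growth t \<le> card (\<Union>b\<in>blocks. Y b)"
      unfolding growth_def using finite_blocks Y(4) by (intro fun_space.dim_le_card) auto
    also have "\<dots> \<le> (\<Sum>b\<in>blocks. card (Y b))" by (rule card_UN_le[OF finite_blocks])
    finally have "m * growth t \<le> (\<Sum>b\<in>blocks. m * card (Y b))" by (simp add: sum_distrib_left[symmetric])
    also have "\<dots> \<le> (\<Sum>b\<in>blocks. growth (t + c))" by (intro sum_mono col)
    finally show ?thesis by simp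
  qed
  then show ?thesis by blast
qed

text \<open>Right multiplication by the projection to a block selects that block column. Left
  multiples of different projections have disjoint columns, so their sum vanishes only term by
  term.\<close>

lemma blocks_independent_generators: "\<exists>p. independent_generators (card blocks) p"
proof -
  obtain b where b: "bij_betw b {..<card blocks} blocks"
    using ex_bij_betw_nat_finite[OF finite_blocks] by (auto simp: atLeast0LessThan)
  have "\<forall>i. \<exists>q. b i \<in> blocks \<longrightarrow> is_transition (b i) (b i) 1 q" using block_projection by blast
  from choice[OF this] obtain p where p: "\<And>i. b i \<in> blocks \<Longrightarrow> is_transition (b i) (b i) 1 (p i)" by blast
  have bB: "b i \<in> blocks" if "i < card blocks" for i using b that by (auto simp: bij_betw_def)
  have pG: "p i \<in> G" if "i < card blocks" for i using p[OF bB[OF that]] by (simp add: is_transition_def)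
  have nz: "\<not> kills (p i)" if i: "i < card blocks" for i
  proof
    assume "kills (p i)"
    obtain \<xi> where \<xi>: "\<xi> \<in> S" "res \<xi> = b i" using bB[OF i] by (auto simp: blocks_def)
    have "act (1 * p i) (delta \<xi>) \<xi> = act 1 (delta \<xi>) \<xi>"
      using act_projection[OF homogeneous_1 p[OF bB[OF i]] \<xi>(1,1)] \<xi>(2) by simp
    also have "\<dots> = 1" using act_fconst[of 1 "delta \<xi>" \<xi>] by (simp add: fconst_1 delta_def)
    finally show False using \<open>kills (p i)\<close> \<xi>(1) by (simp add: kills_iff)
  qed
  have "kills (q i * p i)"
    if q: "\<forall>i<card blocks. q i \<in> G" and k: "kills (\<Sum>i<card blocks. q i * p i)" and i: "i < card blocks" for q i
    unfolding kills_iff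
  proof (intro ballI)
    fix \<zeta> \<xi> assume S: "\<zeta> \<in> S" "\<xi> \<in> S"
    have proj: "act (q j * p j) (delta \<xi>) \<zeta> = (if res \<xi> = b j then act (q j) (delta \<xi>) \<zeta> else 0)" if "j < card blocks" for j
      using act_projection[OF _ p[OF bB[OF that]] S] q that by blast
    show "act (q i * p i) (delta \<xi>) \<zeta> = 0"
    proof (cases "res \<xi> = b i")
      case True
      have "0 = act (\<Sum>j<card blocks. q j * p j) (delta \<xi>) \<zeta>" using k S by (simp add: kills_iff)
      also have "\<dots> = (\<Sum>j<card blocks. if j = i then act (q i * p i) (delta \<xi>) \<zeta> else 0)"
        unfolding act_sum sum_fun_apply
      proof (rule sum.cong[OF refl])
        fix j assume j: "j \<in> {..<card blocks}"
        then have "b i = b j \<longleftrightarrow> j = i" using b i by (auto simp: bij_betw_def inj_on_def)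
        with j show "act (q j * p j) (delta \<xi>) \<zeta> = (if j = i then act (q i * p i) (delta \<xi>) \<zeta> else 0)"
          using proj[of j] True by auto
      qed
      also have "\<dots> = act (q i * p i) (delta \<xi>) \<zeta>" using i by simp
      finally show ?thesis by simp
    qed (simp add: proj[OF i])
  qed
  then have "independent_generators (card blocks) p" using pG nz unfolding independent_generators_def by blast
  then show ?thesis by blast
qed

lemma goldie_rank_eq: "goldie_rank R = card (PJ g \<alpha> J Jp Jm \<inter> int_lattice J)"
  unfolding goldie_rank_def blocks_eq[symmetric]
proof (rule Greatest_equality)
  show "has_direct_sum_of_left_ideals R (card blocks)"
    using has_direct_sum_iff blocks_independent_generators by blast
  fix m assume "has_direct_sum_of_left_ideals R m"
  then obtain p where "independent_generators m p" using has_direct_sum_iff by blast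
  then obtain c where c: "\<And>t. m * growth t \<le> card blocks * growth (t + c)" using direct_sum_growth by blast
  have "card blocks > 0" using finite_blocks res_\<alpha>_blocks by (auto simp: card_gt_0_iff)
  then show "m \<le> card blocks" by (intro polynomial_growth_bound[OF c growth_lower growth_upper])
qed

end

section \<open>The rank along the multiples of \<alpha>\<close>

theorem theorem40:
  fixes r s :: nat
    and g :: "(nat \<Rightarrow> 'k::{alg_closed_field, field_char_0}) set"
    and \<alpha> :: "nat \<Rightarrow> rat"
    and J Jp Jm :: "nat set"
    and \<chi> :: "(nat \<Rightarrow> 'k) \<Rightarrow> 'k"
    and a0 :: rat and aZ aN :: int
    and Q :: "(nat \<Rightarrow> rat) set"
  assumes "fun_space.subspace g" and "g \<subseteq> coord_space {1..r+s}"
    and "rational_subspace (r+s) g"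
    and "of_type r s g \<alpha> J Jp Jm"
    and "\<chi> = eta_comb g {1..r+s} (of_rat_vec \<alpha>)"
    and "restrict_coord J \<alpha> \<noteq> zvec Jm"
    and "zvec Jm \<in> {fscale a0 (restrict_coord J \<alpha>) + v | v. v \<in> V0set g J}"
    and "a0 = of_int aZ / of_int aN" and "aN > 0"
    and "Q = (\<lambda>d. fscale (1 / of_int (aN - aZ)) (d - zvec Jm)) ` PJ g \<alpha> J Jp Jm"
  shows "a0 < 1 \<and> aN - aZ > 0 \<and>
    quasi_polynomial (\<lambda>x. EHP J Q (aN * x - aZ)) \<and>
    (\<forall>x::int. x > 0 \<longrightarrow> of_type r s g (fscale (of_int x) \<alpha>) J Jp Jm \<longrightarrow>
       of_nat (goldie_rank
         (Bring r s g (fscale (of_int x) \<chi>) Quot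
            Jideal r s g (fscale (of_int x) \<chi>) (of_rat_vec (fscale (of_int x) \<alpha>))))
       = EHP J Q (aN * x - aZ))"
proof -
  interpret polytope_data r s g \<alpha> J Jp Jm a0 aZ aN Q
    using assms by unfold_locales auto
  have "quasi_polynomial (\<lambda>x. EHP J Q (aN * x - aZ))"
    using quasi_poly_compose_affine[OF EHP_quasi_poly(1), of aN "- aZ"]
    by (intro quasi_poly_imp_quasi_polynomial) simp
  moreover have "of_nat (goldie_rank
         (Bring r s g (fscale (of_int x) \<chi>) Quot
            Jideal r s g (fscale (of_int x) \<chi>) (of_rat_vec (fscale (of_int x) \<alpha>))))
       = EHP J Q (aN * x - aZ)"
    if x: "x > 0" "of_type r s g (fscale (of_int x) \<alpha>) J Jp Jm" for x :: int
  proof -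
    \<comment> \<open>The rank is computed at x\<alpha> with the same J and signs, while Q and the
      dilation parameters remain those of \<alpha>.\<close>
    interpret X: typed_point r s g "fscale (of_int x) \<alpha>" J Jp Jm
      using assms(1,2) x(2) by unfold_locales
    have "fscale (of_int x) \<chi> = X.\<chi>"
      unfolding X.\<chi>_def assms(5)
      by (auto simp: fun_eq_iff fscale_def eta_comb_apply of_rat_vec_def of_rat_mult sum_distrib_left mult.assoc)
    then show ?thesis using X.goldie_rank_eq EHP_eq_card_PJ[OF x(1)] by simp
  qed
  ultimately show ?thesis using a0_less_1 aN_aZ by blast
qed

end
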